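(* Let $p$ be a prime, let $k$ be an algebraically closed field of characteristic $p$, and let $n\ge 1$ and $m\ge 1$ be integers with $p\nmid m$. Let $G$ be a semi-direct product of the form $\mathbb{Z}/p^n \rtimes \mathbb{Z}/m$. Let $\sigma \in G$ have order $p^n$ and let $m'=|\mathrm{Cent}_G(\sigma)|/p^n$. A sequence $u_1 \leq \cdots \leq u_n$ of rational numbers occurs as the set of positive breaks in the upper numbering of the ramification filtration of a $G$-Galois extension of $k((t))$ if and only if all of the following hold: (a) $u_i \in \frac{1}{m}\mathbb{N}$ for $1 \leq i \leq n$; (b) $\gcd(m, mu_1)=m'$; (c) $p \nmid mu_1$ and, for $1 < i \leq n$, either $u_i=pu_{i-1}$, or both $u_i > pu_{i-1}$ and $p \nmid mu_i$; (d) $mu_i \equiv mu_1 \bmod m$ for $1 \leq i \leq n$.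
   Context: A $G$-Galois extension of $K=k((t))$ is a separable Galois field extension $L/K$ together with a fixed identification of $\mathrm{Aut}(L/K)$ with $G$. Since $k$ is algebraically closed, such an extension is totally ramified. The ramification filtrations in the lower and upper numbering are those of Serre's "Local Fields", Chapter IV: with $v$ the normalized valuation on $L$ and $\pi$ a uniformizer of $L$, the $r$th lower ramification group is $I_r=\{g\in G : v(g(\pi)-\pi)\ge r+1\}$, and the upper numbering is obtained by Herbrand's formula. There are exactly $n$ positive breaks $j_1\le\cdots\le j_n$ in the lower numbering and $n$ positive breaks $u_1\le\cdots\le u_n$ in the upper numbering; with $j_0=u_0=0$ they are related by $u_i-u_{i-1}=(j_i-j_{i-1})/(p^{i-1}m)$ for $1\le i\le n$. *)

theory Defs
  imports
    "HOL-Analysis.Analysis"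
    "HOL-Computational_Algebra.Computational_Algebra"
    "HOL-Number_Theory.Cong"
    "HOL-Algebra.Algebra"
    "HOL-Algebra.Algebraic_Closure_Type"
begin

hide_const (open) Divisibility.irreducible Divisibility.prime

text \<open>
  A finite extension of a field \<open>K\<close> (a type of class \<open>field\<close>) is modelled as a subfield \<open>L\<close> of
  the fixed algebraic closure of \<open>K\<close>, containing the image of \<open>K\<close> under the canonical embedding
  \<^const>\<open>to_ac\<close>. Every finite extension of \<open>K\<close> is \<open>K\<close>-isomorphic to one of this form.
\<close>

definition finite_field_extension :: "'a::field alg_closure set \<Rightarrow> bool" where
  "finite_field_extension L \<longleftrightarrow>
     subfield L ring_of_type_algebra \<and> range to_ac \<subseteq> L \<and>
     ring.finite_dimension ring_of_type_algebra (range (to_ac :: 'a \<Rightarrow> _)) L"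

text \<open>
  Separability and normality are expressed through the irreducible polynomials over \<open>K\<close> having a
  root in \<open>L\<close>, i.e. the minimal polynomials of elements of \<open>L\<close> up to a constant factor.
\<close>

definition separable_extension :: "'a::field alg_closure set \<Rightarrow> bool" where
  "separable_extension L \<longleftrightarrow>
     (\<forall>x\<in>L. \<forall>q :: 'a poly. irreducible q \<longrightarrow> poly (map_poly to_ac q) x = 0 \<longrightarrow>
        rsquarefree (map_poly to_ac q))"

definition normal_extension :: "'a::field alg_closure set \<Rightarrow> bool" where
  "normal_extension L \<longleftrightarrow>
     (\<forall>x\<in>L. \<forall>q :: 'a poly. irreducible q \<longrightarrow> poly (map_poly to_ac q) x = 0 \<longrightarrow>
        (\<forall>y. poly (map_poly to_ac q) y = 0 \<longrightarrow> y \<in> L))"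

definition galois_extension :: "'a::field alg_closure set \<Rightarrow> bool" where
  "galois_extension L \<longleftrightarrow>
     finite_field_extension L \<and> separable_extension L \<and> normal_extension L"

definition field_aut_group :: "'a::field alg_closure set \<Rightarrow> ('a alg_closure \<Rightarrow> 'a alg_closure) monoid"
  where
  "field_aut_group L = BijGroup L
     \<lparr>carrier := {f \<in> Bij L.
        f \<in> ring_hom (ring_of_type_algebra\<lparr>carrier := L\<rparr>) (ring_of_type_algebra\<lparr>carrier := L\<rparr>) \<and>
        (\<forall>c :: 'a. f (to_ac c) = to_ac c)}\<rparr>"

text \<open>The isomorphism \<open>act\<close> is the fixed identification of \<open>G\<close> with \<open>Aut(L/K)\<close>.\<close>

definition G_galois_extension ::
  "('g, 'b) monoid_scheme \<Rightarrow> 'a::field alg_closure set \<Rightarrow> ('g \<Rightarrow> 'a alg_closure \<Rightarrow> 'a alg_closure) \<Rightarrow> bool"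
  where
  "G_galois_extension G L act \<longleftrightarrow> galois_extension L \<and> act \<in> iso G (field_aut_group L)"

text \<open>
  The normalized discrete valuation \<open>v\<close> of a finite extension \<open>L\<close> of \<open>k((t))\<close>: the \<open>\<int>\<close>-valued
  surjective valuation on \<open>L\<close> that prolongs the \<open>t\<close>-adic one, with \<open>e\<close> the ramification index.
  The value \<open>v 0 = \<infinity>\<close> is not represented; \<open>v 0\<close> is unspecified.
\<close>

definition normalized_valuation :: "'k::field fls alg_closure set \<Rightarrow> ('k fls alg_closure \<Rightarrow> int) \<Rightarrow> bool"
  where
  "normalized_valuation L v \<longleftrightarrow>
     (\<forall>x\<in>L - {0}. \<forall>y\<in>L - {0}. v (x * y) = v x + v y) \<and>
     (\<forall>x\<in>L - {0}. \<forall>y\<in>L - {0}. x + y \<noteq> 0 \<longrightarrow> min (v x) (v y) \<le> v (x + y)) \<and>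
     v ` (L - {0}) = UNIV \<and>
     (\<exists>e::nat. e \<ge> 1 \<and> (\<forall>f::'k fls. f \<noteq> 0 \<longrightarrow> v (to_ac f) = int e * fls_subdegree f))"

definition uniformizer :: "'a::field alg_closure set \<Rightarrow> ('a alg_closure \<Rightarrow> int) \<Rightarrow> 'a alg_closure \<Rightarrow> bool"
  where "uniformizer L v \<pi> \<longleftrightarrow> \<pi> \<in> L - {0} \<and> v \<pi> = 1"

text \<open>
  \<open>I\<^sub>r = {g. v (g \<pi> - \<pi>) \<ge> r + 1}\<close> for real \<open>r\<close>; since \<open>v\<close> is integer-valued this agrees with Serre's
  convention that the group at a real \<open>r\<close> is the one at the ceiling of \<open>r\<close>. The disjunct \<open>g \<pi> = \<pi>\<close>
  is the case \<open>v (g \<pi> - \<pi>) = \<infinity>\<close>.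
\<close>

definition lower_ramification ::
  "('g, 'b) monoid_scheme \<Rightarrow> ('g \<Rightarrow> 'a \<Rightarrow> 'a) \<Rightarrow> ('a::field \<Rightarrow> int) \<Rightarrow> 'a \<Rightarrow> real \<Rightarrow> 'g set"
  where
  "lower_ramification G act v \<pi> r =
     {g \<in> carrier G. act g \<pi> = \<pi> \<or> real_of_int (v (act g \<pi> - \<pi>)) \<ge> r + 1}"

text \<open>
  The Herbrand function is the integral from \<open>0\<close> to \<open>u\<close> of \<open>1 / (I\<^sub>0 : I\<^sub>t)\<close>, for \<open>u \<ge> 0\<close>; the group
  \<open>I\<^sup>x\<close> in the upper numbering (\<open>x \<ge> 0\<close>) is \<open>I\<^sub>r\<close> for the \<open>r \<ge> 0\<close> at which the function takes the
  value \<open>x\<close>.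
\<close>

definition herbrand ::
  "('g, 'b) monoid_scheme \<Rightarrow> ('g \<Rightarrow> 'a \<Rightarrow> 'a) \<Rightarrow> ('a::field \<Rightarrow> int) \<Rightarrow> 'a \<Rightarrow> real \<Rightarrow> real"
  where
  "herbrand G act v \<pi> u =
     integral {0..u} (\<lambda>t. real (card (lower_ramification G act v \<pi> t)) /
                          real (card (lower_ramification G act v \<pi> 0)))"

definition upper_ramification ::
  "('g, 'b) monoid_scheme \<Rightarrow> ('g \<Rightarrow> 'a \<Rightarrow> 'a) \<Rightarrow> ('a::field \<Rightarrow> int) \<Rightarrow> 'a \<Rightarrow> real \<Rightarrow> 'g set"
  where
  "upper_ramification G act v \<pi> x =
     lower_ramification G act v \<pi> (the_inv_into {0..} (herbrand G act v \<pi>) x)"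

definition positive_upper_breaks ::
  "('g, 'b) monoid_scheme \<Rightarrow> ('g \<Rightarrow> 'a \<Rightarrow> 'a) \<Rightarrow> ('a::field \<Rightarrow> int) \<Rightarrow> 'a \<Rightarrow> real set"
  where
  "positive_upper_breaks G act v \<pi> =
     {x. x > 0 \<and> (\<forall>\<epsilon>>0. upper_ramification G act v \<pi> (x + \<epsilon>) \<noteq> upper_ramification G act v \<pi> x)}"

definition occurs_as_upper_breaks ::
  "'k::field itself \<Rightarrow> ('g, 'b) monoid_scheme \<Rightarrow> real set \<Rightarrow> bool"
  where
  "occurs_as_upper_breaks _ G B \<longleftrightarrow>
     (\<exists>(L :: 'k fls alg_closure set) act v \<pi>.
        G_galois_extension G L act \<and> normalized_valuation L v \<and> uniformizer L v \<pi> \<and>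
        positive_upper_breaks G act v \<pi> = B)"

text \<open>\<open>G\<close> is an (internal) semidirect product \<open>\<int>/a \<rtimes> \<int>/b\<close> with normal factor \<open>\<int>/a\<close>.\<close>

definition cyclic_semidirect_product :: "('g, 'b) monoid_scheme \<Rightarrow> nat \<Rightarrow> nat \<Rightarrow> bool" where
  "cyclic_semidirect_product G a b \<longleftrightarrow>
     (\<exists>N H. N \<lhd> G \<and> subgroup H G \<and> N \<inter> H = {\<one>\<^bsub>G\<^esub>} \<and> N <#>\<^bsub>G\<^esub> H = carrier G \<and>
        G\<lparr>carrier := N\<rparr> \<cong> integer_mod_group a \<and> G\<lparr>carrier := H\<rparr> \<cong> integer_mod_group b)"

definition centralizer :: "('g, 'b) monoid_scheme \<Rightarrow> 'g \<Rightarrow> 'g set" where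
  "centralizer G s = {g \<in> carrier G. g \<otimes>\<^bsub>G\<^esub> s = s \<otimes>\<^bsub>G\<^esub> g}"

end

theory Submission
  imports Defs
begin

text \<open>
  All fields in sight are copies of the Laurent series field \<open>k((t))\<close>, so extensions are handled as
  embeddings of the type \<open>'k fls\<close> into itself. An extension with group \<open>\<int>/p\<^sup>n\<close> generated by \<open>\<sigma>\<close> is
  described by a power series \<open>Y\<close> with \<open>\<sigma> Y = E Y\<close> and \<open>Fr Y = (\<Prod>i<n. E(h\<^sub>i t\<^bsup>p\<^sup>i\<^esup>)) Y\<close> modulo
  \<open>t\<^bsup>p\<^sup>n\<^esup>\<close>, where \<open>E\<close> is the \<open>p\<close>-typical part of \<open>1 + t\<close> and \<open>Fr\<close> raises coefficients to the \<open>p\<close>-th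
  power; this replaces Witt vectors. The \<open>h\<^sub>i\<close> lie in the base field and can be reduced to \<open>0\<close> or to
  a pole order \<open>a\<^sub>i\<close> prime to \<open>p\<close>. Since \<open>Fr\<close> kills derivatives, \<open>dY = -(df/f) Y\<close> for the product
  \<open>f\<close>, and comparing pole orders of differentials on the layers of the extension gives the upper
  breaks \<open>max {p\<^bsup>l-1-i\<^esup> a\<^sub>i | i < l}\<close>, which is condition (c). The tame part acts on \<open>Y\<close> by
  \<open>Y \<mapsto> Y\<^sup>N\<close>, and its character determines the breaks modulo \<open>m\<close>, which is (b) and (d). Conversely
  the equations for \<open>Y\<close> are solved by a tower of Artin--Schreier extensions with \<open>h\<^sub>i\<close> a monomial
  or \<open>0\<close>.
\<close>

hide_const (open) up_ring.monom up_ring.coeff Polynomials.degree Coset.order module.smult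

text \<open>As k is algebraically closed, residue fields never grow: each layer of a tower is again
  a copy of k((t)), and an extension amounts to an embedding multiplying valuations by its degree.
  One type thus serves for all layers. Multiplication of series with constant term 1 modulo
  \<open>t^(p^n)\<close> stands for addition of Witt vectors of length n, field endomorphisms act
  coefficientwise, and the equation for Y is the Artin-Schreier-Witt equation. The obstacle in
  reading off breaks: the coefficient of Y at \<open>t^(p^(l-1))\<close> generates layer l, but its
  pole order may be divisible by p, and the reduced generator differs from it by an unknown element
  of the layer below. A bound on the different of the lower layers shows that the derivative of this
  unknown summand has a smaller pole. Hence the pole of the derivative of the reduced generator is
  known exactly, and it determines the break. For the converse, (b) permits a choice of primitive
  m-th root of unity for which, by (d), the tame generator scales all \<open>h i\<close> by one
  element of the prime field; this makes it extend to the whole tower.\<close>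

locale field_hom =
  fixes f :: "'a::field \<Rightarrow> 'b::field"
  assumes one [simp]: "f 1 = 1"
    and add: "f (x + y) = f x + f y"
    and mult: "f (x * y) = f x * f y"
begin

lemma zero [simp]: "f 0 = 0"
  using add[of 0 0] by (metis add_cancel_left_left add_0)

lemma uminus: "f (- x) = - f x"
  using add[of x "- x"] by (simp add: eq_neg_iff_add_eq_0 add.commute)

lemma diff: "f (x - y) = f x - f y"
  using add[of x "- y"] by (simp add: uminus)

lemma power: "f (x ^ n) = f x ^ n"
  by (induction n) (simp_all add: mult)

lemma eq_0_iff [simp]: "f x = 0 \<longleftrightarrow> x = 0"
proof
  show "x = 0" if "f x = 0"
  proof (rule ccontr)
    assume "x \<noteq> 0"
    then have "f x * f (inverse x) = 1"
      using mult[of x "inverse x"] by simp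
    with that show False by simp
  qed
qed simp

lemma eq_iff [simp]: "f x = f y \<longleftrightarrow> x = y"
  using eq_0_iff[of "x - y"] unfolding diff by simp

lemma inj: "inj f"
  by (rule injI) simp

lemma inverse: "f (inverse x) = inverse (f x)"
proof (cases "x = 0")
  case False
  then have "f x * f (inverse x) = 1"
    using mult[of x "inverse x"] by simp
  then show ?thesis by (metis inverse_unique)
qed simp

lemma divide: "f (x / y) = f x / f y"
  by (simp add: divide_inverse mult inverse)

lemma power_int: "f (x powi n) = f x powi n"
  by (simp add: power_int_def power inverse)

lemma sum: "f (sum g A) = (\<Sum>i\<in>A. f (g i))"
  by (induction A rule: infinite_finite_induct) (simp_all add: add)

lemma prod: "f (prod g A) = (\<Prod>i\<in>A. f (g i))"
  by (induction A rule: infinite_finite_induct) (simp_all add: mult)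

lemma of_nat: "f (of_nat n) = of_nat n"
  by (induction n) (simp_all add: add)

lemma poly: "f (poly q x) = poly (map_poly f q) (f x)"
  by (induction q) (simp_all add: map_poly_pCons add mult)

end

lemma field_hom_comp: "field_hom f \<Longrightarrow> field_hom g \<Longrightarrow> field_hom (\<lambda>x. f (g x))"
  by (simp add: field_hom_def)

lemma field_hom_funpow: "field_hom f \<Longrightarrow> field_hom (f ^^ k)" for f :: "'a::field \<Rightarrow> 'a"
proof (induction k)
  case 0
  show ?case by unfold_locales simp_all
next
  case (Suc k)
  from field_hom_comp[OF Suc.prems Suc.IH[OF Suc.prems]] show ?case by (simp add: comp_def)
qed

lemma field_hom_frobenius:
  "field_hom (\<lambda>x::'a::field. x ^ p)" if "prime p" "CHAR('a) = p"
  using that by (auto simp: field_hom_def freshmans_dream power_mult_distrib)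

lemma field_hom_to_ac: "field_hom to_ac"
  by unfold_locales auto

section \<open>Valuations of Laurent series\<close>

abbreviation \<nu> :: "'a::zero fls \<Rightarrow> int" where "\<nu> \<equiv> fls_subdegree"

text \<open>The disjunct gives 0 infinite valuation; \<open>fls_subdegree 0\<close> itself is
  0.\<close>

definition vge :: "int \<Rightarrow> 'a::zero fls \<Rightarrow> bool" where
  "vge N x \<longleftrightarrow> x = 0 \<or> N \<le> \<nu> x"

lemma vge_iff: "vge N x \<longleftrightarrow> (\<forall>n<N. fls_nth x n = 0)"
  unfolding vge_def
  using fls_subdegree_geI[of x N] fls_eq0_below_subdegree[of _ x] by force

lemma vge_0 [simp]: "vge N 0" by (simp add: vge_def)
lemma vge_mono: "vge M x \<Longrightarrow> N \<le> M \<Longrightarrow> vge N x" by (auto simp: vge_def)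
lemma vge_subdegree [simp]: "vge (\<nu> x) x" by (simp add: vge_def)
lemma vge_add: "vge N x \<Longrightarrow> vge N y \<Longrightarrow> vge N (x + y)"
  for x y :: "'a::monoid_add fls" by (simp add: vge_iff)
lemma vge_diff: "vge N x \<Longrightarrow> vge N y \<Longrightarrow> vge N (x - y)"
  for x y :: "'a::group_add fls" by (simp add: vge_iff)
lemma vge_uminus: "vge N (- x) \<longleftrightarrow> vge N x"
  for x :: "'a::group_add fls" by (simp add: vge_iff)
lemma vge_sum: "(\<And>i. i \<in> A \<Longrightarrow> vge N (f i)) \<Longrightarrow> vge N (sum f A)"
  for f :: "_ \<Rightarrow> 'a::comm_monoid_add fls"
  by (induction A rule: infinite_finite_induct) (auto intro: vge_add)
lemma vge_mult: "vge M x \<Longrightarrow> vge N y \<Longrightarrow> vge (M + N) (x * y)"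
  for x y :: "'a::field fls" by (auto simp: vge_def)
lemma vge_power: "vge M x \<Longrightarrow> vge (int n * M) (x ^ n)"
  for x :: "'a::field fls" by (auto simp: vge_def fls_subdegree_pow mult_left_mono)
lemma vge_all_imp_0: "(\<And>N. vge N x) \<Longrightarrow> x = 0"
proof (rule ccontr)
  assume "\<And>N. vge N x" "x \<noteq> 0"
  from this(1)[of "\<nu> x + 1"] this(2) show False by (simp add: vge_def)
qed
lemma vge_all_imp_0': "(\<And>n::nat. vge (int n + K) x) \<Longrightarrow> x = 0"
proof (rule vge_all_imp_0)
  fix N assume "\<And>n::nat. vge (int n + K) x"
  from this[of "nat (N - K)"] show "vge N x" by (rule vge_mono) simp
qed
lemma vge_const [simp]: "N \<le> 0 \<Longrightarrow> vge N (fls_const c)"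
  by (simp add: vge_iff)

lemma subdegree_eq_if_vge_diff:
  "vge (\<nu> x + 1) (y - x) \<Longrightarrow> x \<noteq> 0 \<Longrightarrow> y \<noteq> 0 \<and> \<nu> y = \<nu> x"
  for x y :: "'a::group_add fls"
proof -
  assume *: "vge (\<nu> x + 1) (y - x)" "x \<noteq> 0"
  then have nth: "fls_nth y n = fls_nth x n" if "n \<le> \<nu> x" for n
    using that by (auto simp: vge_iff)
  have "\<nu> y = \<nu> x"
    by (rule fls_subdegree_eqI) (use nth * in auto)
  moreover have "y \<noteq> 0" using nth[of "\<nu> x"] * by auto
  ultimately show ?thesis by simp
qed

lemma fls_subdegree_add_eq:
  "x \<noteq> 0 \<Longrightarrow> vge (\<nu> x + 1) y \<Longrightarrow> x + y \<noteq> 0 \<and> \<nu> (x + y) = \<nu> x"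
  for x y :: "'a::ab_group_add fls"
  using subdegree_eq_if_vge_diff[of x "x + y"] by simp

text \<open>Coefficient m of the limit is read off any \<open>A n\<close> with
  \<open>g n > m\<close>, where it no longer changes. The rate g stays in the conclusion because the
  later limit arguments need it.\<close>

lemma fls_complete:
  fixes A :: "nat \<Rightarrow> 'a::ab_group_add fls"
  assumes "\<And>n. vge (g n) (A (Suc n) - A n)" and "mono g" and unb: "\<And>m. \<exists>n. g n \<ge> m"
  obtains a where "\<And>n. vge (g n) (a - A n)"
proof -
  have *: "vge (g n) (A (n + k) - A n)" for n k
  proof (induction k)
    case (Suc k)
    have "vge (g n) (A (Suc (n + k)) - A (n + k))"
      using assms(1)[of "n + k"] monoD[OF \<open>mono g\<close>, of n "n + k"] by (auto intro: vge_mono)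
    from vge_add[OF this Suc] show ?case by simp
  qed simp
  define N where "N m = (SOME n. g n > m)" for m
  have N: "g (N m) > m" for m
    unfolding N_def using unb[of "m + 1"] by (intro someI_ex[where P = "\<lambda>n. m < g n"]) (auto simp: zless_iff_Suc_zadd add1_zle_eq)
  define c where "c m = fls_nth (A (N m)) m" for m
  have c: "c m = fls_nth (A n) m" if "m < g n" for m n
  proof -
    have "fls_nth (A (max n (N m))) m = fls_nth (A n) m"
      using *[of n "max n (N m) - n"] that by (auto simp: vge_iff)
    moreover have "fls_nth (A (max n (N m))) m = fls_nth (A (N m)) m"
      using *[of "N m" "max n (N m) - N m"] N[of m] by (auto simp: vge_iff)
    ultimately show ?thesis by (simp add: c_def)
  qed
  have "\<forall>m < min (g 0) (\<nu> (A 0)). c m = 0"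
    using c[of _ 0] by simp
  then have "fls_nth (Abs_fls c) m = c m" for m
    by (rule nth_Abs_fls_lower_bound)
  then have "vge (g n) (Abs_fls c - A n)" for n
    using c[of _ n] by (simp add: vge_iff)
  then show ?thesis by (rule that)
qed

text \<open>Summands of pairwise distinct valuations cannot cancel, so the smallest valuation is
  that of the sum.\<close>

lemma vge_sum_distinct:
  fixes f :: "'i \<Rightarrow> 'a::ab_group_add fls"
  assumes "finite A" and inj: "inj_on (\<lambda>i. \<nu> (f i)) {i\<in>A. f i \<noteq> 0}"
    and N: "vge N (sum f A)" and "i \<in> A"
  shows "vge N (f i)"
proof (rule ccontr)
  assume "\<not> vge N (f i)"
  define B where "B = {i\<in>A. f i \<noteq> 0}"
  have "finite B" "i \<in> B"
    using assms(1,4) \<open>\<not> vge N (f i)\<close> by (auto simp: B_def vge_def)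
  then have "Min ((\<lambda>i. \<nu> (f i)) ` B) \<in> (\<lambda>i. \<nu> (f i)) ` B"
    by (intro Min_in) auto
  then obtain j where "j \<in> B" "\<nu> (f j) = Min ((\<lambda>i. \<nu> (f i)) ` B)"
    by auto
  with \<open>finite B\<close> have j: "j \<in> B" "\<And>i. i \<in> B \<Longrightarrow> \<nu> (f j) \<le> \<nu> (f i)"
    by auto
  have "sum f A = sum f B"
    unfolding B_def using assms(1) by (intro sum.mono_neutral_right) auto
  also have "\<dots> = f j + sum f (B - {j})"
    using \<open>finite B\<close> j(1) by (simp add: sum.remove)
  finally have eq: "sum f A = f j + sum f (B - {j})" .
  have "vge (\<nu> (f j) + 1) (sum f (B - {j}))"
  proof (rule vge_sum)
    fix k assume k: "k \<in> B - {j}"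
    then have "\<nu> (f k) \<noteq> \<nu> (f j)"
      using inj j(1) by (auto simp: B_def inj_on_def)
    with j(2)[of k] k show "vge (\<nu> (f j) + 1) (f k)" by (auto simp: vge_def)
  qed
  from fls_subdegree_add_eq[OF _ this] j(1) eq
  have "sum f A \<noteq> 0" "\<nu> (sum f A) = \<nu> (f j)"
    by (auto simp: B_def)
  with N have "N \<le> \<nu> (f j)" by (simp add: vge_def)
  with j(2)[OF \<open>i \<in> B\<close>] have "vge N (f i)" by (auto simp: vge_def)
  with \<open>\<not> vge N (f i)\<close> show False ..
qed

text \<open>Constants are only required to be permuted, not fixed, so that the Frobenius
  \<open>x \<mapsto> x^p\<close> is an instance with d = p.\<close>

locale ramified_hom = field_hom \<rho> for \<rho> :: "'a::field fls \<Rightarrow> 'a fls" +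
  fixes d :: nat
  assumes d_pos: "d \<ge> 1"
    and subdegree: "x \<noteq> 0 \<Longrightarrow> \<nu> (\<rho> x) = int d * \<nu> x"
    and const_surj: "\<exists>c'. \<rho> (fls_const c') = fls_const c"
begin

lemma vge: "vge N x \<Longrightarrow> vge (int d * N) (\<rho> x)"
  by (auto simp: vge_def subdegree mult_left_mono)

end

text \<open>Multiplication by an element of the image changes a valuation by a multiple of d.
  Valuations in distinct classes modulo d therefore rule out cancellation, which gives independence;
  completeness gives spanning.\<close>

locale ramified_basis = ramified_hom \<rho> d for \<rho> :: "'a::field fls \<Rightarrow> 'a fls" and d +
  fixes b :: "nat \<Rightarrow> 'a fls"
  assumes b_nz: "i < d \<Longrightarrow> b i \<noteq> 0"
    and b_inj: "inj_on (\<lambda>i. \<nu> (b i) mod int d) {..<d}"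
begin

lemma vge_basis:
  assumes "vge N (\<Sum>i<d. \<rho> (a i) * b i)" "i < d"
  shows "vge N (\<rho> (a i) * b i)"
proof (rule vge_sum_distinct[OF _ _ assms(1)])
  have "\<nu> (\<rho> (a i) * b i) mod int d = \<nu> (b i) mod int d"
    if "\<rho> (a i) * b i \<noteq> 0" for i
    using that subdegree[of "a i"] by simp
  then show "inj_on (\<lambda>i. \<nu> (\<rho> (a i) * b i)) {i \<in> {..<d}. \<rho> (a i) * b i \<noteq> 0}"
    using b_inj unfolding inj_on_def by (metis (mono_tags, lifting) mem_Collect_eq)
qed (use assms in auto)

lemma basis_independent:
  assumes "(\<Sum>i<d. \<rho> (a i) * b i) = 0" "i < d"
  shows "a i = 0"
proof -
  have "\<rho> (a i) * b i = 0"
    by (rule vge_all_imp_0) (use vge_basis[OF _ assms(2)] assms(1) in auto)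
  with b_nz[OF assms(2)] show ?thesis by simp
qed

text \<open>The valuations of the d basis elements exhaust the residues modulo d, so exactly one of
  them can match the leading term at N, and one monomial coefficient removes it.\<close>

lemma basis_step:
  assumes "vge N x"
  shows "\<exists>a. vge (N + 1) (x - (\<Sum>i<d. \<rho> (a i) * b i)) \<and>
             (\<forall>i<d. a i = 0 \<or> int d * \<nu> (a i) = N - \<nu> (b i))"
proof -
  have "(\<lambda>i. \<nu> (b i) mod int d) ` {..<d} = {0..<int d}"
  proof (rule card_subset_eq)
    show "(\<lambda>i. \<nu> (b i) mod int d) ` {..<d} \<subseteq> {0..<int d}"
      using d_pos by auto
    show "card ((\<lambda>i. \<nu> (b i) mod int d) ` {..<d}) = card {0..<int d}"
      using card_image[OF b_inj] by simp
  qed simp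
  moreover have "N mod int d \<in> {0..<int d}"
    using d_pos by auto
  ultimately obtain i where i: "i < d" "\<nu> (b i) mod int d = N mod int d"
    by (metis (no_types, lifting) imageE lessThan_iff)
  then obtain s where s: "N - \<nu> (b i) = int d * s"
    by (metis mod_eq_dvd_iff dvdE)
  define c where "c = fls_nth x N / fls_nth (b i) (\<nu> (b i))"
  obtain c' where c': "\<rho> (fls_const (c' :: 'a)) = fls_const 1" by (rule exE[OF const_surj])
  define u where "u = \<rho> (fls_X_intpow s)"
  have u: "u \<noteq> 0" "\<nu> u = int d * s"
    unfolding u_def by (simp_all add: subdegree)
  define l where "l = fls_nth u (int d * s)"
  have l: "l \<noteq> 0" using u unfolding l_def by (metis nth_fls_subdegree_nonzero)
  obtain e where e: "\<rho> (fls_const e) = fls_const (c / l)" by (rule exE[OF const_surj])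
  define a where "a = (\<lambda>j. if j = i then fls_const e * fls_X_intpow s else 0 :: 'a fls)"
  define y where "y = fls_const (c / l) * u * b i"
  have sum: "(\<Sum>j<d. \<rho> (a j) * b j) = y"
  proof -
    have "(\<Sum>j<d. \<rho> (a j) * b j) = (\<Sum>j<d. if j = i then y else 0)"
      by (rule sum.cong) (auto simp: a_def y_def mult e u_def)
    then show ?thesis using i(1) by simp
  qed
  have bi: "b i \<noteq> 0" using b_nz i(1) by auto
  have "fls_nth (x - y) n = 0" if "n < N + 1" for n
  proof (cases "n < N")
    case True
    have "vge N y"
    proof -
      have "vge (0 + int d * s + \<nu> (b i)) y"
        unfolding y_def by (intro vge_mult) (use u in \<open>auto simp: vge_def\<close>)
      then show ?thesis using s by (simp add: algebra_simps)
    qed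
    with True assms show ?thesis by (simp add: vge_iff)
  next
    case False
    with that have "n = N" by simp
    have N: "N = \<nu> u + \<nu> (b i)" using s u by simp
    have "fls_nth y N = c / l * (fls_nth (u * b i) N)"
      by (simp add: y_def mult.assoc)
    also have "fls_nth (u * b i) N = l * fls_nth (b i) (\<nu> (b i))"
      unfolding N l_def u(2)[symmetric] by (rule fls_times_base)
    finally have "fls_nth y N = fls_nth x N"
      using l bi by (simp add: c_def)
    with \<open>n = N\<close> show ?thesis by simp
  qed
  then have "vge (N + 1) (x - y)" by (simp add: vge_iff)
  moreover have "a j = 0 \<or> int d * \<nu> (a j) = N - \<nu> (b j)" for j
    using s by (cases "e = 0") (auto simp: a_def fls_subdegree_mult)
  ultimately show ?thesis using sum by (intro exI[of _ a]) auto
qed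

lemma basis_span: "\<exists>a. x = (\<Sum>i<d. \<rho> (a i) * b i)"
proof -
  define S where "S a = (\<Sum>i<d. \<rho> (a i) * b i)" for a
  define N0 where "N0 = \<nu> x"
  define K where "K = Max ((\<lambda>i. \<nu> (b i)) ` {..<d})"
  define L where "L = Min ((\<lambda>i. \<nu> (b i)) ` {..<d})"
  have K: "\<nu> (b i) \<le> K" and L: "L \<le> \<nu> (b i)" if "i < d" for i
    using that unfolding K_def L_def by auto
  define P where "P n a a' \<longleftrightarrow> vge (N0 + int n + 1) (x - S a') \<and>
      (\<forall>i<d. vge ((N0 + int n - K) div int d) (a' i - a i))" for n a a'
  have step: "\<exists>a'. vge (N0 + int (Suc n)) (x - S a') \<and> P n a a'" if "vge (N0 + int n) (x - S a)" for n a
  proof -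
    from basis_step[OF that] obtain r where r: "vge (N0 + int n + 1) (x - S a - S r)"
      "\<And>i. i < d \<Longrightarrow> r i = 0 \<or> int d * \<nu> (r i) = N0 + int n - \<nu> (b i)"
      unfolding S_def by blast
    have "S (\<lambda>i. a i + r i) = S a + S r"
      by (simp add: S_def add ring_distribs sum.distrib)
    moreover have "vge ((N0 + int n - K) div int d) (r i)" if "i < d" for i
    proof (cases "r i = 0")
      case False
      have "(N0 + int n - K) div int d \<le> (int d * \<nu> (r i)) div int d"
        using K[OF that] d_pos r(2)[OF that] False by (intro zdiv_mono1) auto
      then show ?thesis using d_pos by (simp add: vge_def)
    qed simp
    ultimately show ?thesis
      using r(1) by (intro exI[of _ "\<lambda>i. a i + r i"]) (auto simp: P_def algebra_simps)
  qed
  have "\<exists>A. \<forall>n. vge (N0 + int n) (x - S (A n)) \<and> P n (A n) (A (Suc n))"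
  proof (rule dependent_nat_choice)
    show "\<exists>a. vge (N0 + int 0) (x - S a)"
      by (intro exI[of _ "\<lambda>_. 0"]) (simp add: S_def N0_def)
  qed (use step in blast)
  then obtain A where A: "\<And>n. vge (N0 + int n) (x - S (A n))" "\<And>n. P n (A n) (A (Suc n))"
    by blast
  \<comment> \<open>A correction made at step n has valuation
    \<open>(N0 + n - \<nu> (b i)) / d\<close>; K makes the bound uniform in i.\<close>
  define g where "g n = (N0 + int n - K) div int d" for n
  have mono: "mono g" unfolding g_def using d_pos by (intro monoI zdiv_mono1) auto
  have unb: "\<exists>n. m \<le> g n" for m
  proof
    have "m = (m * int d) div int d" using d_pos by simp
    also have "\<dots> \<le> g (nat (m * int d + K - N0))"
      unfolding g_def using d_pos by (intro zdiv_mono1) auto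
    finally show "m \<le> g (nat (m * int d + K - N0))" .
  qed
  have "\<exists>a. \<forall>n. vge (g n) (a - A n i)" if "i < d" for i
    using fls_complete[of g "\<lambda>n. A n i", OF _ mono unb] A(2) that
    unfolding P_def g_def by metis
  then obtain a where a: "\<And>i n. i < d \<Longrightarrow> vge (g n) (a i - A n i)" by metis
  have "x - S a = 0"
  proof (rule vge_all_imp_0)
    fix N
    obtain n where n: "\<bar>N\<bar> + \<bar>L\<bar> \<le> g n" "N \<le> N0 + int n"
    proof -
      obtain n1 where n1: "\<bar>N\<bar> + \<bar>L\<bar> \<le> g n1" using unb by blast
      have "g n1 \<le> g (max n1 (nat (N - N0)))" by (rule monoD[OF mono]) simp
      with n1 show ?thesis by (intro that[of "max n1 (nat (N - N0))"]) auto
    qed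
    have *: "x - S a = (x - S (A n)) - (\<Sum>i<d. \<rho> (a i - A n i) * b i)"
      by (simp add: S_def diff algebra_simps sum_subtractf)
    have **: "vge N (\<Sum>i<d. \<rho> (a i - A n i) * b i)"
    proof (rule vge_sum)
      fix i assume "i \<in> {..<d}"
      then have i: "i < d" by simp
      have "vge (int d * (\<bar>N\<bar> + \<bar>L\<bar>) + \<nu> (b i)) (\<rho> (a i - A n i) * b i)"
        by (intro vge_mult vge vge_subdegree vge_mono[OF a[OF i] n(1)])
      moreover have "\<bar>N\<bar> + \<bar>L\<bar> \<le> int d * (\<bar>N\<bar> + \<bar>L\<bar>)"
        using d_pos mult_right_mono[of 1 "int d" "\<bar>N\<bar> + \<bar>L\<bar>"] by simp
      ultimately show "vge N (\<rho> (a i - A n i) * b i)"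
        using L[OF i] by (elim vge_mono) linarith
    qed
    show "vge N (x - S a)"
      unfolding * by (simp only: vge_diff[OF vge_mono[OF A(1) n(2)] **])
  qed
  then show ?thesis unfolding S_def by (intro exI[of _ a]) simp
qed

end

section \<open>Powers and roots of power series\<close>

declare fls_X_power_int [simp del]

definition fcong :: "nat \<Rightarrow> 'a fps \<Rightarrow> 'a fps \<Rightarrow> bool" where
  "fcong N F G \<longleftrightarrow> (\<forall>k<N. fps_nth F k = fps_nth G k)"

lemma fcong_refl [simp]: "fcong N F F" by (simp add: fcong_def)
lemma fcong_sym: "fcong N F G \<Longrightarrow> fcong N G F" by (simp add: fcong_def)
lemma fcong_trans [trans]: "fcong N F G \<Longrightarrow> fcong N G H \<Longrightarrow> fcong N F H" by (simp add: fcong_def)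
lemma fcong_mono: "fcong N F G \<Longrightarrow> M \<le> N \<Longrightarrow> fcong M F G" by (simp add: fcong_def)
lemma fcong_mult:
  fixes F :: "'a::comm_semiring_1 fps"
  shows "fcong N F F' \<Longrightarrow> fcong N G G' \<Longrightarrow> fcong N (F * G) (F' * G')"
  unfolding fcong_def fps_mult_nth by (intro allI impI sum.cong) auto
lemma fcong_power:
  fixes F :: "'a::comm_semiring_1 fps"
  shows "fcong N F F' \<Longrightarrow> fcong N (F ^ n) (F' ^ n)"
  by (induction n) (auto intro: fcong_mult)
lemma fcong_prod:
  fixes F :: "_ \<Rightarrow> 'a::comm_semiring_1 fps"
  shows "(\<And>i. i \<in> A \<Longrightarrow> fcong N (F i) (G i)) \<Longrightarrow> fcong N (prod F A) (prod G A)"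
  by (induction A rule: infinite_finite_induct) (auto intro: fcong_mult)
lemma fcong_all: "(\<And>N. fcong N F G) \<Longrightarrow> F = G"
  unfolding fcong_def fps_eq_iff by blast

lemma fps_power_nth_0: "fps_nth (F ^ n) 0 = fps_nth F 0 ^ n"
  for F :: "'a::comm_semiring_1 fps"
  by (induction n) simp_all

text \<open>With F = 1 + tH the power is \<open>1 + t^(p^s) H^(p^s)\<close>.\<close>

lemma fps_power_frobenius:
  fixes F :: "'a::field fps"
  assumes p: "prime p" "CHAR('a) = p" and F0: "fps_nth F 0 = 1"
  shows "fcong (p ^ s) (F ^ (p ^ s)) 1"
proof -
  have "F = 1 + fps_X * fps_shift 1 F"
    by (rule fps_ext) (auto simp: F0 split: nat.splits)
  then have "F ^ (p ^ s) = (1 + fps_X * fps_shift 1 F) ^ (p ^ s)" by simp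
  also have "\<dots> = 1 + fps_X ^ (p ^ s) * fps_shift 1 F ^ (p ^ s)"
    using p by (subst freshmans_dream'[where m = "p ^ s" and n = s]) (auto simp: power_mult_distrib)
  finally show ?thesis
    by (auto simp: fcong_def fps_X_power_mult_nth)
qed

text \<open>Exponents count only modulo \<open>p^s\<close>: the series with constant term 1 form a
  module over the p-adic integers, in which every N prime to p is invertible.\<close>

lemma fps_power_cong:
  fixes F :: "'a::field fps"
  assumes p: "prime p" "CHAR('a) = p" and F0: "fps_nth F 0 = 1" and ab: "[a = b] (mod p ^ s)"
  shows "fcong (p ^ s) (F ^ a) (F ^ b)"
proof -
  have *: "fcong (p ^ s) (F ^ a) (F ^ (a mod p ^ s))" for a
  proof -
    have "F ^ a = (F ^ (p ^ s)) ^ (a div p ^ s) * F ^ (a mod p ^ s)"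
      by (simp flip: power_mult power_add)
    moreover have "fcong (p ^ s) ((F ^ (p ^ s)) ^ (a div p ^ s) * F ^ (a mod p ^ s)) (1 ^ (a div p ^ s) * F ^ (a mod p ^ s))"
      by (intro fcong_mult fcong_power fps_power_frobenius p F0 fcong_refl)
    ultimately show ?thesis by simp
  qed
  from *[of a] *[of b] ab show ?thesis
    unfolding cong_def by (metis fcong_sym fcong_trans)
qed

lemma exp_gt_self: "prime p \<Longrightarrow> n < p ^ n" for p n :: nat
  by (meson order_less_le_trans power_gt_expt prime_ge_2_nat less_exp power_mono zero_le numeral_2_eq_2 le_refl prime_gt_1_nat)

text \<open>The root is F raised to the p-adic number 1/N, a limit of powers by inverses of N modulo
  \<open>p^s\<close>.\<close>

lemma fps_root:
  fixes F :: "'a::field fps"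
  assumes p: "prime p" "CHAR('a) = p" and F0: "fps_nth F 0 = 1" and N: "\<not> p dvd N"
  obtains G where "fps_nth G 0 = 1" "G ^ N = F"
proof -
  have cop: "coprime N (p ^ s)" for s
    using N p by (metis coprime_commute coprime_power_right_iff prime_imp_coprime)
  have "\<exists>r. [N * r = 1] (mod p ^ s)" for s
    using cong_solve_coprime_nat[OF cop] by simp
  then obtain r where r: "\<And>s. [N * r s = 1] (mod p ^ s)" by metis
  \<comment> \<open>For coefficient n an inverse of N modulo \<open>p^(n+1)\<close> suffices,
    because n + 1 < \<open>p^(n+1)\<close>.\<close>
  define G where "G = Abs_fps (\<lambda>n. fps_nth (F ^ r (Suc n)) n)"
  have G: "fcong s G (F ^ r s)" for s
    unfolding fcong_def
  proof (intro allI impI)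
    fix k assume "k < s"
    have "[N * r s = N * r (Suc k)] (mod p ^ Suc k)"
      using r[of s] r[of "Suc k"] \<open>k < s\<close>
      by (meson Suc_leI cong_dvd_modulus_nat cong_sym cong_trans le_imp_power_dvd)
    then have "[r s = r (Suc k)] (mod p ^ Suc k)"
      using cong_mult_lcancel_nat[OF cop] by blast
    from fps_power_cong[OF p F0 this] show "fps_nth G k = fps_nth (F ^ r s) k"
      using exp_gt_self[OF p(1), of "Suc k"] by (simp add: fcong_def G_def)
  qed
  have "fcong s (G ^ N) F" for s
  proof -
    have "fcong s (G ^ N) ((F ^ r s) ^ N)" by (intro fcong_power G)
    also have "(F ^ r s) ^ N = F ^ (N * r s)" by (simp add: mult.commute flip: power_mult)
    also have "fcong s \<dots> (F ^ 1)"
      by (rule fcong_mono[OF fps_power_cong[OF p F0 r]]) (use exp_gt_self[OF p(1), of s] in simp)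
    finally show ?thesis by simp
  qed
  then have "G ^ N = F" by (rule fcong_all)
  moreover have "fps_nth G 0 = 1" by (simp add: G_def F0 fps_power_nth_0)
  ultimately show ?thesis by (rule that[rotated])
qed

lemma fls_unit_root:
  fixes x :: "'k::alg_closed_field fls"
  assumes p: "prime p" "CHAR('k) = p" and N: "\<not> p dvd N" and x: "x \<noteq> 0" "\<nu> x = 0"
  obtains y where "y ^ N = x" "\<nu> y = 0"
proof -
  define c where "c = fls_nth x 0"
  have c: "c \<noteq> 0" using x by (metis c_def nth_fls_subdegree_nonzero)
  have N0: "N > 0" using N by (intro Nat.gr0I) auto
  obtain c' where c': "c' ^ N = c" using nth_root_exists[OF N0] by metis
  define F where "F = fps_const (inverse c) * fls_regpart x"
  have "fps_nth F 0 = 1" using c by (simp add: F_def c_def)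
  from fps_root[OF p this N] obtain G where G: "fps_nth G 0 = 1" "G ^ N = F" by blast
  define y where "y = fls_const c' * fps_to_fls G"
  have "fls_regpart x = fps_const c * F" using c by (simp add: F_def flip: mult.assoc)
  moreover have "x = fps_to_fls (fls_regpart x)" using x by simp
  ultimately have "x = fls_const c * fps_to_fls F"
    by (metis fls_times_fps_to_fls fps_const_to_fls)
  also have "\<dots> = y ^ N"
    by (simp add: y_def power_mult_distrib G(2) c' flip: fps_to_fls_power fls_const_power)
  finally have "y ^ N = x" by simp
  moreover from this have "\<nu> y = 0"
    using x N0 fls_subdegree_pow[of y N] by auto
  ultimately show ?thesis by (rule that)
qed

lemma fls_decompose:
  fixes x :: "'a::field fls"
  assumes "x \<noteq> 0"
  obtains u where "x = fls_X powi (\<nu> x) * u" "u \<noteq> 0" "\<nu> u = 0"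
proof
  show "x = fls_X powi (\<nu> x) * (fls_X powi (- \<nu> x) * x)"
    by (simp add: power_int_minus flip: mult.assoc)
  show "fls_X powi (- \<nu> x) * x \<noteq> 0" using assms by simp
  show "\<nu> (fls_X powi (- \<nu> x) * x) = 0"
    using assms by (subst fls_subdegree_mult) auto
qed

text \<open>A unit has \<open>N\<close>-th roots for all \<open>N\<close> prime to \<open>p\<close>; so does its image, whose valuation is
  therefore divisible by all such \<open>N\<close>.\<close>

lemma automorphism_subdegree:
  fixes \<alpha> :: "'k::alg_closed_field fls \<Rightarrow> 'k fls"
  assumes p: "prime p" "CHAR('k) = p" and \<alpha>: "field_hom \<alpha>" "surj \<alpha>"
  shows "\<nu> (\<alpha> x) = \<nu> x"
proof (cases "x = 0")
  case True then show ?thesis using field_hom.zero[OF \<alpha>(1)] by simp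
next
  case False
  interpret field_hom \<alpha> by fact
  have unit: "\<nu> (\<alpha> u) = 0" if u: "u \<noteq> 0" "\<nu> u = 0" for u
  proof -
    define s where "s = \<nu> (\<alpha> u)"
    \<comment> \<open>This N is prime to p and exceeds the absolute value of s, so that N dividing s
      forces s = 0.\<close>
    define N where "N = p * nat \<bar>s\<bar> + 1"
    have "\<not> p dvd N"
      unfolding N_def using prime_gt_1_nat[OF p(1)]
      by (subst dvd_add_right_iff) auto
    from fls_unit_root[OF p this u] obtain y where "y ^ N = u" by blast
    then have "s = int N * \<nu> (\<alpha> y)"
      unfolding s_def by (metis power fls_subdegree_pow)
    then have "int N dvd s" by simp
    then have "s = 0 \<or> int N \<le> \<bar>s\<bar>" using dvd_imp_le_int[of s "int N"] by auto
    moreover have "int N > \<bar>s\<bar>"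
    proof -
      have "\<bar>s\<bar> \<le> int p * \<bar>s\<bar>"
        using prime_gt_0_nat[OF p(1)] mult_right_mono[of 1 "int p" "\<bar>s\<bar>"] by simp
      then show ?thesis by (simp add: N_def)
    qed
    ultimately show ?thesis by (simp add: s_def)
  qed
  define d where "d = \<nu> (\<alpha> fls_X)"
  have sub: "\<nu> (\<alpha> x) = \<nu> x * d" if "x \<noteq> 0" for x
  proof -
    from fls_decompose[OF that] obtain u where u: "x = fls_X powi (\<nu> x) * u" "u \<noteq> 0" "\<nu> u = 0" .
    have "\<alpha> x = \<alpha> fls_X powi (\<nu> x) * \<alpha> u"
      by (subst u(1)) (simp add: mult power_int)
    then show ?thesis
      using u by (simp add: unit d_def)
  qed
  obtain w where w: "\<alpha> w = fls_X" using \<alpha>(2) by (metis surjD)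
  then have "w \<noteq> 0" by auto
  from sub[OF this] w have "\<nu> w * d = 1" by simp
  then have "d = 1 \<or> d = -1" by (metis zmult_eq_1_iff)
  \<comment> \<open>With d = -1 the unit 1 + X would have an image of valuation -1.\<close>
  moreover have "d \<noteq> -1"
  proof
    assume "d = -1"
    have "\<nu> (1 + fls_X :: 'k fls) = 0" "1 + fls_X \<noteq> (0 :: 'k fls)"
      using fls_subdegree_add_eq[of "1 :: 'k fls" fls_X] by (auto simp: vge_def)
    then have 1: "\<nu> (\<alpha> (1 + fls_X)) = 0" by (intro unit)
    have "\<nu> (\<alpha> fls_X + 1) = -1"
      using fls_subdegree_add_eq[of "\<alpha> fls_X" 1] \<open>d = -1\<close> by (auto simp: vge_def d_def)
    with 1 show False by (simp add: add add.commute)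
  qed
  ultimately show ?thesis using sub[OF False] by simp
qed

section \<open>Derivations and Frobenius\<close>

text \<open>The powers of X below p are a basis over the subfield of p-th powers, since k is
  perfect. All facts on derivations below come from this expansion, as a derivation is linear over
  p-th powers.\<close>

lemma ramified_basis_frobenius:
  assumes p: "prime p" "CHAR('k::alg_closed_field) = p"
  shows "ramified_basis (\<lambda>x::'k fls. x ^ p) p (\<lambda>i. fls_X ^ i)"
proof -
  interpret field_hom "\<lambda>x::'k fls. x ^ p"
    using field_hom_frobenius[of p, where ?'a = "'k fls"] p by simp
  show ?thesis
  proof unfold_locales
    show "1 \<le> p" using prime_gt_0_nat[OF p(1)] by simp
    show "\<exists>c'. fls_const c' ^ p = fls_const c" for c :: 'k
    proof -
      obtain c' where "c' ^ p = c"
        using nth_root_exists[of p c] prime_gt_0_nat[OF p(1)] by auto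
      then show ?thesis by (intro exI[of _ c']) (simp flip: fls_const_power)
    qed
    show "inj_on (\<lambda>i. \<nu> (fls_X ^ i :: 'k fls) mod int p) {..<p}"
      by (auto simp: inj_on_def fls_subdegree_pow)
  qed (auto simp: fls_subdegree_pow)
qed

lemma fls_deriv_frobenius:
  assumes "prime p" "CHAR('a::field) = p"
  shows "fls_deriv (x ^ p :: 'a fls) = 0"
proof -
  have "of_nat p = (0 :: 'a fls)" using assms by (subst of_nat_eq_0_iff_char_dvd) simp
  then show ?thesis by (simp add: fls_deriv_power)
qed

lemma fls_deriv_p_basis:
  assumes p: "prime p" "CHAR('a::field) = p"
  shows "fls_deriv (\<Sum>i<n. a i ^ p * y ^ i) = (\<Sum>i<n. a i ^ p * (of_nat i * y ^ (i - 1))) * fls_deriv (y :: 'a fls)"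
proof -
  have "fls_deriv (a i ^ p * y ^ i) = a i ^ p * (of_nat i * y ^ (i - 1)) * fls_deriv y" for i
  proof -
    have "fls_deriv (a i ^ p * y ^ i) = a i ^ p * fls_deriv (y ^ i)"
      unfolding fls_deriv_mult fls_deriv_frobenius[OF p] by simp
    then show ?thesis by (simp add: fls_deriv_power mult_ac)
  qed
  then show ?thesis by (simp only: fls_deriv_sum sum_distrib_right)
qed

text \<open>This chain rule holds for every field homomorphism, continuous or not: both sides are
  linear over p-th powers, and the expansion in powers of X below p is a finite sum.\<close>

lemma fls_deriv_hom:
  fixes \<Psi> :: "'k::alg_closed_field fls \<Rightarrow> 'k fls"
  assumes p: "prime p" "CHAR('k) = p" and "field_hom \<Psi>"
  shows "fls_deriv (\<Psi> x) = \<Psi> (fls_deriv x) * fls_deriv (\<Psi> fls_X)"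
proof -
  interpret field_hom \<Psi> by fact
  interpret F: ramified_basis "\<lambda>x::'k fls. x ^ p" p "\<lambda>i. fls_X ^ i"
    by (rule ramified_basis_frobenius[OF p])
  obtain a where a: "x = (\<Sum>i<p. a i ^ p * fls_X ^ i)" using F.basis_span by blast
  show ?thesis
    unfolding a
    by (simp only: sum mult power fls_deriv_p_basis[OF p] of_nat one fls_deriv_X) simp
qed

lemma fls_deriv_eq_0_imp_power:
  fixes x :: "'k::alg_closed_field fls"
  assumes p: "prime p" "CHAR('k) = p" and "fls_deriv x = 0"
  obtains y where "x = y ^ p"
proof -
  interpret F: ramified_basis "\<lambda>x::'k fls. x ^ p" p "\<lambda>i. fls_X ^ i"
    by (rule ramified_basis_frobenius[OF p])
  obtain a where a: "x = (\<Sum>i<p. a i ^ p * fls_X ^ i)" using F.basis_span by blast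
  have p1: "p > 1" using prime_gt_1_nat p by simp
  have "\<exists>c :: 'k fls. c ^ p = of_nat (Suc j)" for j
  proof -
    obtain c :: 'k where "c ^ p = of_nat (Suc j)"
      using nth_root_exists[of p "of_nat (Suc j) :: 'k"] p1 by auto
    then have "fls_const c ^ p = of_nat (Suc j)"
      by (simp only: fls_const_power[symmetric] fls_of_nat)
    then show ?thesis by blast
  qed
  \<comment> \<open>The integer factors produced by differentiation must be p-th powers before
    independence over the p-th powers applies.\<close>
  then obtain r :: "nat \<Rightarrow> 'k fls" where r: "\<And>j. r j ^ p = of_nat (Suc j)" by metis
  define b where "b j = (if Suc j < p then a (Suc j) * r j else 0)" for j
  have b: "b j ^ p = (if Suc j < p then a (Suc j) ^ p * of_nat (Suc j) else 0)" for j
    using p1 by (simp add: b_def power_mult_distrib r del: of_nat_Suc)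
  have "0 = (\<Sum>i<p. a i ^ p * (of_nat i * fls_X ^ (i - 1)))"
    using assms(3) unfolding a fls_deriv_p_basis[OF p] by simp
  also have "\<dots> = (\<Sum>i<Suc (p - 1). a i ^ p * (of_nat i * fls_X ^ (i - 1)))"
    using p1 by simp
  also have "\<dots> = (\<Sum>j<p - 1. a (Suc j) ^ p * (of_nat (Suc j) * fls_X ^ j))"
    by (subst sum.lessThan_Suc_shift) simp
  also have "\<dots> = (\<Sum>j<p - 1. b j ^ p * fls_X ^ j)"
    by (intro sum.cong) (auto simp: b mult_ac simp del: of_nat_Suc)
  also have "\<dots> = (\<Sum>j<p. b j ^ p * fls_X ^ j)"
    using p1 by (intro sum.mono_neutral_left) (auto simp: b)
  finally have *: "b j = 0" if "j < p" for j
    using F.basis_independent that by metis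
  have "a i = 0" if "0 < i" "i < p" for i
  proof -
    have "of_nat i \<noteq> (0 :: 'k fls)"
      using that p by (subst of_nat_eq_0_iff_char_dvd) (auto dest: dvd_imp_le)
    moreover have "a i ^ p * of_nat i = b (i - 1) ^ p"
      using that by (simp add: b)
    ultimately show ?thesis using *[of "i - 1"] that p1 by auto
  qed
  then have "x = (\<Sum>i\<in>{0}. a i ^ p * fls_X ^ i)"
    unfolding a using p1 by (intro sum.mono_neutral_right) (auto simp: power_0_left)
  then show ?thesis by (intro that[of "a 0"]) simp
qed

lemma vge_deriv: "vge N x \<Longrightarrow> vge (N - 1) (fls_deriv x)"
  by (auto simp: vge_iff)

lemma fls_subdegree_deriv:
  fixes x :: "'a::field fls"
  assumes "prime p" "CHAR('a) = p" "\<not> int p dvd \<nu> x"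
  shows "fls_deriv x \<noteq> 0" "\<nu> (fls_deriv x) = \<nu> x - 1"
proof -
  have x: "x \<noteq> 0" using assms(3) by auto
  have "(of_int (\<nu> x) :: 'a) \<noteq> 0"
    using assms by (metis of_int_eq_0_iff_char_dvd)
  with x have nz: "fls_nth (fls_deriv x) (\<nu> x - 1) \<noteq> 0"
    by simp
  then show "fls_deriv x \<noteq> 0" by (metis fls_zero_nth)
  show "\<nu> (fls_deriv x) = \<nu> x - 1"
    by (rule fls_subdegree_eqI) (use nz in auto)
qed

section \<open>Artin--Schreier reduction\<close>

text \<open>The constant term is handled in the algebraically closed k. For the remainder h of
  positive valuation the series with terms \<open>- h^(p^s)\<close> converges, and its image under
  \<open>x^p - x\<close> telescopes to h.\<close>

lemma artin_schreier_nonneg: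
  fixes g :: "'k::alg_closed_field fls"
  assumes p: "prime p" "CHAR('k) = p" and g: "vge 0 g"
  obtains d where "vge 0 d" "d ^ p - d = g"
proof -
  interpret F: field_hom "\<lambda>x::'k fls. x ^ p"
    using field_hom_frobenius[of p, where ?'a = "'k fls"] p by simp
  have p1: "p > 1" using prime_gt_1_nat p by simp
  define c where "c = fls_nth g 0"
  define q where "q = monom 1 p - monom 1 1 - [:c:]"
  have "coeff q p = 1" using p1 by (simp add: q_def coeff_monom coeff_pCons split: nat.splits)
  then have "degree q > 0" using p1 by (metis le_degree one_neq_zero less_le_trans less_trans zero_less_one)
  then obtain e where "poly q e = 0" using alg_closed_imp_poly_has_root by blast
  then have e: "e ^ p - e = c" by (simp add: q_def poly_monom)
  define h where "h = g - fls_const c"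
  have h: "vge 1 h" using g by (auto simp: vge_iff h_def c_def)
  define A where "A n = - (\<Sum>s<n. h ^ (p ^ s))" for n
  have hp: "vge (int n) (h ^ (p ^ n))" for n
    using vge_power[OF h, of "p ^ n"] exp_gt_self[OF p(1), of n]
    by (elim vge_mono) simp
  have "vge (int n) (A (Suc n) - A n)" for n
    using hp[of n] by (simp add: A_def vge_uminus)
  moreover have "\<exists>n. m \<le> int n" for m
    by (intro exI[of _ "nat m"]) simp
  ultimately obtain a where a: "\<And>n. vge (int n) (a - A n)"
    using fls_complete[of int A] by (auto simp: mono_def)
  have "(a ^ p - a) - h = 0"
  proof (rule vge_all_imp_0'[where K = 0])
    fix n
    have "A n ^ p = - (\<Sum>s<n. h ^ (p ^ Suc s))"
      unfolding A_def F.uminus F.sum by (simp add: mult.commute flip: power_mult)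
    then have "A n ^ p - A n = (\<Sum>s<n. h ^ (p ^ s)) - (\<Sum>s<n. h ^ (p ^ Suc s))"
      by (simp add: A_def)
    also have "\<dots> = (\<Sum>s<n. h ^ (p ^ s) - h ^ (p ^ Suc s))" by (simp add: sum_subtractf)
    also have "\<dots> = h ^ (p ^ 0) - h ^ (p ^ n)" by (rule sum_lessThan_telescope')
    finally have A: "A n ^ p - A n = h - h ^ (p ^ n)" by simp
    have "(a ^ p - a) - h = (a - A n) ^ p - (a - A n) - h ^ (p ^ n)"
      using A unfolding F.diff by (simp add: algebra_simps)
    moreover have "vge (int n) ((a - A n) ^ p)"
      using vge_power[OF a, of p n] by (elim vge_mono) (use p1 mult_right_mono[of 1 "int p" "int n"] in simp)
    ultimately show "vge (int n + 0) ((a ^ p - a) - h)"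
      using a[of n] hp[of n] by (simp only: vge_diff add_0_right)
  qed
  then have ap: "a ^ p - a = h" by simp
  have "(a + fls_const e) ^ p - (a + fls_const e) = (a ^ p - a) + (fls_const e ^ p - fls_const e)"
    unfolding F.add by simp
  also have "fls_const e ^ p - fls_const e = fls_const c"
    unfolding e[symmetric] by (simp add: fls_minus_const flip: fls_const_power)
  finally have "(a + fls_const e) ^ p - (a + fls_const e) = g"
    by (simp add: ap h_def)
  moreover have "vge 0 (a + fls_const e)"
    using a[of 0] by (intro vge_add) (auto simp: A_def)
  ultimately show ?thesis by (intro that)
qed

text \<open>A leading term \<open>c^p t^(p n)\<close> of a pole is traded for \<open>c t^n\<close>,
  which has a smaller pole. The last clause says that d has at most 1/p of the pole order of g; the
  comparison of derivatives in \<open>main_step\<close> rests on it.\<close>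

lemma artin_schreier_reduce:
  fixes g :: "'k::alg_closed_field fls"
  assumes p: "prime p" "CHAR('k) = p"
  obtains d r where "g = r + d ^ p - d" "r = 0 \<or> \<nu> r < 0 \<and> \<not> int p dvd \<nu> r"
    "\<And>M. M \<ge> 0 \<Longrightarrow> vge (- M) g \<Longrightarrow> vge (- M) (d ^ p)"
proof -
  interpret F: field_hom "\<lambda>x::'k fls. x ^ p"
    using field_hom_frobenius[of p, where ?'a = "'k fls"] p by simp
  have p1: "p > 1" using prime_gt_1_nat p by simp
  have "\<exists>d r. g = r + d ^ p - d \<and> (r = 0 \<or> \<nu> r < 0 \<and> \<not> int p dvd \<nu> r) \<and>
      (\<forall>M\<ge>0. vge (- M) g \<longrightarrow> vge (- M) (d ^ p))"
  proof (induction "nat (- \<nu> g)" arbitrary: g rule: less_induct)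
    case less
    consider "vge 0 g" | "\<nu> g < 0" "\<not> int p dvd \<nu> g"
      | "\<nu> g < 0" "int p dvd \<nu> g"
      by (metis vge_def not_le)
    then show ?case
    proof cases
      case 1
      then obtain d where "vge 0 d" "d ^ p - d = g" using artin_schreier_nonneg[OF p] by blast
      moreover from this have "vge 0 (d ^ p)" using vge_power[of 0 d p] by simp
      ultimately show ?thesis by (intro exI[of _ d] exI[of _ 0]) (auto elim: vge_mono)
    next
      case 2
      then show ?thesis by (intro exI[of _ 0] exI[of _ g]) (use p1 in auto)
    next
      case 3
      then obtain n where n: "\<nu> g = int p * n" by auto
      obtain c where c: "c ^ p = fls_nth g (\<nu> g)"
        using nth_root_exists[of p "fls_nth g (\<nu> g)"] p1 by auto
      have "g \<noteq> 0" using 3 by auto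
      then have "c ^ p \<noteq> 0" using c by simp
      then have "c \<noteq> 0" using p1 by (auto simp: power_0_left)
      \<comment> \<open>\<open>e^p\<close> has the leading term of g, and since n < 0 the pole of e
        itself is smaller.\<close>
      define e where "e = fls_const c * fls_X powi n"
      have e: "e \<noteq> 0" "\<nu> e = n" using \<open>c \<noteq> 0\<close> by (auto simp: e_def)
      have "n < 0" using 3 n p1 by (simp add: mult_less_0_iff)
      define g' where "g' = g - (e ^ p - e)"
      have ep: "e ^ p = fls_const (c ^ p) * fls_X powi (int p * n)"
        by (simp only: e_def power_mult_distrib fls_const_power power_int_mult mult.commute[of "int p"] power_int_of_nat)
      have "vge (\<nu> g + 1) (g - e ^ p)"
        using c n by (auto simp: vge_iff ep fls_X_power_int)
      moreover have "vge (\<nu> g + 1) e"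
      proof -
        have "int p * n \<le> 2 * n" using \<open>n < 0\<close> p1 by (intro mult_right_mono_neg) auto
        then have "int p * n + 1 \<le> n" using \<open>n < 0\<close> by linarith
        with e n show ?thesis by (simp add: vge_def)
      qed
      ultimately have "vge (\<nu> g + 1) ((g - e ^ p) + e)" by (rule vge_add)
      moreover have "(g - e ^ p) + e = g'" by (simp add: g'_def)
      ultimately have g': "vge (\<nu> g + 1) g'" by simp
      have "nat (- \<nu> g') < nat (- \<nu> g)"
        using g' 3 by (auto simp: vge_def)
      from less[OF this] obtain d r where d: "g' = r + d ^ p - d"
        "r = 0 \<or> \<nu> r < 0 \<and> \<not> int p dvd \<nu> r"
        "\<And>M. M \<ge> 0 \<Longrightarrow> vge (- M) g' \<Longrightarrow> vge (- M) (d ^ p)" by blast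
      show ?thesis
      proof (intro exI conjI allI impI)
        show "g = r + (d + e) ^ p - (d + e)"
          using d(1) by (simp add: F.add g'_def algebra_simps)
        show "r = 0 \<or> \<nu> r < 0 \<and> \<not> int p dvd \<nu> r" by fact
        fix M :: int assume M: "0 \<le> M" "vge (- M) g"
        then have "- M \<le> int p * n" using \<open>g \<noteq> 0\<close> n by (simp add: vge_def)
        then have eM: "vge (- M) (e ^ p)" using e by (simp add: vge_def fls_subdegree_pow)
        have "vge (- M) g'"
          using g' M \<open>g \<noteq> 0\<close> by (elim vge_mono) (simp add: vge_def)
        then show "vge (- M) ((d + e) ^ p)" unfolding F.add using d(3) M(1) eM by (intro vge_add)
      qed
    qed
  qed
  then show ?thesis using that by blast
qed

section \<open>Embeddings of Laurent series fields\<close>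

text \<open>Both residue fields are k, so the target is totally ramified of degree d over the
  image.\<close>

locale vhom = ramified_hom +
  assumes const [simp]: "\<rho> (fls_const c) = fls_const c"

lemma vhomI:
  assumes "field_hom f" "d \<ge> 1" "\<And>x. x \<noteq> 0 \<Longrightarrow> \<nu> (f x) = int d * \<nu> x"
    "\<And>c. f (fls_const c) = fls_const c"
  shows "vhom f d"
proof -
  have "ramified_hom f d"
    using assms(1-3) by (intro ramified_hom.intro ramified_hom_axioms.intro) (auto intro: assms(4))
  then show ?thesis using assms(4) by (intro vhom.intro vhom_axioms.intro)
qed

lemma vhom_comp: "vhom f d \<Longrightarrow> vhom g e \<Longrightarrow> vhom (\<lambda>x. f (g x)) (d * e)"
proof -
  assume "vhom f d" "vhom g e"
  then interpret f: vhom f d + g: vhom g e .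
  show ?thesis
    using f.d_pos g.d_pos field_hom_comp[OF f.field_hom_axioms g.field_hom_axioms]
    by (intro vhomI) (simp_all add: f.subdegree g.subdegree)
qed

lemma vhom_id: "vhom (\<lambda>x. x) 1"
  by (intro vhomI) (simp_all add: field_hom_def)

lemma fls_truncate:
  fixes x :: "'a::field fls"
  obtains t where "t = (\<Sum>i\<in>{\<nu> x..<N}. fls_const (fls_nth x i) * fls_X powi i)" "vge N (x - t)"
proof
  define t where "t = (\<Sum>i\<in>{\<nu> x..<N}. fls_const (fls_nth x i) * fls_X powi i)"
  have "fls_nth t n = fls_nth x n" if "n < N" for n
  proof -
    have "fls_nth t n = (\<Sum>i\<in>{\<nu> x..<N}. if i = n then fls_nth x n else 0)"
      unfolding t_def fls_nth_sum
      by (intro sum.cong) (auto simp: fls_X_power_int)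
    then show ?thesis using that by simp
  qed
  then show "vge N (x - t)" by (simp add: vge_iff)
qed (rule refl)

text \<open>The valuation condition makes both maps continuous, and they agree on Laurent
  polynomials.\<close>

lemma vhom_unique:
  assumes "vhom f d" "vhom g d" and X: "f fls_X = g fls_X"
  shows "f x = g x"
proof -
  interpret f: vhom f d + g: vhom g d using assms by auto
  have "f x - g x = 0"
  proof (rule vge_all_imp_0)
    fix N :: int
    obtain t where t: "t = (\<Sum>i\<in>{\<nu> x..<\<bar>N\<bar>}. fls_const (fls_nth x i) * fls_X powi i)"
      "vge \<bar>N\<bar> (x - t)" by (rule fls_truncate)
    have "f t = g t"
      unfolding t(1) f.sum g.sum by (simp add: f.mult g.mult f.power_int g.power_int X)
    then have "f x - g x = f (x - t) - g (x - t)" by (simp add: f.diff g.diff)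
    also have "vge (int d * \<bar>N\<bar>) \<dots>" by (intro vge_diff f.vge g.vge t)
    finally show "vge N (f x - g x)"
      by (rule vge_mono) (use f.d_pos mult_right_mono[of 1 "int d" "\<bar>N\<bar>"] in simp)
  qed
  then show ?thesis by simp
qed

definition fls_subst :: "'a::field fls \<Rightarrow> 'a fls \<Rightarrow> 'a fls" where
  "fls_subst R x = fls_compose_fps x (fls_regpart R)"

lemma fls_subst:
  fixes R :: "'a::field fls"
  assumes "\<nu> R = int d" "d \<ge> 1"
  shows "vhom (fls_subst R) d" and "fls_subst R fls_X = R"
proof -
  define S where "S = fls_regpart R"
  have RS: "fps_to_fls S = R" using assms by (simp add: S_def)
  have "int (subdegree S) = int d" unfolding assms(1)[symmetric] RS[symmetric] by (simp only: fls_subdegree_fls_to_fps)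
  then have S1: "subdegree S = d" by simp
  then have "S \<noteq> 0" using assms(2) by (intro notI) simp
  moreover have "fps_nth S 0 = 0" using S1 assms(2) by (intro nth_less_subdegree_zero) simp
  ultimately have S: "subdegree S = d" "S \<noteq> 0" "fps_nth S 0 = 0" using S1 by blast+
  show X: "fls_subst R fls_X = R"
    unfolding fls_subst_def S_def[symmetric] by (simp add: RS)
  interpret field_hom "fls_subst R"
    unfolding fls_subst_def S_def[symmetric]
    by unfold_locales (simp_all add: fls_compose_fps_add fls_compose_fps_mult S)
  show "vhom (fls_subst R) d"
  proof (rule vhomI)
    fix x :: "'a fls" assume "x \<noteq> 0"
    then obtain u where u: "x = fls_X powi (\<nu> x) * u" "u \<noteq> 0" "\<nu> u = 0"
      by (rule fls_decompose)
    define U where "U = fls_regpart u"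
    have uU: "fps_to_fls U = u" using u by (simp add: U_def)
    have "fps_nth U 0 \<noteq> 0" using u by (metis U_def fls_regpart_nth nth_fls_subdegree_nonzero of_nat_0)
    then have "fps_nth (fps_compose U S) 0 \<noteq> 0" by simp
    then have "subdegree (fps_compose U S) = 0" by simp
    then have "\<nu> (fls_subst R u) = 0"
      unfolding fls_subst_def uU[symmetric] S_def[symmetric] using S by (simp add: fls_subdegree_fls_to_fps)
    moreover have "fls_subst R x = R powi (\<nu> x) * fls_subst R u"
      by (subst u(1)) (simp add: mult power_int X)
    moreover have "R \<noteq> 0" using assms by auto
    ultimately show "\<nu> (fls_subst R x) = int d * \<nu> x"
      using u assms by (simp add: mult.commute)
  qed (use assms field_hom_axioms in \<open>auto simp: fls_subst_def\<close>)
qed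

text \<open>An explicit model of the extension generated by a root of \<open>y^p - y = g\<close>.
  Fix \<eta> = \<open>X^(-J)\<close> in advance and look for the embedding instead: as J is prime to
  p, there are a uniformizer S with g = \<open>S^(-J)\<close> and a series R of valuation p with
  \<open>\<eta>^p - \<eta> = R^(-J)\<close>. The embedding is the substitution taking S to R, that
  is X to the compositional inverse of S applied to R.\<close>

lemma artin_schreier_model:
  fixes g :: "'k::alg_closed_field fls"
  assumes p: "prime p" "CHAR('k) = p" and J: "\<nu> g = - int J" "\<not> p dvd J"
  obtains \<theta> \<eta> where "vhom \<theta> p" "\<eta> \<noteq> 0" "\<nu> \<eta> = - int J" "\<eta> ^ p - \<eta> = \<theta> g"
proof -
  have p1: "p > 1" using prime_gt_1_nat p by simp
  have J0: "J > 0" using J by (intro Nat.gr0I) auto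
  have root: "\<exists>y. y ^ J = inverse h \<and> \<nu> y = int e \<and> y \<noteq> 0" if "\<nu> h = - int e * int J" "h \<noteq> 0" for h :: "'k fls" and e
  proof -
    define w where "w = inverse h * fls_X powi (- int e * int J)"
    have "w \<noteq> 0" "\<nu> w = 0" using that by (simp_all add: w_def)
    from fls_unit_root[OF p J(2) this] obtain y where y: "y ^ J = w" "\<nu> y = 0" by blast
    have "(fls_X ^ e * y) ^ J = inverse h"
      by (simp add: power_mult_distrib y w_def power_int_minus power_int_mult flip: power_mult)
    moreover have "y \<noteq> 0" using y \<open>w \<noteq> 0\<close> J0 by (auto simp: power_0_left)
    ultimately show ?thesis using y
      by (intro exI[of _ "fls_X ^ e * y"]) (simp add: fls_subdegree_pow)
  qed
  have g: "g \<noteq> 0" using J J0 by auto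
  obtain S where S: "S ^ J = inverse g" "\<nu> S = 1" "S \<noteq> 0"
    using root[of g 1] J g by auto
  define \<eta> where "\<eta> = (fls_X powi (- int J) :: 'k fls)"
  have \<eta>: "\<eta> \<noteq> 0" "\<nu> \<eta> = - int J" by (auto simp: \<eta>_def)
  have H: "\<eta> ^ p - \<eta> \<noteq> 0 \<and> \<nu> (\<eta> ^ p - \<eta>) = - int p * int J"
  proof -
    have "vge (\<nu> (\<eta> ^ p) + 1) (- \<eta>)"
    proof -
      have "2 * int J \<le> int p * int J" using p1 by (intro mult_right_mono) auto
      then have "int p * - int J + 1 \<le> - int J" using J0 unfolding mult_minus_right by linarith
      then show ?thesis unfolding vge_uminus fls_subdegree_pow \<eta>(2) by (simp add: vge_def \<eta>)
    qed
    from fls_subdegree_add_eq[OF _ this] \<eta> show ?thesis by (simp add: fls_subdegree_pow)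
  qed
  obtain R where R: "R ^ J = inverse (\<eta> ^ p - \<eta>)" "\<nu> R = int p" "R \<noteq> 0"
    using root[of "\<eta> ^ p - \<eta>" p] H by auto
  define S' where "S' = fls_regpart S"
  define R' where "R' = fls_regpart R"
  have SS: "fps_to_fls S' = S" and RR: "fps_to_fls R' = R"
    using S R by (simp_all add: S'_def R'_def)
  have S'0: "fps_nth S' 0 = 0" "fps_nth S' 1 \<noteq> 0"
    using S nth_fls_subdegree_nonzero[of S] by (auto simp: S'_def)
  have R'0: "fps_nth R' 0 = 0" using R p1 by (auto simp: R'_def)
  define T where "T = fps_compose (fps_inv S') R'"
  have T0: "fps_nth T 0 = 0" by (simp add: T_def fps_inv_def)
  have "fps_compose S' T = fps_compose (fps_compose S' (fps_inv S')) R'"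
    unfolding T_def by (subst fps_compose_assoc) (use R'0 in \<open>auto simp: fps_inv_def\<close>)
  also have "\<dots> = R'"
    using S'0 R'0 by (simp add: fps_inv_right)
  finally have ST: "fps_compose S' T = R'" .
  have T: "T \<noteq> 0" using ST R RR S'0 by auto
  define \<tau> where "\<tau> = fps_to_fls T"
  have \<tau>: "\<nu> \<tau> = int (subdegree T)" "subdegree T \<ge> 1" "fls_regpart \<tau> = T"
    using T T0 by (auto simp: \<tau>_def fls_subdegree_fls_to_fps Suc_le_eq subdegree_eq_0_iff intro!: Nat.gr0I)
  interpret \<theta>: vhom "fls_subst \<tau>" "subdegree T"
    by (rule fls_subst) fact+
  have "fls_subst \<tau> S = R"
    unfolding fls_subst_def \<tau>(3) using T T0 ST SS RR by (metis fls_compose_fps_to_fls)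
  with \<theta>.subdegree[OF S(3)] S R have "subdegree T = p" by simp
  have "fls_subst \<tau> g = inverse (fls_subst \<tau> (inverse g))"
    by (simp add: \<theta>.inverse)
  also have "fls_subst \<tau> (inverse g) = R ^ J"
    unfolding S(1)[symmetric] \<theta>.power \<open>fls_subst \<tau> S = R\<close> by simp
  finally have "\<eta> ^ p - \<eta> = fls_subst \<tau> g" using R by simp
  then show ?thesis
    using \<theta>.vhom_axioms \<eta> \<open>subdegree T = p\<close> by (intro that[of "fls_subst \<tau>" \<eta>]) auto
qed

section \<open>Polynomials under homomorphisms, and extension of homomorphisms\<close>

context field_hom begin

lemma poly_map_add: "poly (map_poly f (P + Q)) y = poly (map_poly f P) y + poly (map_poly f Q) y"
proof (induction P arbitrary: Q)
  case (pCons a P)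
  obtain b R where Q: "Q = pCons b R" by (cases Q)
  show ?case unfolding Q add_pCons by (simp add: map_poly_pCons pCons.IH add distrib_left)
qed simp

lemma poly_map_smult: "poly (map_poly f (smult a P)) y = f a * poly (map_poly f P) y"
  by (induction P) (simp_all add: map_poly_pCons mult algebra_simps)

lemma poly_map_mult: "poly (map_poly f (P * Q)) y = poly (map_poly f P) y * poly (map_poly f Q) y"
  by (induction P) (simp_all add: map_poly_pCons poly_map_add poly_map_smult algebra_simps)

lemma poly_map_sum: "poly (map_poly f (\<Sum>i\<in>A. P i)) y = (\<Sum>i\<in>A. poly (map_poly f (P i)) y)"
  by (induction A rule: infinite_finite_induct) (simp_all add: poly_map_add)

lemma poly_map_altdef:
  "degree P < d \<Longrightarrow> poly (map_poly f P) y = (\<Sum>i<d. f (coeff P i) * y ^ i)"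
proof -
  assume "degree P < d"
  then have "(\<Sum>i<d. f (coeff P i) * y ^ i) = (\<Sum>i\<le>degree P. f (coeff P i) * y ^ i)"
    by (intro sum.mono_neutral_right) (auto simp: coeff_eq_0)
  also have "degree (map_poly f P) = degree P" by (rule degree_map_poly) simp
  then have "(\<Sum>i\<le>degree P. f (coeff P i) * y ^ i) = poly (map_poly f P) y"
    by (simp add: poly_altdef coeff_map_poly)
  finally show ?thesis by simp
qed

end

text \<open>Since the powers of \<eta> below d are independent, the polynomials vanishing at \<eta>
  are the multiples of A; the target field is the quotient by A, and \<eta> may be sent to any root
  of the transported A.\<close>

lemma field_hom_extend:
  fixes \<Phi> :: "'k::field fls \<Rightarrow> 'b::field"
  assumes "ramified_basis \<theta> d (\<lambda>i. \<eta> ^ i)" "field_hom \<Phi>"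
    and A: "degree A = d" "poly (map_poly \<theta> A) \<eta> = 0" "poly (map_poly \<Phi> A) y = 0"
  obtains \<Phi>' where "field_hom \<Phi>'" "\<And>x. \<Phi>' (\<theta> x) = \<Phi> x" "\<Phi>' \<eta> = y"
proof -
  interpret \<theta>: ramified_basis \<theta> d "\<lambda>i. \<eta> ^ i" by fact
  interpret \<Phi>: field_hom \<Phi> by fact
  define ev1 where "ev1 P = poly (map_poly \<theta> P) \<eta>" for P
  define ev2 where "ev2 P = poly (map_poly \<Phi> P) y" for P
  have ker: "ev2 P = 0" if "ev1 P = 0" for P
  proof -
    define Q where "Q = P mod A"
    have P: "P = A * (P div A) + Q" by (simp add: Q_def)
    have "A \<noteq> 0" "degree A > 0" using A(1) \<theta>.d_pos by auto
    then have deg: "degree Q < d"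
      unfolding Q_def A(1)[symmetric] using degree_mod_less[of A P] by (cases "P mod A = 0") auto
    have "ev1 P = ev1 Q"
      unfolding ev1_def by (subst P) (simp add: \<theta>.poly_map_add \<theta>.poly_map_mult A)
    with that have "(\<Sum>i<d. \<theta> (coeff Q i) * \<eta> ^ i) = 0"
      unfolding ev1_def \<theta>.poly_map_altdef[OF deg] by simp
    then have "coeff Q i = 0" for i
      using \<theta>.basis_independent[of "coeff Q" i] deg coeff_eq_0[of Q i] by (cases "i < d") auto
    then have "Q = 0" by (simp add: poly_eq_iff)
    then show ?thesis
      unfolding ev2_def by (subst P) (simp add: \<Phi>.poly_map_add \<Phi>.poly_map_mult A)
  qed
  have surj: "\<exists>P. ev1 P = x" for x
  proof -
    obtain a where a: "x = (\<Sum>i<d. \<theta> (a i) * \<eta> ^ i)" using \<theta>.basis_span by blast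
    have "ev1 (\<Sum>i<d. monom (a i) i) = x"
      unfolding ev1_def \<theta>.poly_map_sum by (simp add: a map_poly_monom poly_monom)
    then show ?thesis ..
  qed
  define \<Phi>' where "\<Phi>' x = ev2 (SOME P. ev1 P = x)" for x
  have \<Phi>': "\<Phi>' (ev1 P) = ev2 P" for P
  proof -
    define Q where "Q = (SOME Q. ev1 Q = ev1 P)"
    have "ev1 Q = ev1 P" unfolding Q_def by (rule someI) (rule refl)
    moreover have "ev1 (Q + smult (- 1) P) = ev1 Q - ev1 P"
      "ev2 (Q + smult (- 1) P) = ev2 Q - ev2 P"
      unfolding ev1_def ev2_def \<theta>.poly_map_add \<Phi>.poly_map_add \<theta>.poly_map_smult \<Phi>.poly_map_smult
      by (simp_all add: \<theta>.uminus \<Phi>.uminus)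
    ultimately have "ev2 Q = ev2 P" using ker[of "Q + smult (- 1) P"] by simp
    then show ?thesis unfolding \<Phi>'_def Q_def[symmetric] .
  qed
  show ?thesis
  proof (rule that)
    show "field_hom \<Phi>'"
    proof
      show "\<Phi>' 1 = 1" using \<Phi>'[of 1] by (simp add: ev1_def ev2_def)
      fix u v
      obtain P where u: "ev1 P = u" using surj by blast
      obtain Q where v: "ev1 Q = v" using surj by blast
      have "ev1 P + ev1 Q = ev1 (P + Q)" "ev2 P + ev2 Q = ev2 (P + Q)"
        by (simp_all only: ev1_def ev2_def \<theta>.poly_map_add \<Phi>.poly_map_add)
      then show "\<Phi>' (u + v) = \<Phi>' u + \<Phi>' v" unfolding u[symmetric] v[symmetric] by (simp only: \<Phi>')
      have "ev1 P * ev1 Q = ev1 (P * Q)" "ev2 P * ev2 Q = ev2 (P * Q)"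
        by (simp_all only: ev1_def ev2_def \<theta>.poly_map_mult \<Phi>.poly_map_mult)
      then show "\<Phi>' (u * v) = \<Phi>' u * \<Phi>' v" unfolding u[symmetric] v[symmetric] by (simp only: \<Phi>')
    qed
    show "\<Phi>' (\<theta> x) = \<Phi> x" for x
      using \<Phi>'[of "[:x:]"] by (simp add: ev1_def ev2_def map_poly_pCons)
    show "\<Phi>' \<eta> = y"
      using \<Phi>'[of "[:0, 1:]"] by (simp add: ev1_def ev2_def map_poly_pCons)
  qed
qed

section \<open>Automorphisms, fixed fields and ramification breaks\<close>

definition is_aut :: "('a::field fls \<Rightarrow> 'a fls) \<Rightarrow> bool" where
  "is_aut g \<longleftrightarrow> vhom g 1 \<and> surj g"

text \<open>Preservation of the valuation comes from \<open>automorphism_subdegree\<close>.\<close>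

lemma is_autI:
  fixes g :: "'k::alg_closed_field fls \<Rightarrow> 'k fls"
  assumes "prime p" "CHAR('k) = p" "field_hom g" "surj g" "\<And>c. g (fls_const c) = fls_const c"
  shows "is_aut g"
  unfolding is_aut_def using assms automorphism_subdegree[OF assms(1-4)] by (auto intro!: vhomI)

lemma is_aut_id: "is_aut (\<lambda>x. x)"
  unfolding is_aut_def by (intro conjI vhom_id) auto

lemma is_aut_comp: "is_aut g \<Longrightarrow> is_aut h \<Longrightarrow> is_aut (\<lambda>x. g (h x))"
  unfolding is_aut_def using vhom_comp[of g 1 h 1] comp_surj[of h g] by (simp add: comp_def)

lemma is_aut_funpow: "is_aut g \<Longrightarrow> is_aut (g ^^ n)"
  by (induction n) (auto simp: is_aut_id comp_def id_def intro: is_aut_comp)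

lemma is_aut_vhom: "is_aut g \<Longrightarrow> vhom g 1"
  by (simp add: is_aut_def)

lemma is_aut_eqI: "is_aut g \<Longrightarrow> is_aut h \<Longrightarrow> g fls_X = h fls_X \<Longrightarrow> g = h"
  unfolding is_aut_def using vhom_unique by blast

lemma ramified_basis_X_powers:
  assumes "vhom \<theta> d"
  shows "ramified_basis \<theta> d (\<lambda>i. fls_X ^ i)"
proof -
  interpret vhom \<theta> d by fact
  show ?thesis by unfold_locales (auto simp: inj_on_def fls_subdegree_pow)
qed

lemma ramified_basis_coprime_powers:
  assumes "vhom \<theta> d" "\<eta> \<noteq> 0" "coprime (\<nu> \<eta>) (int d)"
  shows "ramified_basis \<theta> d (\<lambda>i. \<eta> ^ i)"
proof -
  interpret vhom \<theta> d by fact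
  show ?thesis
  proof unfold_locales
    show "inj_on (\<lambda>i. \<nu> (\<eta> ^ i) mod int d) {..<d}"
    proof (rule inj_onI)
      fix i j assume ij: "i \<in> {..<d}" "j \<in> {..<d}"
        "\<nu> (\<eta> ^ i) mod int d = \<nu> (\<eta> ^ j) mod int d"
      then have "[int i * \<nu> \<eta> = int j * \<nu> \<eta>] (mod int d)"
        by (simp add: fls_subdegree_pow cong_def)
      then have "[int i = int j] (mod int d)"
        using assms(3) by (simp add: cong_mult_rcancel coprime_commute)
      then show "i = j" using ij by (simp add: cong_def)
    qed
  qed (use assms in auto)
qed

text \<open>Expanding a fixed \<open>x\<close> in powers of the uniformizer turns it into a polynomial of degree
  less than \<open>card S\<close> that has the \<open>card S\<close> conjugates of the uniformizer as roots.\<close>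

lemma fixed_field:
  fixes S :: "('k::field fls \<Rightarrow> 'k fls) set"
  assumes "finite S" "S \<noteq> {}" and aut: "\<And>g. g \<in> S \<Longrightarrow> is_aut g"
    and closed: "\<And>g h. g \<in> S \<Longrightarrow> h \<in> S \<Longrightarrow> (\<lambda>x. g (h x)) \<in> S"
  obtains \<theta> where "vhom \<theta> (card S)" "range \<theta> = {x. \<forall>g\<in>S. g x = x}"
proof -
  \<comment> \<open>The norm of the uniformizer X has valuation \<open>card S\<close>; the fixed
    field turns out to be the Laurent series field in R.\<close>
  define R where "R = (\<Prod>g\<in>S. g fls_X)"
  have gX: "g fls_X \<noteq> 0" "\<nu> (g fls_X) = 1" if "g \<in> S" for g
  proof -
    interpret vhom g 1 using aut[OF that] by (rule is_aut_vhom)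
    show "g fls_X \<noteq> 0" "\<nu> (g fls_X) = 1" by (simp_all add: subdegree)
  qed
  have "\<nu> (\<Prod>g\<in>A. g fls_X) = int (card A) \<and> (\<Prod>g\<in>A. g fls_X) \<noteq> 0" if "A \<subseteq> S" for A
  proof -
    have "finite A" using that assms(1) by (rule finite_subset)
    then show ?thesis using that
      by (induction A) (auto simp: gX)
  qed
  from this[of S] have R: "\<nu> R = int (card S)" by (simp add: R_def)
  have card: "card S \<ge> 1" using assms(1,2) by (simp add: Suc_le_eq card_gt_0_iff)
  note \<theta> = fls_subst[OF R card]
  interpret \<theta>: ramified_basis "fls_subst R" "card S" "\<lambda>i. fls_X ^ i"
    by (rule ramified_basis_X_powers[OF \<theta>(1)])
  have fixed: "g (fls_subst R x) = fls_subst R x" if g: "g \<in> S" for g x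
  proof -
    interpret g: vhom g 1 using aut[OF g] by (rule is_aut_vhom)
    have "bij_betw (\<lambda>h x. g (h x)) S S"
      unfolding bij_betw_def
    proof
      show inj: "inj_on (\<lambda>h x. g (h x)) S"
      proof (rule inj_onI)
        fix h h' assume "(\<lambda>x. g (h x)) = (\<lambda>x. g (h' x))"
        then have "g (h x) = g (h' x)" for x by (rule fun_cong)
        then show "h = h'" by (intro ext) simp
      qed
      show "(\<lambda>h x. g (h x)) ` S = S"
        using closed g by (intro card_subset_eq assms(1)) (auto simp: card_image inj)
    qed
    then have "(\<Prod>h\<in>S. g (h fls_X)) = R"
      unfolding R_def by (rule prod.reindex_bij_betw[where g = "\<lambda>h. h fls_X"])
    then have "g R = R" unfolding R_def g.prod .
    have "vhom (\<lambda>x. g (fls_subst R x)) (card S)"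
      using vhom_comp[OF is_aut_vhom[OF aut[OF g]] \<theta>(1)] by simp
    from vhom_unique[OF this \<theta>(1)] show ?thesis
      using \<theta>(2) \<open>g R = R\<close> by simp
  qed
  have "x \<in> range (fls_subst R)" if x: "\<forall>g\<in>S. g x = x" for x
  proof -
    obtain a where a: "x = (\<Sum>i<card S. fls_subst R (a i) * fls_X ^ i)"
      using \<theta>.basis_span by blast
    define P where "P = (\<Sum>i<card S. monom (fls_subst R (a i)) i) - [:x:]"
    have "degree P \<le> card S - 1"
      unfolding P_def
      by (intro degree_diff_le degree_sum_le) (auto intro: order.trans[OF degree_monom_le])
    then have deg: "degree P < card S" using card by simp
    have "poly P (g fls_X) = 0" if g: "g \<in> S" for g
    proof -
      interpret g: vhom g 1 using aut[OF g] by (rule is_aut_vhom)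
      have "x = g x" using x g by metis
      also have "\<dots> = (\<Sum>i<card S. fls_subst R (a i) * g fls_X ^ i)"
        by (subst a) (simp add: g.sum g.mult g.power fixed[OF g])
      finally show ?thesis by (simp add: P_def poly_sum poly_monom)
    qed
    then have "(\<lambda>g. g fls_X) ` S \<subseteq> {y. poly P y = 0}" by auto
    moreover have "card ((\<lambda>g. g fls_X) ` S) = card S"
      by (intro card_image inj_onI is_aut_eqI aut)
    ultimately have "P = 0"
      using card_mono[OF poly_roots_finite, of P "(\<lambda>g. g fls_X) ` S"] card_poly_roots_bound[of P] deg by fastforce
    \<comment> \<open>The value at 0 is the constant coefficient, so x equals the image of
      \<open>a 0\<close>.\<close>
    then have "poly P 0 = 0" by simp
    then have "x = (\<Sum>i<card S. fls_subst R (a i) * 0 ^ i)"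
      by (simp add: P_def poly_sum poly_monom)
    also have "\<dots> = (\<Sum>i\<in>{0}. fls_subst R (a i) * 0 ^ i)"
      using card by (intro sum.mono_neutral_right) auto
    finally show ?thesis by simp
  qed
  with fixed have "range (fls_subst R) = {x. \<forall>g\<in>S. g x = x}" by fastforce
  with \<theta>(1) show ?thesis by (rule that)
qed

text \<open>The largest r for which g lies in the lower group \<open>I_r\<close>. For g fixing X the
  value is the meaningless -1, which is why that case is excluded wherever breaks are used.\<close>

definition brk :: "('a::field fls \<Rightarrow> 'a fls) \<Rightarrow> int" where
  "brk g = \<nu> (g fls_X - fls_X) - 1"

text \<open>The quantity l x = g x / x - 1 satisfies l(xy) = l x + l y + l x l y, so it is additive
  up to higher order. It has valuation i at X, and at least i everywhere. When i is positive, its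
  coefficient c at i is a homomorphism that kills units, hence c x is \<open>\<nu> x\<close> times c
  X, nonzero for \<open>\<nu> x\<close> prime to p.\<close>

lemma brk_bounds:
  fixes g :: "'a::field fls \<Rightarrow> 'a fls"
  assumes g: "vhom g 1" "g fls_X \<noteq> fls_X"
  shows brk_nonneg: "brk g \<ge> 0"
    and brk_ge: "vge (\<nu> x + brk g) (g x - x)"
    and brk_eq: "prime p \<Longrightarrow> CHAR('a) = p \<Longrightarrow> \<not> int p dvd \<nu> x \<Longrightarrow> brk g \<ge> 1 \<Longrightarrow>
      g x \<noteq> x \<and> \<nu> (g x - x) = \<nu> x + brk g"
proof -
  interpret vhom g 1 by fact
  define i where "i = brk g"
  have "vge 1 (g fls_X - fls_X)"
    by (intro vge_diff) (simp_all add: vge_def subdegree)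
  then show "brk g \<ge> 0" using g(2) by (simp add: brk_def vge_def)
  then have i0: "i \<ge> 0" by (simp add: i_def)
  define l where "l x = g x / x - 1" for x
  have gl: "g x - x = x * l x" if "x \<noteq> 0" for x
    using that by (simp add: l_def field_simps)
  have lX: "l fls_X \<noteq> 0" "\<nu> (l fls_X) = i"
  proof -
    show "l fls_X \<noteq> 0" using gl[of fls_X] g(2) by auto
    then have "\<nu> (fls_X * l fls_X) = 1 + \<nu> (l fls_X)" by simp
    then show "\<nu> (l fls_X) = i" by (simp add: i_def brk_def gl)
  qed
  have l_mult: "l (x * y) = l x + l y + l x * l y" if "x \<noteq> 0" "y \<noteq> 0" for x y
    using that by (simp add: l_def mult field_simps)
  have l_inverse: "l (inverse x) = - l x * inverse (g x / x)" if "x \<noteq> 0" for x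
    using that unfolding l_def inverse by (simp add: field_simps)
  have l_inv_ge: "vge i (l (inverse x))" if "vge i (l x)" "x \<noteq> 0" for x
  proof -
    have "vge (i + 0) (- l x * inverse (g x / x))"
      by (intro vge_mult) (use that in \<open>auto simp: vge_uminus vge_def subdegree divide_inverse\<close>)
    then show ?thesis using l_inverse[OF that(2)] by simp
  qed
  have l_mult_ge: "vge i (l (x * y))" if "vge i (l x)" "vge i (l y)" "x \<noteq> 0" "y \<noteq> 0" for x y
  proof -
    have "vge (i + i) (l x * l y)" by (intro vge_mult that)
    then show ?thesis
      unfolding l_mult[OF that(3,4)] by (intro vge_add that) (use i0 in \<open>auto elim: vge_mono\<close>)
  qed
  have lXn: "vge i (l (fls_X ^ n))" for n
  proof (induction n)
    case 0
    show ?case by (simp add: l_def)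
  next
    case (Suc n)
    have "vge i (l fls_X)" using lX by (simp add: vge_def)
    from l_mult_ge[OF this Suc] show ?case by simp
  qed
  have lXi: "vge i (l (fls_X powi n))" for n
    using lXn[of "nat n"] l_inv_ge[OF lXn[of "nat (- n)"]] by (auto simp: power_int_def power_inverse)
  have ge: "vge (\<nu> x + i) (g x - x)" for x
  proof -
    obtain t where t: "t = (\<Sum>j\<in>{\<nu> x..<\<nu> x + i}. fls_const (fls_nth x j) * fls_X powi j)"
      "vge (\<nu> x + i) (x - t)" by (rule fls_truncate)
    have "g t - t = (\<Sum>j\<in>{\<nu> x..<\<nu> x + i}. fls_const (fls_nth x j) * (g (fls_X powi j) - fls_X powi j))"
      by (simp add: t sum mult sum_subtractf right_diff_distrib)
    also have "vge (\<nu> x + i) \<dots>"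
    proof (rule vge_sum)
      fix j assume j: "j \<in> {\<nu> x..<\<nu> x + i}"
      have "vge (0 + (j + i)) (fls_const (fls_nth x j) * (fls_X powi j * l (fls_X powi j)))"
        by (intro vge_mult lXi) (auto simp: vge_def)
      then show "vge (\<nu> x + i) (fls_const (fls_nth x j) * (g (fls_X powi j) - fls_X powi j))"
        using j by (subst gl) (auto elim!: vge_mono)
    qed
    finally have "vge (\<nu> x + i) (g t - t)" .
    moreover have "vge (\<nu> x + i) (g (x - t) - (x - t))"
      using vge[OF t(2)] by (intro vge_diff[OF _ t(2)]) simp
    ultimately have "vge (\<nu> x + i) ((g t - t) + (g (x - t) - (x - t)))" by (rule vge_add)
    then show ?thesis by (simp add: diff algebra_simps)
  qed
  then show "vge (\<nu> x + brk g) (g x - x)" by (simp add: i_def)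
  assume p: "prime p" "CHAR('a) = p" "\<not> int p dvd \<nu> x" and "brk g \<ge> 1"
  then have i1: "i \<ge> 1" by (simp add: i_def)
  define c where "c x = fls_nth (l x) i" for x
  have l_ge: "vge i (l x)" if "x \<noteq> 0" for x
    using ge[of x] that gl[OF that] by (auto simp: vge_def)
  have c_mult: "c (x * y) = c x + c y" if "x \<noteq> 0" "y \<noteq> 0" for x y
  proof -
    have "vge (i + i) (l x * l y)" by (intro vge_mult l_ge that)
    then show ?thesis using i1 by (simp add: c_def l_mult[OF that] vge_iff)
  qed
  have c1: "c 1 = 0" by (simp add: c_def l_def)
  have c_inv: "c (inverse x) = - c x" if "x \<noteq> 0" for x
    using c_mult[of x "inverse x"] that c1 by (simp add: eq_neg_iff_add_eq_0 add.commute)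
  have c_pow: "c (fls_X ^ n) = of_nat n * c fls_X" for n
    by (induction n) (simp_all add: c1 c_mult algebra_simps)
  have c_powi: "c (fls_X powi n) = of_int n * c fls_X" for n
    using c_pow[of "nat n"] c_inv[of "fls_X ^ nat (- n)"] c_pow[of "nat (- n)"]
    by (cases "n \<ge> 0") (auto simp: power_int_def power_inverse)
  have c_unit: "c u = 0" if "u \<noteq> 0" "\<nu> u = 0" for u
  proof -
    define v where "v = u - fls_const (fls_nth u 0)"
    have v: "vge 1 v" using that by (auto simp: vge_iff v_def)
    have "vge (i + 1) (g v - v)"
    proof (cases "v = 0")
      case False
      with v show ?thesis using ge[of v] by (auto simp: vge_def)
    qed simp
    moreover have "g v - v = g u - u" by (simp add: v_def diff)
    moreover have "l u = (g u - u) * inverse u" using that by (simp add: l_def field_simps)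
    moreover have "vge 0 (inverse u)" using that by (simp add: vge_def)
    ultimately have "vge (i + 1 + 0) (l u)" using vge_mult by metis
    then show ?thesis by (simp add: c_def vge_iff)
  qed
  have x: "x \<noteq> 0" using p(3) by auto
  obtain u where u: "x = fls_X powi (\<nu> x) * u" "u \<noteq> 0" "\<nu> u = 0"
    using fls_decompose[OF x] .
  have "c x = of_int (\<nu> x) * c fls_X"
    by (subst u(1)) (simp add: c_mult c_powi c_unit u(2,3))
  moreover have "c fls_X \<noteq> 0" using lX unfolding c_def by (metis nth_fls_subdegree_nonzero)
  moreover have "(of_int (\<nu> x) :: 'a) \<noteq> 0"
    using p by (simp add: of_int_eq_0_iff_char_dvd)
  ultimately have "c x \<noteq> 0" by simp
  then have nth: "fls_nth (l x) i \<noteq> 0" by (simp only: c_def not_False_eq_True)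
  then have "l x \<noteq> 0" by (intro notI) simp
  moreover have "\<nu> (l x) = i"
    using l_ge[OF x] nth unfolding vge_iff by (intro fls_subdegree_eqI) blast+
  ultimately have "l x \<noteq> 0" "\<nu> (l x) = i" by blast+
  then show "g x \<noteq> x \<and> \<nu> (g x - x) = \<nu> x + brk g"
    using gl[OF x] x by (auto simp: i_def)
qed

section \<open>Typical power series\<close>

definition fmap :: "('a \<Rightarrow> 'b) \<Rightarrow> 'a fps \<Rightarrow> 'b fps" where
  "fmap f F = Abs_fps (\<lambda>n. f (fps_nth F n))"

lemma fmap_nth [simp]: "fps_nth (fmap f F) n = f (fps_nth F n)"
  by (simp add: fmap_def)

lemma fmap_cong_mod: "fcong N F G \<Longrightarrow> fcong N (fmap f F) (fmap f G)"
  by (simp add: fcong_def)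

text \<open>The series \<open>F(a t^s)\<close>.\<close>

definition esub :: "'a::comm_ring_1 fps \<Rightarrow> 'a \<Rightarrow> nat \<Rightarrow> 'a fps" where
  "esub F a s = fps_compose F (fps_const a * fps_X ^ s)"

lemma esub_0 [simp]: "s > 0 \<Longrightarrow> fps_nth (esub F a s) 0 = fps_nth F 0"
  by (simp add: esub_def)

lemma esub_nth:
  fixes F :: "'a::idom fps"
  assumes "s > 0"
  shows "fps_nth (esub F a s) n = (if s dvd n then a ^ (n div s) * fps_nth F (n div s) else 0)"
proof -
  have "(fps_const a * fps_X) oo (fps_X ^ s) = fps_const a * (fps_X ^ s :: 'a fps)"
    using assms by (simp add: fps_compose_mult_distrib)
  then have "esub F a s = fps_compose (fps_compose F (fps_const a * fps_X)) (fps_X ^ s)"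
    unfolding esub_def using assms by (subst fps_compose_assoc[symmetric]) auto
  moreover have "fps_nth (fps_compose G (fps_X ^ s)) n = (if s dvd n then fps_nth G (n div s) else 0)" for G :: "'a fps"
  proof -
    have "fps_nth (fps_compose G (fps_X ^ s)) n = (\<Sum>i = 0..n. if s * i = n then fps_nth G i else 0)"
      by (auto simp: fps_compose_nth fps_X_power_nth mult.commute simp flip: power_mult intro!: sum.cong)
    also have "\<dots> = (\<Sum>i \<in> (if s dvd n then {n div s} else {}). fps_nth G i)"
      using assms by (intro sum.mono_neutral_cong_right) (auto split: if_splits)
    finally show ?thesis by simp
  qed
  ultimately show ?thesis by simp
qed

lemma esub_mult: "s > 0 \<Longrightarrow> esub (F * G) a s = esub F a s * esub G a s"
  for F :: "'a::idom fps"
  by (simp add: esub_def fps_compose_mult_distrib)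

lemma esub_prod: "s > 0 \<Longrightarrow> esub (prod F A) a s = (\<Prod>i\<in>A. esub (F i) a s)"
  for F :: "_ \<Rightarrow> 'a::idom fps"
  by (simp add: esub_def fps_compose_prod_distrib)

lemma esub_power: "s > 0 \<Longrightarrow> esub (F ^ n) a s = esub F a s ^ n"
  for F :: "'a::idom fps"
  by (induction n) (simp_all add: esub_mult, simp add: esub_def)

lemma esub_esub: "s > 0 \<Longrightarrow> r > 0 \<Longrightarrow> esub (esub F a r) b s = esub F (a * b ^ r) (r * s)"
  for F :: "'a::idom fps"
  by (rule fps_ext) (auto simp: esub_nth power_mult_distrib dvd_mult_imp_div mult.assoc
      div_mult2_eq mult.commute[of r] simp flip: power_mult elim!: dvdE)

lemma fcong_esub: "s > 0 \<Longrightarrow> fcong N F G \<Longrightarrow> fcong N (esub F a s) (esub G a s)"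
  for F :: "'a::idom fps"
  unfolding fcong_def
  by (metis (no_types, lifting) esub_nth div_le_dividend le_less_trans)

lemma fmap_esub:
  assumes "field_hom f" "s > 0"
  shows "fmap f (esub F a s) = esub (fmap f F) (f a) s"
proof -
  interpret field_hom f by fact
  show ?thesis by (rule fps_ext) (simp add: esub_nth assms mult power)
qed

context field_hom begin

lemma fmap_mult: "fmap f (F * G) = fmap f F * fmap f G"
  by (rule fps_ext) (simp add: fps_mult_nth sum mult)

lemma fmap_1 [simp]: "fmap f 1 = 1"
  by (rule fps_ext) simp

lemma fmap_power: "fmap f (F ^ n) = fmap f F ^ n"
  by (induction n) (simp_all add: fmap_mult)

lemma fmap_prod: "fmap f (prod F A) = (\<Prod>i\<in>A. fmap f (F i))"
  by (induction A rule: infinite_finite_induct) (simp_all add: fmap_mult)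

lemma fmap_inverse: "fps_nth F 0 \<noteq> 0 \<Longrightarrow> fmap f (inverse F) = inverse (fmap f F)"
  using fmap_mult[of F "inverse F"] fps_inverse_unique[of "fmap f F" "fmap f (inverse F)"]
  by (simp add: inverse_mult_eq_1')

lemma fcong_fmap_iff: "fcong N (fmap f F) (fmap f G) \<longleftrightarrow> fcong N F G"
  by (simp add: fcong_def)

end

section \<open>Roots of unity and products over rotated arguments\<close>

definition uroots :: "nat \<Rightarrow> 'a::field set" where
  "uroots l = {x. x ^ l = 1}"

text \<open>This replaces algebraic closedness: it is inherited by k((t)) and passes along every
  field homomorphism.\<close>

definition full_uroots :: "nat \<Rightarrow> 'a::field itself \<Rightarrow> bool" where
  "full_uroots p _ \<longleftrightarrow> (\<forall>l. prime l \<longrightarrow> l \<noteq> p \<longrightarrow> card (uroots l :: 'a set) = l)"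

lemma finite_uroots: "l > 0 \<Longrightarrow> finite (uroots l :: 'a::field set)"
proof -
  assume "l > 0"
  then have "coeff (monom 1 l - 1 :: 'a poly) l \<noteq> 0" by simp
  then have "monom 1 l - 1 \<noteq> (0 :: 'a poly)" by (metis coeff_0)
  then have "finite {x::'a. poly (monom 1 l - 1) x = 0}" by (rule poly_roots_finite)
  then show ?thesis by (simp add: uroots_def poly_monom)
qed

lemma card_uroots_le: "l > 0 \<Longrightarrow> card (uroots l :: 'a::field set) \<le> l"
proof -
  assume l: "l > 0"
  then have "coeff (monom 1 l - 1 :: 'a poly) l \<noteq> 0" by simp
  then have nz: "monom 1 l - 1 \<noteq> (0 :: 'a poly)" by (metis coeff_0)
  have "card {x::'a. poly (monom 1 l - 1) x = 0} \<le> degree (monom 1 l - 1 :: 'a poly)"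
    by (rule card_poly_roots_bound[OF nz])
  also have "\<dots> \<le> l" by (intro degree_diff_le degree_monom_le) simp
  finally show ?thesis by (simp add: uroots_def poly_monom)
qed

lemma uroots_hom:
  assumes "field_hom (f :: 'a::field \<Rightarrow> 'b::field)" "full_uroots p TYPE('a)" "prime l" "l \<noteq> p"
  shows "bij_betw f (uroots l) (uroots l)" and "card (uroots l :: 'b set) = l"
proof -
  interpret field_hom f by fact
  have l: "l > 0" using assms prime_gt_0_nat by blast
  have sub: "f ` uroots l \<subseteq> uroots l" by (auto simp: uroots_def simp flip: power)
  have card: "card (f ` uroots l) = l"
    using assms by (subst card_image) (auto simp: full_uroots_def intro: inj_on_subset[OF inj])
  then show "card (uroots l :: 'b set) = l"
    using card_mono[OF finite_uroots[OF l] sub] card_uroots_le[OF l, where ?'a = 'b] by simp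
  with card have "f ` uroots l = uroots l"
    by (intro card_subset_eq finite_uroots l sub) simp
  then show "bij_betw f (uroots l) (uroots l)"
    by (auto simp: bij_betw_def intro: inj_on_subset[OF inj])
qed

lemma full_uroots_hom:
  "field_hom (f :: 'a::field \<Rightarrow> 'b::field) \<Longrightarrow> full_uroots p TYPE('a) \<Longrightarrow> full_uroots p TYPE('b)"
  unfolding full_uroots_def[of p "TYPE('b)"] using uroots_hom(2) by blast

text \<open>A root of \<open>1 + x + ... + x^(l-1)\<close> differs from 1 because l is not 0 in the
  field; being of prime order l, it has l distinct powers.\<close>

lemma full_uroots_alg_closed:
  assumes p: "prime p" "CHAR('a::alg_closed_field) = p"
  shows "full_uroots p TYPE('a)"
  unfolding full_uroots_def
proof (intro allI impI)
  fix l :: nat assume l: "prime l" "l \<noteq> p"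
  have l0: "l > 0" using l prime_gt_0_nat by blast
  have l1: "l > 1" using l prime_gt_1_nat by blast
  define P where "P = (\<Sum>i<l. monom 1 i :: 'a poly)"
  have "coeff P (l - 1) = (\<Sum>i<l. if i = l - 1 then 1 else 0)"
    unfolding P_def coeff_sum by (intro sum.cong) auto
  then have "coeff P (l - 1) = 1" using l1 by simp
  then have "l - 1 \<le> degree P" by (intro le_degree) simp
  with l1 have "degree P > 0" by simp
  then obtain x where "poly P x = 0" using alg_closed_imp_poly_has_root by blast
  then have x: "(\<Sum>i<l. x ^ i) = 0" by (simp add: P_def poly_sum poly_monom)
  have "of_nat l \<noteq> (0 :: 'a)"
    using l p primes_dvd_imp_eq[of p l] by (auto simp: of_nat_eq_0_iff_char_dvd)
  with x have "x \<noteq> 1" by auto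
  have "x ^ l - 1 = 0" using x power_diff_1_eq[of x l] by simp
  then have xl: "x ^ l = 1" by simp
  have "x \<noteq> 0" using xl l0 by (auto simp: power_0_left)
  have "inj_on (\<lambda>i. x ^ i) {..<l}"
  proof (rule linorder_inj_onI)
    fix i j assume ij: "i < j" "i \<in> {..<l}" "j \<in> {..<l}"
    show "x ^ i \<noteq> x ^ j"
    proof
      assume "x ^ i = x ^ j"
      also have "x ^ j = x ^ i * x ^ (j - i)" using ij by (simp flip: power_add)
      finally have "x ^ (j - i) = 1" using \<open>x \<noteq> 0\<close> by simp
      have "coprime (j - i) l"
        using ij l(1) by (metis coprime_commute diff_is_0_eq' dvd_imp_le leD lessThan_iff less_imp_diff_less
            linorder_not_le nat_neq_iff prime_imp_coprime zero_less_diff)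
      then obtain a b where "(j - i) * a = l * b + 1"
        using coprime_bezout_strong[of "j - i" l] l1 by auto
      then have "x ^ (l * b + 1) = x ^ ((j - i) * a)" by simp
      then have "x = 1" using xl \<open>x ^ (j - i) = 1\<close> by (simp add: power_mult)
      with \<open>x \<noteq> 1\<close> show False ..
    qed
  qed auto
  then have "l = card ((\<lambda>i. x ^ i) ` {..<l})" by (simp add: card_image)
  also have "\<dots> \<le> card (uroots l :: 'a set)"
    using xl by (intro card_mono finite_uroots l0) (auto simp: uroots_def simp flip: power_mult,
      simp add: mult.commute[of _ l] power_mult)
  finally show "card (uroots l :: 'a set) = l"
    using card_uroots_le[OF l0, where ?'a = 'a] by simp
qed

text \<open>In the language of big Witt vectors this is Verschiebung after Frobenius at the prime l;
  if all l-th roots of unity are present, the product is a series in \<open>t^l\<close>.\<close>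

definition ptwist :: "nat \<Rightarrow> 'a::field fps \<Rightarrow> 'a fps" where
  "ptwist l F = (\<Prod>x\<in>uroots l. esub F x (Suc 0))"

lemma ptwist_mult: "ptwist l (F * G) = ptwist l F * ptwist l G"
  by (simp add: ptwist_def esub_mult prod.distrib)

lemma ptwist_1 [simp]: "ptwist l 1 = 1"
  by (simp add: ptwist_def esub_def)

lemma ptwist_power: "ptwist l (F ^ n) = ptwist l F ^ n"
  by (induction n) (simp_all add: ptwist_mult)

lemma fps_prod_nth_0: "(\<And>i. i \<in> A \<Longrightarrow> fps_nth (F i) 0 = 1) \<Longrightarrow> fps_nth (prod F A) 0 = 1"
  for F :: "_ \<Rightarrow> 'a::comm_ring_1 fps"
  by (induction A rule: infinite_finite_induct) auto

lemma ptwist_nth_0: "fps_nth F 0 = 1 \<Longrightarrow> fps_nth (ptwist l F) 0 = 1"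
  unfolding ptwist_def by (intro fps_prod_nth_0) simp

lemma ptwist_cong: "fcong N F G \<Longrightarrow> fcong N (ptwist l F) (ptwist l G)"
  unfolding ptwist_def by (intro fcong_prod fcong_esub) auto

lemma uroots_mult_bij:
  assumes "y \<in> uroots l" "l > 0"
  shows "bij_betw (\<lambda>x. x * y) (uroots l) (uroots l)"
proof (rule bij_betw_byWitness[where f' = "\<lambda>x. x / y"])
  have "y \<noteq> 0" using assms by (auto simp: uroots_def power_0_left)
  then show "\<forall>a\<in>uroots l. a * y / y = a" "\<forall>a\<in>uroots l. a / y * y = a" by auto
  show "(\<lambda>x. x * y) ` uroots l \<subseteq> uroots l" "(\<lambda>x. x / y) ` uroots l \<subseteq> uroots l"
    using assms by (auto simp: uroots_def power_mult_distrib power_divide)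
qed

lemma power_eq_1_coprime:
  fixes x :: "'a::field"
  assumes "x ^ l = 1" "x ^ k = 1" "coprime k l" "l > 1"
  shows "x = 1"
proof -
  obtain a b where "k * a = l * b + 1"
    using coprime_bezout_strong[of k l] assms by auto
  then have "x ^ (l * b + 1) = x ^ (k * a)" by simp
  then show "x = 1" using assms by (simp add: power_mult)
qed

lemma uroots_power_bij:
  assumes "coprime s l" "l > 1"
  shows "bij_betw (\<lambda>x. x ^ s) (uroots l) (uroots l :: 'a::field set)"
proof -
  have inj: "inj_on (\<lambda>x. x ^ s) (uroots l :: 'a set)"
  proof (rule inj_onI)
    fix x y :: 'a assume xy: "x \<in> uroots l" "y \<in> uroots l" "x ^ s = y ^ s"
    then have "y \<noteq> 0" using assms by (auto simp: uroots_def power_0_left)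
    with xy have "(x / y) ^ l = 1" "(x / y) ^ s = 1" by (auto simp: uroots_def power_divide)
    then have "x / y = 1" using assms by (rule power_eq_1_coprime)
    then show "x = y" using \<open>y \<noteq> 0\<close> by simp
  qed
  have sub: "(\<lambda>x. x ^ s) ` uroots l \<subseteq> (uroots l :: 'a set)"
  proof (intro image_subsetI)
    fix x :: 'a assume "x \<in> uroots l"
    then have "(x ^ s) ^ l = 1" by (simp add: uroots_def power_mult[symmetric] mult.commute[of s]) (simp add: power_mult)
    then show "x ^ s \<in> uroots l" by (simp add: uroots_def)
  qed
  have "(\<lambda>x. x ^ s) ` uroots l = (uroots l :: 'a set)"
    by (rule endo_inj_surj[OF finite_uroots sub inj]) (use assms in simp)
  with inj show ?thesis by (simp add: bij_betw_def)
qed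

lemma ptwist_rotate:
  assumes "y \<in> uroots l" "l > 0"
  shows "esub (ptwist l F) y (Suc 0) = ptwist l F"
  unfolding ptwist_def esub_prod[OF zero_less_Suc]
  using prod.reindex_bij_betw[OF uroots_mult_bij[OF assms], of "\<lambda>x. esub F x (Suc 0)"]
  by (simp add: esub_esub)

text \<open>The twist is invariant under rotation, so twisting again only takes a power. With l
  roots of unity and the exponent -1/l this leads to a projection.\<close>

lemma ptwist_ptwist:
  assumes "l > 0"
  shows "ptwist l (ptwist l (F :: 'a::field fps)) = ptwist l F ^ card (uroots l :: 'a set)"
  unfolding ptwist_def[of l "ptwist l F"] by (simp add: ptwist_rotate[OF _ assms])

lemma ptwist_commute: "ptwist l (ptwist r F) = ptwist r (ptwist l F)"
proof -
  have *: "ptwist l (ptwist r F) = (\<Prod>x\<in>uroots l. \<Prod>y\<in>uroots r. esub F (y * x) (Suc 0))" for l r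
    unfolding ptwist_def by (simp add: esub_prod esub_esub)
  show ?thesis
    unfolding * by (subst prod.swap) (simp only: mult.commute)
qed

lemma ptwist_esub:
  assumes "s > 0" "coprime s l" "l > 1"
  shows "ptwist l (esub F a s) = esub (ptwist l F) a s"
proof -
  have "ptwist l (esub F a s) = (\<Prod>x\<in>uroots l. esub F (a * x ^ s) s)"
    unfolding ptwist_def using assms by (simp add: esub_esub)
  also have "\<dots> = (\<Prod>x\<in>uroots l. esub F (a * x) s)"
    by (rule prod.reindex_bij_betw[OF uroots_power_bij[OF assms(2,3)], of "\<lambda>x. esub F (a * x) s"])
  also have "\<dots> = esub (ptwist l F) a s"
    unfolding ptwist_def using assms by (simp add: esub_prod esub_esub mult.commute)
  finally show ?thesis .
qed

text \<open>A homomorphism permutes the l-th roots of unity bijectively, as there are l of them on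
  both sides.\<close>

lemma fmap_ptwist:
  assumes f: "field_hom (f :: 'a::field \<Rightarrow> 'b::field)" and "full_uroots p TYPE('a)" "prime l" "l \<noteq> p"
  shows "fmap f (ptwist l F) = ptwist l (fmap f F)"
proof -
  interpret field_hom f by fact
  show ?thesis
    unfolding ptwist_def fmap_prod
    using prod.reindex_bij_betw[OF uroots_hom(1)[OF assms], of "\<lambda>x. esub (fmap f F) x (Suc 0)"]
    by (simp add: fmap_esub[OF f])
qed

text \<open>On series that are 1 modulo \<open>t^k\<close> the coefficient at k is additive. This is
  how multiplication imitates addition of the lowest Witt component.\<close>

lemma fps_prod_nth_low:
  fixes F :: "_ \<Rightarrow> 'a::comm_ring_1 fps"
  assumes "finite A" "k \<ge> 1" "\<And>i. i \<in> A \<Longrightarrow> fcong k (F i) 1"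
  shows "fcong k (prod F A) 1 \<and> fps_nth (prod F A) k = (\<Sum>i\<in>A. fps_nth (F i) k)"
  using assms(1,3)
proof (induction A)
  case empty
  then show ?case using assms(2) by simp
next
  case (insert a A)
  then have 1: "fcong k (prod F A) 1" "fcong k (F a) 1"
    and 2: "fps_nth (prod F A) k = (\<Sum>i\<in>A. fps_nth (F i) k)" by auto
  have "fps_nth (F a * G) k = fps_nth (F a) k + fps_nth G k" if "fcong k G 1" for G
  proof -
    have "fps_nth (F a * G) k = (\<Sum>i=0..k. fps_nth (F a) i * fps_nth G (k - i))" by (rule fps_mult_nth)
    also have "\<dots> = (\<Sum>i\<in>{0, k}. fps_nth (F a) i * fps_nth G (k - i))"
      using 1 assms(2) by (intro sum.mono_neutral_right) (auto simp: fcong_def)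
    also have "\<dots> = fps_nth (F a) k + fps_nth G k"
      using 1 that assms(2) by (simp add: fcong_def)
    finally show ?thesis .
  qed
  then show ?case
    using insert 1 2 fcong_mult[OF 1(2,1)] by simp
qed

lemma fps_power_nth_low:
  fixes F :: "'a::comm_ring_1 fps"
  assumes "k \<ge> 1" "fcong k F 1"
  shows "fcong k (F ^ n) 1 \<and> fps_nth (F ^ n) k = of_nat n * fps_nth F k"
  using fps_prod_nth_low[of "{..<n}" k "\<lambda>_. F"] assms by simp

lemma fps_mult_nth_low:
  fixes F G :: "'a::comm_ring_1 fps"
  assumes "k \<ge> 1" "fcong k F 1" "fcong k G 1"
  shows "fcong k (F * G) 1 \<and> fps_nth (F * G) k = fps_nth F k + fps_nth G k"
  using fps_prod_nth_low[of "{True, False}" k "\<lambda>b. if b then F else G"] assms by simp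

lemma ptwist_nth_low:
  fixes F :: "'a::field fps"
  assumes "k \<ge> 1" "fcong k F 1" "l dvd k" "l > 0" "card (uroots l :: 'a set) = l"
  shows "fps_nth (ptwist l F) k = of_nat l * fps_nth F k"
proof -
  have "fcong k (esub F x (Suc 0)) 1" for x
    using assms(2) fcong_esub[of "Suc 0" k F 1 x] by (simp add: esub_def)
  then have "fps_nth (ptwist l F) k = (\<Sum>x\<in>uroots l. fps_nth (esub F x (Suc 0)) k)"
    unfolding ptwist_def
    using fps_prod_nth_low[OF finite_uroots[OF assms(4)] assms(1), of "\<lambda>x. esub F x (Suc 0)"] by simp
  also have "\<dots> = (\<Sum>x\<in>(uroots l :: 'a set). fps_nth F k)"
  proof (rule sum.cong)
    fix x :: 'a assume "x \<in> uroots l"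
    then have "x ^ k = 1" using assms(3) by (auto simp: uroots_def power_mult)
    then show "fps_nth (esub F x (Suc 0)) k = fps_nth F k" by (simp add: esub_nth)
  qed simp
  also have "\<dots> = of_nat l * fps_nth F k" using assms(5) by simp
  finally show ?thesis .
qed

lemma uroots_nontrivial:
  assumes "prime l" "card (uroots l :: 'a::field set) = l" "\<not> l dvd k"
  obtains y :: "'a::field" where "y \<in> uroots l" "y ^ k \<noteq> 1"
proof -
  have l: "l > 1" using assms prime_gt_1_nat by blast
  have "\<not> uroots l \<subseteq> {1::'a}" using card_mono[of "{1::'a}" "uroots l"] assms(2) l by auto
  then obtain y :: 'a where y: "y \<in> uroots l" "y \<noteq> 1" by auto
  moreover have "y ^ k \<noteq> 1"
    using y power_eq_1_coprime[of y l k] assms(1,3) l prime_imp_coprime[of l k]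
    by (auto simp: uroots_def coprime_commute)
  ultimately show ?thesis by (intro that)
qed

lemma ptwist_nth_0_if:
  fixes F :: "'a::field fps"
  assumes "prime l" "card (uroots l :: 'a set) = l" "\<not> l dvd k"
  shows "fps_nth (ptwist l F) k = 0"
proof -
  obtain y :: 'a where y: "y \<in> uroots l" "y ^ k \<noteq> 1" using uroots_nontrivial[OF assms] .
  have "fps_nth (esub (ptwist l F) y (Suc 0)) k = fps_nth (ptwist l F) k"
    using y(1) assms prime_gt_0_nat by (subst ptwist_rotate) auto
  then show ?thesis using y(2) by (simp add: esub_nth)
qed

text \<open>Vanishing of the Frobenius components at all primes other than p is p-typicality of a
  Witt vector. Modulo \<open>t^(p^n)\<close> the primes l not below \<open>p^n\<close> impose
  nothing, the twist being a series in \<open>t^l\<close>.\<close>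

definition ptypical :: "nat \<Rightarrow> nat \<Rightarrow> 'a::field fps \<Rightarrow> bool" where
  "ptypical p n F \<longleftrightarrow> fps_nth F 0 = 1 \<and> (\<forall>l. prime l \<longrightarrow> l \<noteq> p \<longrightarrow> l < p ^ n \<longrightarrow> fcong (p ^ n) (ptwist l F) 1)"

lemma ptypical_nth_0: "ptypical p n F \<Longrightarrow> fps_nth F 0 = 1"
  by (simp add: ptypical_def)

lemma ptypical_mult: "ptypical p n F \<Longrightarrow> ptypical p n G \<Longrightarrow> ptypical p n (F * G)"
  unfolding ptypical_def ptwist_mult by (metis fcong_mult fps_mult_nth_0 mult_1)

lemma ptypical_1: "ptypical p n 1"
  by (simp add: ptypical_def)

lemma ptypical_power: "ptypical p n F \<Longrightarrow> ptypical p n (F ^ k)"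
  by (induction k) (auto intro: ptypical_mult ptypical_1)

lemma ptypical_prod: "(\<And>i. i \<in> A \<Longrightarrow> ptypical p n (F i)) \<Longrightarrow> ptypical p n (prod F A)"
  by (induction A rule: infinite_finite_induct) (auto intro: ptypical_mult ptypical_1)

lemma ptypical_inverse:
  fixes F :: "'a::field fps"
  assumes "ptypical p n F" shows "ptypical p n (inverse F)"
proof -
  have F0: "fps_nth F 0 = 1" using assms by (simp add: ptypical_def)
  have "fcong (p ^ n) (ptwist l (inverse F)) 1" if "prime l" "l \<noteq> p" "l < p ^ n" for l
  proof -
    have "fcong (p ^ n) (1 * ptwist l (inverse F)) (ptwist l F * ptwist l (inverse F))"
      using assms that by (intro fcong_mult fcong_refl) (auto simp: ptypical_def fcong_sym)
    also have "ptwist l F * ptwist l (inverse F) = 1"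
      using F0 by (simp add: inverse_mult_eq_1' flip: ptwist_mult)
    finally show ?thesis by simp
  qed
  then show ?thesis using F0 by (simp add: ptypical_def)
qed

lemma ptypical_esub:
  assumes "prime p" "ptypical p n F" shows "ptypical p n (esub F a (p ^ i))"
proof -
  have "fcong (p ^ n) (ptwist l (esub F a (p ^ i))) 1" if l: "prime l" "l \<noteq> p" "l < p ^ n" for l
  proof -
    have "coprime (p ^ i) l" using assms l by (simp add: primes_coprime)
    then have "ptwist l (esub F a (p ^ i)) = esub (ptwist l F) a (p ^ i)"
      using l assms prime_gt_1_nat[of l] prime_gt_0_nat[of p] by (intro ptwist_esub) auto
    also have "fcong (p ^ n) \<dots> (esub 1 a (p ^ i))"
      using assms l prime_gt_0_nat[of p] by (intro fcong_esub) (auto simp: ptypical_def)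
    finally show ?thesis by (simp add: esub_def)
  qed
  then show ?thesis
    using assms prime_gt_0_nat[of p] by (simp add: ptypical_def)
qed

lemma ptypical_fmap:
  assumes f: "field_hom (f :: 'a::field \<Rightarrow> 'b::field)" and "full_uroots p TYPE('a)"
  shows "ptypical p n (fmap f F) \<longleftrightarrow> ptypical p n F"
proof -
  interpret field_hom f by fact
  have "fcong N (ptwist l (fmap f F)) 1 \<longleftrightarrow> fcong N (ptwist l F) 1" if "prime l" "l \<noteq> p" for l N
    using fcong_fmap_iff[of N "ptwist l F" 1] fmap_ptwist[OF assms that, of F] by simp
  moreover have "f (fps_nth F 0) = 1 \<longleftrightarrow> fps_nth F 0 = 1"
    using eq_iff[of _ 1] by simp
  ultimately show ?thesis by (auto simp: ptypical_def)
qed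

text \<open>Between two powers of p every index k has a prime divisor l different from p; the twist
  at l has coefficient l times that of F there and must vanish. So only indices that are powers of p
  carry information, namely the Witt components.\<close>

lemma ptypical_gap:
  fixes F :: "'a::field fps"
  assumes p: "prime p" "CHAR('a) = p" "full_uroots p TYPE('a)" and F: "ptypical p n F"
    and i: "i < n" "fcong (Suc (p ^ i)) F 1"
  shows "fcong (p ^ Suc i) F 1"
proof -
  have "fps_nth F k = fps_nth 1 k" if "k < p ^ Suc i" for k
    using that
  proof (induction k rule: less_induct)
    case (less k)
    show ?case
    proof (cases "k \<le> p ^ i")
      case True
      then show ?thesis using i(2) by (simp add: fcong_def)
    next
      case False
      then have k: "p ^ i < k" "k < p ^ Suc i" using less.prems by auto
      have k0: "k > 0" using k by simp
      have "\<exists>l. prime l \<and> l \<noteq> p \<and> l dvd k"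
      proof (rule ccontr)
        assume "\<not> ?thesis"
        then have "\<exists>j. k = p ^ j"
          using Ex_other_prime_factor[of k p] k0 p(1) by (auto simp: in_prime_factors_iff)
        then obtain j where j: "k = p ^ j" ..
        have p1: "p > 1" using p(1) prime_gt_1_nat by blast
        have "i < j" "j < Suc i"
          using k power_less_imp_less_exp[OF p1] unfolding j by blast+
        then show False by simp
      qed
      then obtain l where l: "prime l" "l \<noteq> p" "l dvd k" by blast
      have kn: "k < p ^ n"
        using k(2) i(1) p(1) prime_gt_0_nat[of p] power_increasing[of "Suc i" n p] by simp
      have "l < p ^ n" using dvd_imp_le[OF l(3) k0] kn by simp
      then have "fcong (p ^ n) (ptwist l F) 1" using F l by (simp add: ptypical_def)
      then have "fps_nth (ptwist l F) k = 0" using kn k0 by (simp add: fcong_def)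
      moreover have "fps_nth (ptwist l F) k = of_nat l * fps_nth F k"
        using less k k0 l p(3) prime_gt_0_nat[of l]
        by (intro ptwist_nth_low) (auto simp: fcong_def full_uroots_def)
      moreover have "of_nat l \<noteq> (0 :: 'a)"
        using l p primes_dvd_imp_eq[of p l] by (auto simp: of_nat_eq_0_iff_char_dvd)
      ultimately show ?thesis using k0 by simp
    qed
  qed
  then show ?thesis by (simp add: fcong_def)
qed

text \<open>Dividing by \<open>l\<close>-th roots of the twists projects onto the typical series; exponents live in
  \<open>\<int> / p\<^sup>n\<close>, where \<open>l\<close> is invertible.\<close>

definition pcoef :: "nat \<Rightarrow> nat \<Rightarrow> nat \<Rightarrow> nat" where
  "pcoef p n l = (SOME c. [l * c + 1 = 0] (mod p ^ n))"

fun pproj :: "nat \<Rightarrow> nat \<Rightarrow> nat list \<Rightarrow> 'a::field fps \<Rightarrow> 'a fps" where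
  "pproj p n [] F = F"
| "pproj p n (l # ls) F = pproj p n ls F * ptwist l (pproj p n ls F) ^ pcoef p n l"

definition ppart :: "nat \<Rightarrow> nat \<Rightarrow> 'a::field fps \<Rightarrow> 'a fps" where
  "ppart p n F = pproj p n (sorted_list_of_set {l. prime l \<and> l \<noteq> p \<and> l < p ^ n}) F"

lemma set_ppart_primes:
  "set (sorted_list_of_set {l. prime l \<and> l \<noteq> p \<and> l < p ^ n}) = {l::nat. prime l \<and> l \<noteq> p \<and> l < p ^ n}"
  by (rule set_sorted_list_of_set) simp

lemma pcoef:
  assumes "prime p" "prime l" "l \<noteq> p"
  shows "[l * pcoef p n l + 1 = 0] (mod p ^ n)"
proof -
  have "coprime l (p ^ n)" using assms by (simp add: primes_coprime)
  then obtain c where "[l * c = p ^ n * 1 - 1] (mod p ^ n)"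
    using cong_solve_coprime_nat[of l "p ^ n"] by (metis cong_scalar_right mult.assoc mult_1 One_nat_def mult.commute)
  then have "[l * c + 1 = (p ^ n * 1 - 1) + 1] (mod p ^ n)" by (intro cong_add) auto
  then have "[l * c + 1 = 0] (mod p ^ n)"
    using prime_gt_0_nat[OF assms(1)] by (simp add: cong_def)
  then show ?thesis unfolding pcoef_def by (rule someI)
qed

lemma pproj_mult: "pproj p n ls (F * G) = pproj p n ls F * pproj p n ls G"
  by (induction ls) (simp_all add: ptwist_mult power_mult_distrib)

lemma pproj_cong: "fcong N F G \<Longrightarrow> fcong N (pproj p n ls F) (pproj p n ls G)"
  by (induction ls) (auto intro: fcong_mult fcong_power ptwist_cong)

lemma pproj_nth_0: "fps_nth F 0 = 1 \<Longrightarrow> fps_nth (pproj p n ls F) 0 = 1"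
  by (induction ls) (simp_all add: ptwist_nth_0 fps_power_nth_0)

lemma pproj_fmap:
  assumes f: "field_hom (f :: 'a::field \<Rightarrow> 'b::field)" "full_uroots p TYPE('a)"
    and "\<forall>l\<in>set ls. prime l \<and> l \<noteq> p"
  shows "fmap f (pproj p n ls F) = pproj p n ls (fmap f F)"
  using assms(3)
proof (induction ls)
  case (Cons l ls)
  then show ?case
    by (simp add: field_hom.fmap_mult[OF f(1)] field_hom.fmap_power[OF f(1)] fmap_ptwist[OF f])
qed simp

lemma pproj_twist:
  fixes F :: "'a::field fps"
  assumes p: "prime p" "CHAR('a) = p" "full_uroots p TYPE('a)"
    and "\<forall>l\<in>set ls. prime l \<and> l \<noteq> p" "r \<in> set ls" "fps_nth F 0 = 1"
  shows "fcong (p ^ n) (ptwist r (pproj p n ls F)) 1"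
  using assms(4,5)
proof (induction ls)
  case (Cons l ls)
  define G where "G = pproj p n ls F"
  have "fps_nth G 0 = 1" unfolding G_def by (rule pproj_nth_0[OF assms(6)])
  have l: "prime l" "l \<noteq> p" using Cons by auto
  have eq: "ptwist r (pproj p n (l # ls) F) = ptwist r G * ptwist l (ptwist r G) ^ pcoef p n l"
    by (simp add: ptwist_mult ptwist_power ptwist_commute[of r l] flip: G_def)
  show ?case
  proof (cases "r = l")
    case True
    \<comment> \<open>The exponent is 0 modulo \<open>p^n\<close> by the choice of
      \<open>pcoef\<close>, so the twist at l becomes trivial; the twists at other primes stay
      trivial because twists commute.\<close>
    have "ptwist r (pproj p n (l # ls) F) = ptwist l G ^ (l * pcoef p n l + 1)"
      unfolding eq unfolding True using l p(3) prime_gt_0_nat[of l]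
      by (subst ptwist_ptwist) (auto simp: full_uroots_def power_mult)
    also have "fcong (p ^ n) \<dots> (ptwist l G ^ 0)"
      by (rule fps_power_cong[OF p(1,2) ptwist_nth_0[OF \<open>fps_nth G 0 = 1\<close>] pcoef[OF p(1) l]])
    finally show ?thesis by simp
  next
    case False
    then have "fcong (p ^ n) (ptwist r G) 1" using Cons by (auto simp: G_def)
    then have "fcong (p ^ n) (ptwist r G * ptwist l (ptwist r G) ^ pcoef p n l) (1 * ptwist l 1 ^ pcoef p n l)"
      by (intro fcong_mult fcong_power ptwist_cong)
    then show ?thesis unfolding eq by simp
  qed
qed simp

lemma ptypical_ppart:
  fixes F :: "'a::field fps"
  assumes p: "prime p" "CHAR('a) = p" "full_uroots p TYPE('a)" and "fps_nth F 0 = 1"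
  shows "ptypical p n (ppart p n F)"
  unfolding ptypical_def ppart_def
  using pproj_nth_0[OF assms(4)] pproj_twist[OF p _ _ assms(4)] by (auto simp: set_ppart_primes)

lemma ppart_mult: "ppart p n (F * G) = ppart p n F * ppart p n G"
  by (simp add: ppart_def pproj_mult)

lemma ppart_cong: "fcong N F G \<Longrightarrow> fcong N (ppart p n F) (ppart p n G)"
  by (simp add: ppart_def pproj_cong)

lemma ppart_fmap:
  assumes "field_hom (f :: 'a::field \<Rightarrow> 'b::field)" "full_uroots p TYPE('a)"
  shows "fmap f (ppart p n F) = ppart p n (fmap f F)"
  unfolding ppart_def by (rule pproj_fmap[OF assms]) (simp add: set_ppart_primes)

section \<open>Logarithmic derivatives and the series E\<close>

definition ldiff :: "'a::field fps \<Rightarrow> 'a fps" where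
  "ldiff F = fps_deriv F * inverse F"

lemma ldiff_mult: "fps_nth F 0 = 1 \<Longrightarrow> fps_nth G 0 = 1 \<Longrightarrow> ldiff (F * G) = ldiff F + ldiff G"
proof -
  assume "fps_nth F 0 = 1" "fps_nth G 0 = 1"
  then have "F * inverse F = 1" "G * inverse G = 1" by (auto simp: inverse_mult_eq_1')
  moreover have "ldiff (F * G) = ldiff F * (G * inverse G) + ldiff G * (F * inverse F)"
    by (simp add: ldiff_def fps_inverse_mult algebra_simps)
  ultimately show ?thesis by simp
qed

lemma ldiff_power: "fps_nth F 0 = 1 \<Longrightarrow> ldiff (F ^ k) = of_nat k * ldiff F"
  by (induction k) (simp_all add: ldiff_mult fps_power_nth_0 algebra_simps, simp add: ldiff_def)

lemma ldiff_esub: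
  assumes "fps_nth F 0 = 1"
  shows "ldiff (esub F a (Suc 0)) = fps_const a * esub (ldiff F) a (Suc 0)"
  using assms unfolding ldiff_def esub_def
  by (simp add: fps_compose_deriv fps_compose_mult_distrib fps_inverse_compose mult_ac)

text \<open>Rotation invariance multiplies this coefficient by \<open>y^(k+1)\<close>, which is not
  1 for a suitable l-th root of unity y. Consequently the projection to typical series leaves the
  logarithmic derivative unchanged at the indices \<open>p^i - 1\<close>.\<close>

lemma ldiff_ptwist_nth:
  fixes F :: "'a::field fps"
  assumes "prime l" "card (uroots l :: 'a set) = l" "\<not> l dvd Suc k" "fps_nth F 0 = 1"
  shows "fps_nth (ldiff (ptwist l F)) k = 0"
proof -
  obtain y :: 'a where y: "y \<in> uroots l" "y ^ Suc k \<noteq> 1" using uroots_nontrivial[OF assms(1-3)] .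
  have "ldiff (ptwist l F) = fps_const y * esub (ldiff (ptwist l F)) y (Suc 0)"
    using ldiff_esub[OF ptwist_nth_0[OF assms(4), of l], of y] y(1) assms(1) prime_gt_0_nat[of l]
    by (simp add: ptwist_rotate)
  then have "fps_nth (ldiff (ptwist l F)) k = fps_nth (fps_const y * esub (ldiff (ptwist l F)) y (Suc 0)) k"
    by simp
  also have "\<dots> = y ^ Suc k * fps_nth (ldiff (ptwist l F)) k"
    by (simp add: esub_nth)
  finally show ?thesis using y(2) by simp
qed

lemma ldiff_pproj_nth:
  fixes F :: "'a::field fps"
  assumes "full_uroots p TYPE('a)" "\<forall>l\<in>set ls. prime l \<and> l \<noteq> p \<and> \<not> l dvd Suc k" "fps_nth F 0 = 1"
  shows "fps_nth (ldiff (pproj p n ls F)) k = fps_nth (ldiff F) k"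
  using assms(2)
proof (induction ls)
  case (Cons l ls)
  define G where "G = pproj p n ls F"
  have G0: "fps_nth G 0 = 1" unfolding G_def by (rule pproj_nth_0[OF assms(3)])
  have "fps_nth (ldiff (ptwist l G)) k = 0"
    using Cons.prems assms(1) G0 by (intro ldiff_ptwist_nth) (auto simp: full_uroots_def)
  then have "fps_nth (of_nat (pcoef p n l) * ldiff (ptwist l G)) k = 0"
    by (simp flip: fps_of_nat)
  then show ?case
    using Cons by (simp add: ldiff_mult ldiff_power fps_power_nth_0 ptwist_nth_0 G0 flip: G_def)
qed simp

text \<open>The analogue of the Artin-Hasse exponential. Its construction commutes with field
  homomorphisms, in particular with Frobenius, so its coefficients lie in the prime field.\<close>

definition ahexp :: "nat \<Rightarrow> nat \<Rightarrow> 'a::field fps" where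
  "ahexp p n = ppart p n (1 + fps_X)"

lemma ahexp_fmap:
  assumes "field_hom (f :: 'a::field \<Rightarrow> 'b::field)" "full_uroots p TYPE('a)"
  shows "fmap f (ahexp p n) = ahexp p n"
proof -
  interpret field_hom f by fact
  have "fmap f (1 + fps_X) = 1 + fps_X"
    by (rule fps_ext) (simp add: add)
  then show ?thesis unfolding ahexp_def ppart_fmap[OF assms] by simp
qed

lemma ahexp_ptypical:
  assumes "prime p" "CHAR('a::field) = p" "full_uroots p TYPE('a)"
  shows "ptypical p n (ahexp p n :: 'a fps)"
  unfolding ahexp_def by (rule ptypical_ppart[OF assms]) simp

text \<open>The coefficient is that of 1/(1 + t). Its being nonzero makes the pole order in
  \<open>W_top\<close> exact.\<close>

lemma ldiff_ahexp:
  assumes "prime p" "CHAR('a::field) = p" "full_uroots p TYPE('a)"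
  shows "fps_nth (ldiff (ahexp p n :: 'a fps)) (p ^ i - 1) \<noteq> 0"
proof -
  have "ldiff (1 + fps_X :: 'a fps) = Abs_fps (\<lambda>n. (- 1) ^ n)"
    unfolding ldiff_def fps_inverse_fps_X_plus1 by simp
  then have "fps_nth (ldiff (1 + fps_X :: 'a fps)) (p ^ i - 1) \<noteq> 0" by simp
  moreover have "fps_nth (ldiff (ahexp p n :: 'a fps)) (p ^ i - 1) = fps_nth (ldiff (1 + fps_X :: 'a fps)) (p ^ i - 1)"
    unfolding ahexp_def ppart_def
  proof (rule ldiff_pproj_nth[OF assms(3)])
    show "\<forall>l\<in>set (sorted_list_of_set {l. prime l \<and> l \<noteq> p \<and> l < p ^ n}). prime l \<and> l \<noteq> p \<and> \<not> l dvd Suc (p ^ i - 1)"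
      unfolding set_ppart_primes
    proof
      fix l assume l: "l \<in> {l. prime l \<and> l \<noteq> p \<and> l < p ^ n}"
      have "Suc (p ^ i - 1) = p ^ i" using assms(1) prime_gt_0_nat[of p] by simp
      moreover have "\<not> l dvd p ^ i"
        using l assms(1) prime_dvd_power[of l p i] primes_dvd_imp_eq[of l p] by auto
      ultimately show "prime l \<and> l \<noteq> p \<and> \<not> l dvd Suc (p ^ i - 1)" using l by simp
    qed
  qed simp
  ultimately show ?thesis by simp
qed

lemma ahexp_nth_1:
  assumes "prime p" "CHAR('a::field) = p" "full_uroots p TYPE('a)"
  shows "fps_nth (ahexp p n :: 'a fps) (Suc 0) = 1"
proof -
  have "fps_nth (ppart p n F) (Suc 0) = fps_nth F (Suc 0)" if F: "fps_nth F 0 = 1" for F :: "'a fps"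
  proof -
    have "fps_nth (pproj p n ls F) (Suc 0) = fps_nth F (Suc 0)" if "\<forall>l\<in>set ls. prime l \<and> l \<noteq> p" for ls
      using that
    proof (induction ls)
      case (Cons l ls)
      define G where "G = pproj p n ls F"
      have G0: "fps_nth G 0 = 1" unfolding G_def by (rule pproj_nth_0[OF F])
      have "\<not> l dvd Suc 0" using Cons.prems by auto
      then have "fps_nth (ptwist l G) (Suc 0) = 0"
        using Cons.prems assms(3) by (intro ptwist_nth_0_if) (auto simp: full_uroots_def)
      moreover have c: "fcong (Suc 0) G 1" "fcong (Suc 0) (ptwist l G) 1"
        using G0 ptwist_nth_0[OF G0] by (auto simp: fcong_def)
      ultimately have "fps_nth (G * ptwist l G ^ pcoef p n l) (Suc 0) = fps_nth G (Suc 0)"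
        using fps_power_nth_low[OF _ c(2), of "pcoef p n l"] fps_mult_nth_low[OF _ c(1), of "ptwist l G ^ pcoef p n l"] by simp
      then show ?case using Cons by (simp flip: G_def)
    qed simp
    then show ?thesis unfolding ppart_def by (simp add: set_ppart_primes)
  qed
  then show ?thesis unfolding ahexp_def by simp
qed

section \<open>Components of typical series and powers of E\<close>

lemma prime_field:
  fixes a :: "'a::field"
  assumes p: "prime p" "CHAR('a) = p" and "a ^ p = a"
  obtains b where "a = of_nat b"
proof -
  have p1: "p > 1" using p prime_gt_1_nat by blast
  define P where "P = (monom 1 p - monom 1 1 :: 'a poly)"
  have "coeff P p = 1" using p1 by (simp add: P_def)
  then have "P \<noteq> 0" by (metis coeff_0 zero_neq_one)
  have deg: "degree P \<le> p"
    unfolding P_def using p1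
    by (intro degree_diff_le order.trans[OF degree_monom_le]) auto
  have roots: "{x. poly P x = 0} = {x. x ^ p = x}" by (auto simp: P_def poly_monom)
  have fin: "finite {x::'a. x ^ p = x}" using poly_roots_finite[OF \<open>P \<noteq> 0\<close>] roots by simp
  have "card {x::'a. x ^ p = x} \<le> p"
    using card_poly_roots_bound[OF \<open>P \<noteq> 0\<close>] deg unfolding roots by simp
  moreover have "card ((of_nat :: nat \<Rightarrow> 'a) ` {..<p}) = p"
  proof (subst card_image)
    show "inj_on (of_nat :: nat \<Rightarrow> 'a) {..<p}"
      using of_nat_eq_iff_cong_CHAR[where ?'a = 'a] p
      by (auto simp: inj_on_def cong_def)
  qed simp
  moreover have "(of_nat :: nat \<Rightarrow> 'a) ` {..<p} \<subseteq> {x. x ^ p = x}"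
  proof safe
    interpret field_hom "\<lambda>x::'a. x ^ p" by (rule field_hom_frobenius[OF p])
    show "of_nat b ^ p = (of_nat b :: 'a)" for b by (rule of_nat)
  qed
  ultimately have "(of_nat :: nat \<Rightarrow> 'a) ` {..<p} = {x. x ^ p = x}"
    using fin card_mono[OF fin, of "of_nat ` {..<p}"] by (intro card_subset_eq) auto
  with assms(3) that show ?thesis by blast
qed

lemma fps_power_p_nth:
  fixes F :: "'a::field fps"
  assumes p: "prime p" "CHAR('a) = p" and F0: "fps_nth F 0 = 1"
  shows "fps_nth (F ^ (p ^ i)) (p ^ i) = fps_nth F (Suc 0) ^ (p ^ i)"
proof -
  have "F = 1 + fps_X * fps_shift 1 F"
    by (rule fps_ext) (auto simp: F0 split: nat.splits)
  then have "F ^ (p ^ i) = (1 + fps_X * fps_shift 1 F) ^ (p ^ i)" by simp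
  also have "\<dots> = 1 + fps_X ^ (p ^ i) * fps_shift 1 F ^ (p ^ i)"
    using p by (subst freshmans_dream'[where m = "p ^ i" and n = i]) (auto simp: power_mult_distrib)
  finally show ?thesis
    using prime_gt_0_nat[OF p(1)] by (simp add: fps_X_power_mult_nth fps_power_nth_0)
qed

locale ah =
  fixes p n :: nat and ty :: "'a::field itself"
  assumes prime_p: "prime p" and char_p: "CHAR('a) = p" and roots: "full_uroots p TYPE('a)"
begin

abbreviation E :: "'a fps" where "E \<equiv> ahexp p n"

abbreviation fr :: "'a \<Rightarrow> 'a" where "fr \<equiv> (\<lambda>x. x ^ p)"

lemma p_gt_1: "p > 1" using prime_p prime_gt_1_nat by blast
lemma p_pos0 [simp]: "p > 0" using p_gt_1 by simp
lemma p_pos: "p ^ i > 0" by simp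

lemma fr_hom: "field_hom fr" by (rule field_hom_frobenius[OF prime_p char_p])

lemma E_typical: "ptypical p n E" by (rule ahexp_ptypical[OF prime_p char_p roots])
lemma E_0 [simp]: "fps_nth E 0 = 1" by (rule ptypical_nth_0[OF E_typical])
lemma E_1 [simp]: "fps_nth E (Suc 0) = 1" by (rule ahexp_nth_1[OF prime_p char_p roots])
lemma E_fmap: "field_hom f \<Longrightarrow> fmap f E = ahexp p n" by (rule ahexp_fmap[OF _ roots])

lemma esub_E_typical: "ptypical p n (esub E a (p ^ i))"
  by (rule ptypical_esub[OF prime_p E_typical])

lemma esub_E_low: "fcong (p ^ i) (esub E a (p ^ i)) 1" "fps_nth (esub E a (p ^ i)) (p ^ i) = a"
proof -
  show "fcong (p ^ i) (esub E a (p ^ i)) 1"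
    by (auto simp: fcong_def esub_nth dest: dvd_imp_le)
  show "fps_nth (esub E a (p ^ i)) (p ^ i) = a" by (simp add: esub_nth)
qed

lemma inverse_low:
  assumes "k \<ge> 1" "fcong k F 1" "fps_nth F 0 = 1"
  shows "fcong k (inverse F) 1" "fps_nth (inverse F) k = - fps_nth (F :: 'a fps) k"
proof -
  have 1: "F * inverse F = 1" using assms by (simp add: inverse_mult_eq_1')
  have "fcong k (1 * inverse F) (F * inverse F)"
    using assms(2) by (intro fcong_mult fcong_refl) (rule fcong_sym)
  then show *: "fcong k (inverse F) 1" unfolding 1 by simp
  from fps_mult_nth_low[OF assms(1,2) *] assms(1) show "fps_nth (inverse F) k = - fps_nth F k"
    unfolding 1 by (simp add: eq_neg_iff_add_eq_0 add.commute)
qed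

lemma gap:
  assumes "ptypical p n F" "i < n" "fcong (p ^ i) F 1" "fps_nth F (p ^ i) = (0 :: 'a)"
  shows "fcong (p ^ Suc i) F 1"
proof (rule ptypical_gap[OF prime_p char_p roots assms(1,2)])
  show "fcong (Suc (p ^ i)) F 1"
    using assms(3,4) by (auto simp: fcong_def less_Suc_eq)
qed

text \<open>The Witt vector with components \<open>h 0\<close>, ..., \<open>h (k-1)\<close>, written
  multiplicatively.\<close>

definition wprod :: "(nat \<Rightarrow> 'a) \<Rightarrow> nat \<Rightarrow> 'a fps" where
  "wprod h k = (\<Prod>i<k. esub E (h i) (p ^ i))"

lemma wprod_Suc: "wprod h (Suc k) = wprod h k * esub E (h k) (p ^ k)"
  by (simp add: wprod_def)

lemma wprod_0 [simp]: "wprod h 0 = 1" by (simp add: wprod_def)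

lemma wprod_nth_0 [simp]: "fps_nth (wprod h k) 0 = 1"
  unfolding wprod_def by (rule fps_prod_nth_0) simp

lemma wprod_typical: "ptypical p n (wprod h k)"
  unfolding wprod_def by (intro ptypical_prod esub_E_typical)

lemma wprod_cong: "(\<And>i. i < k \<Longrightarrow> h i = h' i) \<Longrightarrow> wprod h k = wprod h' k"
  unfolding wprod_def by (intro prod.cong) auto

text \<open>Artin-Schreier reduction for Witt vectors: F may be changed by a quotient
  \<open>Fr D / D\<close> with D invariant under \<sigma>, and this brings the components into the
  reduced shape R one at a time, the lowest first. G is the remaining error.\<close>

lemma typical_reduce:
  assumes F: "ptypical p n F" and \<sigma>: "field_hom \<sigma>" and fx: "fcong (p ^ n) (fmap \<sigma> F) F"
    and red: "\<And>g. \<sigma> g = g \<Longrightarrow> \<exists>d. \<sigma> d = d \<and> R (g + d ^ p - d)"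
  shows "\<exists>D h. fps_nth D 0 = 1 \<and> fmap \<sigma> D = D \<and>
    fcong (p ^ n) (F * fmap fr D * inverse D) (wprod h n) \<and> (\<forall>i<n. \<sigma> (h i) = h i \<and> R (h i))"
proof -
  interpret \<sigma>: field_hom \<sigma> by fact
  interpret fr: field_hom fr by (rule fr_hom)
  have E\<sigma>: "fmap \<sigma> E = E" "fmap fr E = E" using E_fmap[OF \<sigma>] E_fmap[OF fr_hom] by auto
  define G where "G D h k = F * fmap fr D * inverse D * inverse (wprod h k)" for D h k
  have "\<exists>D h. fps_nth D 0 = 1 \<and> fmap \<sigma> D = D \<and> ptypical p n D \<and> fcong (p ^ k) (G D h k) 1 \<and>
      (\<forall>i<k. \<sigma> (h i) = h i \<and> R (h i))" if "k \<le> n" for k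
    using that
  proof (induction k)
    case 0
    have "fcong (p ^ 0) (G 1 (\<lambda>_. 0) 0) 1"
      using ptypical_nth_0[OF F] by (simp add: fcong_def G_def)
    then show ?case by (intro exI[of _ 1] exI[of _ "\<lambda>_. 0"]) (simp add: ptypical_1)
  next
    case (Suc k)
    then obtain D h where D: "fps_nth D 0 = 1" "fmap \<sigma> D = D" "ptypical p n D" "fcong (p ^ k) (G D h k) 1"
      "\<And>i. i < k \<Longrightarrow> \<sigma> (h i) = h i" "\<And>i. i < k \<Longrightarrow> R (h i)" by auto
    have typG: "ptypical p n (G D h k)"
      unfolding G_def using F D(3) ptypical_fmap[OF fr_hom roots, of n D]
      by (intro ptypical_mult ptypical_inverse wprod_typical) auto
    have w\<sigma>: "fmap \<sigma> (wprod h k) = wprod h k"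
      unfolding wprod_def \<sigma>.fmap_prod using D(5) by (simp add: fmap_esub[OF \<sigma>] E\<sigma>)
    have fD: "fmap \<sigma> (fmap fr D) = fmap fr D"
    proof -
      have "fmap \<sigma> (fmap fr D) = fmap fr (fmap \<sigma> D)" by (rule fps_ext) (simp add: \<sigma>.power)
      then show ?thesis by (simp add: D(2))
    qed
    have "fmap \<sigma> (G D h k) = fmap \<sigma> F * (fmap fr D * inverse D * inverse (wprod h k))"
      by (simp add: G_def \<sigma>.fmap_mult \<sigma>.fmap_inverse D(1,2) w\<sigma> fD mult.assoc)
    also have "fcong (p ^ n) \<dots> (G D h k)"
      unfolding G_def mult.assoc by (intro fcong_mult fx fcong_refl)
    finally have G\<sigma>: "fcong (p ^ n) (fmap \<sigma> (G D h k)) (G D h k)" .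
    \<comment> \<open>The first component of the modified F that is not yet matched; it is fixed by
      \<sigma>, so the reduction in the base field applies to it.\<close>
    define a where "a = fps_nth (G D h k) (p ^ k)"
    have "p ^ k < p ^ n" using Suc.prems p_gt_1 by (intro power_strict_increasing) auto
    then have "\<sigma> a = a" using G\<sigma> by (simp add: fcong_def a_def)
    from red[OF this] obtain d where d: "\<sigma> d = d" "R (a + d ^ p - d)" by blast
    define b where "b = a + d ^ p - d"
    have b\<sigma>: "\<sigma> b = b" using d(1) \<open>\<sigma> a = a\<close> by (simp add: b_def \<sigma>.add \<sigma>.diff \<sigma>.power)
    \<comment> \<open>This factor of D alters component k by \<open>d^p - d\<close>, and b absorbs
      the result.\<close>
    define D' where "D' = D * esub E d (p ^ k)"
    define h' where "h' = h(k := b)"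
    have w: "wprod h' (Suc k) = wprod h k * esub E b (p ^ k)"
    proof -
      have "wprod h' k = wprod h k" unfolding h'_def by (rule wprod_cong) simp
      then show ?thesis by (simp add: wprod_Suc h'_def)
    qed
    have fD': "fmap fr D' = fmap fr D * esub E (d ^ p) (p ^ k)"
      by (simp add: D'_def fr.fmap_mult fmap_esub[OF fr_hom] E\<sigma>)
    have eq: "G D' h' (Suc k) = ((G D h k * esub E (d ^ p) (p ^ k)) * inverse (esub E d (p ^ k))) * inverse (esub E b (p ^ k))"
      unfolding G_def w fD' unfolding D'_def fps_inverse_mult by (simp only: mult_ac)
    have "ptypical p n D'" unfolding D'_def by (intro ptypical_mult D esub_E_typical)
    have typG': "ptypical p n (G D' h' (Suc k))"
      unfolding eq by (intro ptypical_mult ptypical_inverse esub_E_typical typG)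
    have k1: "p ^ k \<ge> 1" using p_pos[of k] by linarith
    note inv = inverse_low[OF k1 esub_E_low(1) ptypical_nth_0[OF esub_E_typical]]
    note 1 = fps_mult_nth_low[OF k1 D(4) esub_E_low(1)[of k "d ^ p"]]
    note 2 = fps_mult_nth_low[OF k1 conjunct1[OF 1] inv(1)[of d]]
    note 3 = fps_mult_nth_low[OF k1 conjunct1[OF 2] inv(1)[of b]]
    have "fps_nth (G D' h' (Suc k)) (p ^ k) = 0"
      unfolding eq conjunct2[OF 3] conjunct2[OF 2] conjunct2[OF 1] inv(2) esub_E_low(2)
      by (simp add: b_def a_def)
    then have "fcong (p ^ Suc k) (G D' h' (Suc k)) 1"
      using conjunct1[OF 3] Suc.prems by (intro gap typG') (auto simp: eq)
    moreover have "fps_nth D' 0 = 1" by (simp add: D'_def D)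
    moreover have "fmap \<sigma> D' = D'" by (simp add: D'_def \<sigma>.fmap_mult D fmap_esub[OF \<sigma>] E\<sigma> d)
    moreover have "\<forall>i<Suc k. \<sigma> (h' i) = h' i \<and> R (h' i)"
      using D(5,6) b\<sigma> d(2) by (auto simp: h'_def b_def less_Suc_eq)
    ultimately show ?case using \<open>ptypical p n D'\<close> by blast
  qed
  from this[of n] obtain D h where D: "fps_nth D 0 = 1" "fmap \<sigma> D = D" "fcong (p ^ n) (G D h n) 1"
      "\<forall>i<n. \<sigma> (h i) = h i \<and> R (h i)" by auto
  have "G D h n * wprod h n = F * fmap fr D * inverse D * (inverse (wprod h n) * wprod h n)"
    by (simp add: G_def mult_ac)
  also have "inverse (wprod h n) * wprod h n = 1" by (simp add: inverse_mult_eq_1)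
  finally have "G D h n * wprod h n = F * fmap fr D * inverse D" by simp
  moreover have "fcong (p ^ n) (G D h n * wprod h n) (1 * wprod h n)"
    using D(3) by (intro fcong_mult fcong_refl)
  ultimately show ?thesis using D by auto
qed

lemma typical_step:
  assumes F: "ptypical p n F" "k < n" "fcong (p ^ k) F 1" and G: "ptypical p n G" "fcong (p ^ k) G 1"
    and eq: "fps_nth F (p ^ k) = fps_nth G (p ^ k)"
  shows "fcong (p ^ Suc k) (F * inverse G) (1 :: 'a fps)"
proof -
  have k1: "p ^ k \<ge> 1" using p_pos[of k] by linarith
  note inv = inverse_low[OF k1 G(2) ptypical_nth_0[OF G(1)]]
  note 1 = fps_mult_nth_low[OF k1 F(3) inv(1)]
  show ?thesis
    using 1 eq inv(2) F(2) by (intro gap ptypical_mult ptypical_inverse F(1) G(1)) auto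
qed

lemma fcong_cancel:
  assumes "fcong N (F * H) (G * H)" "fps_nth H 0 = (1 :: 'a)"
  shows "fcong N F G"
  using fcong_mult[OF assms(1) fcong_refl[of _ "inverse H"]] assms(2) by (simp add: mult.assoc inverse_mult_eq_1')

text \<open>Component k is the coefficient at \<open>p^k\<close> once the lower components have been
  divided off; \<open>gap\<close> then moves the error up to \<open>p^(k+1)\<close>.\<close>

lemma normal_form:
  assumes F: "ptypical p n F" and l: "l \<le> n"
  obtains y where "fcong (p ^ l) F (wprod y l)"
proof -
  have "\<exists>y. fcong (p ^ k) (F * inverse (wprod y k)) 1" if "k \<le> n" for k
    using that
  proof (induction k)
    case 0
    then show ?case using ptypical_nth_0[OF F] by (simp add: fcong_def)
  next
    case (Suc k)
    then obtain y where y: "fcong (p ^ k) (F * inverse (wprod y k)) 1" by auto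
    define G where "G = F * inverse (wprod y k)"
    define y' where "y' = y(k := fps_nth G (p ^ k))"
    have "fcong (p ^ Suc k) (G * inverse (esub E (y' k) (p ^ k))) 1"
      unfolding y'_def G_def using y Suc.prems esub_E_low
      by (intro typical_step ptypical_mult ptypical_inverse wprod_typical esub_E_typical F) auto
    also have "wprod y' k = wprod y k" by (rule wprod_cong) (simp add: y'_def)
    then have "G * inverse (esub E (y' k) (p ^ k)) = F * inverse (wprod y' (Suc k))"
      by (simp add: G_def wprod_Suc fps_inverse_mult mult_ac)
    finally show ?case by blast
  qed
  then obtain y where y: "fcong (p ^ l) (F * inverse (wprod y l)) 1" using l by blast
  have "fcong (p ^ l) ((F * inverse (wprod y l)) * wprod y l) (1 * wprod y l)"
    by (intro fcong_mult y fcong_refl)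
  then have "fcong (p ^ l) F (wprod y l)"
    by (simp add: mult.assoc inverse_mult_eq_1)
  then show ?thesis by (rule that)
qed

text \<open>After cancelling the equal components below k, only the factor of index k contributes to
  the coefficient at \<open>p^k\<close>.\<close>

lemma wprod_unique:
  assumes "fcong (p ^ l) (wprod y l) (wprod z l)" "i < l"
  shows "y i = z i"
  using assms(2)
proof (induction i rule: less_induct)
  case (less k)
  define T where "T y = (\<Prod>i\<in>{k..<l}. esub E (y i) (p ^ i))" for y
  have k1: "p ^ k \<ge> 1" using p_pos[of k] by linarith
  have split: "wprod y l = wprod y k * T y" for y
    unfolding wprod_def T_def using less.prems
    by (subst prod.union_disjoint[symmetric]) (auto intro!: prod.cong)
  have Tk: "fps_nth (T y) (p ^ k) = y k" for y
  proof -
    have low: "fcong (p ^ k) (esub E (y i) (p ^ i)) 1" if "i \<in> {k..<l}" for i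
      using that esub_E_low(1)[of i "y i"] p_gt_1 by (auto elim!: fcong_mono intro!: power_increasing)
    have "fps_nth (T y) (p ^ k) = (\<Sum>i\<in>{k..<l}. fps_nth (esub E (y i) (p ^ i)) (p ^ k))"
      unfolding T_def using fps_prod_nth_low[OF finite_atLeastLessThan k1 low] by simp
    also have "\<dots> = (\<Sum>i\<in>{k..<l}. if i = k then y k else 0)"
    proof (rule sum.cong)
      fix i assume i: "i \<in> {k..<l}"
      show "fps_nth (esub E (y i) (p ^ i)) (p ^ k) = (if i = k then y k else 0)"
      proof (cases "i = k")
        case False
        with i have "p ^ k < p ^ i" using p_gt_1 by (intro power_strict_increasing) auto
        then show ?thesis using esub_E_low(1)[of i "y i"] False k1 by (simp add: fcong_def)
      qed (simp add: esub_E_low(2))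
    qed simp
    also have "\<dots> = y k" using less.prems by simp
    finally show ?thesis .
  qed
  have w: "wprod y k = wprod z k" using less by (intro wprod_cong) simp
  have cancel: "inverse (wprod z k) * (wprod z k * H) = H" for H :: "'a fps"
    by (simp add: inverse_mult_eq_1 flip: mult.assoc)
  have "fcong (p ^ l) (inverse (wprod z k) * wprod y l) (inverse (wprod z k) * wprod z l)"
    by (intro fcong_mult assms fcong_refl)
  then have "fcong (p ^ l) (T y) (T z)"
    unfolding split w cancel by simp
  moreover have "p ^ k < p ^ l" using less.prems p_gt_1 by (intro power_strict_increasing) auto
  ultimately show "y k = z k" using Tk[of y] Tk[of z] by (simp add: fcong_def)
qed

lemma E_power_low: "fcong (p ^ i) (E ^ (p ^ i)) 1" "fps_nth (E ^ (p ^ i)) (p ^ i) = 1"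
  using fps_power_frobenius[OF prime_p char_p E_0] fps_power_p_nth[OF prime_p char_p E_0] by auto

text \<open>Witt vectors of length l over the prime field form the cyclic group
  Z/\<open>p^l\<close>, generated by E: a component k in the prime field is an integer b, and
  \<open>E^(p^k b)\<close> removes it.\<close>

lemma typical_prime_field:
  assumes F: "ptypical p n F" and l: "l \<le> n" and fix_F: "fcong (p ^ l) (fmap fr F) F"
  obtains M where "fcong (p ^ l) F (E ^ M)"
proof -
  interpret fr: field_hom fr by (rule fr_hom)
  have "\<exists>M. fcong (p ^ k) (F * inverse (E ^ M)) 1" if "k \<le> l" for k
    using that
  proof (induction k)
    case 0
    then show ?case using ptypical_nth_0[OF F] by (intro exI[of _ 0]) (simp add: fcong_def)
  next
    case (Suc k)
    then obtain M where M: "fcong (p ^ k) (F * inverse (E ^ M)) 1" by auto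
    define G where "G = F * inverse (E ^ M)"
    have "fmap fr G = fmap fr F * inverse (E ^ M)"
      unfolding G_def fr.fmap_mult
      by (subst fr.fmap_inverse) (simp_all add: fps_power_nth_0 fr.fmap_power E_fmap[OF fr_hom])
    then have "fcong (p ^ l) (fmap fr G) G"
      using fcong_mult[OF fix_F fcong_refl[of _ "inverse (E ^ M)"]] by (simp add: G_def)
    moreover have "p ^ k < p ^ l" using Suc.prems p_gt_1 by (intro power_strict_increasing) auto
    ultimately have "fps_nth G (p ^ k) ^ p = fps_nth G (p ^ k)" by (simp add: fcong_def)
    then obtain b where b: "fps_nth G (p ^ k) = of_nat b" using prime_field[OF prime_p char_p] by blast
    have k1: "p ^ k \<ge> 1" using p_pos[of k] by linarith
    note Eb = fps_power_nth_low[OF k1 E_power_low(1), of b]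
    have "fcong (p ^ Suc k) (G * inverse ((E ^ (p ^ k)) ^ b)) 1"
    proof (rule typical_step)
      show "ptypical p n G" unfolding G_def
        by (intro ptypical_mult ptypical_inverse ptypical_power E_typical F)
      show "fps_nth G (p ^ k) = fps_nth ((E ^ (p ^ k)) ^ b) (p ^ k)"
        using Eb by (simp add: b E_power_low)
    qed (use Suc.prems l Eb M in \<open>auto simp: G_def intro: ptypical_power E_typical\<close>)
    moreover have "G * inverse ((E ^ (p ^ k)) ^ b) = F * inverse (E ^ (M + p ^ k * b))"
      by (simp add: G_def power_add fps_inverse_mult mult_ac flip: power_mult)
    ultimately show ?case by metis
  qed
  then obtain M where M: "fcong (p ^ l) (F * inverse (E ^ M)) 1" by blast
  have "fcong (p ^ l) ((F * inverse (E ^ M)) * E ^ M) (1 * E ^ M)"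
    by (intro fcong_mult M fcong_refl)
  then have "fcong (p ^ l) F (E ^ M)"
    by (simp add: mult.assoc inverse_mult_eq_1 fps_power_nth_0)
  then show ?thesis by (rule that)
qed

text \<open>E has exact order \<open>p^l\<close> modulo \<open>t^(p^l)\<close>: for c =
  \<open>p^k b\<close> with b prime to p, the coefficient of \<open>E^c\<close> at
  \<open>p^k\<close> is b.\<close>

lemma E_power_inj:
  assumes "fcong (p ^ l) (E ^ a) (E ^ b)"
  shows "[a = b] (mod p ^ l)"
proof -
  have *: "p ^ l dvd c" if "fcong (p ^ l) (E ^ c) 1" for c
  proof (rule ccontr)
    assume ndvd: "\<not> p ^ l dvd c"
    then have "c \<noteq> 0" by (intro notI) simp
    define k where "k = multiplicity p c"
    have k: "k < l" using ndvd \<open>c \<noteq> 0\<close> prime_p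
      by (metis k_def linorder_not_le multiplicity_dvd power_le_dvd)
    obtain b where b: "c = p ^ k * b" "\<not> p dvd b"
      using multiplicity_decompose'[of c p] \<open>c \<noteq> 0\<close> prime_p unfolding k_def
      by (metis not_prime_unit)
    have k1: "p ^ k \<ge> 1" using p_pos[of k] by linarith
    have "fps_nth (E ^ c) (p ^ k) = of_nat b"
      using fps_power_nth_low[OF k1 E_power_low(1), of b] by (simp add: b power_mult E_power_low)
    moreover have "p ^ k < p ^ l" using k p_gt_1 by (intro power_strict_increasing) auto
    then have "fps_nth (E ^ c) (p ^ k) = fps_nth 1 (p ^ k)" using that unfolding fcong_def by blast
    ultimately have "(of_nat b :: 'a) = 0" using p_gt_1 by simp
    then show False using b char_p by (simp add: of_nat_eq_0_iff_char_dvd)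
  qed
  have main: "[a = b] (mod p ^ l)" if "fcong (p ^ l) (E ^ a) (E ^ b)" "a \<le> b" for a b
  proof -
    have cancel: "inverse (E ^ a) * E ^ a = 1" by (simp add: inverse_mult_eq_1 fps_power_nth_0)
    have "fcong (p ^ l) (inverse (E ^ a) * E ^ a) (inverse (E ^ a) * E ^ b)"
      by (intro fcong_mult fcong_refl that)
    also have "E ^ b = E ^ a * E ^ (b - a)" using that by (simp flip: power_add)
    finally have "fcong (p ^ l) (E ^ (b - a)) 1"
      using cancel by (simp add: fcong_sym flip: mult.assoc)
    then show ?thesis using *[of "b - a"] that(2) by (metis cong_sym cong_altdef_nat)
  qed
  show ?thesis
    using main[of a b] main[of b a] assms(1) by (metis cong_sym fcong_sym nle_le)
qed

lemma fmap_E_power_iterate: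
  assumes f: "field_hom f" and "fcong N (fmap f Y) (E ^ M * Y)"
  shows "fcong N (fmap (f ^^ k) Y) (E ^ (M * k) * Y)"
proof (induction k)
  case 0
  have "fmap (f ^^ 0) Y = Y" by (simp add: fps_eq_iff)
  then show ?case by (simp add: id_def)
next
  case (Suc k)
  interpret field_hom f by fact
  have "fmap (f ^^ Suc k) Y = fmap f (fmap (f ^^ k) Y)" by (simp add: fps_eq_iff)
  also have "fcong N (fmap f (fmap (f ^^ k) Y)) (fmap f (E ^ (M * k) * Y))"
    using Suc by (rule fmap_cong_mod)
  also have "fmap f (E ^ (M * k) * Y) = E ^ (M * k) * fmap f Y"
    by (simp add: fmap_mult fmap_power E_fmap[OF f])
  also have "fcong N (E ^ (M * k) * fmap f Y) (E ^ (M * k) * (E ^ M * Y))"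
    by (intro fcong_mult fcong_refl assms(2))
  also have "E ^ (M * k) * (E ^ M * Y) = E ^ (M * Suc k) * Y" by (simp add: power_add algebra_simps)
  finally show ?case .
qed

lemma E_power_eq_one: "l \<le> k \<Longrightarrow> fcong (p ^ l) (E ^ (p ^ k * c)) 1"
proof -
  assume "l \<le> k"
  then have "p ^ l \<le> p ^ k" using p_gt_1 by (intro power_increasing) auto
  then have "fcong (p ^ l) (E ^ (p ^ k)) 1" by (rule fcong_mono[OF E_power_low(1)])
  from fcong_power[OF this, of c] show ?thesis by (simp add: power_mult)
qed

end

section \<open>Cyclic extensions of prime power degree\<close>

lemma vhom_funpow: "vhom \<alpha> 1 \<Longrightarrow> vhom (\<alpha> ^^ m) 1"
proof (induction m)
  case 0
  have "\<alpha> ^^ 0 = (\<lambda>x. x)" by auto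
  then show ?case using vhom_id by metis
next
  case (Suc m)
  have "\<alpha> ^^ Suc m = (\<lambda>x. \<alpha> ((\<alpha> ^^ m) x))" by auto
  then show ?case using vhom_comp[OF Suc.prems Suc.IH[OF Suc.prems]] by simp
qed

text \<open>The difference u between the image of X under the m-th iterate and X has valuation at
  least brk + 1, so \<alpha> moves u only from order 2 brk + 1 on, which is beyond brk + 1 as brk is
  positive. Up to that order iterates add.\<close>

lemma brk_power:
  fixes \<alpha> :: "'a::field fls \<Rightarrow> 'a fls"
  assumes \<alpha>: "vhom \<alpha> 1" "\<alpha> fls_X \<noteq> fls_X" "brk \<alpha> \<ge> 1"
  shows "vge (brk \<alpha> + 2) ((\<alpha> ^^ m) fls_X - fls_X - of_nat m * (\<alpha> fls_X - fls_X))"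
proof (induction m)
  case (Suc m)
  interpret vhom \<alpha> 1 by fact
  define w where "w = \<alpha> fls_X - fls_X"
  define u where "u = (\<alpha> ^^ m) fls_X - fls_X"
  define v where "v = u - of_nat m * w"
  have v: "vge (brk \<alpha> + 2) v" using Suc by (simp add: v_def u_def w_def)
  have w: "vge (brk \<alpha> + 1) w" by (simp add: w_def brk_def)
  have u: "vge (brk \<alpha> + 1) u"
  proof -
    have "vge (0 + (brk \<alpha> + 1)) (of_nat m * w)"
      by (intro vge_mult w) (simp add: fls_of_nat)
    moreover have "u = v + of_nat m * w" by (simp add: v_def)
    ultimately show ?thesis using v by (auto intro!: vge_add elim: vge_mono)
  qed
  have "vge (brk \<alpha> + 2) (\<alpha> u - u)"
  proof (cases "u = 0")
    case False
    then have "brk \<alpha> + 2 \<le> \<nu> u + brk \<alpha>" using u \<alpha>(3) by (simp add: vge_def)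
    with brk_ge[OF \<alpha>(1,2), of u] show ?thesis by (rule vge_mono)
  qed simp
  with v have "vge (brk \<alpha> + 2) ((\<alpha> u - u) + v)" by (intro vge_add)
  also have "(\<alpha> u - u) + v = (\<alpha> ^^ Suc m) fls_X - fls_X - of_nat (Suc m) * w"
    by (simp add: u_def v_def w_def diff algebra_simps)
  finally show ?case by (simp add: w_def)
qed simp

lemma brk_power_p:
  fixes \<alpha> :: "'a::field fls \<Rightarrow> 'a fls"
  assumes \<alpha>: "vhom \<alpha> 1" "\<alpha> fls_X \<noteq> fls_X" "brk \<alpha> \<ge> 1" and p: "CHAR('a) = p"
    and ne: "(\<alpha> ^^ p) fls_X \<noteq> fls_X"
  shows "brk (\<alpha> ^^ p) > brk \<alpha>"
proof -
  have "of_nat p = (0 :: 'a fls)" using p by (simp add: of_nat_eq_0_iff_char_dvd)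
  then have "vge (brk \<alpha> + 2) ((\<alpha> ^^ p) fls_X - fls_X)"
    using brk_power[OF \<alpha>, of p] by simp
  then show ?thesis using ne by (simp add: vge_def brk_def)
qed

lemma brk_power_coprime:
  fixes \<alpha> :: "'a::field fls \<Rightarrow> 'a fls"
  assumes \<alpha>: "vhom \<alpha> 1" "\<alpha> fls_X \<noteq> fls_X" "brk \<alpha> \<ge> 1" and p: "CHAR('a) = p" "\<not> p dvd m"
  shows "(\<alpha> ^^ m) fls_X \<noteq> fls_X" "brk (\<alpha> ^^ m) = brk \<alpha>"
proof -
  define w where "w = of_nat m * (\<alpha> fls_X - fls_X)"
  have m: "of_nat m \<noteq> (0 :: 'a)" using p by (simp add: of_nat_eq_0_iff_char_dvd)
  then have "of_nat m \<noteq> (0 :: 'a fls)" "\<nu> (of_nat m :: 'a fls) = 0"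
    by (auto simp: fls_of_nat fls_const_nonzero)
  then have w: "w \<noteq> 0" "\<nu> w = brk \<alpha> + 1"
    using \<alpha>(2) by (auto simp: w_def brk_def)
  have "vge (\<nu> w + 1) ((\<alpha> ^^ m) fls_X - fls_X - w)"
    using brk_power[OF \<alpha>, of m] by (simp add: w w_def[symmetric] add.commute)
  from subdegree_eq_if_vge_diff[OF this w(1)] w(2)
  show "(\<alpha> ^^ m) fls_X \<noteq> fls_X" "brk (\<alpha> ^^ m) = brk \<alpha>" by (auto simp: brk_def)
qed

text \<open>\<alpha> multiplies the leading term at \<open>t^N\<close> by the N-th power of its own
  leading coefficient at X; this is the source of the tame character.\<close>

lemma vhom_leading:
  assumes "vhom \<alpha> 1" "vge (int N) y"
  shows "fls_nth (\<alpha> y) (int N) = fls_nth (\<alpha> fls_X) 1 ^ N * fls_nth y (int N)"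
proof -
  interpret vhom \<alpha> 1 by fact
  define x where "x = \<alpha> fls_X"
  have x: "vge 1 x" by (simp add: x_def vge_def subdegree)
  have pow: "fls_nth (x ^ i) (int i) = fls_nth x 1 ^ i" for i
  proof (induction i)
    case (Suc i)
    define z where "z = x - fls_const (fls_nth x 1) * fls_X"
    have "fls_nth z k = 0" if "k < 2" for k
      using that x by (cases "k = 1") (simp_all add: z_def vge_iff)
    then have "vge 2 z" by (simp add: vge_iff)
    then have "vge (2 + int i) (z * x ^ i)" using vge_power[OF x, of i] by (intro vge_mult) simp_all
    moreover have "x * x ^ i = z * x ^ i + fls_const (fls_nth x 1) * (fls_X * x ^ i)" by (simp add: z_def algebra_simps)
    ultimately have "fls_nth (x * x ^ i) (1 + int i) = fls_nth x 1 * fls_nth (fls_X * x ^ i) (1 + int i)"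
      by (simp add: vge_iff)
    then show ?case using Suc by (simp add: fls_X_times_conv_shift)
  qed simp
  define v where "v = y - fls_const (fls_nth y (int N)) * fls_X ^ N"
  have "fls_nth v k = 0" if "k < int N + 1" for k
    using assms(2) that by (cases "k = int N") (simp_all add: v_def vge_iff)
  then have "vge (int N + 1) (\<alpha> v)" using vge[of "int N + 1" v] by (simp add: vge_iff)
  moreover have "\<alpha> y = fls_const (fls_nth y (int N)) * x ^ N + \<alpha> v" by (simp add: v_def x_def diff mult power)
  ultimately show ?thesis using pow[of N] by (simp add: vge_iff x_def)
qed

lemma vhom_leading_power:
  assumes "vhom \<alpha> 1"
  shows "fls_nth ((\<alpha> ^^ m) fls_X) 1 = fls_nth (\<alpha> fls_X) 1 ^ m"
proof (induction m)
  case (Suc m)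
  interpret m: vhom "\<alpha> ^^ m" 1 by (rule vhom_funpow[OF assms])
  have "vge (int 1) ((\<alpha> ^^ m) fls_X)" by (simp add: vge_def m.subdegree)
  then show ?case using vhom_leading[OF assms, of 1] Suc by simp
qed simp

lemma brk_pos_iff:
  assumes "vhom \<alpha> 1" "\<alpha> fls_X \<noteq> fls_X"
  shows "brk \<alpha> \<ge> 1 \<longleftrightarrow> fls_nth (\<alpha> fls_X) 1 = 1"
proof -
  interpret vhom \<alpha> 1 by fact
  have "vge 1 (\<alpha> fls_X)" by (simp add: vge_def subdegree)
  then have "fls_nth (\<alpha> fls_X - fls_X) n = 0" if "n < 1" for n using that by (simp add: vge_iff)
  then have "vge 2 (\<alpha> fls_X - fls_X) \<longleftrightarrow> fls_nth (\<alpha> fls_X - fls_X) 1 = 0"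
    unfolding vge_iff by (metis add1_zle_eq linorder_not_less one_add_one order_le_less zless_imp_add1_zle)
  moreover have "vge 2 (\<alpha> fls_X - fls_X) \<longleftrightarrow> brk \<alpha> \<ge> 1"
    using assms(2) by (auto simp: vge_def brk_def)
  ultimately show ?thesis by simp
qed

text \<open>The leading coefficient is a \<open>p^k\<close>-th root of unity, hence 1 in
  characteristic p.\<close>

lemma brk_pos_if_p_power:
  fixes \<alpha> :: "'a::field fls \<Rightarrow> 'a fls"
  assumes p: "prime p" "CHAR('a) = p" and "vhom \<alpha> 1" "\<alpha> fls_X \<noteq> fls_X" "\<alpha> ^^ (p ^ k) = id"
  shows "brk \<alpha> \<ge> 1"
proof -
  define c where "c = fls_nth (\<alpha> fls_X) 1"
  interpret fr: field_hom "\<lambda>x::'a. x ^ p" by (rule field_hom_frobenius[OF p])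
  have "c ^ (p ^ k) = 1"
    using vhom_leading_power[OF assms(3), of "p ^ k"] assms(5) by (simp add: c_def)
  then have "c = 1"
  proof (induction k arbitrary: c)
    case (Suc k)
    from Suc.IH[of "c ^ p"] Suc.prems have "c ^ p = 1 ^ p" by (simp flip: power_mult)
    then show ?case by (simp only: fr.eq_iff)
  qed simp
  then show ?thesis using brk_pos_iff[OF assms(3,4)] by (simp add: c_def)
qed

lemma funpow_order_p:
  fixes \<sigma> :: "'a \<Rightarrow> 'a"
  assumes "prime p" "\<sigma> ^^ (p ^ n) = id" "\<sigma> ^^ (p ^ (n - 1)) \<noteq> id" "n \<ge> 1"
  shows "\<sigma> ^^ a = id \<longleftrightarrow> p ^ n dvd a"
proof
  have mult: "\<sigma> ^^ (b * c) = id" if "\<sigma> ^^ b = id" for b c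
    using that by (metis funpow_mult id_funpow mult.commute)
  show "\<sigma> ^^ a = id" if "p ^ n dvd a" using that mult[OF assms(2)] by (auto elim!: dvdE)
  show "p ^ n dvd a" if a: "\<sigma> ^^ a = id"
  proof (rule ccontr)
    assume ndvd: "\<not> p ^ n dvd a"
    then have a0: "a \<noteq> 0" by (intro notI) simp
    define g where "g = gcd a (p ^ n)"
    obtain x y where "a * x = p ^ n * y + g" using bezout_nat[OF a0, of "p ^ n"] by (auto simp: g_def)
    then have "\<sigma> ^^ (a * x) = \<sigma> ^^ (p ^ n * y) \<circ> \<sigma> ^^ g" by (simp add: funpow_add)
    then have "\<sigma> ^^ g = id" by (simp add: mult a assms(2))
    moreover have "g dvd p ^ n" by (simp add: g_def)
    then obtain k where k: "g = p ^ k" "k \<le> n" using divides_primepow_nat[OF assms(1)] by blast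
    moreover have "k \<noteq> n"
    proof
      assume "k = n"
      then have "p ^ n dvd a" using k(1) by (metis g_def gcd_dvd1)
      with ndvd show False ..
    qed
    ultimately have "\<sigma> ^^ (p ^ k * p ^ (n - 1 - k)) = id" by (intro mult) simp
    also have "p ^ k * p ^ (n - 1 - k) = p ^ (n - 1)" using k \<open>k \<noteq> n\<close> by (simp flip: power_add)
    finally show False using assms(3) by blast
  qed
qed

text \<open>The type holds the top field. Layer l is the fixed field of
  \<open>\<sigma>^(p^l)\<close>, so layer 0 is the base and layer n the top.\<close>

locale cyclic_p_ext = ah p n ty for p n and ty :: "'k::alg_closed_field fls itself" +
  fixes \<sigma> :: "'k fls \<Rightarrow> 'k fls"
  assumes n_pos: "n \<ge> 1" and aut: "is_aut \<sigma>"
    and order: "\<sigma> ^^ (p ^ n) = id" "\<sigma> ^^ (p ^ (n - 1)) \<noteq> id"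
begin

lemma char_k: "CHAR('k) = p" using char_p by simp

lemma funpow_eq_id_iff: "\<sigma> ^^ a = id \<longleftrightarrow> p ^ n dvd a"
  by (rule funpow_order_p[OF prime_p order n_pos])

lemma vhom_pow: "vhom (\<sigma> ^^ a) 1"
  by (rule vhom_funpow[OF is_aut_vhom[OF aut]])

lemma fixX_iff: "(\<sigma> ^^ a) fls_X = fls_X \<longleftrightarrow> p ^ n dvd a"
proof -
  have "(\<sigma> ^^ a) fls_X = fls_X \<longleftrightarrow> \<sigma> ^^ a = id"
    using vhom_unique[OF vhom_pow vhom_id, of a] by (auto simp: fun_eq_iff id_def)
  then show ?thesis using funpow_eq_id_iff by simp
qed

text \<open>For l = n the embedding is pinned to the identity, so that breaks on the top layer are
  literally those of powers of \<sigma>.\<close>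

lemma tower:
  assumes "l \<le> n"
  shows "\<exists>\<Psi>. vhom \<Psi> (p ^ (n - l)) \<and> range \<Psi> = {x. (\<sigma> ^^ (p ^ l)) x = x} \<and> (l = n \<longrightarrow> \<Psi> = (\<lambda>x. x))"
proof (cases "l = n")
  case True
  then have "vhom (\<lambda>x::'k fls. x) (p ^ (n - l))" using vhom_id by simp
  moreover have "(\<sigma> ^^ (p ^ l)) x = x" for x using True order(1) by simp
  ultimately show ?thesis by (intro exI[of _ "\<lambda>x. x"]) auto
next
  case False
  with assms have "l < n" by simp
  define S where "S = (\<lambda>i. \<sigma> ^^ (p ^ l * i)) ` {..<p ^ (n - l)}"
  have pl: "p ^ l * p ^ (n - l) = p ^ n" using assms by (simp flip: power_add)
  have red: "\<sigma> ^^ (p ^ l * i) = \<sigma> ^^ (p ^ l * (i mod p ^ (n - l)))" for i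
  proof -
    have "p ^ l * i = p ^ l * (i mod p ^ (n - l)) + p ^ n * (i div p ^ (n - l))"
      unfolding pl[symmetric] by (metis add_mult_distrib2 mod_mult_div_eq mult.assoc)
    then have "\<sigma> ^^ (p ^ l * i) = \<sigma> ^^ (p ^ l * (i mod p ^ (n - l))) \<circ> \<sigma> ^^ (p ^ n * (i div p ^ (n - l)))"
      by (simp only: funpow_add)
    moreover have "\<sigma> ^^ (p ^ n * (i div p ^ (n - l))) = id" by (simp only: funpow_eq_id_iff dvd_triv_left)
    ultimately show ?thesis by simp
  qed
  have inS: "\<sigma> ^^ (p ^ l * i) \<in> S" for i
    unfolding S_def red[of i] by (intro imageI) simp
  have "card S = p ^ (n - l)"
    unfolding S_def
  proof (subst card_image)
    show "inj_on (\<lambda>i. \<sigma> ^^ (p ^ l * i)) {..<p ^ (n - l)}"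
    proof (rule linorder_inj_onI)
      fix i j assume ij: "i < j" "i \<in> {..<p ^ (n - l)}" "j \<in> {..<p ^ (n - l)}"
      show "\<sigma> ^^ (p ^ l * i) \<noteq> \<sigma> ^^ (p ^ l * j)"
      proof
        assume eq: "\<sigma> ^^ (p ^ l * i) = \<sigma> ^^ (p ^ l * j)"
        have "p ^ l * j = p ^ l * i + p ^ l * (j - i)" using ij by (simp flip: add_mult_distrib2)
        then have eq2: "\<sigma> ^^ (p ^ l * i) = \<sigma> ^^ (p ^ l * i) \<circ> \<sigma> ^^ (p ^ l * (j - i))"
          using eq by (simp add: funpow_add)
        interpret i: vhom "\<sigma> ^^ (p ^ l * i)" 1 by (rule vhom_pow)
        have "\<sigma> ^^ (p ^ l * (j - i)) = id"
        proof
          fix x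
          have "(\<sigma> ^^ (p ^ l * i)) x = (\<sigma> ^^ (p ^ l * i)) ((\<sigma> ^^ (p ^ l * (j - i))) x)"
            using fun_cong[OF eq2, of x] by (simp only: comp_def)
          then show "(\<sigma> ^^ (p ^ l * (j - i))) x = id x" unfolding i.eq_iff by simp
        qed
        then have "p ^ l * p ^ (n - l) dvd p ^ l * (j - i)" unfolding funpow_eq_id_iff pl .
        then have "p ^ (n - l) dvd j - i" using p_gt_1 by auto
        then show False using ij by (auto dest: dvd_imp_le)
      qed
    qed auto
  qed simp
  moreover have "is_aut g" if "g \<in> S" for g using that is_aut_funpow[OF aut] by (auto simp: S_def)
  moreover have "(\<lambda>x. g (h x)) \<in> S" if gh: "g \<in> S" "h \<in> S" for g h
  proof -
    obtain i j where "g = \<sigma> ^^ (p ^ l * i)" "h = \<sigma> ^^ (p ^ l * j)" using gh by (auto simp: S_def)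
    then have "(\<lambda>x. g (h x)) = \<sigma> ^^ (p ^ l * (i + j))"
      by (simp add: fun_eq_iff funpow_add add_mult_distrib2)
    then show ?thesis using inS by simp
  qed
  moreover have "finite S" "S \<noteq> {}" using inS[of 0] by (auto simp: S_def)
  ultimately have S: "finite S" "S \<noteq> {}" "\<And>g. g \<in> S \<Longrightarrow> is_aut g"
    "\<And>g h. g \<in> S \<Longrightarrow> h \<in> S \<Longrightarrow> (\<lambda>x. g (h x)) \<in> S" "card S = p ^ (n - l)" by blast+
  have "\<exists>\<Psi>. vhom \<Psi> (card S) \<and> range \<Psi> = {x. \<forall>g\<in>S. g x = x}"
  proof (rule fixed_field[of S])
    show "(\<lambda>x. g (h x)) \<in> S" if "g \<in> S" "h \<in> S" for g h using that by (rule S(4))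
  qed (use S in auto)
  then obtain \<Psi> where \<Psi>: "vhom \<Psi> (card S)" "range \<Psi> = {x. \<forall>g\<in>S. g x = x}" by blast
  have "(\<forall>g\<in>S. g x = x) \<longleftrightarrow> (\<sigma> ^^ (p ^ l)) x = x" for x
  proof
    assume "\<forall>g\<in>S. g x = x"
    with inS[of 1] show "(\<sigma> ^^ (p ^ l)) x = x" by simp
  next
    assume x: "(\<sigma> ^^ (p ^ l)) x = x"
    have "((\<sigma> ^^ (p ^ l)) ^^ i) x = x" for i by (induction i) (simp_all add: x)
    then show "\<forall>g\<in>S. g x = x" by (auto simp: S_def funpow_mult)
  qed
  then have "range \<Psi> = {x. (\<sigma> ^^ (p ^ l)) x = x}" unfolding \<Psi>(2) by simp
  with \<Psi>(1) False show ?thesis unfolding S(5) by blast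
qed

definition \<Psi> :: "nat \<Rightarrow> 'k fls \<Rightarrow> 'k fls" where
  "\<Psi> l = (SOME \<Psi>. vhom \<Psi> (p ^ (n - l)) \<and> range \<Psi> = {x. (\<sigma> ^^ (p ^ l)) x = x} \<and> (l = n \<longrightarrow> \<Psi> = (\<lambda>x. x)))"

lemma \<Psi>:
  assumes "l \<le> n"
  shows \<Psi>_vhom: "vhom (\<Psi> l) (p ^ (n - l))" and \<Psi>_range: "range (\<Psi> l) = {x. (\<sigma> ^^ (p ^ l)) x = x}"
    and \<Psi>_n: "\<Psi> n = (\<lambda>x. x)"
  using someI_ex[OF tower[OF assms]] someI_ex[OF tower[OF order.refl]] unfolding \<Psi>_def by blast+

lemma \<Psi>_ex: "l \<le> n \<Longrightarrow> (\<sigma> ^^ (p ^ l)) x = x \<Longrightarrow> \<exists>x'. x = \<Psi> l x'"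
  using \<Psi>_range by blast

lemma \<Psi>_fixed: "l \<le> n \<Longrightarrow> (\<sigma> ^^ (p ^ l)) (\<Psi> l x) = \<Psi> l x"
  using \<Psi>_range by blast

lemma pow_comm: "(\<sigma> ^^ a) ((\<sigma> ^^ b) x) = (\<sigma> ^^ b) ((\<sigma> ^^ a) x)"
  by (metis add.commute comp_apply funpow_add)

text \<open>The action of \<open>\<sigma>^a\<close> on layer l, carried back to the Laurent series
  field along \<open>\<Psi> l\<close>.\<close>

definition ract :: "nat \<Rightarrow> nat \<Rightarrow> 'k fls \<Rightarrow> 'k fls" where
  "ract l a x = (SOME x'. (\<sigma> ^^ a) (\<Psi> l x) = \<Psi> l x')"

lemma ract: "l \<le> n \<Longrightarrow> \<Psi> l (ract l a x) = (\<sigma> ^^ a) (\<Psi> l x)"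
proof -
  assume l: "l \<le> n"
  have "(\<sigma> ^^ (p ^ l)) ((\<sigma> ^^ a) (\<Psi> l x)) = (\<sigma> ^^ a) (\<Psi> l x)"
    by (subst pow_comm) (simp add: \<Psi>_fixed[OF l])
  from someI_ex[OF \<Psi>_ex[OF l this]] show ?thesis by (simp add: ract_def)
qed

lemma ract_vhom: assumes l: "l \<le> n" shows "vhom (ract l a) 1"
proof -
  interpret \<Psi>: vhom "\<Psi> l" "p ^ (n - l)" by (rule \<Psi>_vhom[OF l])
  interpret s: vhom "\<sigma> ^^ a" 1 by (rule vhom_pow)
  have r: "\<Psi> l (ract l a x) = (\<sigma> ^^ a) (\<Psi> l x)" for x by (rule ract[OF l])
  show ?thesis
  proof (rule vhomI)
    show "field_hom (ract l a)"
    proof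
      have "\<Psi> l (ract l a 1) = \<Psi> l 1" unfolding r by simp
      then show "ract l a 1 = 1" by (simp only: \<Psi>.eq_iff)
      fix x y
      have "\<Psi> l (ract l a (x + y)) = \<Psi> l (ract l a x + ract l a y)"
        unfolding \<Psi>.add r s.add ..
      then show "ract l a (x + y) = ract l a x + ract l a y" by (simp only: \<Psi>.eq_iff)
      have "\<Psi> l (ract l a (x * y)) = \<Psi> l (ract l a x * ract l a y)"
        unfolding \<Psi>.mult r s.mult ..
      then show "ract l a (x * y) = ract l a x * ract l a y" by (simp only: \<Psi>.eq_iff)
    qed
    then interpret R: field_hom "ract l a" .
    show "\<nu> (ract l a x) = int 1 * \<nu> x" if "x \<noteq> 0" for x
    proof -
      have "\<nu> (\<Psi> l (ract l a x)) = \<nu> (\<Psi> l x)"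
        unfolding r using that by (subst s.subdegree) auto
      then show ?thesis using that p_gt_1 by (simp add: \<Psi>.subdegree)
    qed
    show "ract l a (fls_const c) = fls_const c" for c
    proof -
      have "\<Psi> l (ract l a (fls_const c)) = \<Psi> l (fls_const c)" unfolding r by simp
      then show ?thesis by (simp only: \<Psi>.eq_iff)
    qed
  qed simp
qed

lemma ract_funpow: "l \<le> n \<Longrightarrow> ract l a ^^ m = ract l (a * m)"
proof
  fix x assume l: "l \<le> n"
  interpret \<Psi>: vhom "\<Psi> l" "p ^ (n - l)" by (rule \<Psi>_vhom[OF l])
  have "\<Psi> l ((ract l a ^^ m) x) = \<Psi> l (ract l (a * m) x)"
    by (induction m) (simp_all add: ract[OF l] funpow_add)
  then show "(ract l a ^^ m) x = ract l (a * m) x" by simp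
qed

text \<open>Otherwise the uniformizer of layer l would lie in layer k, where valuations are
  divisible by a higher power of p.\<close>

lemma ract_nontrivial:
  assumes "k < l" "l \<le> n"
  shows "ract l (p ^ k) fls_X \<noteq> fls_X"
proof
  interpret \<Psi>: vhom "\<Psi> l" "p ^ (n - l)" by (rule \<Psi>_vhom[OF assms(2)])
  assume "ract l (p ^ k) fls_X = fls_X"
  then have "(\<sigma> ^^ (p ^ k)) (\<Psi> l fls_X) = \<Psi> l fls_X"
    using ract[OF assms(2), of "p ^ k" fls_X] by simp
  then obtain x where x: "\<Psi> l fls_X = \<Psi> k x" using \<Psi>_ex[of k] assms by auto
  interpret k: vhom "\<Psi> k" "p ^ (n - k)" using assms by (intro \<Psi>_vhom) simp
  have "x \<noteq> 0" using x by (intro notI) simp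
  then have "int (p ^ (n - l)) = int (p ^ (n - k)) * \<nu> x"
    using arg_cong[OF x, of \<nu>] by (simp add: \<Psi>.subdegree k.subdegree)
  then have "p ^ (n - k) dvd p ^ (n - l)" by (metis dvd_triv_left int_dvd_int_iff)
  then have "n - k \<le> n - l" using p_gt_1 by (simp add: dvd_power_iff_le)
  then show False using assms by linarith
qed

text \<open>The lower break of layer l belonging to \<open>\<sigma>^(p^k)\<close>, with k counted
  from 0.\<close>

definition jb :: "nat \<Rightarrow> nat \<Rightarrow> int" where
  "jb l k = brk (ract l (p ^ k))"

lemma jb_pos: "k < l \<Longrightarrow> l \<le> n \<Longrightarrow> jb l k \<ge> 1"
proof -
  assume l: "k < l" "l \<le> n"
  interpret \<Psi>: vhom "\<Psi> l" "p ^ (n - l)" by (rule \<Psi>_vhom[OF l(2)])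
  have id: "\<sigma> ^^ (p ^ k * p ^ n) = id" by (simp only: funpow_eq_id_iff dvd_triv_right)
  have "ract l (p ^ k * p ^ n) x = x" for x
  proof -
    have "\<Psi> l (ract l (p ^ k * p ^ n) x) = \<Psi> l x" unfolding ract[OF l(2)] id by simp
    then show ?thesis by (simp only: \<Psi>.eq_iff)
  qed
  then have "ract l (p ^ k) ^^ (p ^ n) = id" unfolding ract_funpow[OF l(2)] by (intro ext) simp
  from brk_pos_if_p_power[OF prime_p char_k ract_vhom[OF l(2)] ract_nontrivial[OF l] this]
  show ?thesis unfolding jb_def .
qed

lemma jb_mono: "Suc k < l \<Longrightarrow> l \<le> n \<Longrightarrow> jb l k < jb l (Suc k)"
proof -
  assume l: "Suc k < l" "l \<le> n"
  have eq: "ract l (p ^ k) ^^ p = ract l (p ^ Suc k)" using ract_funpow[OF l(2)] by (simp add: mult.commute)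
  show ?thesis
    using brk_power_p[OF ract_vhom ract_nontrivial _ char_k, of l k] l jb_pos[of k l] ract_nontrivial[of "Suc k" l]
    unfolding jb_def eq by simp
qed

lemma jb_mono': "k < k' \<Longrightarrow> k' < l \<Longrightarrow> l \<le> n \<Longrightarrow> jb l k < jb l k'"
proof (induction k' rule: less_induct)
  case (less k')
  obtain m where m: "k' = Suc m" using less.prems(1) by (cases k') auto
  show ?case
  proof (cases "k = m")
    case True
    then show ?thesis using jb_mono[of k l] less m by simp
  next
    case False
    then have "jb l k < jb l m" using less m by auto
    moreover have "jb l m < jb l k'" using jb_mono[of m l] less m by simp
    ultimately show ?thesis by simp
  qed
qed

lemma jb_n: "jb n k = brk (\<sigma> ^^ (p ^ k))"
proof -
  have "ract n (p ^ k) = \<sigma> ^^ (p ^ k)"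
    using ract[OF order.refl, of "p ^ k"] unfolding \<Psi>_n[OF order.refl] by (intro ext)
  then show ?thesis by (simp add: jb_def)
qed

text \<open>An Artin--Schreier generator \<open>y\<close> of the \<open>l\<close>-th layer with reduced pole order \<open>J\<close>: \<open>J\<close> is the
  break of that layer, and \<open>g y - y\<close> lies in the layer below, where the equation
  \<open>g r - r = (g y - y)\<^sup>p - (g y - y)\<close> compares the breaks of \<open>g\<close> on the two layers.\<close>

lemma as_generator:
  assumes l: "l = Suc b" "l \<le> n" and e: "(\<sigma> ^^ (p ^ b)) e = e + 1"
  obtains d r y J where "e = \<Psi> b d + \<Psi> l y" "\<Psi> l y ^ p - \<Psi> l y = \<Psi> b r"
    "J = jb l b" "\<nu> r = - J" "\<nu> y = - J" "\<not> int p dvd J"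
    "\<And>M. M \<ge> 0 \<Longrightarrow> vge (- (int (p ^ (n - b)) * M)) (e ^ p - e) \<Longrightarrow> vge (- M) (d ^ p)"
    "\<And>k. k < b \<Longrightarrow> jb b k = jb l k"
proof -
  define q where "q = p ^ b"
  define h where "h = \<sigma> ^^ q"
  have l': "b \<le> n" "b < l" using l by linarith+
  interpret h: vhom h 1 unfolding h_def by (rule vhom_pow)
  interpret T: vhom "\<Psi> l" "p ^ (n - l)" by (rule \<Psi>_vhom[OF l(2)])
  interpret B: vhom "\<Psi> b" "p ^ (n - b)" by (rule \<Psi>_vhom[OF l'(1)])
  interpret fr: field_hom "\<lambda>x::'k fls. x ^ p" by (rule fr_hom)
  have he: "h e = e + 1" using e by (simp add: h_def q_def)
  have inB: "\<exists>x'. x = \<Psi> b x'" if "h x = x" for x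
    using \<Psi>_ex[OF l'(1)] that by (simp add: h_def q_def)
  have hB: "h (\<Psi> b x) = \<Psi> b x" for x
    using \<Psi>_fixed[OF l'(1)] by (simp add: h_def q_def)
  have char0: "of_nat p = (0 :: 'k fls)" using char_p by (simp add: of_nat_eq_0_iff_char_dvd)
  have "h (e ^ p - e) = e ^ p - e"
    by (simp add: h.diff h.power he fr.add)
  then obtain g where g: "e ^ p - e = \<Psi> b g" using inB by blast
  obtain d r where dr: "g = r + d ^ p - d" "r = 0 \<or> \<nu> r < 0 \<and> \<not> int p dvd \<nu> r"
    "\<And>M. M \<ge> 0 \<Longrightarrow> vge (- M) g \<Longrightarrow> vge (- M) (d ^ p)"
  proof (rule artin_schreier_reduce[OF prime_p char_k, of g])
    fix d r assume "g = r + d ^ p - d" "r = 0 \<or> \<nu> r < 0 \<and> \<not> int p dvd \<nu> r"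
      "\<And>M. M \<ge> 0 \<Longrightarrow> vge (- M) g \<Longrightarrow> vge (- M) (d ^ p)"
    then show thesis by (rule that)
  qed
  define y0 where "y0 = e - \<Psi> b d"
  have hy0: "h y0 = y0 + 1" by (simp add: y0_def h.diff he hB)
  have yr: "y0 ^ p - y0 = \<Psi> b r"
  proof -
    have "y0 ^ p - y0 = (e ^ p - e) - \<Psi> b (d ^ p - d)"
      by (simp add: y0_def fr.diff B.diff B.power)
    then show ?thesis unfolding g dr(1) by (simp add: B.add B.diff)
  qed
  have r0: "r \<noteq> 0"
  proof
    assume "r = 0"
    then have "y0 ^ p = y0" using yr by simp
    then obtain b where "y0 = of_nat b" using prime_field[OF prime_p char_p] by blast
    then show False using hy0 by (simp add: h.of_nat)
  qed
  define J where "J = - \<nu> r"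
  have J: "J > 0" "\<not> int p dvd J" using dr(2) r0 by (auto simp: J_def)
  \<comment> \<open>After p steps the shift is p = 0, so y0 lies in layer l.\<close>
  have "(h ^^ m) y0 = y0 + of_nat m" for m
    by (induction m) (simp_all add: h.add h.of_nat hy0 add_ac)
  from this[of p] have "(\<sigma> ^^ (p ^ l)) y0 = y0"
    using char0 unfolding h_def funpow_mult q_def l(1) by (simp add: mult.commute)
  then obtain y where y: "y0 = \<Psi> l y" using \<Psi>_ex[OF l(2)] by blast
  have pp: "int (p ^ (n - b)) = int (p ^ (n - l)) * int p"
  proof -
    have "n - b = Suc (n - l)" using l by linarith
    then show ?thesis by simp
  qed
  have subr: "\<nu> (\<Psi> b r) = - (int (p ^ (n - b)) * J)"
    using r0 by (simp add: B.subdegree J_def)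
  have suby: "\<nu> y = - J"
  proof -
    have neg: "\<not> vge 0 y0"
    proof
      assume v: "vge 0 y0"
      then have "vge 0 (y0 ^ p - y0)" using vge_power[of 0 y0 p] by (intro vge_diff) auto
      then have "0 \<le> \<nu> (\<Psi> b r)" unfolding yr using r0 by (simp add: vge_def)
      moreover have "int (p ^ (n - b)) * J > 0" using J(1) by simp
      ultimately show False using subr by simp
    qed
    then have y0: "y0 \<noteq> 0" "\<nu> y0 < 0" by (auto simp: vge_def)
    have "vge (\<nu> (y0 ^ p) + 1) (- y0)"
    proof -
      have "int p * \<nu> y0 \<le> 2 * \<nu> y0"
        using y0 p_gt_1 by (intro mult_right_mono_neg) auto
      with y0(2) have "int p * \<nu> y0 + 1 \<le> \<nu> y0" by linarith
      then show ?thesis unfolding vge_uminus unfolding fls_subdegree_pow vge_def by (rule disjI2)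
    qed
    note vge_y0 = this
    have "y0 ^ p \<noteq> 0" using y0(1) by simp
    from conjunct2[OF fls_subdegree_add_eq[OF this vge_y0]] have "\<nu> (y0 ^ p - y0) = int p * \<nu> y0"
      by (simp only: fls_subdegree_pow add_uminus_conv_diff)
    then have "int p * (int (p ^ (n - l)) * \<nu> y) = int p * (int (p ^ (n - l)) * - J)"
      unfolding yr subr pp using y y0(1) by (simp add: T.subdegree mult_ac)
    moreover have "int p \<noteq> 0" "int (p ^ (n - l)) \<noteq> 0" using p_gt_1 by auto
    ultimately show ?thesis by (simp only: mult_cancel_left) blast
  qed
  have y_nz: "y \<noteq> 0" using suby J by auto
  have brk_y: "\<nu> (ract l a y - y) = - J + brk (ract l a)" "ract l a y \<noteq> y"
    if "ract l a fls_X \<noteq> fls_X" "brk (ract l a) \<ge> 1" for a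
    using brk_eq[OF ract_vhom[OF l(2)] that(1) prime_p char_k _ that(2), of y] J suby by auto
  \<comment> \<open>This difference has valuation 0; since moving y shifts its valuation by the
    break, the pole order of y equals the break.\<close>
  have "ract l q y - y = 1"
  proof -
    have "\<Psi> l (ract l q y - y) = h y0 - y0" by (simp add: T.diff ract[OF l(2)] y h_def)
    then have "\<Psi> l (ract l q y - y) = \<Psi> l 1" by (simp add: hy0)
    then show ?thesis by (simp only: T.eq_iff)
  qed
  then have JJ: "J = jb l b"
    using brk_y(1)[of q] ract_nontrivial[OF l'(2) l(2)] jb_pos[OF l'(2) l(2)]
    by (simp add: jb_def q_def)
  have compat: "jb b k = jb l k" if k: "k < b" for k
  proof -
    define i where "i = jb l k"
    have kl: "k < l" using k l by linarith
    have i: "1 \<le> i" "i < J"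
      unfolding i_def JJ using jb_pos[OF kl l(2)] jb_mono'[OF k l'(2) l(2)] by auto
    define s where "s = \<sigma> ^^ (p ^ k)"
    interpret s: vhom s 1 unfolding s_def by (rule vhom_pow)
    define c where "c = s y0 - y0"
    have "c = \<Psi> l (ract l (p ^ k) y - y)"
      by (simp add: c_def T.diff ract[OF l(2)] y s_def)
    then have c: "\<nu> c = int (p ^ (n - l)) * (i - J)" "c \<noteq> 0"
      using brk_y[of "p ^ k"] ract_nontrivial[OF kl l(2)] i(1)
      by (simp_all add: T.subdegree jb_def i_def)
    have "h (s y0) = s (h y0)" unfolding h_def s_def by (rule pow_comm)
    then have "h c = c" by (simp add: c_def h.diff hy0 s.add)
    then obtain c' where c': "c = \<Psi> b c'" using inB by blast
    \<comment> \<open>The smaller break i leaves a pole in c, so \<open>c^p\<close> dominates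
      \<open>c^p - c\<close> and the equation determines its valuation.\<close>
    have "\<nu> c < 0"
      unfolding c using i by (intro mult_pos_neg) auto
    then have "vge (\<nu> (c ^ p) + 1) (- c)"
    proof -
      have "int p * \<nu> c \<le> 2 * \<nu> c"
        using \<open>\<nu> c < 0\<close> p_gt_1 by (intro mult_right_mono_neg) auto
      with \<open>\<nu> c < 0\<close> have "int p * \<nu> c + 1 \<le> \<nu> c" by linarith
      then show ?thesis unfolding vge_uminus unfolding fls_subdegree_pow vge_def by (rule disjI2)
    qed
    note vge_c = this
    have "c ^ p \<noteq> 0" using c(2) by simp
    from conjunct2[OF fls_subdegree_add_eq[OF this vge_c]] have cp: "\<nu> (c ^ p - c) = int p * \<nu> c"
      by (simp only: fls_subdegree_pow add_uminus_conv_diff)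
    have "c ^ p - c = s (y0 ^ p - y0) - (y0 ^ p - y0)"
      by (simp add: c_def fr.diff s.diff s.power)
    also have "\<dots> = \<Psi> b (ract b (p ^ k) r - r)"
      unfolding yr by (simp add: B.diff ract[OF l'(1)] s_def)
    finally have eq: "\<nu> (\<Psi> b (ract b (p ^ k) r - r)) = int p * \<nu> c"
      using cp by simp
    have "\<not> int p dvd \<nu> r" using J by (simp add: J_def)
    from brk_eq[OF ract_vhom[OF l'(1)] ract_nontrivial[OF k l'(1)] prime_p char_k this]
    have "\<nu> (ract b (p ^ k) r - r) = - J + jb b k" "ract b (p ^ k) r \<noteq> r"
      using jb_pos[OF k l'(1)] by (auto simp: jb_def J_def)
    with B.subdegree[of "ract b (p ^ k) r - r"]
    have "\<nu> (\<Psi> b (ract b (p ^ k) r - r)) = int (p ^ (n - b)) * (- J + jb b k)" by auto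
    then have "int p * (int (p ^ (n - l)) * (- J + jb b k)) = int p * (int (p ^ (n - l)) * (i - J))"
      using eq unfolding c(1) pp by (simp only: mult_ac)
    moreover have "int p \<noteq> 0" "int (p ^ (n - l)) \<noteq> 0" using p_gt_1 by auto
    ultimately have "- J + jb b k = i - J" by (simp only: mult_cancel_left) blast
    then show ?thesis by (simp add: i_def)
  qed
  have bound: "vge (- M) (d ^ p)" if "M \<ge> 0" "vge (- (int (p ^ (n - b)) * M)) (e ^ p - e)" for M
  proof (rule dr(3)[OF that(1)])
    show "vge (- M) g"
    proof (cases "g = 0")
      case False
      then have "int (p ^ (n - b)) * - M \<le> int (p ^ (n - b)) * \<nu> g"
        using that(2) unfolding g by (simp add: vge_def B.subdegree)
      then have "- M \<le> \<nu> g" by (rule mult_left_le_imp_le) simp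
      then show ?thesis by (simp add: vge_def)
    qed simp
  qed
  show ?thesis
  proof (rule that)
    show "e = \<Psi> b d + \<Psi> l y" unfolding y[symmetric] y0_def by simp
    show "\<Psi> l y ^ p - \<Psi> l y = \<Psi> b r" using yr y by simp
    show "\<nu> r = - J" by (simp add: J_def)
  qed fact+
qed

end

section \<open>Differentials and upper breaks\<close>

lemma fmap_deriv_mult:
  "fmap fls_deriv (F * G) = fmap fls_deriv F * G + F * fmap fls_deriv G"
  for F G :: "'a::field fls fps"
  by (rule fps_ext) (simp add: fps_mult_nth fls_deriv_sum sum.distrib)

text \<open>Here the coefficients are differentiated, in contrast to \<open>ldiff\<close>, which
  differentiates in the series variable.\<close>

definition dlog :: "'a::field fls fps \<Rightarrow> 'a fls fps" where
  "dlog F = fmap fls_deriv F * inverse F"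

lemma dlog_mult: "fps_nth F 0 = 1 \<Longrightarrow> fps_nth G 0 = 1 \<Longrightarrow> dlog (F * G) = dlog F + dlog G"
proof -
  assume "fps_nth F 0 = 1" "fps_nth G 0 = 1"
  then have "F * inverse F = 1" "G * inverse G = 1" by (auto simp: inverse_mult_eq_1')
  moreover have "dlog (F * G) = dlog F * (G * inverse G) + dlog G * (F * inverse F)"
    by (simp add: dlog_def fps_inverse_mult fmap_deriv_mult algebra_simps)
  ultimately show ?thesis by simp
qed

lemma dlog_1 [simp]: "dlog 1 = 0"
proof -
  have "fmap fls_deriv (1 :: 'a::field fls fps) = 0" by (rule fps_ext) simp
  then show ?thesis by (simp add: dlog_def)
qed

text \<open>Pole orders growing at most linearly in the index, with slope c; such bounds are stable
  under products.\<close>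

definition bnd :: "int \<Rightarrow> nat \<Rightarrow> 'a::field fls fps \<Rightarrow> bool" where
  "bnd c N F \<longleftrightarrow> (\<forall>m<N. vge (- (int m * c)) (fps_nth F m))"

lemma bnd_mult: "bnd c N F \<Longrightarrow> bnd c N G \<Longrightarrow> bnd c N (F * G)"
  unfolding bnd_def fps_mult_nth
proof (intro allI impI vge_sum)
  fix m i assume *: "\<forall>m<N. vge (- (int m * c)) (fps_nth F m)" "\<forall>m<N. vge (- (int m * c)) (fps_nth G m)"
    "m < N" "i \<in> {0..m}"
  then have "vge (- (int i * c) + - (int (m - i) * c)) (fps_nth F i * fps_nth G (m - i))"
    by (intro vge_mult) (simp_all del: of_nat_diff)
  also have "- (int i * c) + - (int (m - i) * c) = - (int m * c)"
    using * by (simp add: of_nat_diff algebra_simps)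
  finally show "vge (- (int m * c)) (fps_nth F i * fps_nth G (m - i))" .
qed

lemma bnd_1: "bnd c N 1"
  by (auto simp: bnd_def vge_def)

lemma bnd_prod: "(\<And>i. i \<in> A \<Longrightarrow> bnd c N (F i)) \<Longrightarrow> bnd c N (prod F A)"
  by (induction A rule: infinite_finite_induct) (auto intro: bnd_mult bnd_1)

context cyclic_p_ext begin

lemma prime_field_fls:
  fixes a :: "'k fls"
  assumes "a ^ p = a"
  shows "fls_deriv a = 0" "vge 0 a" "a \<noteq> 0 \<Longrightarrow> \<nu> a = 0"
proof -
  obtain b where a: "a = of_nat b" using prime_field[OF prime_p char_p assms] .
  show "fls_deriv a = 0" "vge 0 a" "a \<noteq> 0 \<Longrightarrow> \<nu> a = 0"
    by (simp_all add: a fls_of_nat)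
qed

lemma E_coeff: "fps_nth E j ^ p = (fps_nth E j :: 'k fls)"
  using arg_cong[OF E_fmap[OF fr_hom], of "\<lambda>F. fps_nth F j"] by simp

lemma ldiff_E_coeff: "fps_nth (ldiff E) j ^ p = (fps_nth (ldiff E) j :: 'k fls)"
proof -
  interpret fr: field_hom "\<lambda>x::'k fls. x ^ p" by (rule fr_hom)
  have "fmap (\<lambda>x. x ^ p) (fps_deriv E) = fps_deriv (fmap (\<lambda>x. x ^ p) (E :: 'k fls fps))"
    by (rule fps_ext) (simp add: fr.mult fr.of_nat del: of_nat_Suc)
  then have "fmap (\<lambda>x. x ^ p) (ldiff E :: 'k fls fps) = ldiff E"
    unfolding ldiff_def fr.fmap_mult using E_fmap[OF fr_hom] by (simp add: fr.fmap_inverse)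
  from arg_cong[OF this, of "\<lambda>F. fps_nth F j"] show ?thesis by simp
qed

text \<open>The coefficients of E lie in the prime field and have derivative 0, so the chain rule
  gives \<open>dh t^s\<close> times the logarithmic derivative of E at \<open>h t^s\<close>.\<close>

lemma dlog_esub_E:
  assumes "s > 0"
  shows "fps_nth (dlog (esub E h s)) m =
    (if s dvd m \<and> m > 0 then fls_deriv h * (h ^ (m div s - 1) * fps_nth (ldiff E) (m div s - 1)) else (0 :: 'k fls))"
proof -
  have "fmap fls_deriv (esub E h s) = fps_const (fls_deriv h) * (fps_X ^ s * esub (fps_deriv E) h s)"
  proof (rule fps_ext)
    fix m
    show "fps_nth (fmap fls_deriv (esub E h s)) m = fps_nth (fps_const (fls_deriv h) * (fps_X ^ s * esub (fps_deriv E) h s)) m"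
    proof (cases "s dvd m")
      case True
      then obtain j where m: "m = s * j" by blast
      have "fls_deriv (h ^ j * fps_nth E j) = fls_deriv (h ^ j) * fps_nth E j"
        unfolding fls_deriv_mult prime_field_fls(1)[OF E_coeff] by simp
      also have "fls_deriv (h ^ j) = of_nat j * h ^ (j - 1) * fls_deriv h"
        by (simp add: fls_deriv_power mult_ac)
      finally have 1: "fls_deriv (h ^ j * fps_nth E j) = of_nat j * h ^ (j - 1) * fls_deriv h * fps_nth E j" .
      show ?thesis
      proof (cases j)
        case 0
        then show ?thesis using assms 1 by (simp add: m esub_nth fps_X_power_mult_nth)
      next
        case (Suc i)
        have "m - s = s * i" "\<not> m < s" by (simp_all add: m Suc)
        then show ?thesis
          using assms 1 by (simp add: m esub_nth fps_X_power_mult_nth Suc mult_ac del: of_nat_Suc)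
      qed
    next
      case False
      then have "\<not> s dvd m - s" if "\<not> m < s" using that by (simp add: dvd_minus_self)
      with False show ?thesis using assms by (simp add: esub_nth fps_X_power_mult_nth)
    qed
  qed
  moreover have "inverse (esub E h s) = esub (inverse E) h s"
    unfolding esub_def using assms by (subst fps_inverse_compose) auto
  ultimately have "dlog (esub E h s) = fps_const (fls_deriv h) * (fps_X ^ s * esub (ldiff E) h s)"
    using assms by (simp add: dlog_def ldiff_def esub_mult mult.assoc)
  then have "fps_nth (dlog (esub E h s)) m =
      (if m < s then 0 else fls_deriv h * fps_nth (esub (ldiff E) h s) (m - s))"
    by (simp add: fps_X_power_mult_nth)
  also have "\<dots> = (if s dvd m \<and> m > 0 then fls_deriv h * (h ^ (m div s - 1) * fps_nth (ldiff E) (m div s - 1)) else 0)"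
  proof (cases "s dvd m \<and> m > 0")
    case True
    then obtain j where m: "m = s * j" "j > 0" by auto
    then obtain i where j: "j = Suc i" by (cases j) auto
    have "m - s = s * i" "\<not> m < s" by (simp_all add: m j)
    then show ?thesis using assms by (simp add: esub_nth m j)
  next
    case False
    then have "\<not> m < s \<longrightarrow> \<not> s dvd m - s" using assms by (auto simp: dvd_minus_self)
    with False show ?thesis using assms by (auto simp: esub_nth)
  qed
  finally show ?thesis .
qed

text \<open>The drop of the top valuation under differentiation for elements of layer l of valuation
  prime to p there. The subtracted term is the exponent of the different of the top field over layer
  l.\<close>

definition \<Delta> :: "nat \<Rightarrow> int" where
  "\<Delta> l = int (p ^ (n - l)) - \<nu> (fls_deriv (\<Psi> l fls_X))"

text \<open>Separability of the top over layer l: a vanishing derivative makes the uniformizer of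
  layer l a p-th power in the top field; its root is fixed by the same automorphism, since Frobenius
  is injective, hence lies in layer l, which contradicts valuation 1.\<close>

lemma deriv_\<Psi>X_nonzero: assumes l: "l \<le> n" shows "fls_deriv (\<Psi> l fls_X) \<noteq> 0"
proof
  interpret T: vhom "\<Psi> l" "p ^ (n - l)" by (rule \<Psi>_vhom[OF l])
  interpret s: vhom "\<sigma> ^^ (p ^ l)" 1 by (rule vhom_pow)
  interpret fr: field_hom "\<lambda>x::'k fls. x ^ p" by (rule fr_hom)
  assume "fls_deriv (\<Psi> l fls_X) = 0"
  then obtain w where w: "\<Psi> l fls_X = w ^ p" by (rule fls_deriv_eq_0_imp_power[OF prime_p char_k])
  have "((\<sigma> ^^ (p ^ l)) w) ^ p = w ^ p"
    using \<Psi>_fixed[OF l, of fls_X] unfolding w s.power .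
  then have "(\<sigma> ^^ (p ^ l)) w = w" by (simp only: fr.eq_iff)
  then obtain w' where "w = \<Psi> l w'" using \<Psi>_ex[OF l] by blast
  then have "\<Psi> l fls_X = \<Psi> l (w' ^ p)" using w T.power by simp
  then have X: "fls_X = w' ^ p" by (simp only: T.eq_iff)
  have "int p * \<nu> w' = 1"
    using arg_cong[OF X, of \<nu>] by (simp add: fls_subdegree_pow)
  then show False using p_gt_1 by (metis abs_of_nat dvd_triv_left less_numeral_extra(4) of_nat_1 of_nat_eq_iff zdvd1_eq)
qed

lemma deriv_\<Psi>:
  assumes l: "l \<le> n"
  shows "vge N (\<Psi> l x) \<Longrightarrow> vge (N - \<Delta> l) (fls_deriv (\<Psi> l x))"
    and "\<not> int p dvd \<nu> x \<Longrightarrow> fls_deriv (\<Psi> l x) \<noteq> 0 \<and>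
      \<nu> (fls_deriv (\<Psi> l x)) = \<nu> (\<Psi> l x) - \<Delta> l"
proof -
  interpret T: vhom "\<Psi> l" "p ^ (n - l)" by (rule \<Psi>_vhom[OF l])
  define z where "z = fls_deriv (\<Psi> l fls_X)"
  have z: "z \<noteq> 0" unfolding z_def by (rule deriv_\<Psi>X_nonzero[OF l])
  have eq: "fls_deriv (\<Psi> l x) = \<Psi> l (fls_deriv x) * z"
    unfolding z_def by (rule fls_deriv_hom[OF prime_p char_k T.field_hom_axioms])
  show "vge (N - \<Delta> l) (fls_deriv (\<Psi> l x))" if "vge N (\<Psi> l x)"
  proof (cases "x = 0")
    case False
    have "vge (int (p ^ (n - l)) * (\<nu> x - 1) + \<nu> z) (fls_deriv (\<Psi> l x))"
      unfolding eq by (intro vge_mult T.vge vge_deriv) auto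
    then show ?thesis
      using that False by (elim vge_mono) (simp add: vge_def T.subdegree \<Delta>_def z_def algebra_simps)
  qed simp
  show "fls_deriv (\<Psi> l x) \<noteq> 0 \<and> \<nu> (fls_deriv (\<Psi> l x)) = \<nu> (\<Psi> l x) - \<Delta> l"
    if "\<not> int p dvd \<nu> x"
  proof -
    have "x \<noteq> 0" using that by auto
    moreover have "\<nu> (fls_deriv x) = \<nu> x - 1"
      by (rule fls_subdegree_deriv[OF prime_p char_k that])
    ultimately show ?thesis
      using fls_subdegree_deriv(1)[OF prime_p char_k that] z
      by (simp add: eq T.subdegree \<Delta>_def z_def[symmetric] right_diff_distrib)
  qed
qed

end

text \<open>Each \<open>h i\<close> belongs to the base, where its pole order is \<open>a i\<close>;
  valuations are measured in the top field, whence the factor \<open>p^n\<close>. The last two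
  assumptions say that \<open>U l\<close> is the maximum of the overview, attained at a nonzero
  \<open>h i\<close>.\<close>

locale typical_data = cyclic_p_ext p n ty \<sigma> for p n and ty :: "'k::alg_closed_field fls itself" and \<sigma> +
  fixes Y :: "'k fls fps" and h :: "nat \<Rightarrow> 'k fls" and a U :: "nat \<Rightarrow> nat"
  assumes Y0: "fps_nth Y 0 = 1" and Y\<sigma>: "fcong (p ^ n) (fmap \<sigma> Y) (E * Y)"
    and Yf: "fcong (p ^ n) (fmap fr Y) (wprod h n * Y)"
    and h_fixed: "i < n \<Longrightarrow> \<sigma> (h i) = h i"
    and h_red: "i < n \<Longrightarrow> h i \<noteq> 0 \<Longrightarrow> \<nu> (h i) = - int (p ^ n * a i) \<and> a i > 0 \<and> \<not> p dvd a i"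
    and U_ge: "1 \<le> l \<Longrightarrow> l \<le> n \<Longrightarrow> i < l \<Longrightarrow> h i \<noteq> 0 \<Longrightarrow> p ^ (l - 1 - i) * a i \<le> U l"
    and U_ex: "1 \<le> l \<Longrightarrow> l \<le> n \<Longrightarrow> \<exists>i<l. h i \<noteq> 0 \<and> U l = p ^ (l - 1 - i) * a i"
begin

lemma U_pos: "1 \<le> l \<Longrightarrow> l \<le> n \<Longrightarrow> U l > 0"
  using U_ex[of l] h_red by fastforce

lemma U_step: "1 \<le> l \<Longrightarrow> Suc l \<le> n \<Longrightarrow> p * U l \<le> U (Suc l)"
proof -
  assume l: "1 \<le> l" "Suc l \<le> n"
  then obtain i where i: "i < l" "h i \<noteq> 0" "U l = p ^ (l - 1 - i) * a i" using U_ex[of l] by auto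
  have "p ^ (Suc l - 1 - i) * a i \<le> U (Suc l)" using U_ge[of "Suc l" i] l i by auto
  also have "Suc l - 1 - i = Suc (l - 1 - i)" using i by simp
  finally show ?thesis unfolding i(3) by (simp add: mult.assoc)
qed

lemma Y\<sigma>_pow: "fcong (p ^ n) (fmap (\<sigma> ^^ m) Y) (E ^ m * Y)"
proof -
  interpret vhom \<sigma> 1 by (rule is_aut_vhom[OF aut])
  show ?thesis using fmap_E_power_iterate[OF field_hom_axioms, of "p ^ n" Y 1 m] Y\<sigma> by simp
qed

text \<open>With q = \<open>p^(l-1)\<close> the automorphism \<open>\<sigma>^q\<close> multiplies Y
  by \<open>E^q\<close>, which is \<open>1 + t^q\<close> up to order q. So this coefficient of Y
  generates layer l over layer l - 1.\<close>

lemma generator: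
  assumes "1 \<le> l" "l \<le> n"
  shows "(\<sigma> ^^ (p ^ (l - 1))) (fps_nth Y (p ^ (l - 1))) = fps_nth Y (p ^ (l - 1)) + 1"
proof -
  define q where "q = p ^ (l - 1)"
  have q: "q < p ^ n" "q > 0" unfolding q_def using assms p_gt_1 by (auto intro!: power_strict_increasing)
  have "(\<sigma> ^^ q) (fps_nth Y q) = fps_nth (E ^ q * Y) q"
    using Y\<sigma>_pow[of q] q by (simp add: fcong_def)
  also have "\<dots> = (\<Sum>i=0..q. fps_nth (E ^ q) i * fps_nth Y (q - i))" by (rule fps_mult_nth)
  also have "\<dots> = (\<Sum>i\<in>{0,q}. fps_nth (E ^ q) i * fps_nth Y (q - i))"
    using E_power_low(1)[of "l - 1"] unfolding q_def[symmetric]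
    by (intro sum.mono_neutral_right) (auto simp: fcong_def)
  also have "\<dots> = fps_nth Y q + 1"
    using E_power_low(2)[of "l - 1"] q Y0 unfolding q_def[symmetric] by (simp add: fps_power_nth_0)
  finally show ?thesis unfolding q_def .
qed

lemma h_bound: "1 \<le> l \<Longrightarrow> l \<le> n \<Longrightarrow> i < l \<Longrightarrow> vge (- (int (p ^ i) * int (p ^ (n - l + 1) * U l))) (h i)"
proof (cases "h i = 0")
  case False
  assume l: "1 \<le> l" "l \<le> n" "i < l"
  have "p ^ n * a i = p ^ i * (p ^ (n - l + 1) * (p ^ (l - 1 - i) * a i))"
  proof -
    have "n = i + ((n - l + 1) + (l - 1 - i))" using l by simp
    then have "p ^ n = p ^ i * (p ^ (n - l + 1) * p ^ (l - 1 - i))" by (metis power_add)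
    then show ?thesis by simp
  qed
  also have "\<dots> \<le> p ^ i * (p ^ (n - l + 1) * U l)"
    using U_ge[OF l False] by simp
  finally have "int (p ^ n * a i) \<le> int (p ^ i) * int (p ^ (n - l + 1) * U l)"
    by (simp only: of_nat_mult[symmetric] of_nat_le_iff)
  then show ?thesis using h_red[of i] l False unfolding vge_def by simp
qed simp

lemma f_bound:
  assumes l: "1 \<le> l" "l \<le> n"
  shows "bnd (int (p ^ (n - l + 1) * U l)) (Suc (p ^ (l - 1))) (wprod h n)"
  unfolding wprod_def
proof (rule bnd_prod)
  define c where "c = int (p ^ (n - l + 1) * U l)"
  fix i assume "i \<in> {..<n}"
  show "bnd c (Suc (p ^ (l - 1))) (esub E (h i) (p ^ i))"
    unfolding bnd_def
  proof (intro allI impI)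
    fix m assume m: "m < Suc (p ^ (l - 1))"
    show "vge (- (int m * c)) (fps_nth (esub E (h i) (p ^ i)) m)"
    proof (cases "p ^ i dvd m \<and> m > 0")
      case True
      then obtain j where j: "m = p ^ i * j" by blast
      have "p ^ i \<le> p ^ (l - 1)" using True m by (meson dvd_imp_le less_Suc_eq_le order_trans)
      then have "i < l" using p_gt_1 l by (simp add: power_increasing_iff)
      have "vge (int j * - (int (p ^ i) * c) + 0) (h i ^ j * fps_nth E j)"
        unfolding c_def by (intro vge_mult vge_power h_bound l \<open>i < l\<close> prime_field_fls(2) E_coeff)
      then show ?thesis using j by (simp add: esub_nth mult_ac)
    next
      case False
      then show ?thesis by (cases "m = 0") (auto simp: esub_nth vge_def)
    qed
  qed
qed

text \<open>A coefficient y of Y with too large a pole is impossible: \<open>y^p\<close> would be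
  the sum of y and of products that are bounded by induction, and none of these reaches p times the
  pole order of y.\<close>

lemma Y_bound:
  assumes l: "1 \<le> l" "l \<le> n" and k: "k \<le> p ^ (l - 1)"
  shows "vge (- (int k * int (p ^ (n - l) * U l))) (fps_nth Y k)"
  using k
proof (induction k rule: less_induct)
  case (less k)
  define c where "c = int (p ^ (n - l) * U l)"
  define b where "b = int (p ^ (n - l + 1) * U l)"
  have bc: "b = int p * c" by (simp add: b_def c_def)
  have c0: "c \<ge> 0" by (simp add: c_def)
  show ?case
  proof (rule ccontr)
    assume not: "\<not> ?thesis"
    define y where "y = fps_nth Y k"
    have y: "y \<noteq> 0" "\<nu> y < - (int k * c)" using not by (auto simp: y_def vge_def c_def)
    have kq: "k < p ^ n" using less.prems l p_gt_1
      by (metis diff_less le_less_trans less_le_trans power_strict_increasing zero_less_one)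
    have "y ^ p = fps_nth (wprod h n * Y) k" using Yf kq by (simp add: fcong_def y_def)
    also have "\<dots> = (\<Sum>i=0..k. fps_nth (wprod h n) i * fps_nth Y (k - i))" by (rule fps_mult_nth)
    also have "vge (min (\<nu> y) (- (int p * (int k * c)))) \<dots>"
    proof (rule vge_sum)
      fix i assume i: "i \<in> {0..k}"
      show "vge (min (\<nu> y) (- (int p * (int k * c)))) (fps_nth (wprod h n) i * fps_nth Y (k - i))"
      proof (cases "i = 0")
        case True
        then show ?thesis by (auto simp: y_def vge_def)
      next
        case False
        have "vge (- (int i * b) + - (int (k - i) * c)) (fps_nth (wprod h n) i * fps_nth Y (k - i))"
        proof (rule vge_mult)
          show "vge (- (int i * b)) (fps_nth (wprod h n) i)"
            using f_bound[OF l] i less.prems unfolding bnd_def b_def by auto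
          show "vge (- (int (k - i) * c)) (fps_nth Y (k - i))"
            unfolding c_def using less.IH[of "k - i"] i False less.prems by auto
        qed
        moreover have "int i * b + int (k - i) * c \<le> int p * (int k * c)"
        proof -
          have "int (k - i) * c \<le> int p * (int (k - i) * c)"
            using p_gt_1 c0 mult_right_mono[of 1 "int p" "int (k - i) * c"] by simp
          then have "int i * b + int (k - i) * c \<le> int p * (int i * c) + int p * (int (k - i) * c)"
            by (simp add: bc mult_ac)
          also have "\<dots> = int p * (int k * c)" using i by (simp add: of_nat_diff algebra_simps)
          finally show ?thesis .
        qed
        ultimately show ?thesis by (elim vge_mono) linarith
      qed
    qed
    finally have "vge (min (\<nu> y) (- (int p * (int k * c)))) (y ^ p)" .
    then have "min (\<nu> y) (- (int p * (int k * c))) \<le> int p * \<nu> y"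
      using y(1) by (simp add: vge_def fls_subdegree_pow)
    moreover have "int p * \<nu> y < int p * (- (int k * c))"
      using y(2) p_gt_1 by (intro mult_strict_left_mono) auto
    moreover have "int p * \<nu> y < \<nu> y"
    proof -
      have "\<nu> y < 0" using y(2) c0 by (meson less_le_trans mult_nonneg_nonneg neg_le_0_iff_le of_nat_0_le_iff)
      then have "int p * \<nu> y \<le> 2 * \<nu> y"
        using p_gt_1 by (intro mult_right_mono_neg) auto
      with \<open>\<nu> y < 0\<close> show ?thesis by linarith
    qed
    ultimately show False by (simp add: min_def split: if_splits)
  qed
qed

lemma dlog_wprod: "fps_nth (dlog (wprod h k)) m = (\<Sum>i<k. fps_nth (dlog (esub E (h i) (p ^ i))) m)"
  by (induction k) (simp_all add: wprod_Suc dlog_mult)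

lemma deriv_Y:
  assumes "k < p ^ n"
  shows "fls_deriv (fps_nth Y k) = - (\<Sum>m=0..k. fps_nth (dlog (wprod h n)) m * fps_nth Y (k - m))"
proof -
  define w where "w = wprod h n"
  have w: "inverse w * w = 1" by (simp add: w_def inverse_mult_eq_1)
  have "fmap fls_deriv (fmap fr Y) = 0"
    by (rule fps_ext) (simp add: fls_deriv_frobenius[OF prime_p char_k])
  then have "fcong (p ^ n) 0 (fmap fls_deriv (w * Y))"
    using fmap_cong_mod[OF Yf, of fls_deriv] by (simp add: w_def)
  then have "fcong (p ^ n) (inverse w * 0) (inverse w * fmap fls_deriv (w * Y))"
    by (intro fcong_mult fcong_refl)
  also have "inverse w * fmap fls_deriv (w * Y) = dlog w * Y + (inverse w * w) * fmap fls_deriv Y"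
    by (simp add: fmap_deriv_mult dlog_def algebra_simps)
  finally have "fcong (p ^ n) 0 (dlog w * Y + fmap fls_deriv Y)" by (simp add: w)
  then have "fps_nth (dlog w * Y) k + fls_deriv (fps_nth Y k) = 0"
    using assms by (simp add: fcong_def)
  then show ?thesis by (simp add: w_def fps_mult_nth eq_neg_iff_add_eq_0 add.commute)
qed

lemma h_\<Psi>: assumes "i < n" obtains h' where "h i = \<Psi> 0 h'"
  using \<Psi>_ex[of 0 "h i"] h_fixed[OF assms] by auto

lemma q_split: "1 \<le> l \<Longrightarrow> l \<le> n \<Longrightarrow> int (p ^ (l - 1)) * int (p ^ (n - l + 1) * U l) = int (p ^ n * U l)"
proof -
  assume "1 \<le> l" "l \<le> n"
  then have "(l - 1) + (n - l + 1) = n" by simp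
  then have "p ^ n = p ^ (l - 1) * p ^ (n - l + 1)" by (metis power_add)
  then show ?thesis by (simp only: of_nat_mult[symmetric] mult.assoc)
qed

lemma W_bound:
  assumes l: "1 \<le> l" "l \<le> n" and m: "m \<le> p ^ (l - 1)"
  shows "vge (- (int m * int (p ^ (n - l + 1) * U l)) - \<Delta> 0) (fps_nth (dlog (wprod h n)) m)"
  unfolding dlog_wprod
proof (rule vge_sum)
  define b where "b = int (p ^ (n - l + 1) * U l)"
  fix i assume i: "i \<in> {..<n}"
  show "vge (- (int m * b) - \<Delta> 0) (fps_nth (dlog (esub E (h i) (p ^ i))) m)"
  proof (cases "p ^ i dvd m \<and> m > 0")
    case True
    then obtain j where "m = p ^ i * j" by blast
    with True have j: "m = p ^ i * j" "j > 0" by auto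
    have "p ^ i \<le> p ^ (l - 1)" using True m by (meson dvd_imp_le order_trans)
    then have il: "i < l" using p_gt_1 l by (simp add: power_increasing_iff)
    have hb: "vge (- (int (p ^ i) * b)) (h i)" unfolding b_def by (rule h_bound[OF l il])
    obtain h' where h': "h i = \<Psi> 0 h'" using h_\<Psi> i by blast
    have "vge (- (int (p ^ i) * b) - \<Delta> 0) (fls_deriv (h i))"
      using hb unfolding h' by (intro deriv_\<Psi>) auto
    then have "vge ((- (int (p ^ i) * b) - \<Delta> 0) + (int (j - 1) * - (int (p ^ i) * b) + 0))
        (fls_deriv (h i) * (h i ^ (j - 1) * fps_nth (ldiff E) (j - 1)))"
      by (intro vge_mult vge_power hb prime_field_fls(2) ldiff_E_coeff)
    also have "(- (int (p ^ i) * b) - \<Delta> 0) + (int (j - 1) * - (int (p ^ i) * b) + 0) = - (int m * b) - \<Delta> 0"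
      using j by (simp add: of_nat_diff algebra_simps)
    finally show ?thesis using True j by (simp add: dlog_esub_E)
  next
    case False
    then have "fps_nth (dlog (esub E (h i) (p ^ i))) m = 0" by (subst dlog_esub_E) auto
    then show ?thesis by simp
  qed
qed

text \<open>Only indices i < l contribute, each with pole order \<open>p^n p^(l-1-i) a i\<close>
  plus \<Delta> 0 when \<open>h i\<close> is nonzero. These orders are distinct because every such
  \<open>a i\<close> is prime to p, so the maximum is attained once and survives in the sum.\<close>

lemma W_top:
  assumes l: "1 \<le> l" "l \<le> n"
  defines "w \<equiv> fps_nth (dlog (wprod h n)) (p ^ (l - 1))"
  shows "w \<noteq> 0" "\<nu> w = - int (p ^ n * U l) - \<Delta> 0"
proof -
  define t where "t i = fps_nth (dlog (esub E (h i) (p ^ i))) (p ^ (l - 1))" for i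
  have t: "t i = (if i < l then fls_deriv (h i) * (h i ^ (p ^ (l - 1 - i) - 1) * fps_nth (ldiff E) (p ^ (l - 1 - i) - 1)) else 0)" for i
  proof (cases "i < l")
    case True
    then have "i \<le> l - 1" using l by simp
    then have "p ^ i dvd p ^ (l - 1)" "p ^ (l - 1) div p ^ i = p ^ (l - 1 - i)"
      using p_gt_1 power_diff[of p i "l - 1"] by (auto simp: le_imp_power_dvd)
    then show ?thesis using True by (simp add: t_def dlog_esub_E)
  next
    case False
    then have "\<not> p ^ i dvd p ^ (l - 1)" using p_gt_1 l by (simp add: dvd_power_iff_le)
    then show ?thesis using False by (simp add: t_def dlog_esub_E)
  qed
  have exact: "t i \<noteq> 0 \<and> \<nu> (t i) = - int (p ^ n * (p ^ (l - 1 - i) * a i)) - \<Delta> 0"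
    if i: "i < l" "h i \<noteq> 0" for i
  proof -
    have i_n: "i < n" using i l by simp
    obtain h' where h': "h i = \<Psi> 0 h'" using h_\<Psi> i_n by blast
    interpret T: vhom "\<Psi> 0" "p ^ (n - 0)" by (rule \<Psi>_vhom) simp
    note red = h_red[OF i_n i(2)]
    have "h' \<noteq> 0" using i(2) h' by (intro notI) simp
    then have "int (p ^ n) * \<nu> h' = int (p ^ n) * - int (a i)"
      using red unfolding h' by (simp add: T.subdegree)
    moreover have "int (p ^ n) \<noteq> 0" using p_gt_1 by simp
    ultimately have "\<nu> h' = - int (a i)" by (simp only: mult_cancel_left) blast
    then have "\<not> int p dvd \<nu> h'" using red by simp
    then have dh: "fls_deriv (h i) \<noteq> 0" "\<nu> (fls_deriv (h i)) = - int (p ^ n * a i) - \<Delta> 0"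
      using deriv_\<Psi>(2)[of 0 h'] red unfolding h' by auto
    define j where "j = p ^ (l - 1 - i)"
    have "fps_nth (ldiff E) (j - 1) \<noteq> (0 :: 'k fls)"
      unfolding j_def by (rule ldiff_ahexp[OF prime_p char_p roots])
    moreover from this have "\<nu> (fps_nth (ldiff E) (j - 1) :: 'k fls) = 0"
      by (intro prime_field_fls(3) ldiff_E_coeff)
    moreover have "h i ^ (j - 1) \<noteq> 0" using i(2) by simp
    moreover have "\<nu> (h i ^ (j - 1)) = int (j - 1) * - int (p ^ n * a i)"
      using red by (simp only: fls_subdegree_pow)
    ultimately have "t i \<noteq> 0" "\<nu> (t i) = (- int (p ^ n * a i) - \<Delta> 0) + int (j - 1) * - int (p ^ n * a i)"
      using i(1) dh unfolding t j_def[symmetric] by simp_all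
    moreover have "(- int (p ^ n * a i) - \<Delta> 0) + int (j - 1) * - int (p ^ n * a i) = - int (p ^ n * (j * a i)) - \<Delta> 0"
    proof -
      have "j > 0" by (simp add: j_def)
      then have "int j = 1 + int (j - 1)" by simp
      then show ?thesis by (simp only: of_nat_mult) (simp add: algebra_simps del: of_nat_diff)
    qed
    ultimately show ?thesis unfolding j_def by simp
  qed
  obtain i0 where i0: "i0 < l" "h i0 \<noteq> 0" "U l = p ^ (l - 1 - i0) * a i0" using U_ex[OF l] by blast
  have "{..<n} = insert i0 ({..<n} - {i0})" using i0(1) l by auto
  then have w: "w = t i0 + (\<Sum>i\<in>{..<n} - {i0}. t i)"
    unfolding w_def dlog_wprod t_def[symmetric] by (metis finite_Diff finite_lessThan insertCI sum.remove)
  have sub0: "\<nu> (t i0) = - int (p ^ n * U l) - \<Delta> 0" using exact[OF i0(1,2)] i0(3) by simp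
  have "vge (\<nu> (t i0) + 1) (\<Sum>i\<in>{..<n} - {i0}. t i)"
  proof (rule vge_sum)
    fix i assume i: "i \<in> {..<n} - {i0}"
    consider "i \<ge> l" | "i < l" "h i = 0" | "i < l" "h i \<noteq> 0" by linarith
    then show "vge (\<nu> (t i0) + 1) (t i)"
    proof cases
      case 3
      \<comment> \<open>If two of these agreed, the \<open>a\<close> of larger index would be
        divisible by p.\<close>
      have "p ^ (l - 1 - i) * a i \<noteq> p ^ (l - 1 - i0) * a i0"
      proof -
        have *: False if ij: "i < j" "j < l" "\<not> p dvd a j" "p ^ (l - 1 - i) * a i = p ^ (l - 1 - j) * a j" for i j
        proof -
          have "l - 1 - i = (l - 1 - j) + (j - i)" using ij by simp
          then have "p ^ (l - 1 - j) * (p ^ (j - i) * a i) = p ^ (l - 1 - j) * a j"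
            using ij(4) by (simp add: power_add mult.assoc)
          then have "p ^ (j - i) * a i = a j" using p_gt_1 by simp
          moreover have "p dvd p ^ (j - i)" using ij(1) by simp
          ultimately show False using ij(3) by (metis dvd_mult2)
        qed
        show ?thesis
        proof
          assume eq: "p ^ (l - 1 - i) * a i = p ^ (l - 1 - i0) * a i0"
          have "i \<noteq> i0" "i < n" "i0 < n" using i i0(1) l by auto
          then show False
            using *[of i i0] *[of i0 i] eq 3 i0 h_red[of i] h_red[of i0] by (metis linorder_neqE_nat)
        qed
      qed
      then have "p ^ (l - 1 - i) * a i < U l" using U_ge[OF l 3] i0(3) by simp
      then have "p ^ n * (p ^ (l - 1 - i) * a i) < p ^ n * U l" by simp
      then have "int (p ^ n * (p ^ (l - 1 - i) * a i)) + 1 \<le> int (p ^ n * U l)" by linarith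
      then show ?thesis using exact[OF 3] unfolding sub0 vge_def by linarith
    qed (auto simp: t)
  qed
  from fls_subdegree_add_eq[OF conjunct1[OF exact[OF i0(1,2)]] this]
  show "w \<noteq> 0" "\<nu> w = - int (p ^ n * U l) - \<Delta> 0"
    unfolding w sub0 by blast+
qed

text \<open>In the convolution for the derivative of the generator, poles of the logarithmic
  differential grow with slope b = p c and those of Y only with slope c. Hence the term with the
  full index q has strictly the largest pole.\<close>

lemma deriv_generator:
  assumes l: "1 \<le> l" "l \<le> n"
  defines "e \<equiv> fps_nth Y (p ^ (l - 1))"
  shows "fls_deriv e \<noteq> 0" "\<nu> (fls_deriv e) = - int (p ^ n * U l) - \<Delta> 0"
proof -
  define q where "q = p ^ (l - 1)"
  define w where "w m = fps_nth (dlog (wprod h n)) m" for m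
  have q: "q < p ^ n" "q > 0" unfolding q_def using l p_gt_1 by (auto intro!: power_strict_increasing)
  define b where "b = int (p ^ (n - l + 1) * U l)"
  define c where "c = int (p ^ (n - l) * U l)"
  have bc: "b = int p * c" by (simp add: b_def c_def)
  have "p ^ (n - l) * U l > 0" using U_pos[OF l] by simp
  then have c1: "c \<ge> 1" unfolding c_def by linarith
  have "int p * c \<ge> 2 * c" using p_gt_1 c1 by (intro mult_right_mono) auto
  then have "c + 1 \<le> b" unfolding bc using c1 by linarith
  have qb: "int q * b = int (p ^ n * U l)" unfolding q_def b_def by (rule q_split[OF l])
  have w0: "w 0 = 0" by (simp add: w_def dlog_wprod dlog_esub_E)
  have "fls_deriv e = - (\<Sum>m=0..q. w m * fps_nth Y (q - m))"
    unfolding e_def w_def q_def[symmetric] by (rule deriv_Y[OF q(1)])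
  also have "(\<Sum>m=0..q. w m * fps_nth Y (q - m)) = w q + (\<Sum>m\<in>{0..q} - {q}. w m * fps_nth Y (q - m))"
    by (subst sum.remove[of _ q]) (auto simp: Y0)
  finally have eq: "fls_deriv e = - (w q + (\<Sum>m\<in>{0..q} - {q}. w m * fps_nth Y (q - m)))" .
  have wq: "w q \<noteq> 0" "\<nu> (w q) = - int (p ^ n * U l) - \<Delta> 0"
    unfolding w_def q_def by (rule W_top[OF l])+
  have "vge (\<nu> (w q) + 1) (\<Sum>m\<in>{0..q} - {q}. w m * fps_nth Y (q - m))"
  proof (rule vge_sum)
    fix m assume m: "m \<in> {0..q} - {q}"
    show "vge (\<nu> (w q) + 1) (w m * fps_nth Y (q - m))"
    proof (cases "m = 0")
      case False
      have "vge ((- (int m * b) - \<Delta> 0) + - (int (q - m) * c)) (w m * fps_nth Y (q - m))"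
        unfolding w_def b_def c_def using m unfolding q_def
        by (intro vge_mult W_bound Y_bound l) auto
      moreover have "int m * b + int (q - m) * c + 1 \<le> int q * b"
      proof -
        have "int (q - m) * (c + 1) \<le> int (q - m) * b" using \<open>c + 1 \<le> b\<close> by (intro mult_left_mono) auto
        moreover have "int (q - m) \<ge> 1" using m by auto
        moreover have "int q = int m + int (q - m)" using m by auto
        then have "int q * b = int m * b + int (q - m) * b" by (simp only: distrib_right)
        ultimately show ?thesis unfolding distrib_left by linarith
      qed
      ultimately show ?thesis unfolding wq(2) qb[symmetric] by (elim vge_mono) linarith
    qed (simp add: w0)
  qed
  from fls_subdegree_add_eq[OF wq(1) this]
  show "fls_deriv e \<noteq> 0" "\<nu> (fls_deriv e) = - int (p ^ n * U l) - \<Delta> 0"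
    unfolding eq neg_equal_0_iff_equal fls_uminus_subdegree wq(2)[symmetric] by blast+
qed

text \<open>The generator e is \<Psi> b d plus the reduced generator \<Psi> l y. The hypothesis on
  \<Delta> b keeps the pole of the derivative of \<Psi> b d below that of e, so the derivative of
  \<Psi> l y has the known valuation. Reading it once in layer l and once in layer b yields the two
  equations.\<close>

lemma main_step:
  assumes l: "l = Suc b" "l \<le> n" and \<Delta>b: "int p * (\<Delta> b - \<Delta> 0) < (int p - 1) * int (p ^ n * U l)"
  defines "J \<equiv> jb l b"
  shows "int (p ^ (n - b)) * J + \<Delta> b = int (p ^ n * U l) + \<Delta> 0"
    and "\<Delta> l = int (p ^ n * U l) + \<Delta> 0 - int (p ^ (n - l)) * J"
    and "k < b \<Longrightarrow> jb b k = jb l k"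
proof -
  have l1: "1 \<le> l" "l - 1 = b" using l by auto
  have bn: "b \<le> n" using l by simp
  define e where "e = fps_nth Y (p ^ b)"
  have e: "(\<sigma> ^^ (p ^ b)) e = e + 1" using generator[OF l1(1) l(2)] unfolding l1(2) e_def .
  obtain d r y J' where ag: "e = \<Psi> b d + \<Psi> l y" "\<Psi> l y ^ p - \<Psi> l y = \<Psi> b r"
    "J' = jb l b" "\<nu> r = - J'" "\<nu> y = - J'" "\<not> int p dvd J'"
    "\<And>M. M \<ge> 0 \<Longrightarrow> vge (- (int (p ^ (n - b)) * M)) (e ^ p - e) \<Longrightarrow> vge (- M) (d ^ p)"
    "\<And>k. k < b \<Longrightarrow> jb b k = jb l k"
  proof (rule as_generator[OF l e])
    fix d r y J
    assume "e = \<Psi> b d + \<Psi> l y" "\<Psi> l y ^ p - \<Psi> l y = \<Psi> b r"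
    "J = jb l b" "\<nu> r = - J" "\<nu> y = - J" "\<not> int p dvd J"
    "\<And>M. M \<ge> 0 \<Longrightarrow> vge (- (int (p ^ (n - b)) * M)) (e ^ p - e) \<Longrightarrow> vge (- M) (d ^ p)"
    "\<And>k. k < b \<Longrightarrow> jb b k = jb l k"
    then show thesis by (rule that)
  qed
  have J': "J' = J" by (simp add: ag(3) J_def)
  show "k < b \<Longrightarrow> jb b k = jb l k" by (rule ag(8))
  interpret T: vhom "\<Psi> l" "p ^ (n - l)" by (rule \<Psi>_vhom[OF l(2)])
  interpret B: vhom "\<Psi> b" "p ^ (n - b)" by (rule \<Psi>_vhom[OF bn])
  define V where "V = int (p ^ n * U l)"
  have eb: "vge (- V) (e ^ p)"
  proof -
    have "vge (int p * - (int (p ^ b) * int (p ^ (n - l) * U l))) (e ^ p)"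
      unfolding e_def using Y_bound[OF l1(1) l(2), of "p ^ b"] unfolding l1(2) by (intro vge_power) auto
    also have "int p * - (int (p ^ b) * int (p ^ (n - l) * U l)) = - V"
    proof -
      have "p ^ n = p * p ^ b * p ^ (n - l)" using l by (simp flip: power_Suc power_add)
      then show ?thesis unfolding V_def by (simp add: mult_ac)
    qed
    finally show ?thesis .
  qed
  have V0: "V \<ge> 0" by (simp add: V_def)
  have ee: "vge (- V) e"
  proof (cases "e = 0 \<or> \<nu> e \<ge> 0")
    case True
    then show ?thesis using V0 by (auto simp: vge_def)
  next
    case False
    then have "- V \<le> int p * \<nu> e" using eb by (simp add: vge_def fls_subdegree_pow)
    also have "\<dots> \<le> 1 * \<nu> e" using False p_gt_1 by (intro mult_right_mono_neg) auto
    finally show ?thesis by (simp add: vge_def)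
  qed
  have pb: "int (p ^ (n - b)) * int (p ^ b * U l) = V"
  proof -
    have "p ^ n = p ^ (n - b) * p ^ b" using bn by (simp flip: power_add)
    then show ?thesis unfolding V_def by (simp only: of_nat_mult[symmetric] mult.assoc)
  qed
  have dp: "vge (- int (p ^ b * U l)) (d ^ p)"
  proof (rule ag(7))
    show "vge (- (int (p ^ (n - b)) * int (p ^ b * U l))) (e ^ p - e)"
      unfolding pb by (intro vge_diff eb ee)
  qed simp
  \<comment> \<open>The pole order of \<Psi> b d is at most V/p, and V/p + \<Delta> b < V + \<Delta>
    0 is the hypothesis divided by p.\<close>
  have dd: "vge (- V - \<Delta> 0 + 1) (fls_deriv (\<Psi> b d))"
  proof (cases "d = 0")
    case False
    then have "- int (p ^ b * U l) \<le> int p * \<nu> d" using dp by (simp add: vge_def fls_subdegree_pow)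
    then have "int (p ^ (n - b)) * (- int (p ^ b * U l)) \<le> int (p ^ (n - b)) * (int p * \<nu> d)"
      by (intro mult_left_mono) auto
    then have 1: "- V \<le> int p * (int (p ^ (n - b)) * \<nu> d)"
      using pb by (simp only: mult_minus_right mult.left_commute)
    define s where "s = int (p ^ (n - b)) * \<nu> d"
    have "int p * (- V - \<Delta> 0) < int p * (s - \<Delta> b)"
      using 1 \<Delta>b unfolding s_def[symmetric] V_def[symmetric] by (simp only: right_diff_distrib left_diff_distrib mult_minus_right)
    then have "- V - \<Delta> 0 < s - \<Delta> b" using p_gt_1 by (simp only: mult_less_cancel_left_pos of_nat_0_less_iff p_pos0)
    moreover have "vge (s - \<Delta> b) (fls_deriv (\<Psi> b d))"
      using False by (intro deriv_\<Psi>(1) bn) (simp add: vge_def B.subdegree s_def)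
    ultimately show ?thesis by (elim vge_mono) linarith
  qed simp
  note de = deriv_generator[OF l1(1) l(2), unfolded l1(2), folded e_def V_def]
  have "fls_deriv (\<Psi> l y) = fls_deriv e + - fls_deriv (\<Psi> b d)"
    unfolding ag(1) by simp
  moreover have "vge (\<nu> (fls_deriv e) + 1) (- fls_deriv (\<Psi> b d))"
    using dd unfolding de(2) vge_uminus .
  ultimately have dy: "\<nu> (fls_deriv (\<Psi> l y)) = - V - \<Delta> 0"
    using fls_subdegree_add_eq[OF de(1)] de(2) by metis
  have ndvd: "\<not> int p dvd \<nu> y" "\<not> int p dvd \<nu> r" using ag(4-6) by auto
  then have nz: "y \<noteq> 0" "r \<noteq> 0" by auto
  have "\<nu> (fls_deriv (\<Psi> l y)) = - (int (p ^ (n - l)) * J) - \<Delta> l"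
    using deriv_\<Psi>(2)[OF l(2) ndvd(1)] nz ag(5) J' by (simp add: T.subdegree)
  with dy show "\<Delta> l = int (p ^ n * U l) + \<Delta> 0 - int (p ^ (n - l)) * J" unfolding V_def by linarith
  \<comment> \<open>Differentiation kills the p-th power, so y in layer l and r in layer b have
    opposite derivatives.\<close>
  have "fls_deriv (\<Psi> b r) = - fls_deriv (\<Psi> l y)"
    unfolding ag(2)[symmetric] fls_deriv_sub fls_deriv_frobenius[OF prime_p char_k] by simp
  then have "\<nu> (fls_deriv (\<Psi> b r)) = - V - \<Delta> 0" using dy by simp
  moreover have "\<nu> (fls_deriv (\<Psi> b r)) = - (int (p ^ (n - b)) * J) - \<Delta> b"
    using deriv_\<Psi>(2)[OF bn ndvd(2)] nz ag(4) J' by (simp add: B.subdegree)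
  ultimately show "int (p ^ (n - b)) * J + \<Delta> b = int (p ^ n * U l) + \<Delta> 0" unfolding V_def by linarith
qed

text \<open>The inequality is the hypothesis of \<open>main_step\<close> one layer up. It persists
  because the difference of \<Delta> from \<Delta> 0 stays below \<open>p^n U l\<close>, the breaks
  being positive, and the next U is at least p times the present one.\<close>

lemma \<Delta>_invariant:
  "1 \<le> l \<Longrightarrow> l \<le> n \<Longrightarrow> \<Delta> l = int (p ^ n * U l) + \<Delta> 0 - int (p ^ (n - l)) * jb l (l - 1)"
  "l < n \<Longrightarrow> int p * (\<Delta> l - \<Delta> 0) < (int p - 1) * int (p ^ n * U (Suc l))"
proof (induction l)
  case 0
  {
    case 1
    then show ?case by simp
  next
    case 2
    then show ?case using U_pos[of 1] p_gt_1 by simp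
  }
next
  case (Suc l)
  {
    case 1
    then show ?case using main_step(2)[OF refl, of l] Suc.IH(2) by simp
  next
    case 2
    have "\<Delta> (Suc l) = int (p ^ n * U (Suc l)) + \<Delta> 0 - int (p ^ (n - Suc l)) * jb (Suc l) l"
      using main_step(2)[OF refl, of l] Suc.IH(2) 2 by simp
    moreover have "int (p ^ (n - Suc l)) * jb (Suc l) l > 0"
      using jb_pos[of l "Suc l"] 2 p_gt_1 by (intro mult_pos_pos) auto
    ultimately have "\<Delta> (Suc l) - \<Delta> 0 < int (p ^ n * U (Suc l))" by linarith
    then have "int p * (\<Delta> (Suc l) - \<Delta> 0) < int p * int (p ^ n * U (Suc l))"
      using p_gt_1 by (intro mult_strict_left_mono) auto
    also have "\<dots> = int (p ^ n * (p * U (Suc l)))" by simp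
    also have "\<dots> \<le> 1 * int (p ^ n * U (Suc (Suc l)))"
      using U_step[of "Suc l"] 2 by (simp only: mult_1 of_nat_le_iff) (intro mult_left_mono, auto)
    also have "\<dots> \<le> (int p - 1) * int (p ^ n * U (Suc (Suc l)))"
      using p_gt_1 by (intro mult_right_mono) auto
    finally show ?case .
  }
qed

lemma jb_stable: "k < l \<Longrightarrow> l \<le> n \<Longrightarrow> jb l k = jb (Suc k) k"
proof (induction l)
  case (Suc l)
  show ?case
  proof (cases "k = l")
    case False
    then show ?thesis
      using Suc main_step(3)[OF refl, of l k] \<Delta>_invariant(2)[of l] by simp
  qed simp
qed simp

text \<open>Eliminate \<Delta> l between the formula for the break of layer l + 1 and the formula
  for \<Delta> l; \<open>jb_stable\<close> identifies these breaks with those of the top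
  layer.\<close>

theorem breaks:
  shows breaks_1: "brk \<sigma> = int (U 1)"
    and breaks_Suc: "1 \<le> l \<Longrightarrow> l < n \<Longrightarrow>
      brk (\<sigma> ^^ (p ^ l)) = brk (\<sigma> ^^ (p ^ (l - 1))) + int (p ^ l) * (int (U (Suc l)) - int (U l))"
proof -
  have jbn: "brk (\<sigma> ^^ (p ^ l)) = jb (Suc l) l" if "l < n" for l
    using jb_stable[of l n] that by (simp add: jb_n)
  have main: "int (p ^ (n - l)) * jb (Suc l) l + \<Delta> l = int (p ^ n * U (Suc l)) + \<Delta> 0" if "l < n" for l
    using main_step(1)[OF refl, of l] \<Delta>_invariant(2)[of l] that by simp
  have "int (p ^ n) * jb 1 0 = int (p ^ n) * int (U 1)" using main[of 0] n_pos by simp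
  then show "brk \<sigma> = int (U 1)" using jbn[of 0] n_pos p_gt_1 by simp
  assume l: "1 \<le> l" "l < n"
  define P where "P = int (p ^ (n - l))"
  have P: "P > 0" by (simp add: P_def)
  have pn: "int (p ^ n) = P * int (p ^ l)"
    unfolding P_def using l by (simp flip: of_nat_mult power_add)
  have "P * jb (Suc l) l + (int (p ^ n * U l) - P * jb l (l - 1)) = int (p ^ n * U (Suc l))"
    using main[OF l(2)] \<Delta>_invariant(1)[OF l(1)] l(2) unfolding P_def by simp
  then have "P * jb (Suc l) l = P * (jb l (l - 1) + int (p ^ l) * (int (U (Suc l)) - int (U l)))"
    unfolding of_nat_mult pn by (simp add: algebra_simps)
  then have "jb (Suc l) l = jb l (l - 1) + int (p ^ l) * (int (U (Suc l)) - int (U l))"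
    using P by (simp only: mult_cancel_left) auto
  then show "brk (\<sigma> ^^ (p ^ l)) = brk (\<sigma> ^^ (p ^ (l - 1))) + int (p ^ l) * (int (U (Suc l)) - int (U l))"
    using jbn[of l] jbn[of "l - 1"] l by simp
qed

end

section \<open>Typical series attached to a cyclic extension\<close>

lemma fcong_inverse:
  fixes F :: "'a::field fps"
  assumes "fcong N F G" "fps_nth F 0 = 1" "fps_nth G 0 = 1"
  shows "fcong N (inverse F) (inverse G)"
proof -
  have "F * inverse F = 1" "G * inverse G = 1" using assms by (auto simp: inverse_mult_eq_1')
  then have 1: "inverse F = inverse F * (G * inverse G)" "inverse F * F = 1" by (simp_all add: mult.commute)
  have "fcong N (inverse F * (G * inverse G)) (inverse F * (F * inverse G))"
    by (intro fcong_mult fcong_refl) (rule fcong_sym[OF assms(1)])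
  also have "inverse F * (F * inverse G) = inverse G" using 1 by (simp flip: mult.assoc)
  finally show ?thesis using 1 by simp
qed

lemma choose_prime_power_char:
  assumes p: "prime p" "CHAR('a::field) = p" and k: "0 < k" "k < p ^ n"
  shows "of_nat (p ^ n choose k) = (0 :: 'a)"
proof -
  have "(1 + fps_X :: 'a fps) ^ (p ^ n) = 1 + fps_X ^ (p ^ n)"
    using p by (subst freshmans_dream'[where m = "p ^ n" and n = n]) auto
  then have "fps_nth ((1 + fps_X :: 'a fps) ^ (p ^ n)) k = fps_nth (1 + fps_X ^ (p ^ n)) k" by (simp only:)
  also have "\<dots> = 0" using k by (simp add: fps_X_power_nth)
  finally have "fps_nth ((1 + fps_X :: 'a fps) ^ (p ^ n)) k = 0" .
  moreover have "fps_nth ((1 + fps_X :: 'a fps) ^ N) k = of_nat (N choose k)" for N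
  proof -
    have "(1 + fps_X :: 'a fps) ^ N = (\<Sum>i\<le>N. of_nat (N choose i) * fps_X ^ i)"
      using binomial_ring[of fps_X "1 :: 'a fps" N] by (simp add: add.commute)
    then have "fps_nth ((1 + fps_X :: 'a fps) ^ N) k = (\<Sum>i\<le>N. fps_nth (of_nat (N choose i) * fps_X ^ i) k)"
      by (simp only: fps_sum_nth)
    also have "\<dots> = (\<Sum>i\<le>N. if i = k then of_nat (N choose i) else 0)"
      by (intro sum.cong) (auto simp: fps_X_power_nth simp flip: fps_of_nat)
    also have "\<dots> = of_nat (N choose k)" by (simp add: binomial_eq_0)
    finally show ?thesis .
  qed
  ultimately show ?thesis by simp
qed

context cyclic_p_ext begin

interpretation s: vhom \<sigma> 1 by (rule is_aut_vhom[OF aut])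

definition trace :: "'k fls \<Rightarrow> 'k fls" where
  "trace x = (\<Sum>i<p ^ n. (\<sigma> ^^ i) x)"

lemma sum_rotate:
  fixes c :: "nat \<Rightarrow> 'k fls"
  shows "(\<Sum>i<p ^ n. c i * (\<sigma> ^^ Suc i) x) = (\<Sum>i\<in>{1..<p ^ n}. c (i - 1) * (\<sigma> ^^ i) x) + c (p ^ n - 1) * x"
proof -
  obtain N where N: "p ^ n = Suc N" using p_pos[of n] by (metis Suc_pred)
  have "(\<Sum>i<Suc N. c i * (\<sigma> ^^ Suc i) x) = (\<Sum>i<N. c i * (\<sigma> ^^ Suc i) x) + c N * (\<sigma> ^^ Suc N) x"
    by simp
  also have "(\<Sum>i<N. c i * (\<sigma> ^^ Suc i) x) = (\<Sum>i\<in>{1..<Suc N}. c (i - 1) * (\<sigma> ^^ i) x)"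
    by (rule sum.reindex_bij_witness[of _ "\<lambda>i. i - 1" Suc]) auto
  also have "(\<sigma> ^^ Suc N) x = x" using order(1) unfolding N by simp
  finally show ?thesis unfolding N by simp
qed

lemma trace_fixed: "\<sigma> (trace x) = trace x"
proof -
  have "\<sigma> (trace x) = (\<Sum>i<p ^ n. 1 * (\<sigma> ^^ Suc i) x)" by (simp add: trace_def s.sum)
  also have "\<dots> = (\<Sum>i\<in>{1..<p ^ n}. (\<sigma> ^^ i) x) + x" unfolding sum_rotate by simp
  also have "\<dots> = trace x"
    unfolding trace_def using p_pos[of n]
    by (subst sum.remove[of "{..<p ^ n}" 0]) (auto intro!: sum.cong)
  finally show ?thesis .
qed

text \<open>The polynomial with the nontrivial conjugates of the uniformizer as roots has nonzero trace
  at the uniformizer, so the trace cannot vanish on all its powers.\<close>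

lemma trace_surj: "\<exists>x. trace x = 1"
proof -
  define P where "P = (\<Prod>i\<in>{1..<p ^ n}. [:- (\<sigma> ^^ i) fls_X, 1:])"
  have PX: "poly P ((\<sigma> ^^ j) fls_X) = (\<Prod>i\<in>{1..<p ^ n}. (\<sigma> ^^ j) fls_X - (\<sigma> ^^ i) fls_X)" for j
    by (simp add: P_def poly_prod)
  have "poly P ((\<sigma> ^^ 0) fls_X) \<noteq> 0"
    unfolding PX
  proof (subst prod_zero_iff, simp, safe)
    fix i assume i: "i \<in> {1..<p ^ n}" "(\<sigma> ^^ 0) fls_X - (\<sigma> ^^ i) fls_X = 0"
    then have "p ^ n dvd i" using fixX_iff[of i] by simp
    then show False using i by (auto dest: dvd_imp_le)
  qed
  moreover have "poly P ((\<sigma> ^^ j) fls_X) = 0" if "j \<in> {..<p ^ n} - {0}" for j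
    unfolding PX using that by (intro prod_zero bexI[of _ j]) auto
  then have "(\<Sum>j<p ^ n. poly P ((\<sigma> ^^ j) fls_X)) = poly P ((\<sigma> ^^ 0) fls_X)"
    by (subst sum.remove[of _ 0]) auto
  moreover have "(\<Sum>j<p ^ n. poly P ((\<sigma> ^^ j) fls_X)) = (\<Sum>a\<le>degree P. coeff P a * trace (fls_X ^ a))"
    unfolding poly_altdef trace_def sum_distrib_left
    by (subst sum.swap) (simp add: field_hom.power[OF field_hom_funpow[OF s.field_hom_axioms]])
  ultimately have "\<exists>a. trace (fls_X ^ a) \<noteq> 0"
    by (metis (no_types, lifting) mult_zero_right sum.neutral)
  then obtain a where a: "trace (fls_X ^ a) \<noteq> 0" ..
  define w where "w = trace (fls_X ^ a)"
  have "\<sigma> w = w" unfolding w_def by (rule trace_fixed)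
  then have "(\<sigma> ^^ i) w = w" for i by (induction i) simp_all
  then have "trace (fls_X ^ a / w) = trace (fls_X ^ a) / w"
    unfolding trace_def by (simp add: field_hom.divide[OF field_hom_funpow[OF s.field_hom_axioms]] sum_divide_distrib)
  then show ?thesis using a by (intro exI[of _ "fls_X ^ a / w"]) (simp add: w_def)
qed

text \<open>Y is the sum over i < N = \<open>p^n\<close> of \<open>(1+t)^(N-1-i)\<close> times
  \<open>\<sigma>^i x\<close>, where x has trace 1. Applying \<sigma> shifts the index; the sum
  closes up to (1+t)Y because \<open>(1+t)^N\<close> is 1 modulo \<open>t^N\<close>. The
  coefficients \<open>e k\<close> spell this out with binomials.\<close>

lemma binomial_series_exists:
  obtains Y where "fps_nth Y 0 = 1" "fcong (p ^ n) (fmap \<sigma> Y) ((1 + fps_X) * Y)"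
proof -
  obtain x where x: "trace x = 1" using trace_surj by blast
  define N where "N = p ^ n"
  have N: "N > 0" by (simp add: N_def)
  define e where "e k = (\<Sum>i<N. of_nat ((N - 1 - i) choose k) * (\<sigma> ^^ i) x)" for k
  have e0: "e 0 = 1" using x by (simp add: e_def trace_def N_def)
  have step: "\<sigma> (e k) = e k + e (k - 1)" if k: "0 < k" "k < N" for k
  proof -
    have c0: "of_nat (N choose k) = (0 :: 'k fls)"
      using choose_prime_power_char[OF prime_p char_p, of k n] k by (simp add: N_def)
    have "\<sigma> (e k) = (\<Sum>i<p ^ n. of_nat ((N - 1 - i) choose k) * (\<sigma> ^^ Suc i) x)"
      by (simp add: e_def N_def s.sum s.mult s.of_nat)
    also have "\<dots> = (\<Sum>i\<in>{1..<N}. of_nat ((N - 1 - (i - 1)) choose k) * (\<sigma> ^^ i) x)"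
      unfolding sum_rotate using k by (simp add: N_def binomial_eq_0)
    also have "\<dots> = (\<Sum>i\<in>{1..<N}. of_nat ((N - i) choose k) * (\<sigma> ^^ i) x)"
      by (intro sum.cong) auto
    also have "\<dots> = (\<Sum>i<N. of_nat ((N - i) choose k) * (\<sigma> ^^ i) x)"
      using N c0 by (subst sum.remove[of "{..<N}" 0]) (auto intro!: sum.cong)
    also have "\<dots> = (\<Sum>i<N. (of_nat ((N - 1 - i) choose k) + of_nat ((N - 1 - i) choose (k - 1))) * (\<sigma> ^^ i) x)"
    proof (rule sum.cong)
      fix i assume "i \<in> {..<N}"
      then have "N - i = Suc (N - 1 - i)" by auto
      moreover obtain k' where "k = Suc k'" using k by (cases k) auto
      ultimately have "(N - i) choose k = ((N - 1 - i) choose k) + ((N - 1 - i) choose (k - 1))" by simp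
      then show "of_nat ((N - i) choose k) * (\<sigma> ^^ i) x =
          (of_nat ((N - 1 - i) choose k) + of_nat ((N - 1 - i) choose (k - 1))) * (\<sigma> ^^ i) x"
        by (simp only: of_nat_add)
    qed simp
    also have "\<dots> = e k + e (k - 1)" by (simp add: e_def distrib_right sum.distrib)
    finally show ?thesis .
  qed
  define Y where "Y = Abs_fps e"
  have "fps_nth (fmap \<sigma> Y) k = fps_nth ((1 + fps_X) * Y) k" if "k < N" for k
    using step[of k] that by (cases k) (simp_all add: Y_def e0 distrib_right)
  then have "fcong (p ^ n) (fmap \<sigma> Y) ((1 + fps_X) * Y)" by (simp add: fcong_def N_def)
  then show ?thesis using e0 by (intro that[of Y]) (simp_all add: Y_def)
qed

text \<open>Projection to typical series turns the factor 1 + t into E. As Frobenius fixes E, the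
  quotient of Fr Y by Y is invariant under \<sigma>, so its components can be reduced inside the
  base field.\<close>

lemma typical_series_exists:
  obtains Y h where "fps_nth Y 0 = 1" "fcong (p ^ n) (fmap \<sigma> Y) (E * Y)"
    "fcong (p ^ n) (fmap fr Y) (wprod h n * Y)" "\<And>i. i < n \<Longrightarrow> \<sigma> (h i) = h i"
    "\<And>i. i < n \<Longrightarrow> h i \<noteq> 0 \<Longrightarrow> \<exists>a. \<nu> (h i) = - int (p ^ n * a) \<and> a > 0 \<and> \<not> p dvd a"
proof -
  interpret fr: field_hom "\<lambda>x::'k fls. x ^ p" by (rule fr_hom)
  note sh = s.field_hom_axioms
  obtain Y0 where Y0: "fps_nth Y0 0 = 1" "fcong (p ^ n) (fmap \<sigma> Y0) ((1 + fps_X) * Y0)"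
    by (rule binomial_series_exists)
  define Y1 where "Y1 = ppart p n Y0"
  have typY: "ptypical p n Y1" unfolding Y1_def by (rule ptypical_ppart[OF prime_p char_p roots Y0(1)])
  have Y1_0: "fps_nth Y1 0 = 1" by (rule ptypical_nth_0[OF typY])
  have Y1\<sigma>: "fcong (p ^ n) (fmap \<sigma> Y1) (E * Y1)"
    using ppart_cong[OF Y0(2), of p n] unfolding ppart_mult ahexp_def[symmetric] ppart_fmap[OF sh roots, symmetric]
    by (simp add: Y1_def)
  define F where "F = fmap fr Y1 * inverse Y1"
  have typF: "ptypical p n F"
    unfolding F_def by (intro ptypical_mult ptypical_inverse typY) (simp add: ptypical_fmap[OF fr_hom roots] typY)
  have frE: "fmap fr E = E" "fmap \<sigma> E = E" using E_fmap[OF fr_hom] E_fmap[OF sh] by auto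
  have comm: "fmap \<sigma> (fmap fr G) = fmap fr (fmap \<sigma> G)" for G by (rule fps_ext) (simp add: s.power)
  have "fmap \<sigma> F = fmap fr (fmap \<sigma> Y1) * inverse (fmap \<sigma> Y1)"
    by (simp add: F_def s.fmap_mult s.fmap_inverse Y1_0 comm)
  also have "fcong (p ^ n) \<dots> (fmap fr (E * Y1) * inverse (E * Y1))"
    using Y1\<sigma> Y1_0 by (intro fcong_mult fmap_cong_mod fcong_inverse) auto
  also have "fmap fr (E * Y1) * inverse (E * Y1) = (E * inverse E) * F"
    by (simp add: fr.fmap_mult frE F_def fps_inverse_mult mult_ac)
  also have "E * inverse E = 1" by (simp add: inverse_mult_eq_1')
  finally have F\<sigma>: "fcong (p ^ n) (fmap \<sigma> F) F" by simp
  define R where "R g \<longleftrightarrow> g = 0 \<or> (\<exists>a. \<nu> g = - int (p ^ n * a) \<and> a > 0 \<and> \<not> p dvd a)" for g :: "'k fls"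
  have "\<exists>d. \<sigma> d = d \<and> R (g + d ^ p - d)" if g: "\<sigma> g = g" for g
  proof -
    interpret T: vhom "\<Psi> 0" "p ^ (n - 0)" by (rule \<Psi>_vhom) simp
    obtain g' where g': "g = \<Psi> 0 g'" using \<Psi>_ex[of 0 g] g by auto
    obtain d r where dr: "g' = r + d ^ p - d" "r = 0 \<or> \<nu> r < 0 \<and> \<not> int p dvd \<nu> r"
    proof (rule artin_schreier_reduce[OF prime_p char_k, of g'])
      fix d r assume "g' = r + d ^ p - d" "r = 0 \<or> \<nu> r < 0 \<and> \<not> int p dvd \<nu> r"
      then show thesis by (rule that)
    qed
    have "g + (- \<Psi> 0 d) ^ p - (- \<Psi> 0 d) = \<Psi> 0 r"
      unfolding g' dr(1) fr.uminus by (simp add: T.add T.diff T.power)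
    moreover have "R (\<Psi> 0 r)"
    proof (cases "r = 0")
      case False
      then have "\<nu> r = - int (nat (- \<nu> r))" "nat (- \<nu> r) > 0" using dr(2) by auto
      moreover from this have "\<not> p dvd nat (- \<nu> r)"
        using dr(2) False by (metis dvd_minus_iff int_dvd_int_iff)
      ultimately show ?thesis using False T.subdegree[of r] unfolding R_def
        by (metis diff_zero mult_minus_right of_nat_mult)
    qed (simp add: R_def)
    moreover have "\<sigma> (- \<Psi> 0 d) = - \<Psi> 0 d" using \<Psi>_fixed[of 0 d] by (simp add: s.uminus)
    ultimately show ?thesis by metis
  qed
  from typical_reduce[OF typF sh F\<sigma> this]
  obtain D h where D: "fps_nth D 0 = 1" "fmap \<sigma> D = D"
    "fcong (p ^ n) (F * fmap fr D * inverse D) (wprod h n)" "\<forall>i<n. \<sigma> (h i) = h i \<and> R (h i)" by blast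
  define Y where "Y = Y1 * D"
  have "fmap \<sigma> Y = fmap \<sigma> Y1 * D" by (simp add: Y_def s.fmap_mult D)
  also have "fcong (p ^ n) \<dots> ((E * Y1) * D)" by (intro fcong_mult Y1\<sigma> fcong_refl)
  finally have Y\<sigma>: "fcong (p ^ n) (fmap \<sigma> Y) (E * Y)" by (simp add: Y_def mult.assoc)
  have inv: "inverse Y1 * Y1 = 1" "inverse D * D = 1" using Y1_0 D(1) by (auto simp: inverse_mult_eq_1)
  have "(F * fmap fr D * inverse D) * Y = fmap fr Y1 * fmap fr D * (inverse Y1 * Y1) * (inverse D * D)"
    by (simp add: F_def Y_def mult_ac)
  then have "fmap fr Y = (F * fmap fr D * inverse D) * Y" unfolding inv by (simp only: Y_def fr.fmap_mult mult_1_right)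
  also have "fcong (p ^ n) \<dots> (wprod h n * Y)" by (intro fcong_mult D(3) fcong_refl)
  finally have Yf: "fcong (p ^ n) (fmap fr Y) (wprod h n * Y)" .
  show ?thesis
    by (rule that[OF _ Y\<sigma> Yf]) (use D(4) Y1_0 D(1) in \<open>auto simp: Y_def R_def\<close>)
qed

lemma wprod_nth_1: "k \<ge> 1 \<Longrightarrow> fps_nth (wprod h k) 1 = h 0"
proof -
  assume k: "k \<ge> 1"
  have "fps_nth (wprod h k) 1 = (\<Sum>i<k. fps_nth (esub E (h i) (p ^ i)) 1)"
    unfolding wprod_def
    using fps_prod_nth_low[of "{..<k}" 1 "\<lambda>i. esub E (h i) (p ^ i)"] by (simp add: fcong_def)
  also have "\<dots> = (\<Sum>i<k. if i = 0 then h 0 else 0)"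
    using p_gt_1 by (intro sum.cong) (auto simp: esub_nth)
  also have "\<dots> = h 0" using k by simp
  finally show ?thesis .
qed

text \<open>Were \<open>h 0\<close> zero, the first coefficient of Y would lie in the prime field
  and be fixed by \<sigma>, although \<sigma> adds 1 to it. This makes the maximum
  \<open>U l\<close> well defined and U 1 equal to the pole order of \<open>h 0\<close>.\<close>

lemma first_nonzero:
  assumes "fps_nth Y 0 = 1" "fcong (p ^ n) (fmap \<sigma> Y) (E * Y)" "fcong (p ^ n) (fmap fr Y) (wprod h n * Y)"
  shows "h 0 \<noteq> 0"
proof
  assume h0: "h 0 = 0"
  have n1: "1 < p ^ n" using one_less_power[of p n] p_gt_1 n_pos by simp
  define y where "y = fps_nth Y 1"
  have nth1: "fps_nth (G * Y) 1 = fps_nth G 1 + y" if "fps_nth G 0 = 1" for G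
    using that assms(1) by (simp add: fps_mult_nth y_def)
  have "y ^ p = fps_nth (wprod h n * Y) 1" using assms(3) n1 by (simp add: fcong_def y_def)
  also have "\<dots> = y" using nth1[of "wprod h n"] wprod_nth_1[OF n_pos] h0 by simp
  finally obtain b where "y = of_nat b" using prime_field[OF prime_p char_p] by blast
  then have "\<sigma> y = y" by (simp add: s.of_nat)
  moreover have "\<sigma> y = fps_nth (E * Y) 1" using assms(2) n1 by (simp add: fcong_def y_def)
  then have "\<sigma> y = 1 + y" using nth1[of E] by simp
  ultimately show False by simp
qed

lemma typical_data_exists:
  obtains Y h a U where "typical_data p n \<sigma> Y h a U"
proof -
  obtain Y h where Y: "fps_nth Y 0 = 1" "fcong (p ^ n) (fmap \<sigma> Y) (E * Y)"
    "fcong (p ^ n) (fmap fr Y) (wprod h n * Y)" "\<And>i. i < n \<Longrightarrow> \<sigma> (h i) = h i"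
    "\<And>i. i < n \<Longrightarrow> h i \<noteq> 0 \<Longrightarrow> \<exists>a. \<nu> (h i) = - int (p ^ n * a) \<and> a > 0 \<and> \<not> p dvd a"
    using typical_series_exists by metis
  then have "\<forall>i. \<exists>a. i < n \<longrightarrow> h i \<noteq> 0 \<longrightarrow> \<nu> (h i) = - int (p ^ n * a) \<and> a > 0 \<and> \<not> p dvd a"
    by blast
  then obtain a where a: "\<And>i. i < n \<Longrightarrow> h i \<noteq> 0 \<Longrightarrow> \<nu> (h i) = - int (p ^ n * a i) \<and> a i > 0 \<and> \<not> p dvd a i"
    by metis
  define S where "S l = (\<lambda>i. p ^ (l - 1 - i) * a i) ` {i. i < l \<and> h i \<noteq> 0}" for l
  define U where "U l = Max (S l)" for l
  have h0: "h 0 \<noteq> 0" using first_nonzero[OF Y(1-3)] .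
  have fin: "finite (S l)" for l by (simp add: S_def)
  have "typical_data p n \<sigma> Y h a U"
  proof
    show "p ^ (l - 1 - i) * a i \<le> U l" if "i < l" "h i \<noteq> 0" for i l
      unfolding U_def using that by (intro Max_ge fin) (auto simp: S_def)
    show "\<exists>i<l. h i \<noteq> 0 \<and> U l = p ^ (l - 1 - i) * a i" if "1 \<le> l" for l
    proof -
      have "0 \<in> {i. i < l \<and> h i \<noteq> 0}" using that h0 by simp
      then have "S l \<noteq> {}" unfolding S_def by blast
      from Max_in[OF fin this] show ?thesis by (auto simp: U_def S_def)
    qed
  qed (use Y a in auto)
  then show ?thesis by (rule that)
qed

text \<open>\<open>U (l+1)\<close> is the larger of \<open>p U l\<close> and, if \<open>h l\<close>
  is nonzero, the number \<open>a l\<close> prime to p; this is the alternative in the last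
  clause.\<close>

theorem cyclic_upper_breaks:
  obtains U :: "nat \<Rightarrow> nat" where "brk \<sigma> = int (U 1)"
    "\<And>l. 1 \<le> l \<Longrightarrow> l < n \<Longrightarrow> brk (\<sigma> ^^ (p ^ l)) = brk (\<sigma> ^^ (p ^ (l - 1))) + int (p ^ l) * (int (U (Suc l)) - int (U l))"
    "\<not> p dvd U 1" "\<And>l. 1 \<le> l \<Longrightarrow> l < n \<Longrightarrow> U (Suc l) = p * U l \<or> (U (Suc l) > p * U l \<and> \<not> p dvd U (Suc l))"
proof -
  obtain Y h a U where "typical_data p n \<sigma> Y h a U" by (rule typical_data_exists)
  then interpret typical_data p n ty \<sigma> Y h a U .
  show ?thesis
  proof (rule that[OF breaks_1 breaks_Suc])
    show "\<not> p dvd U 1" using U_ex[of 1] h_red[of 0] n_pos by auto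
    fix l assume l: "1 \<le> l" "l < n"
    have ge: "p * U l \<le> U (Suc l)" using U_step[of l] l by simp
    obtain i where i: "i < Suc l" "h i \<noteq> 0" "U (Suc l) = p ^ (Suc l - 1 - i) * a i" using U_ex[of "Suc l"] l by auto
    show "U (Suc l) = p * U l \<or> (U (Suc l) > p * U l \<and> \<not> p dvd U (Suc l))"
    proof (cases "i = l")
      case True
      then have "\<not> p dvd U (Suc l)" using i h_red[of i] l by simp
      then show ?thesis using ge by (metis dvd_triv_left le_neq_implies_less)
    next
      case False
      then have il: "i < l" using i by simp
      then have "Suc l - 1 - i = Suc (l - 1 - i)" by simp
      then have "U (Suc l) = p * (p ^ (l - 1 - i) * a i)" using i(3) by simp
      also have "\<dots> \<le> p * U l" using U_ge[of l i] l il i(2) by simp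
      finally show ?thesis using ge by simp
    qed
  qed
qed

end

section \<open>Semidirect products of cyclic groups\<close>

lemma (in group) cyclic_of_iso_integer_mod_group:
  assumes H: "subgroup H G" and iso: "G\<lparr>carrier := H\<rparr> \<cong> integer_mod_group a" and "a \<ge> 1"
  obtains c where "c \<in> H" "\<forall>x\<in>H. \<exists>i<a. x = c [^] i" "c [^] a = \<one>" "card H = a" "finite H"
proof -
  interpret H: group "G\<lparr>carrier := H\<rparr>" using H by (rule subgroup_imp_group)
  have "integer_mod_group a \<cong> G\<lparr>carrier := H\<rparr>" using H.iso_sym[OF iso] .
  then obtain g where g: "g \<in> iso (integer_mod_group a) (G\<lparr>carrier := H\<rparr>)"
    by (auto simp: is_iso_def)
  interpret Z: group "integer_mod_group a" by simp
  interpret g: group_hom "integer_mod_group a" "G\<lparr>carrier := H\<rparr>" g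
    using g by unfold_locales (auto simp: iso_def)
  have Z: "carrier (integer_mod_group a) = {0..<int a}" using \<open>a \<ge> 1\<close> by (simp add: carrier_integer_mod_group)
  have bij: "bij_betw g {0..<int a} H" using g by (simp add: iso_def Z)
  define z where "z = 1 mod int a"
  have z: "z \<in> carrier (integer_mod_group a)" using \<open>a \<ge> 1\<close> by (simp add: Z z_def)
  define c where "c = g z"
  have pow: "c [^] i = g (int i mod int a)" for i :: nat
  proof -
    have "c [^] i = g z [^]\<^bsub>G\<lparr>carrier := H\<rparr>\<^esub> i" unfolding c_def by (rule nat_pow_consistent)
    also have "\<dots> = g (z [^]\<^bsub>integer_mod_group a\<^esub> i)" using g.hom_nat_pow[OF z, of i] by simp
    also have "z [^]\<^bsub>integer_mod_group a\<^esub> i = int i mod int a"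
      by (simp add: z_def mod_mult_right_eq)
    finally show ?thesis .
  qed
  show ?thesis
  proof
    show "c \<in> H" using z bij by (auto simp: c_def bij_betw_def Z)
    show "\<forall>x\<in>H. \<exists>i<a. x = c [^] i"
    proof
      fix x assume x: "x \<in> H"
      obtain y where y: "y \<in> {0..<int a}" "x = g y" using bij x unfolding bij_betw_def by blast
      then have "x = c [^] (nat y)" "nat y < a" by (auto simp: pow)
      then show "\<exists>i<a. x = c [^] i" by blast
    qed
    show "c [^] a = \<one>" using g.hom_one by (simp add: pow)
    show "card H = a" using bij_betw_same_card[OF bij] by simp
    show "finite H" using bij_betw_finite[OF bij] by simp
  qed
qed

locale cyclic_semidirect = group +
  fixes p n m :: nat and s t :: 'a and \<kappa> :: nat
  assumes p: "Factorial_Ring.prime p" and n: "n \<ge> 1" and m: "m \<ge> 1" "\<not> p dvd m"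
    and s: "s \<in> carrier G" "ord s = p ^ n"
    and t: "t \<in> carrier G" "ord t = m"
    and elems: "bij_betw (\<lambda>(i, j). s [^] i \<otimes> t [^] j) ({..<p ^ n} \<times> {..<m}) (carrier G)"
    and conj: "t \<otimes> s = s [^] \<kappa> \<otimes> t"
begin

lemma pn: "p ^ n > 0" using p prime_gt_0_nat by simp

lemma conj_pow_right: "t \<otimes> s [^] (i::nat) = s [^] (\<kappa> * i) \<otimes> t"
proof (induction i)
  case (Suc i)
  have "t \<otimes> s [^] Suc i = (t \<otimes> s [^] i) \<otimes> s" using s(1) t(1) by (simp add: m_assoc)
  also have "\<dots> = s [^] (\<kappa> * i) \<otimes> (t \<otimes> s)" using s(1) t(1) by (simp add: Suc m_assoc)
  also have "\<dots> = (s [^] (\<kappa> * i) \<otimes> s [^] \<kappa>) \<otimes> t" using s(1) t(1) by (simp add: conj m_assoc)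
  also have "\<dots> = s [^] (\<kappa> * Suc i) \<otimes> t" using s(1) t(1) by (simp add: nat_pow_mult add.commute)
  finally show ?case .
qed (use t in simp)

lemma conj_pow: "t [^] (j::nat) \<otimes> s [^] (i::nat) = s [^] (\<kappa> ^ j * i) \<otimes> t [^] j"
proof (induction j arbitrary: i)
  case (Suc j)
  have "t [^] Suc j \<otimes> s [^] i = (t [^] j \<otimes> s [^] (\<kappa> * i)) \<otimes> t"
    using s(1) t(1) by (simp add: conj_pow_right m_assoc)
  also have "\<dots> = s [^] (\<kappa> ^ Suc j * i) \<otimes> t [^] Suc j"
    using s(1) t(1) by (simp add: Suc m_assoc mult_ac)
  finally show ?case .
qed (use s t in simp)

lemma spow_eq_iff: "s [^] (a::nat) = s [^] (b::nat) \<longleftrightarrow> [a = b] (mod p ^ n)"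
proof -
  have *: "s [^] (a::nat) = s [^] (b::nat) \<longleftrightarrow> [a = b] (mod p ^ n)" if "a \<le> b" for a b
  proof -
    have "s [^] a = s [^] b \<longleftrightarrow> s [^] (b - a) = \<one>"
    proof -
      have "s [^] b = s [^] a \<otimes> s [^] (b - a)" using s(1) that by (simp add: nat_pow_mult)
      then show ?thesis using s(1) by (metis l_cancel_one nat_pow_closed)
    qed
    also have "\<dots> \<longleftrightarrow> p ^ n dvd b - a" using s by (simp add: pow_eq_id)
    also have "\<dots> \<longleftrightarrow> [a = b] (mod p ^ n)" using that by (metis cong_altdef_nat cong_sym_eq)
    finally show ?thesis .
  qed
  show ?thesis using *[of a b] *[of b a] by (metis cong_sym_eq nat_le_linear)
qed

lemma chi_pow: "[\<kappa> ^ m = 1] (mod p ^ n)"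
proof -
  have "t [^] m = \<one>" using t by (simp add: pow_eq_id)
  then have "s [^] (\<kappa> ^ m) = s [^] (1::nat)" using conj_pow[of m 1] s(1) by simp
  then show ?thesis by (simp only: spow_eq_iff)
qed

lemma elem_cases:
  assumes "g \<in> carrier G"
  obtains i j where "i < p ^ n" "j < m" "g = s [^] i \<otimes> t [^] j"
  using assms elems unfolding bij_betw_def by force

lemma mult_elem: "(s [^] (i::nat) \<otimes> t [^] (j::nat)) \<otimes> (s [^] (i'::nat) \<otimes> t [^] (j'::nat)) =
    s [^] (i + \<kappa> ^ j * i') \<otimes> t [^] (j + j')"
proof -
  have "(s [^] i \<otimes> t [^] j) \<otimes> (s [^] i' \<otimes> t [^] j') = s [^] i \<otimes> (t [^] j \<otimes> s [^] i') \<otimes> t [^] j'"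
    using s(1) t(1) by (simp add: m_assoc)
  also have "\<dots> = s [^] (i + \<kappa> ^ j * i') \<otimes> t [^] (j + j')"
    unfolding conj_pow using s(1) t(1) by (simp add: m_assoc flip: nat_pow_mult)
  finally show ?thesis .
qed

lemma card_carrier: "card (carrier G) = p ^ n * m" "finite (carrier G)"
  using bij_betw_same_card[OF elems] bij_betw_finite[OF elems] by (simp_all add: card_cartesian_product)

lemma card_centralizer: "card (centralizer G s) = p ^ n * card {j. j < m \<and> [\<kappa> ^ j = 1] (mod p ^ n)}"
proof -
  have iff: "(s [^] i \<otimes> t [^] j) \<otimes> s = s \<otimes> (s [^] i \<otimes> t [^] j) \<longleftrightarrow> [\<kappa> ^ j = 1] (mod p ^ n)" for i j :: nat
  proof -
    have "(s [^] i \<otimes> t [^] j) \<otimes> s = s [^] (i + \<kappa> ^ j) \<otimes> t [^] j" using mult_elem[of i j 1 0] s(1) t(1) by simp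
    moreover have "s \<otimes> (s [^] i \<otimes> t [^] j) = s [^] (i + 1) \<otimes> t [^] j" using mult_elem[of 1 0 i j] s(1) t(1) by simp
    ultimately show ?thesis using s(1) t(1) by (simp add: spow_eq_iff cong_add_lcancel_nat del: nat_pow_Suc add_Suc_right)
  qed
  have "centralizer G s = (\<lambda>(i, j). s [^] i \<otimes> t [^] j) ` ({..<p ^ n} \<times> {j. j < m \<and> [\<kappa> ^ j = 1] (mod p ^ n)})"
  proof (intro Set.set_eqI iffI)
    fix g assume g: "g \<in> centralizer G s"
    then obtain i j where ij: "i < p ^ n" "j < m" "g = s [^] i \<otimes> t [^] j"
      unfolding centralizer_def by (blast elim: elem_cases)
    then have "[\<kappa> ^ j = 1] (mod p ^ n)" using g iff by (simp add: centralizer_def)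
    then show "g \<in> (\<lambda>(i, j). s [^] i \<otimes> t [^] j) ` ({..<p ^ n} \<times> {j. j < m \<and> [\<kappa> ^ j = 1] (mod p ^ n)})"
      using ij by force
  qed (use s(1) t(1) iff in \<open>auto simp: centralizer_def\<close>)
  moreover have "inj_on (\<lambda>(i, j). s [^] i \<otimes> t [^] j) ({..<p ^ n} \<times> {j. j < m \<and> [\<kappa> ^ j = 1] (mod p ^ n)})"
    using elems unfolding bij_betw_def by (auto intro: inj_on_subset)
  ultimately show ?thesis by (simp add: card_image card_cartesian_product)
qed

end

text \<open>The given element s need not come from the chosen factor N. Its H-component has order
  dividing both \<open>p^n\<close> and m, hence is trivial, so s lies in N and generates it.\<close>

lemma cyclic_semidirectI:
  fixes G (structure) and p n m :: nat
  assumes p: "Factorial_Ring.prime p" and n: "n \<ge> 1" and m: "m \<ge> 1" "\<not> p dvd m"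
    and "group G" and sd: "cyclic_semidirect_product G (p ^ n) m"
    and s: "s \<in> carrier G" "group.ord G s = p ^ n"
  obtains t \<kappa> where "cyclic_semidirect G p n m s t \<kappa>"
proof -
  interpret group G by fact
  have pn: "p ^ n \<ge> 1" using p prime_gt_0_nat[of p] by simp
  obtain N H where N: "N \<lhd> G" and H: "subgroup H G" and int: "N \<inter> H = {\<one>}" and prod: "N <#> H = carrier G"
    and isos: "G\<lparr>carrier := N\<rparr> \<cong> integer_mod_group (p ^ n)" "G\<lparr>carrier := H\<rparr> \<cong> integer_mod_group m"
    using sd unfolding cyclic_semidirect_product_def by blast
  interpret N: normal N G by fact
  interpret H: subgroup H G by fact
  obtain c where c: "c \<in> N" "\<forall>x\<in>N. \<exists>i<p ^ n. x = c [^] i" "c [^] (p ^ n) = \<one>"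
    and cardN: "card N = p ^ n" "finite N"
    by (rule cyclic_of_iso_integer_mod_group[OF N.is_subgroup isos(1) pn])
  obtain t where t: "t \<in> H" "\<forall>x\<in>H. \<exists>i<m. x = t [^] i" "t [^] m = \<one>"
    and cardH: "card H = m" "finite H"
    by (rule cyclic_of_iso_integer_mod_group[OF H isos(2) m(1)])
  have Hpow: "t [^] j \<in> H" for j :: nat
    using t(1) by (induction j) auto
  have "s \<in> N"
  proof -
    obtain x y where xy: "x \<in> N" "y \<in> H" "s = x \<otimes> y" using s(1) prod[symmetric] by (auto simp: set_mult_def)
    \<comment> \<open>Modulo N the powers of s are those of its H-component y.\<close>
    have pw: "\<exists>z\<in>N. s [^] k = z \<otimes> y [^] k" for k :: nat
    proof (induction k)
      case (Suc k)
      then obtain z where z: "z \<in> N" "s [^] k = z \<otimes> y [^] k" by blast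
      define w where "w = y [^] k \<otimes> x \<otimes> inv (y [^] k)"
      have w: "w \<in> N" unfolding w_def using xy by (intro N.inv_op_closed2) auto
      have "s [^] Suc k = z \<otimes> (y [^] k \<otimes> x) \<otimes> y" using xy z by (simp add: m_assoc)
      also have "y [^] k \<otimes> x = w \<otimes> y [^] k" using xy by (simp add: w_def m_assoc)
      finally have "s [^] Suc k = (z \<otimes> w) \<otimes> y [^] Suc k" using z w xy by (simp add: m_assoc)
      then show ?case using z w by blast
    qed (use N.one_closed in auto)
    obtain z where z: "z \<in> N" "s [^] (p ^ n) = z \<otimes> y [^] (p ^ n)" using pw by blast
    have "s [^] (p ^ n) = \<one>" using s by (simp add: pow_eq_id)
    then have "z \<otimes> y [^] (p ^ n) = \<one>" using z by simp
    then have "y [^] (p ^ n) = inv z" using z xy by (metis H.mem_carrier N.mem_carrier inv_equality inv_inv nat_pow_closed inv_closed)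
    then have "y [^] (p ^ n) \<in> N" using z by simp
    moreover have "y [^] (p ^ n) \<in> H"
    proof -
      obtain i :: nat where "y = t [^] i" using t(2) xy(2) by blast
      then show ?thesis using Hpow t(1) by (simp add: nat_pow_pow)
    qed
    ultimately have "y [^] (p ^ n) = \<one>" using int by blast
    moreover have "y [^] m = \<one>"
    proof -
      obtain i :: nat where "y = t [^] i" using t(2) xy(2) by blast
      then have "y [^] m = (t [^] m) [^] i" using t(1) by (simp add: nat_pow_pow mult.commute)
      then show ?thesis by (simp add: t(3))
    qed
    ultimately have "ord y dvd p ^ n" "ord y dvd m" using xy by (simp_all add: pow_eq_id)
    moreover have "coprime (p ^ n) m" using p m(2) by (simp add: prime_imp_coprime)
    ultimately have "ord y = 1" by (metis coprime_common_divisor_nat)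
    then have "y = \<one>" using xy ord_eq_1[of y] by simp
    then show ?thesis using xy by simp
  qed
  have spow: "s [^] i \<in> N" for i :: nat
    using \<open>s \<in> N\<close> by (induction i) auto
  have inj: "inj_on (\<lambda>i::nat. s [^] i) {..<p ^ n}"
    using ord_inj[OF s(1)] unfolding s(2) by (rule inj_on_subset) auto
  have Neq: "N = (\<lambda>i::nat. s [^] i) ` {..<p ^ n}"
    using card_image[OF inj] cardN spow by (intro card_subset_eq[symmetric]) auto
  have injt: "inj_on (\<lambda>i::nat. t [^] i) {..<m}"
  proof (rule eq_card_imp_inj_on)
    have "H = (\<lambda>i::nat. t [^] i) ` {..<m}" using t(2) Hpow by auto
    then show "card ((\<lambda>i::nat. t [^] i) ` {..<m}) = card {..<m}" using cardH by simp
  qed simp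
  have Heq: "H = (\<lambda>i::nat. t [^] i) ` {..<m}" using t(2) Hpow by auto
  have ordt: "ord t = m"
  proof -
    have d: "ord t dvd m" using t by (simp add: pow_eq_id)
    show ?thesis
    proof (rule ccontr)
      assume "ord t \<noteq> m"
      then have lt: "ord t < m" using d m(1) by (meson dvd_imp_le le_neq_implies_less less_le_trans zero_less_one)
      have "t [^] ord t = t [^] (0::nat)" using t(1) by simp
      then have "ord t = 0" using injt lt m(1) by (auto simp: inj_on_def)
      then show False using d m(1) by simp
    qed
  qed
  have "t \<otimes> s \<otimes> inv t \<in> N" using \<open>s \<in> N\<close> t(1) by (intro N.inv_op_closed2) auto
  then obtain \<kappa> where \<kappa>: "t \<otimes> s \<otimes> inv t = s [^] (\<kappa>::nat)" unfolding Neq by blast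
  have "cyclic_semidirect G p n m s t \<kappa>"
  proof unfold_locales
    show "t \<otimes> s = s [^] \<kappa> \<otimes> t" using s t(1) by (simp add: \<kappa>[symmetric] m_assoc)
    show "bij_betw (\<lambda>(i, j). s [^] i \<otimes> t [^] j) ({..<p ^ n} \<times> {..<m}) (carrier G)"
    proof (rule bij_betw_imageI)
      show "inj_on (\<lambda>(i, j). s [^] i \<otimes> t [^] j) ({..<p ^ n} \<times> {..<m})"
      proof (rule inj_onI, clarify)
        fix i j i' j' :: nat assume ij: "i < p ^ n" "i' < p ^ n" "j < m" "j' < m" "s [^] i \<otimes> t [^] j = s [^] i' \<otimes> t [^] j'"
        have "inv (s [^] i') \<otimes> (s [^] i \<otimes> t [^] j) \<otimes> inv (t [^] j) = inv (s [^] i') \<otimes> (s [^] i' \<otimes> t [^] j') \<otimes> inv (t [^] j)"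
          unfolding ij(5) ..
        then have eq: "inv (s [^] i') \<otimes> s [^] i = t [^] j' \<otimes> inv (t [^] j)"
          using s(1) t(1) by (simp add: m_assoc flip: m_assoc[of "inv (s [^] i')" "s [^] i'"])
        have "inv (s [^] i') \<otimes> s [^] i \<in> N" using spow by simp
        moreover have "t [^] j' \<otimes> inv (t [^] j) \<in> H" using Hpow by simp
        ultimately have one: "inv (s [^] i') \<otimes> s [^] i = \<one>" using int eq by auto
        then have "s [^] i = s [^] i'" using s(1) by (metis inv_equality inv_inv inv_closed nat_pow_closed)
        moreover have "t [^] j' = t [^] j" using one eq t(1) by (metis inv_equality inv_inv inv_closed nat_pow_closed H.mem_carrier)
        ultimately show "i = i' \<and> j = j'" using inj injt ij unfolding inj_on_def by simp
      qed
      show "(\<lambda>(i, j). s [^] i \<otimes> t [^] j) ` ({..<p ^ n} \<times> {..<m}) = carrier G"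
        unfolding prod[symmetric] set_mult_def Neq Heq by auto
    qed
  qed (use p n m s t(1) ordt in auto)
  then show ?thesis by (rule that)
qed

section \<open>The Herbrand function of a step filtration\<close>

lemma has_integral_step:
  fixes c u :: real
  assumes "u \<ge> 0" "c \<ge> 0"
  shows "((\<lambda>t. if t \<le> c then 1 else 0) has_integral min u c) {0..u}"
proof -
  have "((\<lambda>t. 1::real) has_integral min u c) {0..min u c}"
    using has_integral_const_real[of "1::real" 0 "min u c"] assms by simp
  then have "((\<lambda>t. if t \<in> {0..min u c} then 1 else 0::real) has_integral min u c) {0..u}"
    by (subst has_integral_restrict) auto
  then show ?thesis by (rule has_integral_eq[rotated]) auto
qed

locale step_jumps =
  fixes J :: "nat \<Rightarrow> real" and p n m :: nat
  assumes p: "p \<ge> 2" and m: "m \<ge> 1" and n: "n \<ge> 1"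
    and J0: "J 0 > 0" and J_Suc: "Suc l < n \<Longrightarrow> J l < J (Suc l)"
begin

definition lev :: "real \<Rightarrow> nat" where "lev r = card {l. l < n \<and> J l < r}"
text \<open>The quotient of the orders of \<open>I_t\<close> and \<open>I_0\<close> after l jumps,
  which is the slope of the Herbrand function there.\<close>

definition w :: "nat \<Rightarrow> real" where "w l = 1 / (real m * real p ^ l)"

lemma J_less: "k < l \<Longrightarrow> l < n \<Longrightarrow> J k < J l"
proof (induction l)
  case (Suc l)
  then show ?case using J_Suc[of l] by (cases "k = l") auto
qed simp

lemma J_le: "k \<le> l \<Longrightarrow> l < n \<Longrightarrow> J k \<le> J l"
  using J_less[of k l] by (cases "k = l") auto

lemma J_pos: "l < n \<Longrightarrow> J l > 0"
  using J_le[of 0 l] J0 by simp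

lemma lev_le: "lev r \<le> n"
  using card_mono[of "{..<n}" "{l. l < n \<and> J l < r}"] by (auto simp: lev_def)

lemma J_less_iff: "l < n \<Longrightarrow> J l < r \<longleftrightarrow> l < lev r"
proof -
  assume l: "l < n"
  show ?thesis
  proof
    assume "J l < r"
    then have "{..l} \<subseteq> {l. l < n \<and> J l < r}" using J_le[of _ l] l by force
    then have "card {..l} \<le> lev r" unfolding lev_def by (intro card_mono) auto
    then show "l < lev r" by simp
  next
    assume *: "l < lev r"
    show "J l < r"
    proof (rule ccontr)
      assume "\<not> J l < r"
      then have "i < l" if "i < n" "J i < r" for i
        using J_le[of l i] that by (cases "l \<le> i") auto
      then have "{l. l < n \<and> J l < r} \<subseteq> {..<l}" by auto
      then have "lev r \<le> card {..<l}" unfolding lev_def by (intro card_mono) auto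
      then show False using * by simp
    qed
  qed
qed

lemma w_less: "w (Suc l) < w l" and w_pos: "w l > 0"
  using p m by (auto simp: w_def field_simps)

end

text \<open>The value at 0 is separate: it is the whole group including the tame part, whereas all
  groups at positive arguments are p-groups.\<close>

locale step_filtration = step_jumps J p n m
  for low :: "real \<Rightarrow> 'g set" and S :: "nat \<Rightarrow> 'g set" and J :: "nat \<Rightarrow> real" and p n m :: nat +
  assumes low_0: "card (low 0) = p ^ n * m"
    and low_pos: "r > 0 \<Longrightarrow> low r = S (lev r)"
    and card_S: "l \<le> n \<Longrightarrow> card (S l) = p ^ (n - l)"
begin

definition herb :: "real \<Rightarrow> real" where
  "herb u = integral {0..u} (\<lambda>t. real (card (low t)) / real (card (low 0)))"

text \<open>Summation by parts writes the decreasing step function through indicators of initial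
  intervals, each of which integrates to a minimum.\<close>

lemma ratio: "t > 0 \<Longrightarrow> real (card (low t)) / real (card (low 0)) =
    w n + (\<Sum>l<n. (w l - w (Suc l)) * (if t \<le> J l then 1 else 0))"
proof -
  assume t: "t > 0"
  have "(\<Sum>l<n. (w l - w (Suc l)) * (if t \<le> J l then 1 else 0)) = (\<Sum>l\<in>{lev t..<n}. w l - w (Suc l))"
    by (intro sum.mono_neutral_cong_right) (auto simp flip: J_less_iff not_less)
  also have "\<dots> = w (lev t) - w n"
    using sum_Suc_diff'[OF lev_le[of t], of "\<lambda>l. - w l"] by simp
  finally have "w n + (\<Sum>l<n. (w l - w (Suc l)) * (if t \<le> J l then 1 else 0)) = w (lev t)" by simp
  moreover have "card (low t) = p ^ (n - lev t)" using low_pos[OF t] card_S[OF lev_le] by simp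
  moreover have "real p ^ (n - lev t) / real (p ^ n * m) = w (lev t)"
    using lev_le[of t] p m by (simp add: w_def field_simps flip: power_add)
  ultimately show ?thesis by (simp add: low_0)
qed

lemma herb_eq: "u \<ge> 0 \<Longrightarrow> herb u = w n * u + (\<Sum>l<n. (w l - w (Suc l)) * min u (J l))"
proof -
  assume u: "u \<ge> 0"
  have "((\<lambda>t. w n + (\<Sum>l<n. (w l - w (Suc l)) * (if t \<le> J l then 1 else 0))) has_integral
      (w n * u + (\<Sum>l<n. (w l - w (Suc l)) * min u (J l)))) {0..u}"
  proof (intro has_integral_add has_integral_sum has_integral_mult_right)
    show "((\<lambda>x. w n) has_integral w n * u) {0..u}"
      using has_integral_const_real[of "w n" 0 u] u by (simp add: mult.commute)
    show "((\<lambda>x. if x \<le> J i then 1 else 0) has_integral min u (J i)) {0..u}" if "i \<in> {..<n}" for i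
      using has_integral_step[OF u, of "J i"] J_pos[of i] that by simp
  qed simp
  \<comment> \<open>The formula for the quotient is available for t > 0 only; the single point 0
    does not affect the integral.\<close>
  then have "((\<lambda>t. real (card (low t)) / real (card (low 0))) has_integral
      (w n * u + (\<Sum>l<n. (w l - w (Suc l)) * min u (J l)))) {0..u}"
    by (rule has_integral_spike_finite[of "{0}", rotated 2]) (auto simp: ratio)
  then show ?thesis unfolding herb_def by (rule integral_unique)
qed

lemma herb_less: "0 \<le> x \<Longrightarrow> x < y \<Longrightarrow> herb x < herb y"
proof -
  assume *: "0 \<le> x" "x < y"
  have "(\<Sum>l<n. (w l - w (Suc l)) * min x (J l)) \<le> (\<Sum>l<n. (w l - w (Suc l)) * min y (J l))"
    using w_less * by (intro sum_mono mult_left_mono) (auto simp: less_imp_le)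
  moreover have "w n * x < w n * y" using * w_pos by simp
  ultimately show ?thesis using * by (simp add: herb_eq)
qed

lemma herb_0: "herb 0 = 0"
  using J_pos by (simp add: herb_eq min_def) (intro sum.neutral, force)

lemma bij_herb: "bij_betw herb {0..} {0..}"
proof (rule bij_betw_imageI)
  show "inj_on herb {0..}"
    by (rule linorder_inj_onI) (use herb_less in \<open>force+\<close>)
  show "herb ` {0..} = {0..}"
  proof (intro equalityI subsetI)
    fix y assume "y \<in> herb ` {0..}"
    then obtain x where x: "x \<ge> 0" "y = herb x" by auto
    then show "y \<in> {0..}" using herb_less[of 0 x] herb_0 by (cases "x = 0") auto
  next
    fix y :: real assume y: "y \<in> {0..}"
    have "continuous_on {0..y / w n} (\<lambda>u. w n * u + (\<Sum>l<n. (w l - w (Suc l)) * min u (J l)))"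
      by (intro continuous_intros)
    then have "continuous_on {0..y / w n} herb"
      by (rule continuous_on_eq) (simp add: herb_eq)
    moreover have "herb (y / w n) \<ge> y"
    proof -
      have "(\<Sum>l<n. (w l - w (Suc l)) * min (y / w n) (J l)) \<ge> 0"
        using w_less w_pos y J_pos by (intro sum_nonneg mult_nonneg_nonneg) (auto simp: less_imp_le)
      then show ?thesis using y w_pos[of n] by (simp add: herb_eq)
    qed
    ultimately obtain x where "0 \<le> x" "herb x = y"
      using IVT'[of herb 0 y "y / w n"] y w_pos[of n] herb_0 by auto
    then show "y \<in> herb ` {0..}" by auto
  qed
qed

lemma herb_surj:
  assumes "y \<ge> 0"
  obtains r where "r \<ge> 0" "herb r = y"
proof -
  have "y \<in> herb ` {0..}" using bij_herb assms by (simp add: bij_betw_def)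
  then show ?thesis using that by auto
qed

lemma the_inv_herb: "r \<ge> 0 \<Longrightarrow> the_inv_into {0..} herb (herb r) = r"
  using bij_herb by (simp add: bij_betw_def the_inv_into_f_f)

lemma low_eq_iff: "r > 0 \<Longrightarrow> r' > 0 \<Longrightarrow> low r = low r' \<longleftrightarrow> lev r = lev r'"
proof -
  assume r: "r > 0" "r' > 0"
  have "lev r = lev r'" if "low r = low r'"
  proof -
    have "card (S (lev r)) = card (S (lev r'))" using that r by (simp add: low_pos)
    then have "p ^ (n - lev r) = p ^ (n - lev r')" by (simp add: card_S lev_le)
    then have "n - lev r = n - lev r'" using p by (simp add: power_inject_exp)
    then show ?thesis using lev_le[of r] lev_le[of r'] by simp
  qed
  then show ?thesis using r by (auto simp: low_pos)
qed

lemma breaks: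
  "{x. x > 0 \<and> (\<forall>\<epsilon>>0. low (the_inv_into {0..} herb (x + \<epsilon>)) \<noteq> low (the_inv_into {0..} herb x))} =
    (\<lambda>l. herb (J l)) ` {..<n}"
proof (intro equalityI subsetI)
  fix x assume "x \<in> (\<lambda>l. herb (J l)) ` {..<n}"
  then obtain l where l: "l < n" "x = herb (J l)" by auto
  have x: "x > 0" using herb_less[of 0 "J l"] J_pos[OF l(1)] herb_0 l by simp
  have "low (the_inv_into {0..} herb (x + \<epsilon>)) \<noteq> low (the_inv_into {0..} herb x)" if "\<epsilon> > 0" for \<epsilon>
  proof -
    obtain r where r: "r \<ge> 0" "herb r = x + \<epsilon>"
      using herb_surj[of "x + \<epsilon>"] x \<open>\<epsilon> > 0\<close> by auto
    have "J l < r"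
    proof (rule ccontr)
      assume "\<not> J l < r"
      then have "herb r \<le> herb (J l)" using herb_less[of r "J l"] r by (cases "r = J l") auto
      then show False using r l that by simp
    qed
    then have "l < lev r" "\<not> l < lev (J l)" using J_less_iff[OF l(1)] by auto
    then have "lev r \<noteq> lev (J l)" by auto
    then show ?thesis
      using low_eq_iff[of r "J l"] J_pos[OF l(1)] \<open>J l < r\<close> the_inv_herb[of r] the_inv_herb[of "J l"]
      unfolding r(2) l(2) by simp
  qed
  then show "x \<in> {x. x > 0 \<and> (\<forall>\<epsilon>>0. low (the_inv_into {0..} herb (x + \<epsilon>)) \<noteq> low (the_inv_into {0..} herb x))}"
    using x by simp
next
  fix x assume "x \<in> {x. x > 0 \<and> (\<forall>\<epsilon>>0. low (the_inv_into {0..} herb (x + \<epsilon>)) \<noteq> low (the_inv_into {0..} herb x))}"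
  then have x: "x > 0" and ne: "\<And>\<epsilon>. \<epsilon> > 0 \<Longrightarrow> low (the_inv_into {0..} herb (x + \<epsilon>)) \<noteq> low (the_inv_into {0..} herb x)"
    by auto
  obtain r where r: "r \<ge> 0" "herb r = x"
    using herb_surj[of x] x by auto
  then have r0: "r > 0" using herb_0 x by (cases "r = 0") auto
  have "\<exists>l<n. J l = r"
  proof (rule ccontr)
    assume no: "\<not> (\<exists>l<n. J l = r)"
    \<comment> \<open>T collects the jumps beyond r. Up to the smallest of them the group does not
      change, which contradicts r giving a break.\<close>
    define T where "T = {J l |l. l < n \<and> J l > r}"
    have T: "finite T" unfolding T_def by simp
    define r' where "r' = (if T = {} then r + 1 else Min T)"
    have "r' > r" using T by (auto simp: r'_def T_def)
    have "J l < r \<longleftrightarrow> J l < r'" if l: "l < n" for l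
    proof
      assume "J l < r'"
      show "J l < r"
      proof (rule ccontr)
        assume "\<not> J l < r"
        then have "J l \<in> T" using no l by (force simp: T_def)
        then have "Min T \<le> J l" "T \<noteq> {}" using T by auto
        then show False using \<open>J l < r'\<close> by (simp add: r'_def)
      qed
    qed (use \<open>r' > r\<close> in simp)
    then have "lev r = lev r'" unfolding lev_def by (intro arg_cong[of _ _ card]) auto
    then have "low r = low r'" using low_eq_iff r0 \<open>r' > r\<close> by simp
    moreover have "herb r' - x > 0" using herb_less[of r r'] r \<open>r' > r\<close> by simp
    then have "low r' \<noteq> low r"
      using ne[of "herb r' - x"] \<open>r' > r\<close> r0 the_inv_herb[of r] the_inv_herb[of r'] r(2) by simp
    ultimately show False by simp
  qed
  then show "x \<in> (\<lambda>l. herb (J l)) ` {..<n}" using r by auto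
qed

text \<open>From jump l to the next the slope is \<open>1 / (m p^(l+1))\<close>, which cancels the
  factor in the recursion; before the first jump it is 1/m.\<close>

lemma herb_J:
  fixes U :: "nat \<Rightarrow> real"
  assumes "J 0 = U 1" "\<And>l. Suc l < n \<Longrightarrow> J (Suc l) = J l + real p ^ Suc l * (U (Suc (Suc l)) - U (Suc l))"
  shows "l < n \<Longrightarrow> herb (J l) = U (Suc l) / real m"
proof (induction l)
  case 0
  have "(\<Sum>l<n. (w l - w (Suc l)) * min (J 0) (J l)) = (\<Sum>l<n. (w l - w (Suc l)) * J 0)"
    using J_le[of 0] by (intro sum.cong) (auto simp: min_def)
  also have "\<dots> = (w 0 - w n) * J 0"
    by (simp add: sum_lessThan_telescope' flip: sum_distrib_right)
  finally have "herb (J 0) = w 0 * J 0" using J_pos[of 0] n by (simp add: herb_eq algebra_simps)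
  then show ?case by (simp add: assms(1) w_def)
next
  case (Suc l)
  define D where "D = J (Suc l) - J l"
  have "(\<Sum>k<n. (w k - w (Suc k)) * min (J (Suc l)) (J k)) - (\<Sum>k<n. (w k - w (Suc k)) * min (J l) (J k)) =
     (\<Sum>k<n. (w k - w (Suc k)) * (min (J (Suc l)) (J k) - min (J l) (J k)))"
    by (simp add: algebra_simps flip: sum_subtractf)
  also have "\<dots> = (\<Sum>k\<in>{Suc l..<n}. (w k - w (Suc k)) * D)"
  proof (intro sum.mono_neutral_cong_right ballI)
    fix k assume "k \<in> {..<n} - {Suc l..<n}"
    then have "k \<le> l" by auto
    then show "(w k - w (Suc k)) * (min (J (Suc l)) (J k) - min (J l) (J k)) = 0"
      using J_le[of k l] J_le[of k "Suc l"] Suc.prems by simp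
  next
    fix k assume "k \<in> {Suc l..<n}"
    then show "(w k - w (Suc k)) * (min (J (Suc l)) (J k) - min (J l) (J k)) = (w k - w (Suc k)) * D"
      using J_le[of "Suc l" k] J_less[of l k] by (simp add: D_def min_def)
  qed auto
  also have "\<dots> = (w (Suc l) - w n) * D"
    using sum_Suc_diff'[of "Suc l" n "\<lambda>l. - w l"] Suc.prems by (simp flip: sum_distrib_right)
  finally have "herb (J (Suc l)) - herb (J l) = w (Suc l) * D"
    using J_pos[of l] J_pos[of "Suc l"] Suc.prems by (simp add: herb_eq D_def algebra_simps)
  also have "\<dots> = (U (Suc (Suc l)) - U (Suc l)) / real m"
    using assms(2)[OF Suc.prems] p by (simp add: w_def D_def)
  finally show ?case using Suc by (simp add: diff_divide_distrib)
qed

end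

section \<open>Ramification of the semidirect product\<close>

lemma field_hom_fls_const: "field_hom (fls_const :: 'a::field \<Rightarrow> 'a fls)"
  by unfold_locales (simp_all add: fls_plus_const)

lemma ah_fls:
  assumes "prime p" "CHAR('k::alg_closed_field) = p"
  shows "ah TYPE('k fls) p"
proof
  show "full_uroots p TYPE('k fls)"
    using field_hom_fls_const full_uroots_alg_closed[OF assms] by (rule full_uroots_hom)
qed (use assms in simp_all)

text \<open>The extension field as k((X)) with G acting faithfully on it; the base field is present
  only as the fixed field.\<close>

locale ramified_action = cyclic_semidirect +
  fixes A :: "'a \<Rightarrow> 'k::alg_closed_field fls \<Rightarrow> 'k fls"
  assumes char_k: "CHAR('k) = p" and is_aut: "g \<in> carrier G \<Longrightarrow> is_aut (A g)"
    and action: "g \<in> carrier G \<Longrightarrow> h \<in> carrier G \<Longrightarrow> A (g \<otimes> h) x = A g (A h x)"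
    and faithful: "g \<in> carrier G \<Longrightarrow> A g = id \<Longrightarrow> g = \<one>"
begin

lemma action_one: "A \<one> = id"
proof
  fix x
  interpret vhom "A \<one>" 1 using is_aut[OF one_closed] by (rule is_aut_vhom)
  have "A \<one> (A \<one> x) = A \<one> x" using action[of \<one> \<one> x] by simp
  then show "A \<one> x = id x" by simp
qed

lemma action_pow: "g \<in> carrier G \<Longrightarrow> A (g [^] (k::nat)) = A g ^^ k"
proof (induction k)
  case (Suc k)
  then show ?case using action[of "g [^] k" g] by (simp add: funpow_swap1 fun_eq_iff)
qed (simp add: action_one id_def)

lemma vhom: "g \<in> carrier G \<Longrightarrow> vhom (A g) 1"
  using is_aut by (rule is_aut_vhom)

lemma fixes_X: "g \<in> carrier G \<Longrightarrow> A g fls_X = fls_X \<longleftrightarrow> g = \<one>"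
proof
  assume g: "g \<in> carrier G" "A g fls_X = fls_X"
  then have "A g = (\<lambda>x. x)" by (intro is_aut_eqI is_aut is_aut_id)
  then show "g = \<one>" using faithful g by (simp add: id_def)
qed (simp add: action_one)

abbreviation "\<zeta> \<equiv> fls_nth (A t fls_X) 1"

lemma spow_eq_one: "s [^] (i::nat) = \<one> \<longleftrightarrow> p ^ n dvd i"
  using s by (simp add: pow_eq_id)

lemma spow_id: "A (s [^] (i::nat)) ^^ (p ^ n) = id"
proof -
  have "A (s [^] i) ^^ (p ^ n) = A (s [^] (i * p ^ n))"
    using s(1) by (simp add: action_pow[symmetric] nat_pow_pow)
  also have "s [^] (i * p ^ n) = \<one>" by (simp add: spow_eq_one)
  finally show ?thesis by (simp add: action_one id_def)
qed

lemma lead_s: "fls_nth (A (s [^] (i::nat)) fls_X) 1 = 1"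
proof (cases "A (s [^] i) fls_X = fls_X")
  case False
  have "brk (A (s [^] i)) \<ge> 1"
    using brk_pos_if_p_power[OF p char_k vhom False spow_id] s(1) by simp
  then show ?thesis using brk_pos_iff[OF vhom False] s(1) by simp
qed simp

lemma lead: "fls_nth (A (s [^] (i::nat) \<otimes> t [^] (j::nat)) fls_X) 1 = \<zeta> ^ j"
proof -
  interpret T: vhom "A (t [^] j)" 1 using t(1) by (intro vhom) simp
  have "vge 1 (A (t [^] j) fls_X)" by (simp add: vge_def T.subdegree)
  then have "fls_nth (A (s [^] i) (A (t [^] j) fls_X)) 1 = fls_nth (A (t [^] j) fls_X) 1"
    using vhom_leading[OF vhom, of _ 1] lead_s s(1) by simp
  also have "\<dots> = \<zeta> ^ j" using vhom_leading_power[OF vhom[OF t(1)]] t(1) by (simp add: action_pow)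
  finally show ?thesis using s(1) t(1) by (simp add: action)
qed

text \<open>If \<open>\<zeta>^j = 1\<close> while \<open>t^j\<close> is nontrivial, then
  \<open>t^j\<close> has a positive break, and its m-th power would still be nontrivial because m is
  prime to p.\<close>

lemma \<zeta>_pow: "\<zeta> ^ j = 1 \<longleftrightarrow> m dvd j"
proof
  assume j: "\<zeta> ^ j = 1"
  show "m dvd j"
  proof (rule ccontr)
    assume "\<not> m dvd j"
    then have ne: "t [^] j \<noteq> \<one>" using t by (simp add: pow_eq_id)
    then have neX: "A (t [^] j) fls_X \<noteq> fls_X" using t(1) by (simp add: fixes_X)
    have "brk (A (t [^] j)) \<ge> 1"
      using brk_pos_iff[OF vhom neX] lead[of 0 j] t(1) j by simp
    from brk_power_coprime(1)[OF vhom neX this char_k m(2)]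
    have "(A (t [^] j) ^^ m) fls_X \<noteq> fls_X" using t(1) by simp
    moreover have "A (t [^] j) ^^ m = A (t [^] (j * m))"
      using t(1) by (simp add: action_pow[symmetric] nat_pow_pow)
    moreover have "t [^] (j * m) = \<one>" using t by (simp add: pow_eq_id)
    ultimately show False by (simp add: action_one)
  qed
next
  have "\<zeta> ^ m = 1" using lead[of 0 m] t by (simp add: pow_eq_id[THEN iffD2] action_one)
  then show "m dvd j \<Longrightarrow> \<zeta> ^ j = 1" by (auto elim!: dvdE simp: power_mult)
qed

lemma brk_tame:
  assumes "0 < j" "j < m"
  shows "brk (A (s [^] (i::nat) \<otimes> t [^] j)) = 0" "A (s [^] i \<otimes> t [^] j) fls_X \<noteq> fls_X"
proof -
  have "\<zeta> ^ j \<noteq> 1" using assms by (auto simp: \<zeta>_pow dest: dvd_imp_le)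
  then have *: "fls_nth (A (s [^] i \<otimes> t [^] j) fls_X) 1 \<noteq> 1" by (simp add: lead)
  then show ne: "A (s [^] i \<otimes> t [^] j) fls_X \<noteq> fls_X" by auto
  have "\<not> brk (A (s [^] i \<otimes> t [^] j)) \<ge> 1"
    using brk_pos_iff[OF vhom ne] * s(1) t(1) by simp
  moreover have "brk (A (s [^] i \<otimes> t [^] j)) \<ge> 0"
    using brk_nonneg[OF vhom ne] s(1) t(1) by simp
  ultimately show "brk (A (s [^] i \<otimes> t [^] j)) = 0" by simp
qed

definition J :: "nat \<Rightarrow> int" where "J l = brk (A (s [^] (p ^ l)))"

lemma ppow_not_dvd: "l < n \<Longrightarrow> \<not> p ^ n dvd p ^ l"
  using p by (meson le_antisym less_le_not_le dvd_power_iff_le prime_ge_2_nat)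

lemma s_ppow_ne: "l < n \<Longrightarrow> A (s [^] (p ^ l)) fls_X \<noteq> fls_X"
  using s(1) ppow_not_dvd by (simp add: fixes_X spow_eq_one)

lemma J_pos: "l < n \<Longrightarrow> J l \<ge> 1"
  unfolding J_def using brk_pos_if_p_power[OF p char_k vhom s_ppow_ne spow_id] s(1) by simp

lemma J_Suc: "Suc l < n \<Longrightarrow> J l < J (Suc l)"
proof -
  assume l: "Suc l < n"
  have "A (s [^] (p ^ Suc l)) = A (s [^] (p ^ l)) ^^ p"
    using s(1) by (simp add: action_pow[symmetric] nat_pow_pow mult.commute)
  then show ?thesis
    unfolding J_def
    using brk_power_p[OF vhom s_ppow_ne J_pos[unfolded J_def] char_k, of l] s_ppow_ne[of "Suc l"] l s(1) by simp
qed

lemma brk_wild: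
  assumes "l < n" "\<not> p dvd c"
  shows "brk (A (s [^] (p ^ l * c))) = J l"
proof -
  have "A (s [^] (p ^ l * c)) = A (s [^] (p ^ l)) ^^ c"
    using s(1) by (simp add: action_pow[symmetric] nat_pow_pow)
  then show ?thesis
    unfolding J_def
    using brk_power_coprime(2)[OF vhom s_ppow_ne J_pos[unfolded J_def] char_k assms(2), of l] assms(1) s(1) by simp
qed

text \<open>\<open>U l\<close> is m times the l-th upper break, counted from 1, while J counts lower
  breaks from 0; the recursion is Herbrand's formula.\<close>

definition upper_jumps :: "(nat \<Rightarrow> nat) \<Rightarrow> bool" where
  "upper_jumps U \<longleftrightarrow> J 0 = int (U 1) \<and>
    (\<forall>l. Suc l < n \<longrightarrow> J (Suc l) = J l + int (p ^ Suc l) * (int (U (Suc (Suc l))) - int (U (Suc l))))"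

lemma upper_jumps_exists:
  obtains U where "upper_jumps U" "\<not> p dvd U 1"
    "\<And>l. 1 \<le> l \<Longrightarrow> l < n \<Longrightarrow> U (Suc l) = p * U l \<or> (U (Suc l) > p * U l \<and> \<not> p dvd U (Suc l))"
proof -
  interpret ah p n "TYPE('k fls)" using p char_k by (rule ah_fls)
  interpret C: cyclic_p_ext p n "TYPE('k fls)" "A s"
  proof unfold_locales
    show "A s ^^ (p ^ n) = id" using spow_id[of 1] s(1) by simp
    show "A s ^^ (p ^ (n - 1)) \<noteq> id"
      using s_ppow_ne[of "n - 1"] n s(1) by (auto simp: action_pow)
  qed (use n is_aut s(1) in auto)
  have J: "J l = brk (A s ^^ (p ^ l))" for l using s(1) by (simp add: J_def action_pow)
  show ?thesis
  proof (rule C.cyclic_upper_breaks)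
    fix U :: "nat \<Rightarrow> nat"
    assume U: "brk (A s) = int (U 1)"
      "\<And>l. 1 \<le> l \<Longrightarrow> l < n \<Longrightarrow> brk (A s ^^ (p ^ l)) = brk (A s ^^ (p ^ (l - 1))) + int (p ^ l) * (int (U (Suc l)) - int (U l))"
      "\<not> p dvd U 1" "\<And>l. 1 \<le> l \<Longrightarrow> l < n \<Longrightarrow> U (Suc l) = p * U l \<or> (U (Suc l) > p * U l \<and> \<not> p dvd U (Suc l))"
    show thesis
    proof (rule that[OF _ U(3,4)])
      show "upper_jumps U" unfolding upper_jumps_def J using U(1) U(2)[of "Suc _"] by simp
    qed
  qed
qed

definition low :: "real \<Rightarrow> 'a set" where
  "low r = {g \<in> carrier G. A g fls_X = fls_X \<or> real_of_int (\<nu> (A g fls_X - fls_X)) \<ge> r + 1}"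

definition S :: "nat \<Rightarrow> 'a set" where "S l = (\<lambda>i::nat. s [^] (p ^ l * i)) ` {..<p ^ (n - l)}"

lemma p_ge_2: "p \<ge> 2" using p by (rule prime_ge_2_nat)

sublocale jumps: step_jumps "\<lambda>l. real_of_int (J l)" p n m
  using p_ge_2 m n J_pos[of 0] J_Suc by unfold_locales auto

lemma low_iff: "g \<in> low r \<longleftrightarrow> g \<in> carrier G \<and> (g = \<one> \<or> real_of_int (brk (A g)) \<ge> r)"
  by (auto simp: low_def fixes_X brk_def)

lemma spow_cases:
  assumes "i < p ^ n" "i \<noteq> 0"
  obtains v c where "i = p ^ v * c" "\<not> p dvd c" "v < n" "brk (A (s [^] i)) = J v"
proof -
  obtain c where c: "i = p ^ multiplicity p i * c" "\<not> p dvd c"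
    using multiplicity_decompose'[of i p] assms(2) p by (metis not_prime_unit)
  define v where "v = multiplicity p i"
  have "p ^ v \<le> i" using c assms(2) by (auto simp: v_def intro: dvd_imp_le dvdI)
  then have "v < n" using assms(1) p_ge_2 by (metis le_less_trans power_less_imp_less_exp Suc_1 Suc_le_lessD)
  show ?thesis
    using c brk_wild[OF \<open>v < n\<close> c(2)] \<open>v < n\<close> by (intro that[of v c]) (simp_all add: v_def)
qed

sublocale filtration: step_filtration low S "\<lambda>l. real_of_int (J l)" p n m
proof
  have "brk (A g) \<ge> 0" if "g \<in> carrier G" "g \<noteq> \<one>" for g
    using brk_nonneg[OF vhom] that by (simp add: fixes_X)
  then have "low 0 = carrier G" by (simp add: set_eq_iff low_iff) blast
  then show "card (low 0) = p ^ n * m" by (simp add: card_carrier)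
  show "card (S l) = p ^ (n - l)" if l: "l \<le> n" for l
  proof -
    have "inj_on (\<lambda>i::nat. s [^] (p ^ l * i)) {..<p ^ (n - l)}"
    proof (rule inj_onI)
      fix i j assume ij: "i \<in> {..<p ^ (n - l)}" "j \<in> {..<p ^ (n - l)}" "s [^] (p ^ l * i) = s [^] (p ^ l * j)"
      have pn: "p ^ n = p ^ l * p ^ (n - l)" using l by (simp flip: power_add)
      then have "p ^ l * i < p ^ n" "p ^ l * j < p ^ n" using ij(1,2) p_ge_2 by simp_all
      then have "p ^ l * i = p ^ l * j" using ij(3) unfolding spow_eq_iff by (rule cong_less_modulus_unique_nat[rotated])
      then show "i = j" using p_ge_2 by simp
    qed
    then show ?thesis unfolding S_def by (simp add: card_image)
  qed
  show "low r = S (jumps.lev r)" if r: "r > 0" for r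
  proof (intro equalityI subsetI)
    fix g assume g: "g \<in> low r"
    then have gG: "g \<in> carrier G" by (simp add: low_iff)
    then obtain i j where ij: "i < p ^ n" "j < m" "g = s [^] i \<otimes> t [^] j" by (rule elem_cases)
    have "j = 0"
    proof (rule ccontr)
      assume "j \<noteq> 0"
      then have "brk (A g) = 0" "A g fls_X \<noteq> fls_X" using brk_tame[of j i] ij by auto
      then show False using g r by (auto simp: low_iff action_one)
    qed
    then have gi: "g = s [^] i" using ij s(1) by simp
    show "g \<in> S (jumps.lev r)"
    proof (cases "i = 0")
      case True
      then show ?thesis unfolding gi S_def using p_ge_2 by (intro image_eqI[of _ _ 0]) auto
    next
      case False
      then obtain v c where v: "i = p ^ v * c" "\<not> p dvd c" "v < n" "brk (A (s [^] i)) = J v"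
        using spow_cases[OF ij(1)] by metis
      have "g \<noteq> \<one>" unfolding gi spow_eq_one using False ij(1) by (auto dest: dvd_imp_le)
      then have "\<not> real_of_int (J v) < r" using g v(4) gi by (auto simp: low_iff)
      then have "jumps.lev r \<le> v" using jumps.J_less_iff[OF v(3)] by simp
      then have i: "i = p ^ jumps.lev r * (p ^ (v - jumps.lev r) * c)" by (simp add: v(1) flip: power_add mult.assoc)
      have "p ^ n = p ^ jumps.lev r * p ^ (n - jumps.lev r)" using jumps.lev_le[of r] by (simp flip: power_add)
      then have "p ^ (v - jumps.lev r) * c < p ^ (n - jumps.lev r)" using ij(1) i by (metis mult_less_cancel1)
      then show ?thesis unfolding gi S_def by (subst i) (intro imageI, simp)
    qed
  next
    fix g assume "g \<in> S (jumps.lev r)"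
    then obtain k where k: "k < p ^ (n - jumps.lev r)" "g = s [^] (p ^ jumps.lev r * k)" by (auto simp: S_def)
    define i where "i = p ^ jumps.lev r * k"
    have "p ^ n = p ^ jumps.lev r * p ^ (n - jumps.lev r)" using jumps.lev_le[of r] by (simp flip: power_add)
    then have ilt: "i < p ^ n" using k p_ge_2 by (simp add: i_def)
    show "g \<in> low r"
    proof (cases "i = 0")
      case True
      then have "g = \<one>" using k(2) by (simp only: i_def[symmetric] nat_pow_0)
      then show ?thesis by (simp add: low_iff)
    next
      case False
      then obtain v c where v: "i = p ^ v * c" "\<not> p dvd c" "v < n" "brk (A (s [^] i)) = J v"
        using spow_cases[OF ilt] by metis
      have "p ^ jumps.lev r dvd p ^ v"
      proof -
        have "coprime (p ^ jumps.lev r) c" using p v(2) by (simp add: prime_imp_coprime)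
        moreover have "p ^ jumps.lev r dvd p ^ v * c" using v(1) by (simp add: i_def flip: v(1))
        ultimately show ?thesis by (simp add: coprime_dvd_mult_left_iff)
      qed
      then have "jumps.lev r \<le> v" using p_ge_2 by (simp add: dvd_power_iff_le)
      then have "\<not> real_of_int (J v) < r" using jumps.J_less_iff[OF v(3)] by simp
      then show ?thesis using k s(1) v(4) by (simp add: low_iff i_def)
    qed
  qed
qed

lemma upper_breaks:
  assumes "upper_jumps U"
  shows "{x. x > 0 \<and> (\<forall>\<epsilon>>0. low (the_inv_into {0..} filtration.herb (x + \<epsilon>)) \<noteq>
      low (the_inv_into {0..} filtration.herb x))} = (\<lambda>l. real (U l) / real m) ` {1..n}"
proof -
  have "filtration.herb (real_of_int (J l)) = real (U (Suc l)) / real m" if "l < n" for l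
    using that by (rule filtration.herb_J[rotated 2]) (use assms in \<open>simp_all add: upper_jumps_def\<close>)
  moreover have "{1..n} = Suc ` {..<n}" by (simp add: image_Suc_lessThan)
  ultimately show ?thesis unfolding filtration.breaks by (simp add: image_image)
qed

text \<open>Compare two actions of t at the break: conjugation replaces \<alpha> by its power
  \<kappa>, which multiplies the leading coefficient of \<alpha> X - X by \<kappa>, whereas t itself
  scales a term of order J + 1 by \<open>\<zeta>^(J+1)\<close>. One factor \<zeta> cancels, as X is
  also scaled.\<close>

lemma tame_character:
  assumes l: "l < n"
  shows "\<zeta> ^ nat (J l) = of_nat \<kappa>"
proof -
  define \<alpha> where "\<alpha> = A (s [^] (p ^ l))"
  define w where "w = \<alpha> fls_X - fls_X"
  define a where "a = fls_nth w (J l + 1)"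
  have \<alpha>: "vhom \<alpha> 1" "\<alpha> fls_X \<noteq> fls_X" using vhom s_ppow_ne[OF l] s(1) by (simp_all add: \<alpha>_def)
  have brk\<alpha>: "brk \<alpha> = J l" by (simp add: \<alpha>_def J_def)
  have sub: "\<nu> w = J l + 1" using brk\<alpha> by (simp add: brk_def w_def)
  have w0: "w \<noteq> 0" using \<alpha>(2) by (simp add: w_def)
  have a0: "a \<noteq> 0" using w0 sub by (metis a_def nth_fls_subdegree_nonzero)
  have J1: "J l \<ge> 1" using J_pos[OF l] .
  interpret T: vhom "A t" 1 using t(1) by (rule vhom)
  interpret K: vhom "\<alpha> ^^ \<kappa>" 1 using \<alpha>(1) by (rule vhom_funpow)
  define N where "N = J l + 2"
  have "t \<otimes> s [^] (p ^ l) = s [^] (\<kappa> * p ^ l) \<otimes> t" by (rule conj_pow_right)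
  then have "A t (\<alpha> fls_X) = A (s [^] (\<kappa> * p ^ l)) (A t fls_X)"
    unfolding \<alpha>_def using s(1) t(1) by (metis action nat_pow_closed)
  also have pow_eq: "A (s [^] (\<kappa> * p ^ l)) = \<alpha> ^^ \<kappa>"
    using s(1) by (simp add: \<alpha>_def action_pow[symmetric] nat_pow_pow mult.commute)
  finally have comm: "A t (\<alpha> fls_X) = (\<alpha> ^^ \<kappa>) (A t fls_X)" .
  define x where "x = A t fls_X"
  have x: "vge 1 x" by (simp add: x_def vge_def T.subdegree)
  define v where "v = x - fls_const \<zeta> * fls_X"
  have v: "vge 2 v"
  proof -
    have "fls_nth v k = 0" if "k < 2" for k
      using that x by (cases "k = 1") (simp_all add: v_def x_def vge_iff)
    then show ?thesis by (simp add: vge_iff)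
  qed
  have "fls_nth (A t w) (J l + 1) = a * \<zeta> ^ nat (J l + 1)"
    using vhom_leading[OF vhom[OF t(1)], of "nat (J l + 1)" w] sub J1 by (simp add: vge_def a_def)
  moreover have "A t w = (\<alpha> ^^ \<kappa>) x - x" using comm by (simp add: w_def x_def T.diff)
  moreover have "fls_nth ((\<alpha> ^^ \<kappa>) x - x) (J l + 1) = \<zeta> * (of_nat \<kappa> * a)"
  \<comment> \<open>\<open>brk\<close> carries no information for a map fixing X; in that case both
    sides vanish.\<close>
  proof (cases "(\<alpha> ^^ \<kappa>) fls_X = fls_X")
    case True
    have "vge N (of_nat \<kappa> * w)" using brk_power[OF \<alpha> J1[folded brk\<alpha>], of \<kappa>] True
      by (simp add: N_def brk\<alpha> w_def vge_uminus)
    then have "of_nat \<kappa> * a = 0" by (simp add: vge_iff N_def a_def fls_of_nat)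
    moreover have "\<alpha> ^^ \<kappa> = id"
    proof -
      have "s [^] (\<kappa> * p ^ l) = \<one>"
        using True s(1) fixes_X[of "s [^] (\<kappa> * p ^ l)"] by (simp add: pow_eq)
      then show ?thesis using pow_eq action_one by simp
    qed
    ultimately show ?thesis by simp
  next
    case False
    define e where "e = (\<alpha> ^^ \<kappa>) fls_X - fls_X"
    have e: "vge N (e - of_nat \<kappa> * w)"
      using brk_power[OF \<alpha> J1[folded brk\<alpha>], of \<kappa>] by (simp add: N_def brk\<alpha> w_def e_def)
    then have enth: "fls_nth e (J l + 1) = of_nat \<kappa> * a" by (simp add: vge_iff N_def a_def fls_of_nat)
    have "vge (J l + 1) e"
    proof -
      have "vge (J l + 1) (of_nat \<kappa> * w)" using sub by (simp add: vge_iff fls_of_nat)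
      then have "vge (J l + 1) ((e - of_nat \<kappa> * w) + of_nat \<kappa> * w)" using e
        by (intro vge_add vge_mono[OF e]) (simp_all add: N_def)
      then show ?thesis by simp
    qed
    then have "brk (\<alpha> ^^ \<kappa>) \<ge> J l" using False by (simp add: brk_def e_def vge_def)
    have "vge N ((\<alpha> ^^ \<kappa>) v - v)"
    proof (cases "v = 0")
      case False
      have "vge (\<nu> v + brk (\<alpha> ^^ \<kappa>)) ((\<alpha> ^^ \<kappa>) v - v)"
        using brk_ge[OF vhom_funpow[OF \<alpha>(1)] \<open>(\<alpha> ^^ \<kappa>) fls_X \<noteq> fls_X\<close>] .
      then show ?thesis by (rule vge_mono) (use v False \<open>brk (\<alpha> ^^ \<kappa>) \<ge> J l\<close> in \<open>simp add: vge_def N_def\<close>)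
    qed simp
    moreover have "(\<alpha> ^^ \<kappa>) x - x = fls_const \<zeta> * e + ((\<alpha> ^^ \<kappa>) v - v)"
      by (simp add: v_def e_def K.diff K.mult algebra_simps)
    ultimately show ?thesis using enth by (simp add: vge_iff N_def)
  qed
  ultimately have "a * \<zeta> ^ nat (J l + 1) = \<zeta> * (of_nat \<kappa> * a)" by simp
  moreover have "nat (J l + 1) = Suc (nat (J l))" using J1 by simp
  moreover have "\<zeta> \<noteq> 0" using \<zeta>_pow[of m] m by (auto simp: power_0_left)
  ultimately show ?thesis using a0 by (simp add: mult_ac)
qed

end

text \<open>In the factorization of \<open>x^m - 1\<close> the cofactor of x - 1 is congruent to m
  modulo p, hence prime to p, so the whole power of p divides x - 1.\<close>

lemma cong_1_lift:
  fixes p n m x :: nat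
  assumes p: "prime p" "\<not> p dvd m" and "n \<ge> 1" "[x ^ m = 1] (mod p ^ n)"
  shows "[x = 1] (mod p ^ n) \<longleftrightarrow> [x = 1] (mod p)"
proof
  assume "[x = 1] (mod p ^ n)"
  then show "[x = 1] (mod p)" using assms(3) by (metis cong_dvd_modulus_nat dvd_power less_le_trans zero_less_one)
next
  assume x: "[x = 1] (mod p)"
  have xi: "[int x = 1] (mod int p)" using x by (metis cong_int_iff of_nat_1)
  have "[(\<Sum>i<m. int x ^ i) = (\<Sum>i<m. 1 ^ i)] (mod int p)"
    by (intro cong_sum cong_pow xi)
  then have "[(\<Sum>i<m. int x ^ i) = int m] (mod int p)" by simp
  then have "\<not> int p dvd (\<Sum>i<m. int x ^ i)" using p(2) by (simp add: cong_dvd_iff)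
  then have cop: "coprime (int p ^ n) (\<Sum>i<m. int x ^ i)"
    using p(1) by (simp add: prime_imp_coprime)
  have "int p ^ n dvd int x ^ m - 1"
    using assms(4) by (metis cong_iff_dvd_diff cong_int_iff of_nat_1 of_nat_power)
  also have "int x ^ m - 1 = (int x - 1) * (\<Sum>i<m. int x ^ i)" by (rule power_diff_1_eq)
  finally have "int p ^ n dvd int x - 1" using cop by (simp add: coprime_dvd_mult_left_iff)
  then show "[x = 1] (mod p ^ n)" by (metis cong_iff_dvd_diff cong_int_iff of_nat_1 of_nat_power)
qed

lemma card_annihilator:
  fixes a m :: nat
  assumes "m \<ge> 1"
  shows "card {j. j < m \<and> m dvd a * j} = gcd m a"
proof -
  define g where "g = gcd m a"
  have g0: "g > 0" using assms by (simp add: g_def)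
  define b where "b = m div g"
  have mb: "m = b * g" by (simp add: b_def g_def)
  have b0: "b > 0" using assms mb by (cases b) auto
  have "m dvd a * j \<longleftrightarrow> b dvd j" for j
  proof -
    have "a = (a div g) * g" by (simp add: g_def)
    then have "m dvd a * j \<longleftrightarrow> b * g dvd ((a div g) * j) * g" using mb by (metis mult.assoc mult.commute)
    also have "\<dots> \<longleftrightarrow> b dvd (a div g) * j" using g0 by simp
    also have "\<dots> \<longleftrightarrow> b dvd j"
    proof -
      have "coprime b (a div g)" unfolding b_def g_def using assms by (intro div_gcd_coprime) auto
      then show ?thesis by (simp add: coprime_dvd_mult_right_iff)
    qed
    finally show ?thesis .
  qed
  then have "{j. j < m \<and> m dvd a * j} = (\<lambda>i. b * i) ` {..<g}"
    using b0 by (auto simp: mb elim!: dvdE)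
  moreover have "inj_on (\<lambda>i. b * i) {..<g}" using b0 by (auto simp: inj_on_def)
  ultimately show ?thesis by (simp add: card_image g_def)
qed

section \<open>The centralizer and the congruences modulo m\<close>

context ramified_action
begin

text \<open>In k the exponent \<kappa> is visible modulo p only; \<open>cong_1_lift\<close> raises
  this to \<open>p^n\<close> since \<open>\<kappa>^m\<close> is 1 there.\<close>

lemma \<kappa>_pow:
  assumes "l < n"
  shows "[\<kappa> ^ j = 1] (mod p ^ n) \<longleftrightarrow> m dvd nat (J l) * j"
proof -
  have "[(\<kappa> ^ j) ^ m = 1] (mod p ^ n)"
    using cong_pow[OF chi_pow, of j] by (simp add: mult.commute flip: power_mult)
  then have "[\<kappa> ^ j = 1] (mod p ^ n) \<longleftrightarrow> [\<kappa> ^ j = 1] (mod p)"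
    using cong_1_lift p m(2) n by blast
  also have "\<dots> \<longleftrightarrow> (of_nat (\<kappa> ^ j) :: 'k) = of_nat 1"
    using char_k by (simp only: of_nat_eq_iff_cong_CHAR)
  also have "\<dots> \<longleftrightarrow> (\<zeta> ^ nat (J l)) ^ j = 1" unfolding tame_character[OF assms] by simp
  also have "\<dots> \<longleftrightarrow> m dvd nat (J l) * j" unfolding power_mult[symmetric] by (rule \<zeta>_pow)
  finally show ?thesis .
qed

lemma centralizer_index: "card (centralizer G s) div p ^ n = gcd m (nat (J 0))"
  using n \<kappa>_pow[of 0] card_annihilator[OF m(1), of "nat (J 0)"] pn by (simp add: card_centralizer)

lemma J_cong:
  assumes "l < n"
  shows "[nat (J l) = nat (J 0)] (mod m)"
proof -
  have eq: "\<zeta> ^ nat (J l) = \<zeta> ^ nat (J 0)" using tame_character[OF assms] tame_character[of 0] n by simp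
  have z: "\<zeta> \<noteq> 0" using \<zeta>_pow[of m] m by (auto simp: power_0_left)
  have *: "[a = b] (mod m)" if "\<zeta> ^ a = \<zeta> ^ b" "a \<le> b" for a b
  proof -
    have "\<zeta> ^ a * \<zeta> ^ (b - a) = \<zeta> ^ b" using that(2) by (simp flip: power_add)
    then have "\<zeta> ^ (b - a) = 1" using z that(1) by simp
    then show ?thesis using that(2) by (metis \<zeta>_pow cong_altdef_nat cong_sym_eq)
  qed
  show ?thesis using *[OF eq] *[OF eq[symmetric]] by (metis cong_sym_eq nat_le_linear)
qed

text \<open>All lower breaks agree modulo m, since the tame character takes the same value at each
  of them; differences of U are obtained after division by powers of p, which are units modulo
  m.\<close>

lemma U_cong:
  assumes U: "upper_jumps U"
  shows "l < n \<Longrightarrow> [U (Suc l) = U 1] (mod m)"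
proof (induction l)
  case (Suc l)
  have "[int (nat (J (Suc l))) = int (nat (J l))] (mod int m)"
    using J_cong[of l] J_cong[of "Suc l"] Suc.prems unfolding cong_int_iff by (metis Suc_lessD cong_sym cong_trans)
  then have "[J (Suc l) = J l] (mod int m)" using J_pos[of l] J_pos[of "Suc l"] Suc.prems by simp
  then have "int m dvd int (p ^ Suc l) * (int (U (Suc (Suc l))) - int (U (Suc l)))"
    using U Suc.prems by (simp add: upper_jumps_def cong_iff_dvd_diff)
  moreover have "coprime (int m) (int (p ^ Suc l))"
  proof -
    have "coprime m (p ^ Suc l)" using p m(2) by (metis coprime_commute coprime_power_left_iff prime_imp_coprime)
    then show ?thesis by (simp only: coprime_int_iff)
  qed
  ultimately have "int m dvd int (U (Suc (Suc l))) - int (U (Suc l))" by (simp only: coprime_dvd_mult_right_iff)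
  then have "[U (Suc (Suc l)) = U (Suc l)] (mod m)" by (metis cong_iff_dvd_diff cong_int_iff)
  then show ?case using Suc by (metis Suc_lessD cong_trans)
qed simp

end

section \<open>Uniformization of totally ramified extensions\<close>

text \<open>Neither completeness of L nor its residue field is part of the data:
  \<open>algebraic\<close> yields that the residue field is k, and \<open>rel_surj\<close> takes the
  place of completeness.\<close>

locale valued_ext = field_hom \<iota> for \<iota> :: "'k::alg_closed_field fls \<Rightarrow> 'b::field" +
  fixes L :: "'b set" and v :: "'b \<Rightarrow> int" and \<pi> :: 'b and e :: nat
  assumes \<iota>_in: "\<iota> f \<in> L"
    and add_in: "x \<in> L \<Longrightarrow> y \<in> L \<Longrightarrow> x + y \<in> L"
    and mult_in: "x \<in> L \<Longrightarrow> y \<in> L \<Longrightarrow> x * y \<in> L"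
    and inverse_in: "x \<in> L \<Longrightarrow> inverse x \<in> L"
    and v_mult: "x \<in> L \<Longrightarrow> y \<in> L \<Longrightarrow> x \<noteq> 0 \<Longrightarrow> y \<noteq> 0 \<Longrightarrow> v (x * y) = v x + v y"
    and v_add: "x \<in> L \<Longrightarrow> y \<in> L \<Longrightarrow> x \<noteq> 0 \<Longrightarrow> y \<noteq> 0 \<Longrightarrow> x + y \<noteq> 0 \<Longrightarrow> min (v x) (v y) \<le> v (x + y)"
    and e_pos: "e \<ge> 1" and v_\<iota>: "f \<noteq> 0 \<Longrightarrow> v (\<iota> f) = int e * \<nu> f"
    and \<pi>: "\<pi> \<in> L" "\<pi> \<noteq> 0" "v \<pi> = 1"
    and algebraic: "x \<in> L \<Longrightarrow> \<exists>q. q \<noteq> 0 \<and> poly (map_poly \<iota> q) x = 0"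
begin

definition vL :: "int \<Rightarrow> 'b \<Rightarrow> bool" where "vL N x \<longleftrightarrow> x \<in> L \<and> (x = 0 \<or> N \<le> v x)"

abbreviation C :: "'k \<Rightarrow> 'b" where "C c \<equiv> \<iota> (fls_const c)"

lemma C_hom: "field_hom (\<lambda>c. C c)"
  using field_hom_comp[OF field_hom_axioms field_hom_fls_const] by simp

sublocale C: field_hom "\<lambda>c. C c" by (rule C_hom)

lemma one_in [simp]: "1 \<in> L" using \<iota>_in[of 1] by simp
lemma zero_in [simp]: "0 \<in> L" using \<iota>_in[of 0] by simp

lemma minus_in [simp]: "x \<in> L \<Longrightarrow> - x \<in> L"
  using mult_in[OF \<iota>_in[of "-1"], of x] by (simp add: uminus)

lemma v_neg: "x \<in> L \<Longrightarrow> v (- x) = v x"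
  using v_mult[OF \<iota>_in[of "-1"], of x] v_\<iota>[of "-1"] by (cases "x = 0") (simp_all add: uminus)

lemma vL_0 [simp]: "vL N 0" by (simp add: vL_def)

lemma vL_mono: "vL M x \<Longrightarrow> N \<le> M \<Longrightarrow> vL N x" by (auto simp: vL_def)

lemma vL_add: "vL N x \<Longrightarrow> vL N y \<Longrightarrow> vL N (x + y)"
  using v_add[of x y] add_in[of x y] by (cases "x = 0 \<or> y = 0 \<or> x + y = 0") (auto simp: vL_def)

lemma vL_diff: "vL N x \<Longrightarrow> vL N y \<Longrightarrow> vL N (x - y)"
  using vL_add[of N x "- y"] v_neg[of y] by (auto simp: vL_def)

lemma vL_mult: "vL M x \<Longrightarrow> vL N y \<Longrightarrow> vL (M + N) (x * y)"
  using v_mult[of x y] mult_in[of x y] by (auto simp: vL_def)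

lemma vL_power: "vL 0 x \<Longrightarrow> vL 0 (x ^ n)"
proof (induction n)
  case 0
  show ?case using v_\<iota>[of 1] one_in by (simp add: vL_def)
next
  case (Suc n)
  then show ?case using vL_mult[of 0 x 0 "x ^ n"] by simp
qed

lemma vL_sum: "(\<And>i. i \<in> A \<Longrightarrow> vL N (f i)) \<Longrightarrow> vL N (sum f A)"
  by (induction A rule: infinite_finite_induct) (auto intro: vL_add)

lemma vL_\<iota>: "vge N f \<Longrightarrow> vL (int e * N) (\<iota> f)"
  using v_\<iota>[of f] \<iota>_in e_pos by (auto simp: vL_def vge_def)

lemma v_C: "c \<noteq> 0 \<Longrightarrow> v (C c) = 0" using v_\<iota>[of "fls_const c"] by (simp add: fls_const_nonzero)

lemma vL_C: "vL 0 (C c)" using v_C[of c] \<iota>_in by (cases "c = 0") (auto simp: vL_def)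

text \<open>Over the algebraically closed k the polynomial splits into factors x - c; if all of them
  were units, so would be the value.\<close>

lemma vL_factor:
  assumes "q \<noteq> 0" "vL 0 x" "vL 1 (poly (map_poly (\<lambda>c. C c) q) x)"
  shows "\<exists>c. vL 1 (x - C c)"
  using assms(1,3)
proof (induction "degree q" arbitrary: q)
  case 0
  then obtain a where "q = [:a:]" by (metis degree_eq_zeroE)
  with 0 have "a \<noteq> 0" "vL 1 (C a)" by (auto simp: map_poly_pCons)
  then show ?case using v_C[of a] by (simp add: vL_def fls_const_nonzero)
next
  case (Suc d)
  then obtain r where "poly q r = 0" using alg_closed_imp_poly_has_root[of q] by auto
  then obtain q' where q': "q = [:-r, 1:] * q'" by (metis dvdE poly_eq_0_iff_dvd)
  have q0: "q' \<noteq> 0" using q' Suc.prems by auto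
  have deg: "d = degree q'"
    using Suc.hyps(2) q0 degree_mult_eq[of "[:-r, 1:]" q'] unfolding q' by (simp del: mult_pCons_left)
  have ev: "poly (map_poly (\<lambda>c. C c) q) x = (x - C r) * poly (map_poly (\<lambda>c. C c) q') x"
    unfolding q' C.poly_map_mult by (simp add: map_poly_pCons uminus)
  show ?case
  proof (cases "vL 1 (x - C r)")
    case False
    have "vL 0 (x - C r)" using assms(2) vL_C by (intro vL_diff)
    with False have ne: "x - C r \<in> L" "x - C r \<noteq> 0" "v (x - C r) = 0" by (auto simp: vL_def)
    define y where "y = poly (map_poly (\<lambda>c. C c) q') x"
    have "y \<in> L"
    proof -
      have "vL 0 y" unfolding y_def C.poly_map_altdef[OF lessI]
        using vL_mult[OF vL_C vL_power[OF assms(2)]] by (intro vL_sum) simp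
      then show ?thesis by (simp add: vL_def)
    qed
    then have "vL 1 y" using Suc.prems(2) ne v_mult[of "x - C r" y] unfolding ev y_def[symmetric]
      by (auto simp: vL_def)
    then show ?thesis using Suc.hyps(1)[OF deg q0] by (simp add: y_def)
  qed blast
qed

lemma residue:
  assumes x: "vL 0 x"
  shows "\<exists>c. vL 1 (x - C c)"
proof -
  obtain q where q: "q \<noteq> 0" "poly (map_poly \<iota> q) x = 0" using algebraic x by (auto simp: vL_def)
  define B where "B = {\<nu> (coeff q i) |i. i \<le> degree q \<and> coeff q i \<noteq> 0}"
  have B: "finite B" "B \<noteq> {}" using q(1) leading_coeff_neq_0[of q] by (auto simp: B_def)
  obtain i0 where i0: "i0 \<le> degree q" "coeff q i0 \<noteq> 0" "\<nu> (coeff q i0) = Min B"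
    using Min_in[OF B] by (auto simp: B_def)
  \<comment> \<open>After this scaling all coefficients are integral and one is a unit, so the
    reduction to k is a nonzero polynomial.\<close>
  define b where "b i = fls_X powi (- Min B) * coeff q i" for i
  define d where "d = Suc (degree q)"
  have b: "vge 0 (b i)" for i
  proof (cases "coeff q i = 0")
    case False
    then have "\<nu> (coeff q i) \<in> B" by (auto simp: B_def intro: le_degree)
    then have "Min B \<le> \<nu> (coeff q i)" using B by simp
    then show ?thesis using False by (simp add: b_def vge_def)
  qed (simp add: b_def)
  have sum0: "(\<Sum>i<d. \<iota> (b i) * x ^ i) = 0"
  proof -
    have "(\<Sum>i<d. \<iota> (b i) * x ^ i) = \<iota> (fls_X powi (- Min B)) * poly (map_poly \<iota> q) x"
      unfolding poly_map_altdef[OF lessI] d_def by (simp add: b_def mult sum_distrib_left mult.assoc del: sum.lessThan_Suc)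
    then show ?thesis by (simp add: q)
  qed
  define qb where "qb = (\<Sum>i<d. monom (fls_nth (b i) 0) i)"
  have qb: "poly (map_poly (\<lambda>c. C c) qb) x = (\<Sum>i<d. C (fls_nth (b i) 0) * x ^ i)"
    unfolding qb_def C.poly_map_sum by (simp add: map_poly_monom poly_monom)
  have "poly (map_poly (\<lambda>c. C c) qb) x = - (\<Sum>i<d. \<iota> (b i - fls_const (fls_nth (b i) 0)) * x ^ i)"
    unfolding qb diff left_diff_distrib sum_subtractf sum0 by simp
  moreover have "vL 1 (\<Sum>i<d. \<iota> (b i - fls_const (fls_nth (b i) 0)) * x ^ i)"
  proof (intro vL_sum)
    fix i
    have "fls_nth (b i - fls_const (fls_nth (b i) 0)) k = 0" if "k < 1" for k
      using b[of i] that by (cases "k = 0") (simp_all add: vge_iff)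
    then have "vge 1 (b i - fls_const (fls_nth (b i) 0))" unfolding vge_iff by blast
    from vL_\<iota>[OF this] have "vL 1 (\<iota> (b i - fls_const (fls_nth (b i) 0)))"
      by (rule vL_mono) (use e_pos in simp)
    from vL_mult[OF this vL_power[OF x]] show "vL 1 (\<iota> (b i - fls_const (fls_nth (b i) 0)) * x ^ i)" by simp
  qed
  ultimately have "vL 1 (poly (map_poly (\<lambda>c. C c) qb) x)" using vL_diff[OF vL_0] by simp
  moreover have "qb \<noteq> 0"
  proof -
    have "coeff qb i0 = fls_nth (b i0) 0" using i0(1) by (simp add: qb_def coeff_sum d_def)
    also have "\<dots> = fls_nth (b i0) (\<nu> (b i0))" using i0(2,3) by (simp add: b_def)
    also have "\<dots> \<noteq> 0" using i0(2) by (intro nth_fls_subdegree_nonzero) (simp add: b_def)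
    finally show ?thesis by auto
  qed
  ultimately show ?thesis using vL_factor x by blast
qed

section \<open>Expansion in the uniformizer\<close>

abbreviation F_ev :: "'k poly \<Rightarrow> 'k fls" where "F_ev q \<equiv> poly (map_poly fls_const q) fls_X"
abbreviation L_ev :: "'k poly \<Rightarrow> 'b" where "L_ev q \<equiv> poly (map_poly (\<lambda>c. C c) q) \<pi>"

sublocale K: field_hom "fls_const :: 'k \<Rightarrow> 'k fls" by (rule field_hom_fls_const)

text \<open>In both fields the lowest nonzero coefficient determines the valuation, because
  constants are units and both uniformizers have valuation 1.\<close>

lemma ev_valuation:
  "q \<noteq> 0 \<Longrightarrow> \<exists>k::nat. F_ev q \<noteq> 0 \<and> \<nu> (F_ev q) = int k \<and> L_ev q \<in> L \<and> L_ev q \<noteq> 0 \<and> v (L_ev q) = int k"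
proof (induction q)
  case (pCons a q)
  show ?case
  proof (cases "q = 0")
    case True
    then show ?thesis using pCons.hyps v_C[of a] \<iota>_in
      by (intro exI[of _ 0]) (auto simp: map_poly_pCons fls_const_nonzero)
  next
    case False
    then obtain k :: nat where k: "F_ev q \<noteq> 0" "\<nu> (F_ev q) = int k" "L_ev q \<in> L" "L_ev q \<noteq> 0" "v (L_ev q) = int k"
      using pCons.IH by blast
    have F1: "\<nu> (fls_X * F_ev q) = int (Suc k)" "fls_X * F_ev q \<noteq> 0" using k by simp_all
    have L1: "v (\<pi> * L_ev q) = int (Suc k)" "\<pi> * L_ev q \<noteq> 0" "\<pi> * L_ev q \<in> L"
      using k \<pi> v_mult[of \<pi> "L_ev q"] mult_in by simp_all
    have ev: "F_ev (pCons a q) = fls_const a + fls_X * F_ev q" "L_ev (pCons a q) = C a + \<pi> * L_ev q"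
      by (simp_all add: map_poly_pCons)
    show ?thesis
    proof (cases "a = 0")
      case True
      then show ?thesis using F1 L1 unfolding ev by (intro exI[of _ "Suc k"]) simp
    next
      case False
      have F: "vge 1 (fls_X * F_ev q)" using F1 by (simp add: vge_def)
      have "fls_nth (F_ev (pCons a q)) 0 = a" "vge 0 (F_ev (pCons a q))"
        using F unfolding ev by (auto simp: vge_iff)
      then have F0: "F_ev (pCons a q) \<noteq> 0" "\<nu> (F_ev (pCons a q)) = 0"
        using False by (auto simp: vge_iff intro!: fls_subdegree_eqI)
      have inL: "L_ev (pCons a q) \<in> L" unfolding ev using L1 \<iota>_in add_in by blast
      have "vL 0 (L_ev (pCons a q))" unfolding ev using L1 by (intro vL_add vL_C) (simp add: vL_def)
      moreover have "\<not> vL 1 (L_ev (pCons a q))"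
      proof
        assume "vL 1 (L_ev (pCons a q))"
        moreover have "vL 1 (\<pi> * L_ev q)" using L1 by (simp add: vL_def)
        ultimately have "vL 1 (C a)" unfolding ev using vL_diff[of 1 "C a + \<pi> * L_ev q" "\<pi> * L_ev q"] by simp
        then show False using v_C[OF False] False by (simp add: vL_def fls_const_nonzero)
      qed
      ultimately show ?thesis using F0 inL by (intro exI[of _ 0]) (auto simp: vL_def)
    qed
  qed
qed simp

text \<open>P is a Laurent polynomial and x its value at \<pi>; multiplication by the M-th power
  clears denominators.\<close>

definition ap :: "'k fls \<Rightarrow> 'b \<Rightarrow> bool" where
  "ap P x \<longleftrightarrow> (\<exists>(M::nat) q. P * fls_X ^ M = F_ev q \<and> x * \<pi> ^ M = L_ev q)"

lemma v_pow_\<pi>: "v (\<pi> ^ M) = int M" "\<pi> ^ M \<in> L"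
proof (induction M)
  case 0
  show "v (\<pi> ^ 0) = int 0" "\<pi> ^ 0 \<in> L" using v_\<iota>[of 1] by simp_all
next
  case (Suc M)
  then show "v (\<pi> ^ Suc M) = int (Suc M)" "\<pi> ^ Suc M \<in> L" using \<pi> v_mult[of \<pi> "\<pi> ^ M"] mult_in by simp_all
qed

lemma ap_valuation: "ap P x \<Longrightarrow> vge N P \<longleftrightarrow> vL N x"
proof -
  assume "ap P x"
  then obtain M q where Mq: "P * fls_X ^ M = F_ev q" "x * \<pi> ^ M = L_ev q" by (auto simp: ap_def)
  show ?thesis
  proof (cases "q = 0")
    case True
    then show ?thesis using Mq \<pi> by simp
  next
    case False
    then obtain k :: nat where k: "F_ev q \<noteq> 0" "\<nu> (F_ev q) = int k" "L_ev q \<in> L" "L_ev q \<noteq> 0" "v (L_ev q) = int k"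
      using ev_valuation by blast
    have x: "x = L_ev q * inverse (\<pi> ^ M)" using Mq(2) \<pi> by (simp add: field_simps)
    have xL: "x \<in> L" unfolding x using k v_pow_\<pi> mult_in inverse_in by blast
    have ne: "P \<noteq> 0" "x \<noteq> 0" using Mq k by auto
    have "\<nu> P + int M = int k"
      using k(2) ne unfolding Mq(1)[symmetric] by (simp add: fls_subdegree_pow)
    moreover have "v x + int M = int k"
      using v_mult[of x "\<pi> ^ M"] v_pow_\<pi>[of M] xL ne \<pi>(2) k(5) unfolding Mq(2)[symmetric] by simp
    ultimately have "\<nu> P = v x" by simp
    then show ?thesis using ne xL by (simp add: vge_def vL_def)
  qed
qed

lemma ev_monom: "F_ev (monom 1 j) = fls_X ^ j" "L_ev (monom 1 j) = \<pi> ^ j"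
  by (simp_all add: map_poly_monom poly_monom)

lemma ap_mult: "ap P x \<Longrightarrow> ap Q y \<Longrightarrow> ap (P * Q) (x * y)"
proof -
  assume "ap P x" "ap Q y"
  then obtain M q N r where *: "P * fls_X ^ M = F_ev q" "x * \<pi> ^ M = L_ev q"
      "Q * fls_X ^ N = F_ev r" "y * \<pi> ^ N = L_ev r" by (auto simp: ap_def)
  show ?thesis unfolding ap_def
  proof (intro exI conjI)
    show "P * Q * fls_X ^ (M + N) = F_ev (q * r)"
      unfolding K.poly_map_mult *[symmetric] by (simp add: power_add)
    show "x * y * \<pi> ^ (M + N) = L_ev (q * r)"
      unfolding C.poly_map_mult *[symmetric] by (simp add: power_add)
  qed
qed

lemma ap_add: "ap P x \<Longrightarrow> ap Q y \<Longrightarrow> ap (P + Q) (x + y)"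
proof -
  assume "ap P x" "ap Q y"
  then obtain M q N r where *: "P * fls_X ^ M = F_ev q" "x * \<pi> ^ M = L_ev q"
      "Q * fls_X ^ N = F_ev r" "y * \<pi> ^ N = L_ev r" by (auto simp: ap_def)
  show ?thesis unfolding ap_def
  proof (intro exI conjI)
    show "(P + Q) * fls_X ^ (M + N) = F_ev (q * monom 1 N + r * monom 1 M)"
      unfolding K.poly_map_add K.poly_map_mult ev_monom *[symmetric] by (simp add: power_add algebra_simps)
    show "(x + y) * \<pi> ^ (M + N) = L_ev (q * monom 1 N + r * monom 1 M)"
      unfolding C.poly_map_add C.poly_map_mult ev_monom *[symmetric] by (simp add: power_add algebra_simps)
  qed
qed

lemma ap_const: "ap (fls_const c) (C c)"
  unfolding ap_def by (intro exI[of _ 0] exI[of _ "[:c:]"]) (simp add: map_poly_pCons)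

lemma ap_X: "ap fls_X \<pi>"
  unfolding ap_def by (intro exI[of _ 0] exI[of _ "[:0, 1:]"]) (simp add: map_poly_pCons)

lemma ap_power: "ap (fls_X ^ j) (\<pi> ^ j)"
  unfolding ap_def using ev_monom by (intro exI[of _ 0] exI[of _ "monom 1 j"]) simp

lemma ap_inverse_power: "ap (inverse (fls_X ^ j)) (inverse (\<pi> ^ j))"
  unfolding ap_def using \<pi> by (intro exI[of _ j] exI[of _ "[:1:]"]) (simp add: map_poly_pCons)

text \<open>The graph of the isomorphism to be. A relation is used because the value of a Laurent
  series at \<pi> is not known to converge in L; F and x are related when the same Laurent
  polynomials approximate both.\<close>

definition rel :: "'k fls \<Rightarrow> 'b \<Rightarrow> bool" where
  "rel F x \<longleftrightarrow> x \<in> L \<and> (\<forall>N. \<exists>P y. ap P y \<and> vge N (F - P) \<and> vL N (x - y))"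

lemma ap_in: "ap P y \<Longrightarrow> y \<in> L"
  using ap_valuation[of P y "\<nu> P"] by (simp add: vL_def)

lemma ap_rel: "ap P x \<Longrightarrow> rel P x"
  unfolding rel_def using ap_in[of P x] by (intro conjI allI exI[of _ P] exI[of _ x]) simp_all

lemma rel_add: "rel F x \<Longrightarrow> rel G y \<Longrightarrow> rel (F + G) (x + y)"
  unfolding rel_def
proof (intro conjI allI)
  fix N assume *: "x \<in> L \<and> (\<forall>N. \<exists>P y. ap P y \<and> vge N (F - P) \<and> vL N (x - y))"
    "y \<in> L \<and> (\<forall>N. \<exists>P z. ap P z \<and> vge N (G - P) \<and> vL N (y - z))"
  obtain P x' where P: "ap P x'" "vge N (F - P)" "vL N (x - x')" using * by blast
  obtain Q y' where Q: "ap Q y'" "vge N (G - Q)" "vL N (y - y')" using * by blast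
  have "F + G - (P + Q) = (F - P) + (G - Q)" "x + y - (x' + y') = (x - x') + (y - y')" by simp_all
  then show "\<exists>P z. ap P z \<and> vge N (F + G - P) \<and> vL N (x + y - z)"
    using ap_add[OF P(1) Q(1)] vge_add[OF P(2) Q(2)] vL_add[OF P(3) Q(3)] by metis
qed (use add_in in blast)

lemma rel_vge: "rel F x \<Longrightarrow> vge N F \<longleftrightarrow> vL N x"
proof -
  assume "rel F x"
  then obtain P y where P: "ap P y" "vge N (F - P)" "vL N (x - y)" unfolding rel_def by blast
  have "vge N F \<longleftrightarrow> vge N P"
    using vge_add[OF P(2), of P] vge_diff[of N F, OF _ P(2)] by auto
  moreover have "vL N x \<longleftrightarrow> vL N y"
    using vL_add[OF P(3), of y] vL_diff[of N x, OF _ P(3)] by auto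
  ultimately show ?thesis using ap_valuation[OF P(1)] by simp
qed

lemma vL_exists: "x \<in> L \<Longrightarrow> \<exists>N\<le>0. vL N x"
  by (rule exI[of _ "min 0 (v x)"]) (auto simp: vL_def)

lemma rel_mult: "rel F x \<Longrightarrow> rel G y \<Longrightarrow> rel (F * G) (x * y)"
proof -
  assume F: "rel F x" and G: "rel G y"
  have xy: "x \<in> L" "y \<in> L" using F G by (simp_all add: rel_def)
  obtain A where A: "A \<le> 0" "vL A x" using vL_exists xy by blast
  obtain B where B: "B \<le> 0" "vL B y" using vL_exists xy by blast
  have AF: "vge A F" and BG: "vge B G" using rel_vge F G A B by blast+
  have "\<exists>P z. ap P z \<and> vge N (F * G - P) \<and> vL N (x * y - z)" for N
  proof -
    \<comment> \<open>The surplus compensates the negative bounds A and B of the two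
      factors.\<close>
    define N' where "N' = max 0 N - A - B"
    have N': "N \<le> N' + B" "N \<le> A + N'" "A \<le> N'" using A B by (auto simp: N'_def)
    obtain P x' where P: "ap P x'" "vge N' (F - P)" "vL N' (x - x')" using F unfolding rel_def by blast
    obtain Q y' where Q: "ap Q y'" "vge N' (G - Q)" "vL N' (y - y')" using G unfolding rel_def by blast
    have P': "vge A P" using vge_diff[OF AF vge_mono[OF P(2) N'(3)]] by simp
    then have x': "vL A x'" using ap_valuation[OF P(1)] by simp
    have "F * G - P * Q = (F - P) * G + P * (G - Q)" by (simp add: algebra_simps)
    moreover have "vge N ((F - P) * G + P * (G - Q))"
      using vge_mono[OF vge_mult[OF P(2) BG] N'(1)] vge_mono[OF vge_mult[OF P' Q(2)] N'(2)] by (rule vge_add)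
    moreover have "x * y - x' * y' = (x - x') * y + x' * (y - y')" by (simp add: algebra_simps)
    moreover have "vL N ((x - x') * y + x' * (y - y'))"
      using vL_mono[OF vL_mult[OF P(3) B(2)] N'(1)] vL_mono[OF vL_mult[OF x' Q(3)] N'(2)] by (rule vL_add)
    ultimately show ?thesis using ap_mult[OF P(1) Q(1)] by metis
  qed
  then show ?thesis unfolding rel_def using mult_in[OF xy] by blast
qed

lemma rel_uminus: "rel F x \<Longrightarrow> rel (- F) (- x)"
  using rel_mult[OF ap_rel[OF ap_const[of "-1"]], of F x] by (simp add: uminus K.uminus)

lemma rel_0_iff: "rel F x \<Longrightarrow> F = 0 \<longleftrightarrow> x = 0"
proof -
  assume F: "rel F x"
  show ?thesis
  proof
    assume "F = 0"
    then have "vL (v x + 1) x" using rel_vge[OF F] by simp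
    then show "x = 0" by (simp add: vL_def)
  next
    assume "x = 0"
    then have "vge (\<nu> F + 1) F" using rel_vge[OF F] by simp
    then show "F = 0" by (simp add: vge_def)
  qed
qed

lemma rel_unique: "rel F x \<Longrightarrow> rel G y \<Longrightarrow> F = G \<longleftrightarrow> x = y"
  using rel_0_iff[OF rel_add[OF _ rel_uminus], of F x G y] by simp

text \<open>Successive residues are the digits of x in powers of \<pi>. Only the target k((X)) has
  to be complete here.\<close>

lemma rel_exists_integral:
  assumes x: "vL 0 x"
  obtains F where "rel F x"
proof -
  define c where "c y = (SOME c. vL 1 (y - C c))" for y
  have c: "vL 1 (y - C (c y))" if "vL 0 y" for y
    unfolding c_def using residue[OF that] by (rule someI_ex)
  define r where "r = rec_nat x (\<lambda>_ y. (y - C (c y)) * inverse \<pi>)"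
  have r_Suc: "r (Suc j) = (r j - C (c (r j))) * inverse \<pi>" for j by (simp add: r_def)
  have inv_pi: "vL (- 1) (inverse \<pi>)"
    using ap_valuation[OF ap_inverse_power[of 1], of "-1"] by (simp add: vge_def)
  have r: "vL 0 (r j)" for j
  proof (induction j)
    case (Suc j)
    then show ?case unfolding r_Suc using vL_mult[OF c[OF Suc] inv_pi] by simp
  qed (simp add: r_def x)
  define P where "P j = (\<Sum>i<j. fls_const (c (r i)) * fls_X ^ i)" for j
  define y where "y j = (\<Sum>i<j. C (c (r i)) * \<pi> ^ i)" for j
  have ap: "ap (P j) (y j)" for j
  proof (induction j)
    case 0
    show ?case using ap_const[of 0] by (simp add: P_def y_def)
  next
    case (Suc j)
    then show ?case using ap_add[OF Suc ap_mult[OF ap_const ap_power]] by (simp add: P_def y_def)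
  qed
  have xr: "x = y j + r j * \<pi> ^ j" for j
  proof (induction j)
    case (Suc j)
    have "r j = C (c (r j)) + r (Suc j) * \<pi>" using \<pi> by (simp add: r_Suc mult.assoc)
    then have "r j * \<pi> ^ j = C (c (r j)) * \<pi> ^ j + r (Suc j) * \<pi> ^ Suc j" by (metis distrib_right mult.assoc power_Suc)
    then show ?case using Suc by (simp only: y_def sum.lessThan_Suc add.assoc)
  qed (simp add: y_def r_def)
  have "vge (int j) (P (Suc j) - P j)" for j
  proof -
    have "vge (0 + int j) (fls_const (c (r j)) * fls_X ^ j)"
      by (intro vge_mult) (simp_all add: vge_def fls_subdegree_pow)
    then show ?thesis by (simp add: P_def)
  qed
  then obtain F where F: "\<And>j. vge (int j) (F - P j)"
  proof (rule fls_complete[of int P])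
    show "\<exists>n. m \<le> int n" for m by (rule exI[of _ "nat m"]) simp
  qed (auto simp: mono_def)
  have "rel F x" unfolding rel_def
  proof (intro conjI allI)
    show "x \<in> L" using x by (simp add: vL_def)
    fix N
    have "vge N (F - P (nat N))" using F[of "nat N"] by (rule vge_mono) simp
    moreover have "vL N (x - y (nat N))"
    proof -
      have "vL (int (nat N)) (\<pi> ^ nat N)" using v_pow_\<pi> by (simp add: vL_def)
      then have "vL (0 + int (nat N)) (r (nat N) * \<pi> ^ nat N)" using r by (intro vL_mult)
      moreover have "x - y (nat N) = r (nat N) * \<pi> ^ nat N" using xr[of "nat N"] by (simp only: add_diff_cancel_left')
      ultimately have "vL (0 + int (nat N)) (x - y (nat N))" by (simp only:)
      then show ?thesis by (rule vL_mono) simp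
    qed
    ultimately show "\<exists>P y. ap P y \<and> vge N (F - P) \<and> vL N (x - y)" using ap by blast
  qed
  then show ?thesis by (rule that)
qed

lemma rel_exists:
  assumes "x \<in> L"
  obtains F where "rel F x"
proof -
  define M where "M = nat (- v x)"
  have "vL (v x + int M) (x * \<pi> ^ M)" using assms v_pow_\<pi> by (intro vL_mult) (simp_all add: vL_def)
  then have "vL 0 (x * \<pi> ^ M)" by (rule vL_mono) (simp add: M_def)
  then obtain F where "rel F (x * \<pi> ^ M)" by (rule rel_exists_integral)
  from rel_mult[OF this ap_rel[OF ap_inverse_power[of M]]] have "rel (F * inverse (fls_X ^ M)) x"
    using \<pi> by (simp add: mult.assoc)
  then show ?thesis by (rule that)
qed

text \<open>Expansion gives an embedding of L into k((X)). Its restriction to the base is totally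
  ramified of degree e, so the powers of X below e span k((X)) over the image of the base; all of
  these come from L.\<close>

lemma rel_surj:
  shows "\<exists>x. rel F x"
proof -
  define \<Psi> where "\<Psi> x = (THE F. rel F x)" for x
  have \<Psi>: "rel (\<Psi> x) x" if x: "x \<in> L" for x
  proof -
    obtain F where F: "rel F x" using x by (rule rel_exists)
    have "\<And>G. rel G x \<Longrightarrow> G = F" using rel_unique F by blast
    with F show ?thesis unfolding \<Psi>_def by (rule theI)
  qed
  have \<Psi>I: "\<Psi> x = F" if "rel F x" for x F
    using \<Psi> rel_unique that by (metis rel_def)
  have "vhom (\<lambda>f. \<Psi> (\<iota> f)) e"
  proof (rule vhomI)
    show "field_hom (\<lambda>f. \<Psi> (\<iota> f))"
    proof
      show "\<Psi> (\<iota> 1) = 1" using ap_rel[OF ap_const[of 1]] by (intro \<Psi>I) simp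
      show "\<Psi> (\<iota> (x + y)) = \<Psi> (\<iota> x) + \<Psi> (\<iota> y)" for x y
        unfolding add by (intro \<Psi>I rel_add \<Psi> \<iota>_in)
      show "\<Psi> (\<iota> (x * y)) = \<Psi> (\<iota> x) * \<Psi> (\<iota> y)" for x y
        unfolding mult by (intro \<Psi>I rel_mult \<Psi> \<iota>_in)
    qed
    fix f :: "'k fls" assume f: "f \<noteq> 0"
    have r: "rel (\<Psi> (\<iota> f)) (\<iota> f)" by (intro \<Psi> \<iota>_in)
    have ne: "\<Psi> (\<iota> f) \<noteq> 0" using rel_0_iff[OF r] f by simp
    show "\<nu> (\<Psi> (\<iota> f)) = int e * \<nu> f"
    proof (rule antisym)
      show "\<nu> (\<Psi> (\<iota> f)) \<le> int e * \<nu> f"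
        using rel_vge[OF r, of "\<nu> (\<Psi> (\<iota> f))"] v_\<iota>[OF f] f by (simp add: vL_def)
      show "int e * \<nu> f \<le> \<nu> (\<Psi> (\<iota> f))"
        using rel_vge[OF r, of "int e * \<nu> f"] v_\<iota>[OF f] ne \<iota>_in by (simp add: vge_def vL_def)
    qed
  next
    show "\<Psi> (\<iota> (fls_const c)) = fls_const c" for c by (intro \<Psi>I ap_rel ap_const)
  qed (rule e_pos)
  then interpret ramified_basis "\<lambda>f. \<Psi> (\<iota> f)" e "\<lambda>i. fls_X ^ i" by (rule ramified_basis_X_powers)
  obtain a where F: "F = (\<Sum>i<e. \<Psi> (\<iota> (a i)) * fls_X ^ i)" using basis_span by blast
  have "rel (\<Sum>i<j. \<Psi> (\<iota> (a i)) * fls_X ^ i) (\<Sum>i<j. \<iota> (a i) * \<pi> ^ i)" for j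
  proof (induction j)
    case 0
    then show ?case using ap_rel[OF ap_const[of 0]] by simp
  next
    case (Suc j)
    then show ?case unfolding sum.lessThan_Suc by (intro rel_add[OF Suc] rel_mult[OF \<Psi>[OF \<iota>_in] ap_rel[OF ap_power]])
  qed
  then show ?thesis unfolding F by blast
qed

theorem uniformization:
  obtains \<Phi> where "field_hom \<Phi>" "range \<Phi> = L" "\<Phi> fls_X = \<pi>" "\<And>c. \<Phi> (fls_const c) = \<iota> (fls_const c)"
    "\<And>F. F \<noteq> 0 \<Longrightarrow> v (\<Phi> F) = \<nu> F"
proof -
  define \<Phi> where "\<Phi> F = (SOME x. rel F x)" for F
  have \<Phi>: "rel F (\<Phi> F)" for F unfolding \<Phi>_def using rel_surj by (rule someI_ex)
  have \<Phi>I: "\<Phi> F = x" if "rel F x" for F x using rel_unique[OF \<Phi>[of F] that] by simp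
  show ?thesis
  proof (rule that)
    show "field_hom \<Phi>"
    proof
      show "\<Phi> 1 = 1" using ap_rel[OF ap_const[of 1]] by (intro \<Phi>I) simp
      show "\<Phi> (x + y) = \<Phi> x + \<Phi> y" for x y by (intro \<Phi>I rel_add \<Phi>)
      show "\<Phi> (x * y) = \<Phi> x * \<Phi> y" for x y by (intro \<Phi>I rel_mult \<Phi>)
    qed
    show "range \<Phi> = L"
    proof (intro equalityI subsetI)
      fix x assume "x \<in> L"
      then obtain F where "rel F x" by (rule rel_exists)
      then show "x \<in> range \<Phi>" using \<Phi>I by blast
    qed (use \<Phi> in \<open>auto simp: rel_def\<close>)
    show "\<Phi> fls_X = \<pi>" by (intro \<Phi>I ap_rel ap_X)
    show "\<Phi> (fls_const c) = \<iota> (fls_const c)" for c by (intro \<Phi>I ap_rel ap_const)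
    fix F :: "'k fls" assume F: "F \<noteq> 0"
    then have ne: "\<Phi> F \<noteq> 0" "\<Phi> F \<in> L" using rel_0_iff[OF \<Phi>] \<Phi>[of F] by (auto simp: rel_def)
    show "v (\<Phi> F) = \<nu> F"
    proof (rule antisym)
      show "v (\<Phi> F) \<le> \<nu> F"
        using rel_vge[OF \<Phi>[of F], of "v (\<Phi> F)"] ne F by (simp add: vge_def vL_def)
      show "\<nu> F \<le> v (\<Phi> F)"
        using rel_vge[OF \<Phi>[of F], of "\<nu> F"] ne by (simp add: vL_def)
    qed
  qed
qed

end

section \<open>Galois extensions and automorphisms of the Laurent series field\<close>

lemma subfield_type_algebraD:
  assumes "subfield L (ring_of_type_algebra :: 'a::field ring)"
  shows "1 \<in> L" "x \<in> L \<Longrightarrow> y \<in> L \<Longrightarrow> x + y \<in> L" "x \<in> L \<Longrightarrow> y \<in> L \<Longrightarrow> x * y \<in> L"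
    "x \<in> L \<Longrightarrow> inverse x \<in> L"
proof -
  interpret F: field "ring_of_type_algebra :: 'a ring" by (rule field_from_type_algebra)
  interpret subfield L "ring_of_type_algebra :: 'a ring" by fact
  show one: "1 \<in> L" using one_closed by (simp add: ring_of_type_algebra_def)
  show "x \<in> L \<Longrightarrow> y \<in> L \<Longrightarrow> x + y \<in> L" using subringE(7)[OF subfieldE(1)[OF assms]] by (simp add: ring_of_type_algebra_def)
  show "x \<in> L \<Longrightarrow> y \<in> L \<Longrightarrow> x * y \<in> L" using m_closed by (simp add: ring_of_type_algebra_def)
  show "inverse x \<in> L" if x: "x \<in> L"
  proof (cases "x = 0")
    case False
    then have "x \<in> Units (ring_of_type_algebra\<lparr>carrier := L\<rparr>)"
      using x subfield_Units by (simp add: ring_of_type_algebra_def)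
    then obtain y where "y \<in> L" "y * x = 1" by (auto simp: Units_def ring_of_type_algebra_def)
    then show ?thesis using inverse_unique[of x y] by (simp add: mult.commute)
  qed (use x in simp)
qed

lemma field_aut_groupD:
  assumes "f \<in> carrier (field_aut_group L)"
  shows "bij_betw f L L" "f \<in> extensional L" "x \<in> L \<Longrightarrow> y \<in> L \<Longrightarrow> f (x + y) = f x + f y"
    "x \<in> L \<Longrightarrow> y \<in> L \<Longrightarrow> f (x * y) = f x * f y" "f 1 = 1" "f (to_ac c) = to_ac c"
  using assms by (auto simp: field_aut_group_def Bij_def ring_hom_def ring_of_type_algebra_def)

lemma field_aut_group_mult:
  assumes "f \<in> carrier (field_aut_group L)" "g \<in> carrier (field_aut_group L)"
  shows "f \<otimes>\<^bsub>field_aut_group L\<^esub> g = compose L f g"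
  using assms by (auto simp: field_aut_group_def BijGroup_def)

text \<open>The residue field being algebraically closed, \<open>L\<close> is again a Laurent series field over \<open>k\<close>.\<close>

lemma galois_extension_model:
  fixes G :: "('g, 'b) monoid_scheme" and L :: "'k::alg_closed_field fls alg_closure set"
  assumes G: "cyclic_semidirect G p n m s t \<kappa>" and char: "CHAR('k) = p"
    and gal: "G_galois_extension G L act" and v: "normalized_valuation L v" and \<pi>: "uniformizer L v \<pi>"
  obtains A where "ramified_action G p n m s t \<kappa> A"
    "\<forall>r. lower_ramification G act v \<pi> r = ramified_action.low G (A :: 'g \<Rightarrow> 'k fls \<Rightarrow> 'k fls) r"
proof -
  interpret G: cyclic_semidirect G p n m s t \<kappa> by fact
  have iso: "act \<in> iso G (field_aut_group L)" and ext: "finite_field_extension L"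
    using gal by (simp_all add: G_galois_extension_def galois_extension_def)
  have sub: "subfield L ring_of_type_algebra" and ac: "\<And>c. to_ac c \<in> L"
    using ext by (auto simp: finite_field_extension_def)
  obtain e where e: "e \<ge> 1" "\<And>f. f \<noteq> 0 \<Longrightarrow> v (to_ac f) = int e * \<nu> f"
    using v by (auto simp: normalized_valuation_def)
  interpret V: valued_ext to_ac L v \<pi> e
  proof (intro valued_ext.intro field_hom_to_ac valued_ext_axioms.intro)
    show "\<exists>q. q \<noteq> 0 \<and> poly (map_poly to_ac q) x = 0" for x :: "'k fls alg_closure"
      by (rule alg_closure_algebraic) blast
  qed (use subfield_type_algebraD[OF sub] ac v \<pi> e in \<open>auto simp: normalized_valuation_def uniformizer_def\<close>)
  obtain \<Phi> where \<Phi>: "field_hom \<Phi>" "range \<Phi> = L" "\<Phi> fls_X = \<pi>" "\<And>c. \<Phi> (fls_const c) = to_ac (fls_const c)"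
    "\<And>F. F \<noteq> 0 \<Longrightarrow> v (\<Phi> F) = \<nu> F"
    by (rule V.uniformization) blast
  interpret \<Phi>: field_hom \<Phi> by fact
  have act: "act g \<in> carrier (field_aut_group L)" if "g \<in> carrier G" for g
    using iso that by (auto simp: iso_def hom_def)
  define A where "A g F = inv_into UNIV \<Phi> (act g (\<Phi> F))" for g F
  have \<Phi>A: "\<Phi> (A g F) = act g (\<Phi> F)" if "g \<in> carrier G" for g F
  proof -
    have "\<Phi> F \<in> L" using \<Phi>(2) by blast
    then have "act g (\<Phi> F) \<in> range \<Phi>" using field_aut_groupD(1)[OF act[OF that]] \<Phi>(2) by (auto simp: bij_betw_def)
    then show ?thesis unfolding A_def by (rule f_inv_into_f)
  qed
  have in_L: "\<Phi> F \<in> L" for F using \<Phi>(2) by blast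
  have AI: "A g F = F'" if "g \<in> carrier G" "act g (\<Phi> F) = \<Phi> F'" for g F F'
    using \<Phi>A[OF that(1), of F] that(2) by simp
  have hom_act: "act (g \<otimes>\<^bsub>G\<^esub> h) x = act g (act h x)" if "g \<in> carrier G" "h \<in> carrier G" "x \<in> L" for g h x
  proof -
    have "act (g \<otimes>\<^bsub>G\<^esub> h) = act g \<otimes>\<^bsub>field_aut_group L\<^esub> act h" using iso that by (simp add: iso_def hom_def)
    also have "\<dots> = compose L (act g) (act h)" using that by (intro field_aut_group_mult act)
    finally show ?thesis using that by (simp add: compose_def)
  qed
  interpret A: ramified_action G p n m s t \<kappa> A
  proof
    show "CHAR('k) = p" by fact
    fix g assume g: "g \<in> carrier G"
    show "is_aut (A g)"
    proof (rule is_autI[OF G.p char])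
      show "field_hom (A g)"
        using field_aut_groupD[OF act[OF g]] in_L
        by unfold_locales (auto intro!: AI[OF g] simp: \<Phi>A[OF g] \<Phi>.add \<Phi>.mult)
      show "surj (A g)"
        unfolding surj_def
      proof
        fix F
        have "\<Phi> F \<in> act g ` range \<Phi>"
          using field_aut_groupD(1)[OF act[OF g]] in_L[of F] unfolding bij_betw_def \<Phi>(2) by simp
        then obtain F' where "act g (\<Phi> F') = \<Phi> F" by auto
        then show "\<exists>F'. F = A g F'" using AI[OF g] by metis
      qed
      show "A g (fls_const c) = fls_const c" for c
        using field_aut_groupD(6)[OF act[OF g]] by (intro AI g) (simp add: \<Phi>(4))
    qed
    show "A (g \<otimes>\<^bsub>G\<^esub> h) F = A g (A h F)" if "h \<in> carrier G" for h F
      using g that in_L by (intro AI) (simp_all add: \<Phi>A hom_act)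
    show "g = \<one>\<^bsub>G\<^esub>" if id: "A g = id"
    proof -
      have "act g x = x" if "x \<in> L" for x
        using \<Phi>A[OF g] that id unfolding \<Phi>(2)[symmetric] by (metis id_apply imageE)
      then have "act g = (\<lambda>x\<in>L. x)" using field_aut_groupD(2)[OF act[OF g]]
        by (intro extensionalityI) (auto simp: restrict_def extensional_def)
      moreover have "act \<one>\<^bsub>G\<^esub> = (\<lambda>x\<in>L. x)"
      proof -
        have "act \<one>\<^bsub>G\<^esub> x = x" if "x \<in> L" for x
        proof -
          have inj: "inj_on (act \<one>\<^bsub>G\<^esub>) L" "act \<one>\<^bsub>G\<^esub> x \<in> L"
            using field_aut_groupD(1)[OF act[OF G.one_closed]] that by (auto simp: bij_betw_def)
          have "act \<one>\<^bsub>G\<^esub> (act \<one>\<^bsub>G\<^esub> x) = act \<one>\<^bsub>G\<^esub> x" using hom_act[of "\<one>\<^bsub>G\<^esub>" "\<one>\<^bsub>G\<^esub>" x] that by simp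
          then show ?thesis using inj that by (simp add: inj_on_def)
        qed
        then show ?thesis using field_aut_groupD(2)[OF act[OF G.one_closed]]
          by (intro extensionalityI) (auto simp: restrict_def extensional_def)
      qed
      moreover have "inj_on act (carrier G)" using iso by (simp add: iso_def bij_betw_def)
      ultimately show ?thesis using g by (simp add: inj_on_def)
    qed
  qed
  have "lower_ramification G act v \<pi> r = A.low r" for r
  proof -
    have "act g \<pi> = \<pi> \<longleftrightarrow> A g fls_X = fls_X"
      "A g fls_X \<noteq> fls_X \<Longrightarrow> v (act g \<pi> - \<pi>) = \<nu> (A g fls_X - fls_X)" if g: "g \<in> carrier G" for g
    proof -
      have X: "act g \<pi> = \<Phi> (A g fls_X)" using \<Phi>A[OF g] \<Phi>(3) by simp
      show "act g \<pi> = \<pi> \<longleftrightarrow> A g fls_X = fls_X" unfolding X unfolding \<Phi>(3)[symmetric] by simp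
      show "v (act g \<pi> - \<pi>) = \<nu> (A g fls_X - fls_X)" if "A g fls_X \<noteq> fls_X"
        unfolding X unfolding \<Phi>(3)[symmetric] \<Phi>.diff[symmetric] using that by (intro \<Phi>(5)) simp
    qed
    then show ?thesis unfolding lower_ramification_def A.low_def by (intro Collect_cong) metis
  qed
  then show ?thesis using that A.ramified_action_axioms by blast
qed

lemma (in ramified_action) positive_upper_breaks:
  assumes "\<And>r. lower_ramification G act v \<pi> r = low r"
    and U: "upper_jumps U"
  shows "positive_upper_breaks G act v \<pi> = (\<lambda>l. real (U l) / real m) ` {1..n}"
proof -
  have "herbrand G act v \<pi> = filtration.herb"
    by (intro ext) (simp add: herbrand_def filtration.herb_def assms(1))
  then show ?thesis
    using upper_breaks[OF U] by (simp add: positive_upper_breaks_def upper_ramification_def assms(1))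
qed

text \<open>Breaks are given as a set, and this recovers the individual \<open>u i\<close> from
  it.\<close>

lemma monotone_enumeration_unique:
  fixes f g :: "nat \<Rightarrow> 'a::linorder"
  assumes f: "mono_on {1..n} f" and g: "strict_mono_on {1..n} g" and eq: "f ` {1..n} = g ` {1..n}"
  shows "l \<in> {1..n} \<Longrightarrow> f l = g l"
proof -
  have g_inj: "inj_on g {1..n}" using g by (rule strict_mono_on_imp_inj_on)
  have "card (f ` {1..n}) = card {1..n}" using eq card_image[OF g_inj] by simp
  then have f_inj: "inj_on f {1..n}" by (intro eq_card_imp_inj_on) auto
  have set: "set [1..<Suc n] = {1..n}" by auto
  have "map f [1..<Suc n] = map g [1..<Suc n]"
  proof (rule sorted_distinct_set_unique)
    show "sorted (map f [1..<Suc n])" unfolding sorted_map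
      by (rule sorted_wrt_mono_rel[OF _ sorted_upt])
        (use f in \<open>auto simp: mono_on_def\<close>)
    show "sorted (map g [1..<Suc n])" unfolding sorted_map
      by (rule sorted_wrt_mono_rel[OF _ sorted_upt])
        (use strict_mono_on_imp_mono_on[OF g] in \<open>auto simp: mono_on_def\<close>)
    show "distinct (map f [1..<Suc n])" "distinct (map g [1..<Suc n])"
      unfolding distinct_map set using f_inj g_inj by simp_all
    show "set (map f [1..<Suc n]) = set (map g [1..<Suc n])" unfolding set_map set by (rule eq)
  qed
  then show "l \<in> {1..n} \<Longrightarrow> f l = g l" by (simp add: map_eq_conv del: upt_Suc)
qed

theorem upper_breaks_necessary:
  fixes G :: "('g, 'b) monoid_scheme" and u :: "nat \<Rightarrow> rat"
  assumes G: "cyclic_semidirect G p n m s t \<kappa>" and char: "CHAR('k::alg_closed_field) = p"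
    and u: "mono_on {1..n} u"
    and occ: "occurs_as_upper_breaks TYPE('k) G ((\<lambda>i. of_rat (u i)) ` {1..n})"
  shows "\<exists>a :: nat \<Rightarrow> nat.
       (\<forall>i\<in>{1..n}. u i = of_nat (a i) / of_nat m) \<and>
       gcd m (a 1) = card (centralizer G s) div p ^ n \<and>
       \<not> p dvd a 1 \<and>
       (\<forall>i\<in>{2..n}. u i = of_nat p * u (i - 1) \<or> (u i > of_nat p * u (i - 1) \<and> \<not> p dvd a i)) \<and>
       (\<forall>i\<in>{1..n}. [a i = a 1] (mod m))"
proof -
  obtain L :: "'k fls alg_closure set" and act v \<pi> where
    ext: "G_galois_extension G L act" "normalized_valuation L v" "uniformizer L v \<pi>"
    and breaks: "positive_upper_breaks G act v \<pi> = (\<lambda>i. of_rat (u i)) ` {1..n}"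
    using occ unfolding occurs_as_upper_breaks_def by blast
  obtain A :: "'g \<Rightarrow> 'k fls \<Rightarrow> 'k fls" where "ramified_action G p n m s t \<kappa> A"
    and low: "\<forall>r. lower_ramification G act v \<pi> r = ramified_action.low G A r"
    by (rule galois_extension_model[OF G char ext])
  then interpret ramified_action G p n m s t \<kappa> A by simp
  obtain U where U: "upper_jumps U" and U1: "\<not> p dvd U 1"
    and U_Suc: "\<And>l. 1 \<le> l \<Longrightarrow> l < n \<Longrightarrow> U (Suc l) = p * U l \<or> (U (Suc l) > p * U l \<and> \<not> p dvd U (Suc l))"
    using upper_jumps_exists by metis
  have Upos: "1 \<le> l \<Longrightarrow> l \<le> n \<Longrightarrow> U l > 0" for l
  proof (induction l)
    case (Suc l)
    then show ?case
      using U1 U_Suc[of l] p_ge_2 by (cases "l = 0") (auto intro!: Nat.gr0I)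
  qed simp
  \<comment> \<open>Strict growth means the set of breaks has n elements, so the monotone u has to
    list them in order.\<close>
  have Uless: "U l < U (Suc l)" if "1 \<le> l" "l < n" for l
  proof -
    have "U l < p * U l" using Upos[of l] p_ge_2 that by simp
    also have "p * U l \<le> U (Suc l)" using U_Suc[OF that] by auto
    finally show ?thesis .
  qed
  define g where "g l = (of_nat (U l) / of_nat m :: rat)" for l
  have "U i < U j" if "1 \<le> i" "i < j" "j \<le> n" for i j
    using that(2,3)
  proof (induction j)
    case (Suc j)
    then show ?case using Uless[of j] that(1) by (cases "i = j") auto
  qed simp
  then have g: "strict_mono_on {1..n} g"
    using m(1) by (auto simp: strict_mono_on_def g_def divide_strict_right_mono)
  have "real_of_rat ` u ` {1..n} = real_of_rat ` g ` {1..n}"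
    using breaks positive_upper_breaks[OF low[rule_format] U] by (simp add: image_image g_def of_rat_divide)
  then have "u ` {1..n} = g ` {1..n}" by (simp add: inj_image_eq_iff inj_def)
  then have ug: "u l = of_nat (U l) / of_nat m" if "l \<in> {1..n}" for l
    using monotone_enumeration_unique[OF u g] that by (simp add: g_def)
  show ?thesis
  proof (intro exI[of _ U] conjI ballI)
    show "gcd m (U 1) = card (centralizer G s) div p ^ n" using centralizer_index U by (simp add: upper_jumps_def)
    fix i assume i: "i \<in> {2..n}"
    then obtain l where l: "i = Suc l" "1 \<le> l" "l < n" by (cases i) auto
    have m0: "(of_nat m :: rat) > 0" using m(1) by simp
    have "u i = of_nat (U (Suc l)) / of_nat m" "of_nat p * u (i - 1) = of_nat (p * U l) / of_nat m"
      using ug[of i] ug[of l] l by simp_all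
    then show "u i = of_nat p * u (i - 1) \<or> (u i > of_nat p * u (i - 1) \<and> \<not> p dvd U i)"
      using U_Suc[OF l(2,3)] m0 l(1) by (auto simp: divide_strict_right_mono simp del: of_nat_mult)
  next
    fix i assume "i \<in> {1..n}"
    then obtain l where "i = Suc l" "l < n" by (cases i) auto
    then show "[U i = U 1] (mod m)" using U_cong[OF U] by simp
  qed (use ug U1 in auto)
qed

section \<open>Construction of a cyclic extension with prescribed Artin--Schreier data\<close>

context ah
begin

text \<open>The Artin-Schreier-Witt equation of length l for the components y with right-hand side
  h, in multiplicative form.\<close>

definition sys :: "nat \<Rightarrow> (nat \<Rightarrow> 'a) \<Rightarrow> (nat \<Rightarrow> 'a) \<Rightarrow> bool" where
  "sys l h y \<longleftrightarrow> fcong (p ^ l) (fmap fr (wprod y l)) (wprod h l * wprod y l)"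

text \<open>The right-hand side of the ordinary Artin-Schreier equation for component l, once the
  components below l are known.\<close>

definition obst :: "nat \<Rightarrow> (nat \<Rightarrow> 'a) \<Rightarrow> (nat \<Rightarrow> 'a) \<Rightarrow> 'a" where
  "obst l h y = fps_nth (wprod h (Suc l) * wprod y l * inverse (fmap fr (wprod y l))) (p ^ l)"

lemma fcong_quotient_iff:
  assumes "fps_nth F 0 = (1 :: 'a)"
  shows "fcong N F G \<longleftrightarrow> fcong N (G * inverse F) 1"
proof
  have 1: "F * inverse F = 1" using assms by (simp add: inverse_mult_eq_1')
  show "fcong N F G \<Longrightarrow> fcong N (G * inverse F) 1"
    using fcong_mult[OF fcong_sym fcong_refl, of N F G "inverse F"] 1 by simp
  assume "fcong N (G * inverse F) 1"
  from fcong_mult[OF this fcong_refl[of _ F]] show "fcong N F G"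
    using 1 by (simp add: mult.assoc mult.commute[of "inverse F"] fcong_sym)
qed

lemma fmap_wprod:
  assumes "field_hom f"
  shows "fmap f (wprod y l) = wprod (\<lambda>i. f (y i)) l"
proof -
  interpret field_hom f by fact
  show ?thesis unfolding wprod_def fmap_prod by (simp add: fmap_esub[OF assms] E_fmap[OF assms])
qed

lemma fmap_fr_wprod_nth_0 [simp]: "fps_nth (fmap fr (wprod y l)) 0 = 1"
  by simp

lemma obst_hom:
  assumes f: "field_hom f"
  shows "f (obst l h y) = obst l (\<lambda>i. f (h i)) (\<lambda>i. f (y i))"
proof -
  interpret field_hom f by fact
  have "f (obst l h y) = fps_nth (fmap f (wprod h (Suc l) * wprod y l * inverse (fmap fr (wprod y l)))) (p ^ l)"
    by (simp add: obst_def)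
  also have "fmap f (wprod h (Suc l) * wprod y l * inverse (fmap fr (wprod y l))) =
      wprod (\<lambda>i. f (h i)) (Suc l) * wprod (\<lambda>i. f (y i)) l * inverse (fmap fr (wprod (\<lambda>i. f (y i)) l))"
    unfolding fmap_mult by (subst fmap_inverse) (simp_all add: fmap_wprod f fr_hom power)
  finally show ?thesis by (simp add: obst_def)
qed

lemma sys_hom:
  assumes f: "field_hom f" and "sys l h y"
  shows "sys l (\<lambda>i. f (h i)) (\<lambda>i. f (y i))"
proof -
  interpret field_hom f by fact
  have "fcong (p ^ l) (fmap f (fmap fr (wprod y l))) (fmap f (wprod h l * wprod y l))"
    using assms(2) unfolding sys_def by (rule fmap_cong_mod)
  then show ?thesis by (simp add: sys_def fmap_mult fmap_wprod f fr_hom power)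
qed

lemma sys_cong: "(\<And>i. i < l \<Longrightarrow> y i = y' i) \<Longrightarrow> sys l h y \<longleftrightarrow> sys l h y'"
  using wprod_cong[of l y y'] by (simp add: sys_def)

lemma obst_cong: "(\<And>i. i < l \<Longrightarrow> y i = y' i) \<Longrightarrow> obst l h y = obst l h y'"
  using wprod_cong[of l y y'] by (simp add: obst_def)

lemma wprod_Suc_low: "fcong (p ^ l) (wprod h (Suc l)) (wprod h l)"
  using fcong_mult[OF fcong_refl esub_E_low(1), of l "wprod h l" "h l"] by (simp add: wprod_Suc)

text \<open>The error of the equation is a typical series, so passing from length l to l + 1 adds
  one condition, at \<open>t^(p^l)\<close>; there the error is the obstruction plus
  \<open>y l - (y l)^p\<close>.\<close>

lemma sys_Suc:
  assumes l: "l < n"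
  shows "sys (Suc l) h y \<longleftrightarrow> sys l h y \<and> y l ^ p - y l = obst l h y"
proof -
  define Y where "Y = wprod y l"
  define Q where "Q = wprod h (Suc l) * Y * inverse (fmap fr Y)"
  define e where "e = esub E (y l) (p ^ l)"
  define e' where "e' = esub E (y l ^ p) (p ^ l)"
  have l1: "p ^ l \<ge> 1" using p_pos[of l] by linarith
  have lt: "p ^ l < p ^ Suc l" using p_gt_1 by simp
  have Y0: "fps_nth (fmap fr Y) 0 = 1" unfolding Y_def by (rule fmap_fr_wprod_nth_0)
  have typQ: "ptypical p n Q"
    unfolding Q_def Y_def using ptypical_fmap[OF fr_hom roots, of n "wprod y l"]
    by (intro ptypical_mult ptypical_inverse wprod_typical) (simp add: wprod_typical)
  have sysl: "sys l h y \<longleftrightarrow> fcong (p ^ l) Q 1"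
  proof -
    have c: "fcong (p ^ l) Q (wprod h l * Y * inverse (fmap fr Y))"
      unfolding Q_def by (intro fcong_mult fcong_refl wprod_Suc_low)
    have "sys l h y \<longleftrightarrow> fcong (p ^ l) (wprod h l * Y * inverse (fmap fr Y)) 1"
      unfolding sys_def Y_def[symmetric] by (rule fcong_quotient_iff[OF Y0])
    then show ?thesis using c by (metis fcong_sym fcong_trans)
  qed
  have fe: "fmap fr (wprod y (Suc l)) = fmap fr Y * e'"
  proof -
    interpret fr: field_hom fr by (rule fr_hom)
    show ?thesis
      by (simp add: wprod_Suc fr.fmap_mult Y_def e'_def fmap_esub[OF fr_hom] E_fmap[OF fr_hom])
  qed
  have Q': "wprod h (Suc l) * wprod y (Suc l) * inverse (fmap fr (wprod y (Suc l))) = Q * e * inverse e'"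
    unfolding fe by (simp add: wprod_Suc[of y] Y_def Q_def e_def fps_inverse_mult mult_ac)
  have sysS: "sys (Suc l) h y \<longleftrightarrow> fcong (p ^ Suc l) (Q * e * inverse e') 1"
    unfolding sys_def Q'[symmetric] by (rule fcong_quotient_iff) simp
  have typQ': "ptypical p n (Q * e * inverse e')"
    unfolding e_def e'_def by (intro ptypical_mult ptypical_inverse esub_E_typical typQ)
  note inv = inverse_low[OF l1 esub_E_low(1) ptypical_nth_0[OF esub_E_typical], of "y l ^ p", folded e'_def]
  have low: "fcong (p ^ l) e 1" unfolding e_def by (rule esub_E_low)
  have eq: "fcong (p ^ l) (Q * e * inverse e') 1 \<and> fps_nth (Q * e * inverse e') (p ^ l) = obst l h y + y l - y l ^ p"
    if "fcong (p ^ l) Q 1"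
  proof -
    note 1 = fps_mult_nth_low[OF l1 that low]
    note 2 = fps_mult_nth_low[OF l1 conjunct1[OF 1] inv(1)]
    have "fps_nth Q (p ^ l) = obst l h y" by (simp add: Q_def Y_def obst_def)
    then show ?thesis using 1 2 inv(2) by (simp add: e_def e'_def esub_E_low(2))
  qed
  show ?thesis
  proof
    assume S: "sys (Suc l) h y"
    have "fcong (p ^ l) (Q * e * inverse e') 1" using S unfolding sysS by (rule fcong_mono) (use lt in simp)
    moreover have "fcong (p ^ l) (Q * e * inverse e') (Q * 1 * 1)"
      by (intro fcong_mult fcong_refl low inv(1))
    ultimately have Q1: "fcong (p ^ l) Q 1" by (metis fcong_sym fcong_trans mult_1_right)
    have "fps_nth (Q * e * inverse e') (p ^ l) = fps_nth 1 (p ^ l)"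
      using S lt unfolding sysS fcong_def by blast
    then have "obst l h y + y l - y l ^ p = 0" using eq[OF Q1] l1 by simp
    then show "sys l h y \<and> y l ^ p - y l = obst l h y" using sysl Q1 by (simp add: algebra_simps)
  next
    assume *: "sys l h y \<and> y l ^ p - y l = obst l h y"
    then have Q1: "fcong (p ^ l) Q 1" using sysl by simp
    show "sys (Suc l) h y" unfolding sysS
    proof (rule gap[OF typQ' l])
      show "fps_nth (Q * e * inverse e') (p ^ l) = 0" using eq[OF Q1] * by (simp add: algebra_simps)
    qed (use eq[OF Q1] in simp)
  qed
qed

lemma sys_0 [simp]: "sys 0 h y"
  by (simp add: sys_def fcong_def)

end

locale as_tower = ah p n ty for p n and ty :: "'k::alg_closed_field fls itself" +
  fixes h :: "nat \<Rightarrow> 'k fls" and a\<^sub>1 :: nat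
  assumes n_pos: "n \<ge> 1" and h_0: "\<nu> (h 0) = - int a\<^sub>1" "\<not> p dvd a\<^sub>1"
begin

lemma char_k: "CHAR('k) = p" using char_p by simp

text \<open>\<theta> embeds the base and \<eta> is a universal solution: every homomorphism on the
  base together with a solution over it extends, and uniquely. This carries the induction and later
  produces all automorphisms, so no Galois theory of the tower is developed.\<close>

definition tower :: "nat \<Rightarrow> ('k fls \<Rightarrow> 'k fls) \<Rightarrow> (nat \<Rightarrow> 'k fls) \<Rightarrow> bool" where
  "tower l \<theta> \<eta> \<longleftrightarrow> vhom \<theta> (p ^ l) \<and> sys l (\<lambda>i. \<theta> (h i)) \<eta> \<and>
     (\<forall>\<alpha> y. field_hom \<alpha> \<longrightarrow> sys l (\<lambda>i. \<alpha> (h i)) y \<longrightarrow>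
        (\<exists>\<Phi>::'k fls \<Rightarrow> 'k fls. field_hom \<Phi> \<and> (\<forall>x. \<Phi> (\<theta> x) = \<alpha> x) \<and> (\<forall>i<l. \<Phi> (\<eta> i) = y i))) \<and>
     (\<forall>\<Phi> \<Phi>' :: 'k fls \<Rightarrow> 'k fls. field_hom \<Phi> \<longrightarrow> field_hom \<Phi>' \<longrightarrow> (\<forall>x. \<Phi> (\<theta> x) = \<Phi>' (\<theta> x)) \<longrightarrow>
        (\<forall>i<l. \<Phi> (\<eta> i) = \<Phi>' (\<eta> i)) \<longrightarrow> \<Phi> = \<Phi>')"

lemma towerD:
  fixes \<Phi> \<Phi>' :: "'k fls \<Rightarrow> 'k fls"
  assumes "tower l \<theta> \<eta>"
  shows "vhom \<theta> (p ^ l)" "sys l (\<lambda>i. \<theta> (h i)) \<eta>"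
    "field_hom \<alpha> \<Longrightarrow> sys l (\<lambda>i. \<alpha> (h i)) y \<Longrightarrow>
        \<exists>\<Phi>::'k fls \<Rightarrow> 'k fls. field_hom \<Phi> \<and> (\<forall>x. \<Phi> (\<theta> x) = \<alpha> x) \<and> (\<forall>i<l. \<Phi> (\<eta> i) = y i)"
    "field_hom \<Phi> \<Longrightarrow> field_hom \<Phi>' \<Longrightarrow> (\<And>x. \<Phi> (\<theta> x) = \<Phi>' (\<theta> x)) \<Longrightarrow>
        (\<And>i. i < l \<Longrightarrow> \<Phi> (\<eta> i) = \<Phi>' (\<eta> i)) \<Longrightarrow> \<Phi> = \<Phi>'"
proof -
  have "\<forall>\<Phi> \<Phi>' :: 'k fls \<Rightarrow> 'k fls. field_hom \<Phi> \<longrightarrow> field_hom \<Phi>' \<longrightarrow> (\<forall>x. \<Phi> (\<theta> x) = \<Phi>' (\<theta> x)) \<longrightarrow>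
        (\<forall>i<l. \<Phi> (\<eta> i) = \<Phi>' (\<eta> i)) \<longrightarrow> \<Phi> = \<Phi>'"
    using assms unfolding tower_def by (elim conjE)
  from this[rule_format] show "field_hom \<Phi> \<Longrightarrow> field_hom \<Phi>' \<Longrightarrow> (\<And>x. \<Phi> (\<theta> x) = \<Phi>' (\<theta> x)) \<Longrightarrow>
        (\<And>i. i < l \<Longrightarrow> \<Phi> (\<eta> i) = \<Phi>' (\<eta> i)) \<Longrightarrow> \<Phi> = \<Phi>'" .
qed (use assms in \<open>unfold tower_def, blast+\<close>)

lemma tower_0: "tower 0 (\<lambda>x. x) \<eta>"
  unfolding tower_def using vhom_id by (auto simp del: One_nat_def)

text \<open>E is fixed by Frobenius, so E Y solves the same equation as Y; its components define
  \<sigma> by universality. The order of \<sigma> is bounded by that of E.\<close>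

lemma tower_aut:
  assumes T: "tower l \<theta> \<eta>" and l: "l \<le> n"
  obtains \<sigma> where "field_hom \<sigma>" "\<And>x. \<sigma> (\<theta> x) = \<theta> x"
    "fcong (p ^ l) (fmap \<sigma> (wprod \<eta> l)) (E * wprod \<eta> l)" "\<sigma> ^^ (p ^ l) = id"
proof -
  interpret fr: field_hom fr by (rule fr_hom)
  interpret \<theta>: vhom \<theta> "p ^ l" using towerD(1)[OF T] .
  have "ptypical p n (E * wprod \<eta> l)" by (intro ptypical_mult E_typical wprod_typical)
  then obtain y where y: "fcong (p ^ l) (E * wprod \<eta> l) (wprod y l)" using l by (rule normal_form)
  have "sys l (\<lambda>i. \<theta> (h i)) y"
    unfolding sys_def
  proof -
    have "fcong (p ^ l) (fmap fr (wprod y l)) (fmap fr (E * wprod \<eta> l))"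
      using fcong_sym[OF y] by (rule fmap_cong_mod)
    also have "fmap fr (E * wprod \<eta> l) = E * fmap fr (wprod \<eta> l)"
      by (simp add: fr.fmap_mult E_fmap[OF fr_hom])
    also have "fcong (p ^ l) (E * fmap fr (wprod \<eta> l)) (E * (wprod (\<lambda>i. \<theta> (h i)) l * wprod \<eta> l))"
      using towerD(2)[OF T] unfolding sys_def by (intro fcong_mult fcong_refl)
    also have "E * (wprod (\<lambda>i. \<theta> (h i)) l * wprod \<eta> l) = wprod (\<lambda>i. \<theta> (h i)) l * (E * wprod \<eta> l)"
      by (simp add: mult_ac)
    also have "fcong (p ^ l) (wprod (\<lambda>i. \<theta> (h i)) l * (E * wprod \<eta> l)) (wprod (\<lambda>i. \<theta> (h i)) l * wprod y l)"
      by (intro fcong_mult fcong_refl y)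
    finally show "fcong (p ^ l) (fmap fr (wprod y l)) (wprod (\<lambda>i. \<theta> (h i)) l * wprod y l)" .
  qed
  from towerD(3)[OF T \<theta>.field_hom_axioms this]
  obtain \<sigma> where \<sigma>: "field_hom \<sigma>" "\<And>x. \<sigma> (\<theta> x) = \<theta> x" "\<And>i. i < l \<Longrightarrow> \<sigma> (\<eta> i) = y i" by blast
  have "fmap \<sigma> (wprod \<eta> l) = wprod y l"
    unfolding fmap_wprod[OF \<sigma>(1)] using \<sigma>(3) by (intro wprod_cong)
  then have \<sigma>Y: "fcong (p ^ l) (fmap \<sigma> (wprod \<eta> l)) (E * wprod \<eta> l)" using fcong_sym[OF y] by simp
  note pow = field_hom_funpow[OF \<sigma>(1)]
  have "\<sigma> ^^ (p ^ l) = id"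
  proof (rule towerD(4)[OF T pow])
    show "field_hom (id :: 'k fls \<Rightarrow> 'k fls)" by unfold_locales simp_all
    show "(\<sigma> ^^ (p ^ l)) (\<theta> x) = id (\<theta> x)" for x
    proof -
      have "(\<sigma> ^^ k) (\<theta> x) = \<theta> x" for k by (induction k) (simp_all add: \<sigma>(2))
      then show ?thesis by simp
    qed
    have "fcong (p ^ l) (fmap (\<sigma> ^^ (p ^ l)) (wprod \<eta> l)) (E ^ (1 * p ^ l) * wprod \<eta> l)"
      using \<sigma>Y by (intro fmap_E_power_iterate \<sigma>(1)) simp
    also have "fcong (p ^ l) (E ^ (1 * p ^ l) * wprod \<eta> l) (1 * wprod \<eta> l)"
      using E_power_eq_one[of l l 1] by (intro fcong_mult fcong_refl) simp
    finally have "fcong (p ^ l) (wprod (\<lambda>i. (\<sigma> ^^ (p ^ l)) (\<eta> i)) l) (wprod \<eta> l)"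
      by (simp add: fmap_wprod[OF pow])
    from wprod_unique[OF this] show "(\<sigma> ^^ (p ^ l)) (\<eta> i) = id (\<eta> i)" if "i < l" for i
      using that by simp
  qed
  with \<sigma>(1,2) \<sigma>Y show ?thesis by (rule that)
qed

text \<open>If the next Artin--Schreier equation were solvable already, then the automorphism of order
  \<open>p ^ l\<close> would act on a solution modulo \<open>t ^ p ^ Suc l\<close> with order \<open>p ^ Suc l\<close>.\<close>

lemma tower_nondegenerate:
  assumes T: "tower l \<theta> \<eta>" and l: "l < n" and d: "d ^ p - d = obst l (\<lambda>i. \<theta> (h i)) \<eta>"
  shows False
\<comment> \<open>For l = 0 the congruence M = 1 modulo \<open>p^l\<close> of the general argument
  is empty; the pole order of \<open>h 0\<close>, prime to p, decides instead.\<close>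
proof (cases "l = 0")
  case True
  interpret \<theta>: vhom \<theta> "p ^ l" using towerD(1)[OF T] .
  interpret fr: field_hom fr by (rule fr_hom)
  have "fps_nth (esub E x 1) 1 = x" for x using esub_E_low(2)[of x 0] by simp
  then have "obst l (\<lambda>i. \<theta> (h i)) \<eta> = \<theta> (h 0)" unfolding True obst_def wprod_Suc
    by (simp add: fps_inverse_one)
  then have eq: "d ^ p - d = \<theta> (h 0)" using d by simp
  have a1: "a\<^sub>1 > 0" using h_0(2) by (intro Nat.gr0I) simp
  have "h 0 \<noteq> 0" using h_0(1) a1 by auto
  then have sub: "\<nu> (d ^ p - d) = - int a\<^sub>1" unfolding eq using h_0(1) True by (simp add: \<theta>.subdegree)
  have d0: "d \<noteq> 0" using sub a1 p_gt_1 by (intro notI) (simp add: power_0_left)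
  show False
  proof (cases "\<nu> d \<ge> 0")
    case True
    then have "vge 0 d" by (simp add: vge_def)
    then have "vge 0 (d ^ p - d)" using vge_power[of 0 d p] by (intro vge_diff) simp_all
    then show False using sub a1 by (auto simp: vge_def)
  next
    case False
    then have lt: "\<nu> (d ^ p) < \<nu> d" using p_gt_1 by (simp add: fls_subdegree_pow)
    have "\<nu> (d ^ p - d) = \<nu> (d ^ p)"
      using lt d0 by (intro fls_subdegree_diff_eq1) simp_all
    then have "int a\<^sub>1 = int p * (- \<nu> d)" using sub by (simp add: fls_subdegree_pow)
    then have "int p dvd int a\<^sub>1" by (rule dvdI)
    then show False using h_0(2) by simp
  qed
next
  case False
  obtain \<sigma> where \<sigma>: "field_hom \<sigma>" "\<And>x. \<sigma> (\<theta> x) = \<theta> x"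
    "fcong (p ^ l) (fmap \<sigma> (wprod \<eta> l)) (E * wprod \<eta> l)" "\<sigma> ^^ (p ^ l) = id"
    using tower_aut[OF T] l by (metis less_imp_le)
  interpret \<sigma>: field_hom \<sigma> by fact
  interpret fr: field_hom fr by (rule fr_hom)
  define \<eta>' where "\<eta>' = \<eta>(l := d)"
  define H where "H = wprod (\<lambda>i. \<theta> (h i)) (Suc l)"
  define Y where "Y = wprod \<eta>' (Suc l)"
  have S: "sys (Suc l) (\<lambda>i. \<theta> (h i)) \<eta>'"
    unfolding sys_Suc[OF l] using towerD(2)[OF T] d sys_cong[of l \<eta>' \<eta>] obst_cong[of l \<eta>' \<eta>]
    by (simp add: \<eta>'_def)
  then have frY: "fcong (p ^ Suc l) (fmap fr Y) (H * Y)" by (simp add: sys_def Y_def H_def)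
  have "fmap \<sigma> H = H" by (simp add: H_def fmap_wprod[OF \<sigma>(1)] \<sigma>(2))
  define R where "R = fmap \<sigma> Y * inverse Y"
  have Y0: "fps_nth Y 0 = 1" by (simp add: Y_def)
  have typY: "ptypical p n Y" unfolding Y_def by (rule wprod_typical)
  have typR: "ptypical p n R"
    unfolding R_def using ptypical_fmap[OF \<sigma>(1) roots, of n Y] typY
    by (intro ptypical_mult ptypical_inverse) simp_all
  have YR: "fmap \<sigma> Y = R * Y" using Y0 by (simp add: R_def mult.assoc inverse_mult_eq_1)
  \<comment> \<open>Y and its image under \<sigma> satisfy the same equation, so their quotient R is
    fixed by Frobenius and is a power of E.\<close>
  have "fcong (p ^ Suc l) (fmap fr R) R"
  proof -
    have "fmap fr R = fmap fr (fmap \<sigma> Y) * inverse (fmap fr Y)"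
      unfolding R_def fr.fmap_mult by (subst fr.fmap_inverse) (simp_all add: Y0)
    also have "fmap fr (fmap \<sigma> Y) = fmap \<sigma> (fmap fr Y)" by (simp add: fps_eq_iff \<sigma>.power)
    finally have "fmap fr R * fmap fr Y = fmap \<sigma> (fmap fr Y)"
      using Y0 by (simp add: mult.assoc inverse_mult_eq_1)
    also have "fcong (p ^ Suc l) (fmap \<sigma> (fmap fr Y)) (fmap \<sigma> (H * Y))" using frY by (rule fmap_cong_mod)
    also have "fmap \<sigma> (H * Y) = R * (H * Y)" by (simp add: \<sigma>.fmap_mult \<open>fmap \<sigma> H = H\<close> YR mult_ac)
    also have "fcong (p ^ Suc l) (R * (H * Y)) (R * fmap fr Y)" by (intro fcong_mult fcong_refl fcong_sym[OF frY])
    finally show ?thesis by (rule fcong_cancel) (simp add: Y0)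
  qed
  then obtain M where M: "fcong (p ^ Suc l) R (E ^ M)"
    using typical_prime_field[OF typR, of "Suc l"] l by (metis Suc_leI)
  have \<sigma>Y: "fcong (p ^ Suc l) (fmap \<sigma> Y) (E ^ M * Y)" unfolding YR by (intro fcong_mult M fcong_refl)
  have pl: "p ^ l \<le> p ^ Suc l" using p_gt_1 by simp
  have "fcong (p ^ l) Y (wprod \<eta> l)"
    using fcong_trans[OF wprod_Suc_low[of l \<eta>']] wprod_cong[of l \<eta>' \<eta>] by (simp add: Y_def \<eta>'_def)
  note Yl = this
  have "fcong (p ^ l) (E ^ M * Y) (E ^ 1 * Y)"
  proof -
    have "fcong (p ^ l) (E ^ M * Y) (fmap \<sigma> Y)" using fcong_mono[OF \<sigma>Y pl] by (rule fcong_sym)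
    also have "fcong (p ^ l) (fmap \<sigma> Y) (fmap \<sigma> (wprod \<eta> l))" using Yl by (rule fmap_cong_mod)
    also note \<sigma>(3)
    also have "fcong (p ^ l) (E * wprod \<eta> l) (E ^ 1 * Y)" using fcong_mult[OF fcong_refl fcong_sym[OF Yl]] by simp
    finally show ?thesis .
  qed
  then have "fcong (p ^ l) (E ^ M) (E ^ 1)" using Y0 by (rule fcong_cancel)
  then have M1: "[M = 1] (mod p ^ l)" by (rule E_power_inj)
  have "fcong (p ^ Suc l) (fmap (\<sigma> ^^ (p ^ l)) Y) (E ^ (M * p ^ l) * Y)"
    by (rule fmap_E_power_iterate[OF \<sigma>(1) \<sigma>Y])
  moreover have "fmap (\<sigma> ^^ (p ^ l)) Y = Y" unfolding \<sigma>(4) by (simp add: fps_eq_iff)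
  ultimately have "fcong (p ^ Suc l) (E ^ (M * p ^ l) * Y) (E ^ 0 * Y)" by (simp add: fcong_sym)
  then have "fcong (p ^ Suc l) (E ^ (M * p ^ l)) (E ^ 0)" using Y0 by (rule fcong_cancel)
  then have "[M * p ^ l = 0] (mod p ^ Suc l)" by (rule E_power_inj)
  then have "p ^ l * p dvd p ^ l * M" by (simp add: cong_0_iff mult.commute)
  then have "p dvd M" using p_gt_1 by simp
  moreover have "[M = 1] (mod p)" using M1 False by (metis cong_dvd_modulus_nat dvd_power neq0_conv)
  ultimately have "p dvd 1" by (simp add: cong_dvd_iff)
  then show False using p_gt_1 by simp
qed

text \<open>The obstruction is reduced to g with pole order prime to p, nonzero by
  \<open>tower_nondegenerate\<close>, and \<open>artin_schreier_model\<close> adjoins a root.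
  Universality is inherited through \<open>field_hom_extend\<close>.\<close>

lemma tower_Suc:
  assumes T: "tower l \<theta> \<eta>" and l: "l < n"
  shows "\<exists>\<theta>' \<eta>'. tower (Suc l) \<theta>' \<eta>'"
proof -
  interpret \<theta>: vhom \<theta> "p ^ l" using towerD(1)[OF T] .
  interpret fr: field_hom fr by (rule fr_hom)
  define q where "q = obst l (\<lambda>i. \<theta> (h i)) \<eta>"
  obtain d g where dg: "q = g + d ^ p - d" "g = 0 \<or> \<nu> g < 0 \<and> \<not> int p dvd \<nu> g"
    by (rule artin_schreier_reduce[OF prime_p char_k, of q]) blast
  have "g \<noteq> 0" using tower_nondegenerate[OF T l, of d] dg(1) by (auto simp: q_def)
  then have g: "\<nu> g < 0" "\<not> int p dvd \<nu> g" using dg(2) by auto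
  define J where "J = nat (- \<nu> g)"
  have J: "\<nu> g = - int J" using g(1) by (simp add: J_def)
  then have "\<not> p dvd J" using g(2) by simp
  then obtain \<rho> \<xi> where \<rho>: "vhom \<rho> p" and \<xi>: "\<xi> \<noteq> 0" "\<nu> \<xi> = - int J" "\<xi> ^ p - \<xi> = \<rho> g"
    using artin_schreier_model[OF prime_p char_k J] by blast
  interpret \<rho>: vhom \<rho> p by fact
  have "coprime (\<nu> \<xi>) (int p)"
    unfolding \<xi>(2) using prime_imp_coprime[OF prime_p \<open>\<not> p dvd J\<close>] by (simp add: coprime_commute)
  then have "ramified_basis \<rho> p (\<lambda>i. \<xi> ^ i)"
    by (rule ramified_basis_coprime_powers[OF \<rho> \<xi>(1)])
  then interpret R: ramified_basis \<rho> p "\<lambda>i. \<xi> ^ i" .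
  \<comment> \<open>\<xi> solves the reduced equation, and the summand \<rho> d undoes the
    reduction.\<close>
  define \<eta>' where "\<eta>' i = (if i < l then \<rho> (\<eta> i) else \<xi> + \<rho> d)" for i
  define \<theta>' where "\<theta>' x = \<rho> (\<theta> x)" for x
  have "vhom \<theta>' (p ^ Suc l)"
    unfolding \<theta>'_def using vhom_comp[OF \<rho> \<theta>.vhom_axioms] by simp
  moreover have "sys (Suc l) (\<lambda>i. \<theta>' (h i)) \<eta>'"
    unfolding sys_Suc[OF l]
  proof
    have "sys l (\<lambda>i. \<theta>' (h i)) (\<lambda>i. \<rho> (\<eta> i))"
      unfolding \<theta>'_def using \<rho>.field_hom_axioms towerD(2)[OF T] by (rule sys_hom)
    then show "sys l (\<lambda>i. \<theta>' (h i)) \<eta>'" using sys_cong[of l \<eta>' "\<lambda>i. \<rho> (\<eta> i)"] by (simp add: \<eta>'_def)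
    have "obst l (\<lambda>i. \<theta>' (h i)) \<eta>' = obst l (\<lambda>i. \<theta>' (h i)) (\<lambda>i. \<rho> (\<eta> i))"
      by (rule obst_cong) (simp add: \<eta>'_def)
    also have "\<dots> = \<rho> q" unfolding q_def \<theta>'_def by (rule obst_hom[OF \<rho>.field_hom_axioms, symmetric])
    also have "\<dots> = (\<xi> ^ p - \<xi>) + \<rho> d ^ p - \<rho> d" unfolding \<xi>(3) by (simp add: dg(1) \<rho>.add \<rho>.diff \<rho>.power)
    also have "\<dots> = \<eta>' l ^ p - \<eta>' l" by (simp add: \<eta>'_def fr.add)
    finally show "\<eta>' l ^ p - \<eta>' l = obst l (\<lambda>i. \<theta>' (h i)) \<eta>'" ..
  qed
  moreover have "\<exists>\<Phi>::'k fls \<Rightarrow> 'k fls. field_hom \<Phi> \<and> (\<forall>x. \<Phi> (\<theta>' x) = \<alpha> x) \<and> (\<forall>i<Suc l. \<Phi> (\<eta>' i) = y i)"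
    if \<alpha>: "field_hom \<alpha>" and y: "sys (Suc l) (\<lambda>i. \<alpha> (h i)) y" for \<alpha> y
  proof -
    have yl: "sys l (\<lambda>i. \<alpha> (h i)) y" "y l ^ p - y l = obst l (\<lambda>i. \<alpha> (h i)) y"
      using y unfolding sys_Suc[OF l] by auto
    obtain \<Phi> :: "'k fls \<Rightarrow> 'k fls" where \<Phi>: "field_hom \<Phi>" "\<And>x. \<Phi> (\<theta> x) = \<alpha> x" "\<And>i. i < l \<Longrightarrow> \<Phi> (\<eta> i) = y i"
      using towerD(3)[OF T \<alpha> yl(1)] by blast
    interpret \<Phi>: field_hom \<Phi> by fact
    have "\<Phi> q = obst l (\<lambda>i. \<alpha> (h i)) (\<lambda>i. \<Phi> (\<eta> i))" unfolding q_def obst_hom[OF \<Phi>(1)] \<Phi>(2) ..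
    also have "\<dots> = y l ^ p - y l" unfolding yl(2) using \<Phi>(3) by (intro obst_cong)
    finally have \<Phi>q: "\<Phi> q = y l ^ p - y l" .
    define z where "z = y l - \<Phi> d"
    have z: "z ^ p - z = \<Phi> g"
    proof -
      have "\<Phi> g = \<Phi> q - (\<Phi> d ^ p - \<Phi> d)" by (simp add: dg(1) \<Phi>.add \<Phi>.diff \<Phi>.power)
      then show ?thesis by (simp add: \<Phi>q z_def fr.diff)
    qed
    define A where "A = monom 1 p + (- monom 1 1 + [:- g:])"
    have degA: "degree A = p"
    proof -
      have "degree (- monom 1 1 + [:- g:]) < p"
        using p_gt_1 by (intro degree_add_less) (simp_all add: degree_monom_eq)
      then show ?thesis unfolding A_def by (subst degree_add_eq_left) (simp_all add: degree_monom_eq)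
    qed
    have evA: "poly (map_poly f A) x = x ^ p - x - f g" if "field_hom f" for f :: "'k fls \<Rightarrow> 'k fls" and x
    proof -
      interpret f: field_hom f by fact
      have "- monom (1 :: 'k fls) 1 = monom (- 1) 1" by (simp add: minus_monom)
      then show ?thesis unfolding A_def f.poly_map_add
        by (simp add: map_poly_monom poly_monom map_poly_pCons f.uminus)
    qed
    obtain \<Phi>' where \<Phi>': "field_hom \<Phi>'" "\<And>x. \<Phi>' (\<rho> x) = \<Phi> x" "\<Phi>' \<xi> = z"
    proof (rule field_hom_extend[OF R.ramified_basis_axioms \<Phi>(1) degA])
      show "poly (map_poly \<rho> A) \<xi> = 0" using \<xi>(3) by (simp add: evA[OF \<rho>.field_hom_axioms])
      show "poly (map_poly \<Phi> A) z = 0" using z by (simp add: evA[OF \<Phi>(1)])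
    qed (rule that)
    interpret \<Phi>': field_hom \<Phi>' by fact
    have "\<Phi>' (\<eta>' i) = y i" if "i < Suc l" for i
      using that \<Phi>(3)[of i] by (cases "i = l") (simp_all add: \<eta>'_def \<Phi>'.add \<Phi>'(2,3) z_def)
    then show ?thesis using \<Phi>' \<Phi>(2) by (intro exI[of _ \<Phi>']) (simp add: \<theta>'_def)
  qed
  moreover have "\<Phi> = \<Phi>'" if f: "field_hom \<Phi>" "field_hom \<Phi>'" and eq: "\<And>x. \<Phi> (\<theta>' x) = \<Phi>' (\<theta>' x)"
    "\<And>i. i < Suc l \<Longrightarrow> \<Phi> (\<eta>' i) = \<Phi>' (\<eta>' i)" for \<Phi> \<Phi>' :: "'k fls \<Rightarrow> 'k fls"
  proof
    interpret \<Phi>: field_hom \<Phi> by fact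
    interpret \<Phi>': field_hom \<Phi>' by fact
    have "(\<lambda>x. \<Phi> (\<rho> x)) = (\<lambda>x. \<Phi>' (\<rho> x))"
    proof (rule towerD(4)[OF T])
      show "field_hom (\<lambda>x. \<Phi> (\<rho> x))" "field_hom (\<lambda>x. \<Phi>' (\<rho> x))"
        using field_hom_comp f \<rho>.field_hom_axioms by blast+
      show "\<Phi> (\<rho> (\<theta> x)) = \<Phi>' (\<rho> (\<theta> x))" for x using eq(1) by (simp add: \<theta>'_def)
      show "\<Phi> (\<rho> (\<eta> i)) = \<Phi>' (\<rho> (\<eta> i))" if "i < l" for i using eq(2)[of i] that by (simp add: \<eta>'_def)
    qed
    then have \<rho>eq: "\<Phi> (\<rho> x) = \<Phi>' (\<rho> x)" for x by (rule fun_cong)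
    have "\<Phi> \<xi> + \<Phi> (\<rho> d) = \<Phi>' \<xi> + \<Phi>' (\<rho> d)" using eq(2)[of l] by (simp add: \<eta>'_def \<Phi>.add \<Phi>'.add)
    then have \<xi>eq: "\<Phi> \<xi> = \<Phi>' \<xi>" by (simp add: \<rho>eq)
    fix x
    obtain c where x: "x = (\<Sum>i<p. \<rho> (c i) * \<xi> ^ i)" using R.basis_span by blast
    show "\<Phi> x = \<Phi>' x"
      unfolding x \<Phi>.sum \<Phi>'.sum by (simp add: \<Phi>.mult \<Phi>'.mult \<Phi>.power \<Phi>'.power \<rho>eq \<xi>eq)
  qed
  ultimately have "tower (Suc l) \<theta>' \<eta>'" unfolding tower_def by blast
  then show ?thesis by blast
qed

lemma tower_exists: "l \<le> n \<Longrightarrow> \<exists>\<theta> \<eta>. tower l \<theta> \<eta>"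
  by (induction l) (use tower_0 tower_Suc in \<open>auto dest: Suc_leD\<close>)

end

section \<open>Roots of unity\<close>

lemma power_mod_exponent:
  fixes x :: "'a::monoid_mult"
  assumes "x ^ m = 1"
  shows "x ^ (j mod m) = x ^ j"
proof -
  have "x ^ j = x ^ (m * (j div m) + j mod m)" by simp
  also have "\<dots> = x ^ (j mod m)" unfolding power_add power_mult assms by simp
  finally show ?thesis ..
qed

text \<open>Split off a prime q, m = q m'. If q still divides m', a q-th root of a primitive m'-th
  root works; otherwise multiply by a nontrivial q-th root of unity.\<close>

lemma primitive_root_exists:
  assumes p: "prime p" "CHAR('k::alg_closed_field) = p" and "m \<ge> 1" "\<not> p dvd m"
  shows "\<exists>\<zeta>::'k. \<forall>j. \<zeta> ^ j = 1 \<longleftrightarrow> m dvd j"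
  using assms(3,4)
proof (induction m rule: less_induct)
  case (less m)
  show ?case
  proof (cases "m = 1")
    case True
    then show ?thesis by (intro exI[of _ 1]) simp
  next
    case False
    then obtain q where q: "prime q" "q dvd m" using prime_factor_nat[of m] by blast
    then obtain m' where m: "m = q * m'" by (elim dvdE)
    have q1: "q > 1" using q(1) by (rule prime_gt_1_nat)
    have "m' \<noteq> 0" using less.prems(1) m by (intro notI) simp
    then have m': "m' \<ge> 1" "m' < m" using q1 unfolding m by simp_all
    have "\<not> p dvd m'" using less.prems(2) m by auto
    then obtain \<zeta>' :: 'k where \<zeta>': "\<zeta>' ^ j = 1 \<longleftrightarrow> m' dvd j" for j using less.IH[OF m'(2,1)] by blast
    show ?thesis
    proof (cases "q dvd m'")
      case True
      obtain \<zeta> where \<zeta>: "\<zeta> ^ q = \<zeta>'" using nth_root_exists[of q \<zeta>'] q1 by auto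
      have "\<zeta> ^ j = 1 \<longleftrightarrow> m dvd j" for j
      proof
        assume j: "\<zeta> ^ j = 1"
        then have "\<zeta>' ^ j = 1" unfolding \<zeta>[symmetric] power_mult[symmetric] mult.commute[of q] unfolding power_mult by simp
        then have "q dvd j" using \<zeta>' True by (meson dvd_trans)
        then obtain i where i: "j = q * i" by (elim dvdE)
        then have "\<zeta>' ^ i = 1" using j by (simp add: \<zeta>[symmetric] power_mult)
        then show "m dvd j" using \<zeta>' by (simp add: m i)
      next
        assume "m dvd j"
        then obtain i where "j = q * (m' * i)" unfolding m dvd_def mult.assoc by blast
        then have "\<zeta> ^ j = (\<zeta>' ^ m') ^ i" by (simp add: \<zeta>[symmetric] power_mult)
        then show "\<zeta> ^ j = 1" using \<zeta>'[of m'] by simp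
      qed
      then show ?thesis by blast
    next
      case False
      have "q \<noteq> p" using less.prems(2) m by auto
      then have "card (uroots q :: 'k set) = q"
        using full_uroots_alg_closed[OF p] q(1) by (simp add: full_uroots_def)
      moreover have "\<not> q dvd 1" using q1 by simp
      ultimately obtain \<omega> :: 'k where "\<omega> \<in> uroots q" "\<omega> ^ 1 \<noteq> 1"
        using uroots_nontrivial[OF q(1)] by blast
      then have \<omega>: "\<omega> ^ q = 1" "\<omega> \<noteq> 1" by (simp_all add: uroots_def)
      have \<omega>j: "q dvd j" if "\<omega> ^ j = 1" for j
        using power_eq_1_coprime[of \<omega> q j] prime_imp_coprime[OF q(1), of j] \<omega> that q1
        by (auto simp: coprime_commute)
      have cop: "coprime m' q" using prime_imp_coprime[OF q(1) False] by (simp add: coprime_commute)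
      have "(\<zeta>' * \<omega>) ^ j = 1 \<longleftrightarrow> m dvd j" for j
      proof
        assume j: "(\<zeta>' * \<omega>) ^ j = 1"
        have "((\<zeta>' * \<omega>) ^ j) ^ q = \<zeta>' ^ (j * q) * (\<omega> ^ q) ^ j" by (simp add: power_mult_distrib mult.commute flip: power_mult)
        then have "\<zeta>' ^ (j * q) = 1" using j \<omega>(1) by simp
        then have "m' dvd j" using \<zeta>' cop by (simp add: coprime_dvd_mult_left_iff)
        then have "\<omega> ^ j = 1" using j \<zeta>'[of j] by (simp add: power_mult_distrib)
        then have "q dvd j" by (rule \<omega>j)
        then show "m dvd j" using \<open>m' dvd j\<close> cop by (simp add: m divides_mult coprime_commute)
      next
        assume "m dvd j"
        then have "m' dvd j" "q dvd j" unfolding m by (blast dest: dvd_mult_left dvd_mult_right)+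
        then show "(\<zeta>' * \<omega>) ^ j = 1" using \<zeta>'[of j] \<omega>(1) by (auto simp: power_mult_distrib power_mult elim!: dvdE[of q])
      qed
      then show ?thesis by blast
    qed
  qed
qed

lemma root_of_unity_power:
  fixes \<zeta> :: "'k::field"
  assumes \<zeta>: "\<And>j. \<zeta> ^ j = 1 \<longleftrightarrow> m dvd j" and m: "m \<ge> 1" and x: "x ^ m = 1"
  obtains b where "x = \<zeta> ^ b"
proof -
  have inj: "inj_on (\<lambda>j. \<zeta> ^ j) {..<m}"
  proof -
    have z: "\<zeta> \<noteq> 0" using \<zeta>[of m] m by (auto simp: power_0_left)
    have "i = j" if "i \<le> j" "j < m" "\<zeta> ^ i = \<zeta> ^ j" for i j
    proof -
      have "\<zeta> ^ i * \<zeta> ^ (j - i) = \<zeta> ^ j" using that(1) by (simp flip: power_add)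
      then have "\<zeta> ^ (j - i) = 1" using z that(3) by simp
      then have "m dvd j - i" by (simp add: \<zeta>)
      then show "i = j" using that by (cases "i = j") (auto dest: dvd_imp_le)
    qed
    then show ?thesis by (intro inj_onI) (metis lessThan_iff nle_le)
  qed
  define P where "P = (monom 1 m - 1 :: 'k poly)"
  have coeff: "coeff P m = 1" using m by (simp add: P_def)
  then have P0: "P \<noteq> 0" by auto
  have deg: "degree P \<le> m" unfolding P_def by (intro degree_diff_le) (simp_all add: degree_monom_le)
  have roots: "{x. poly P x = 0} = {x. x ^ m = 1}" by (simp add: P_def poly_monom)
  have "card {x. poly P x = 0} \<le> m" using card_poly_roots_bound[OF P0] deg by simp
  moreover have fin: "finite {x. poly P x = 0}" using poly_roots_finite[OF P0] .
  moreover have sub: "(\<lambda>j. \<zeta> ^ j) ` {..<m} \<subseteq> {x. poly P x = 0}"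
  proof -
    have "(\<zeta> ^ j) ^ m = 1" for j using \<zeta>[of "j * m"] by (simp add: power_mult)
    then show ?thesis unfolding roots by auto
  qed
  ultimately have "(\<lambda>j. \<zeta> ^ j) ` {..<m} = {x. poly P x = 0}"
    using card_image[OF inj] card_mono[OF fin sub] by (intro card_subset_eq[OF fin]) simp_all
  then have "x \<in> (\<lambda>j. \<zeta> ^ j) ` {..<m}" using x roots by simp
  then show ?thesis using that by blast
qed

text \<open>Dividing by the common gcd g determines r modulo m/g as a unit; the freedom of adding
  multiples of m/g suffices to make r prime to all of m.\<close>

lemma unit_multiplier:
  fixes a b m :: nat
  assumes m: "m \<ge> 1" and gcd: "gcd m a = gcd m b"
  obtains r where "coprime r m" "[a * r = b] (mod m)"
proof -
  define g where "g = gcd m a"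
  have g0: "g > 0" using m by (simp add: g_def)
  define m' a' b' where "m' = m div g" and "a' = a div g" and "b' = b div g"
  have "g dvd m" "g dvd a" by (simp_all add: g_def)
  moreover have "g dvd b" unfolding g_def gcd by simp
  ultimately have eqs: "m = g * m'" "a = g * a'" "b = g * b'" by (simp_all add: m'_def a'_def b'_def)
  have "coprime m' a'" unfolding m'_def a'_def g_def using m by (intro div_gcd_coprime) auto
  moreover have "coprime m' b'" unfolding m'_def b'_def g_def gcd using m by (intro div_gcd_coprime) auto
  ultimately have cop: "coprime a' m'" "coprime b' m'" by (simp_all add: coprime_commute)
  then obtain i where i: "[a' * i = 1] (mod m')" using cong_solve_coprime_nat by (metis One_nat_def)
  define r0 where "r0 = i * b'"
  have ar0: "[a' * r0 = b'] (mod m')" using cong_scalar_right[OF i, of b'] by (simp add: r0_def mult.assoc)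
  have cop0: "coprime r0 m'" using ar0 cop(2) by (metis cong_imp_coprime cong_sym coprime_mult_left_iff)
  \<comment> \<open>For a prime q dividing m exactly one of \<open>r0\<close> and m' k is divisible
    by q: those missing from \<open>r0\<close> occur in k, and those dividing \<open>r0\<close>
    divide neither m' nor k.\<close>
  define k where "k = \<Prod>{q. prime q \<and> q dvd m \<and> \<not> q dvd r0}"
  have fin: "finite {q. prime q \<and> q dvd m \<and> \<not> q dvd r0}" using m by (intro finite_subset[OF _ finite_divisors_nat[of m]]) auto
  define r where "r = r0 + m' * k"
  have "coprime r m"
  proof (rule ccontr)
    assume "\<not> coprime r m"
    then have "gcd r m \<noteq> 1" by (simp add: coprime_iff_gcd_eq_1)
    then obtain q where q: "prime q" "q dvd r" "q dvd m"
      using prime_factor_nat[of "gcd r m"] by auto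
    show False
    proof (cases "q dvd r0")
      case True
      then have "q dvd m' * k" using q(2) by (simp add: r_def dvd_add_right_iff)
      moreover have "\<not> q dvd m'" using True cop0 q(1) by (metis coprime_common_divisor_nat not_prime_1)
      ultimately have "q dvd k" using q(1) by (simp add: prime_dvd_mult_iff)
      then obtain q' where "prime q'" "\<not> q' dvd r0" "q dvd q'"
        unfolding k_def using q(1) fin by (auto simp: prime_dvd_prod_iff)
      then show False using True q(1) primes_dvd_imp_eq by blast
    next
      case False
      then have "q dvd k" unfolding k_def using q by (intro dvd_prodI fin[THEN finite_subset[rotated]]) auto
      then have "q dvd r0" using q(2) by (simp add: r_def dvd_add_left_iff)
      then show False using False by simp
    qed
  qed
  moreover have "[a * r = b] (mod m)"
  proof -
    have "[a' * r = a' * r0] (mod m')" unfolding r_def by (intro cong_scalar_left) (simp add: cong_def)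
    then have "[a' * r = b'] (mod m')" using ar0 by (rule cong_trans)
    then have "[g * (a' * r) = g * b'] (mod g * m')" using g0 by (simp add: cong_def mod_mult_mult1)
    then show ?thesis using eqs by (simp add: mult.assoc)
  qed
  ultimately show ?thesis by (rule that)
qed

text \<open>Condition (b) enters here: it says that \<kappa> in k and the a-th power of any
  primitive m-th root of unity have the same order, so changing the primitive root by a unit
  exponent makes them equal.\<close>

lemma root_of_unity_with_power:
  fixes a \<kappa> p n m :: nat
  assumes p: "prime p" "CHAR('k::alg_closed_field) = p" and m: "m \<ge> 1" "\<not> p dvd m" and n: "n \<ge> 1"
    and \<kappa>: "[\<kappa> ^ m = 1] (mod p ^ n)" and gcd: "gcd m a = card {j. j < m \<and> [\<kappa> ^ j = 1] (mod p ^ n)}"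
  obtains \<zeta> :: "'k::alg_closed_field" where "\<And>j. \<zeta> ^ j = 1 \<longleftrightarrow> m dvd j" "\<zeta> ^ a = of_nat \<kappa>"
proof -
  obtain \<zeta>0 :: 'k where \<zeta>0: "\<And>j. \<zeta>0 ^ j = 1 \<longleftrightarrow> m dvd j" using primitive_root_exists[OF p m] by blast
  have k_iff: "(of_nat \<kappa> :: 'k) ^ j = 1 \<longleftrightarrow> [\<kappa> ^ j = 1] (mod p ^ n)" for j
  proof -
    have "(of_nat \<kappa> :: 'k) ^ j = 1 \<longleftrightarrow> (of_nat (\<kappa> ^ j) :: 'k) = of_nat 1" by simp
    also have "\<dots> \<longleftrightarrow> [\<kappa> ^ j = 1] (mod p)" using p(2) by (simp only: of_nat_eq_iff_cong_CHAR)
    also have "\<dots> \<longleftrightarrow> [\<kappa> ^ j = 1] (mod p ^ n)"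
    proof -
      have "[(\<kappa> ^ j) ^ m = 1] (mod p ^ n)" using cong_pow[OF \<kappa>, of j] by (simp add: mult.commute flip: power_mult)
      then show ?thesis using cong_1_lift[OF p(1) m(2) n] by blast
    qed
    finally show ?thesis .
  qed
  then have "(of_nat \<kappa> :: 'k) ^ m = 1" using \<kappa> by blast
  then obtain b where b: "of_nat \<kappa> = \<zeta>0 ^ b" using root_of_unity_power[OF \<zeta>0 m(1)] by blast
  have "[\<kappa> ^ j = 1] (mod p ^ n) \<longleftrightarrow> m dvd b * j" for j
    unfolding k_iff[symmetric] b power_mult[symmetric] by (rule \<zeta>0)
  then have "gcd m a = gcd m b" using gcd card_annihilator[OF m(1), of b] by simp
  then obtain r where r: "coprime r m" "[a * r = b] (mod m)" using unit_multiplier[OF m(1)] by blast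
  show ?thesis
  proof (rule that[of "\<zeta>0 ^ r"])
    show "(\<zeta>0 ^ r) ^ j = 1 \<longleftrightarrow> m dvd j" for j
      unfolding power_mult[symmetric] \<zeta>0 using r(1) by (simp add: coprime_dvd_mult_right_iff coprime_commute)
    have mod: "\<zeta>0 ^ x = \<zeta>0 ^ (x mod m)" for x
      using power_mod_exponent[of \<zeta>0 m x] \<zeta>0[of m] by simp
    have "(\<zeta>0 ^ r) ^ a = \<zeta>0 ^ (a * r)" by (simp add: mult.commute flip: power_mult)
    also have "\<dots> = \<zeta>0 ^ b" using mod[of "a * r"] mod[of b] r(2) by (simp add: cong_def)
    finally show "(\<zeta>0 ^ r) ^ a = of_nat \<kappa>" by (simp add: b)
  qed
qed

section \<open>Realization of the semidirect product\<close>

lemma funpow_twisted_commute: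
  assumes "\<And>x. \<tau> (\<sigma> x) = (\<sigma> ^^ c) (\<tau> x)"
  shows "(\<tau> ^^ j) ((\<sigma> ^^ i) x) = (\<sigma> ^^ (c ^ j * i)) ((\<tau> ^^ j) x)"
proof (induction j)
  case (Suc j)
  have one: "\<tau> ((\<sigma> ^^ i) x) = (\<sigma> ^^ (c * i)) (\<tau> x)" for i x
    by (induction i) (simp_all add: assms funpow_add)
  show ?case using Suc one[of "c ^ j * i" "(\<tau> ^^ j) x"] by (simp add: mult.assoc)
qed simp

lemma funpow_mod_order:
  assumes "f ^^ k = id"
  shows "f ^^ (i mod k) = f ^^ i"
proof -
  have id: "f ^^ (k * q) = id" for q by (induction q) (simp_all add: funpow_add assms)
  have "f ^^ i = f ^^ (i mod k + k * (i div k))" by (simp only: mod_mult_div_eq)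
  then show ?thesis by (simp only: funpow_add id comp_id)
qed

lemma surj_if_finite_order:
  assumes "f ^^ k = id" "k \<ge> 1"
  shows "surj f"
proof -
  obtain j where "k = Suc j" using assms(2) by (cases k) auto
  then have "f ((f ^^ j) x) = x" for x using assms(1) by (metis comp_apply funpow.simps(2) id_apply)
  then show ?thesis by (metis surjI)
qed

context as_tower
begin

text \<open>Y determines its components, so a homomorphism is determined by its effect on the base
  and on Y.\<close>

lemma tower_eqI:
  fixes \<Phi> \<Phi>' :: "'k fls \<Rightarrow> 'k fls"
  assumes T: "tower l \<theta> \<eta>" and "field_hom \<Phi>" "field_hom \<Phi>'" "\<And>x. \<Phi> (\<theta> x) = \<Phi>' (\<theta> x)"
    and "fcong (p ^ l) (fmap \<Phi> (wprod \<eta> l)) (fmap \<Phi>' (wprod \<eta> l))"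
  shows "\<Phi> = \<Phi>'"
proof (rule towerD(4)[OF T assms(2-4)])
  fix i assume "i < l"
  then show "\<Phi> (\<eta> i) = \<Phi>' (\<eta> i)"
    using wprod_unique[of l "\<lambda>i. \<Phi> (\<eta> i)" "\<lambda>i. \<Phi>' (\<eta> i)" i] assms(5)
    by (simp add: fmap_wprod assms(2,3))
qed

lemma E_power_cong: "[i = j] (mod p ^ n) \<Longrightarrow> fcong (p ^ n) (F ^ i) (F ^ j)" if "fps_nth F 0 = (1 :: 'k fls)" for F i j
proof -
  have *: "fcong (p ^ n) (F ^ (i mod p ^ n)) (F ^ i)" for i
  proof -
    have "F ^ i = (F ^ (p ^ n)) ^ (i div p ^ n) * F ^ (i mod p ^ n)"
      by (simp flip: power_mult power_add)
    moreover have "fcong (p ^ n) ((F ^ (p ^ n)) ^ (i div p ^ n)) (1 ^ (i div p ^ n))"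
      by (intro fcong_power fps_power_frobenius prime_p char_p that)
    ultimately show ?thesis using fcong_mult[OF _ fcong_refl[of _ "F ^ (i mod p ^ n)"]]
      by (metis fcong_sym mult_1 power_one)
  qed
  assume "[i = j] (mod p ^ n)"
  then show "fcong (p ^ n) (F ^ i) (F ^ j)"
    using *[of i] *[of j] unfolding cong_def by (metis fcong_sym fcong_trans)
qed

text \<open>\<open>E (c t)\<close> is a power \<open>E ^ N\<close> when \<open>c\<close> lies in the prime field; \<open>N\<close> is the Teichmueller
  representative of \<open>c\<close>.\<close>

lemma E_scaled:
  assumes c: "c ^ p = c" "c ^ m = (1 :: 'k fls)"
  obtains N where "fcong (p ^ n) (esub E c 1) (E ^ N)" "of_nat N = c" "[N ^ m = 1] (mod p ^ n)"
proof -
  have typE: "ptypical p n (esub E c 1)" using esub_E_typical[of c 0] by simp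
  have "fmap fr (esub E c 1) = esub E c 1" by (simp add: fmap_esub[OF fr_hom] E_fmap[OF fr_hom] c(1))
  then obtain N where N: "fcong (p ^ n) (esub E c 1) (E ^ N)"
    using typical_prime_field[OF typE order_refl] by auto
  have "fps_nth (esub E c 1) 1 = fps_nth (E ^ N) 1"
  proof -
    have "p ^ n > 1" using p_gt_1 n_pos by (intro one_less_power) auto
    then show ?thesis using N unfolding fcong_def by blast
  qed
  moreover have "fps_nth (esub E c 1) 1 = c" using esub_E_low(2)[of c 0] by simp
  moreover have "fps_nth (E ^ N) 1 = of_nat N" using fps_power_nth_low[of 1 E N] by (simp add: fcong_def)
  ultimately have "of_nat N = c" by simp
  \<comment> \<open>Scaling repeatedly by c multiplies the exponents; j = m returns to E and gives
    the congruence for N.\<close>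
  have "fcong (p ^ n) (esub E (c ^ j) 1) (E ^ (N ^ j))" for j
  proof (induction j)
    case 0
    have "esub E 1 1 = E" by (rule fps_ext) (simp add: esub_nth)
    then show ?case by simp
  next
    case (Suc j)
    have "esub E (c ^ Suc j) 1 = esub (esub E (c ^ j) 1) c 1" by (simp add: esub_esub mult.commute)
    also have "fcong (p ^ n) \<dots> (esub (E ^ (N ^ j)) c 1)" using Suc by (intro fcong_esub) simp_all
    also have "esub (E ^ (N ^ j)) c 1 = esub E c 1 ^ (N ^ j)" by (simp add: esub_power)
    also have "fcong (p ^ n) \<dots> ((E ^ N) ^ (N ^ j))" by (intro fcong_power N)
    also have "(E ^ N) ^ (N ^ j) = E ^ (N ^ Suc j)" by (simp flip: power_mult)
    finally show ?case .
  qed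
  from this[of m] have "fcong (p ^ n) (esub E 1 1) (E ^ (N ^ m))" by (simp only: c(2))
  moreover have "esub E 1 1 = E ^ 1" by (rule fps_ext) (simp add: esub_nth)
  ultimately have "fcong (p ^ n) (E ^ (N ^ m)) (E ^ 1)" by (simp only: fcong_sym)
  then have "[N ^ m = 1] (mod p ^ n)" by (rule E_power_inj)
  with N \<open>of_nat N = c\<close> show ?thesis by (rule that)
qed

end

section \<open>The tower with prescribed breaks and its tame automorphism\<close>

locale equivariant_tower = cyclic_semidirect +
  fixes a :: "nat \<Rightarrow> nat" and \<zeta> :: "'k::alg_closed_field"
  assumes char_k: "CHAR('k) = p" and \<zeta>: "\<zeta> ^ j = 1 \<longleftrightarrow> m dvd j" and \<zeta>_pow: "\<zeta> ^ a 1 = of_nat \<kappa>"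
    and a_1: "\<not> p dvd a 1"
    and a_Suc: "1 \<le> l \<Longrightarrow> l < n \<Longrightarrow> a (Suc l) = p * a l \<or> (a (Suc l) > p * a l \<and> \<not> p dvd a (Suc l))"
    and a_cong: "l < n \<Longrightarrow> [a (Suc l) = a 1] (mod m)"
begin

text \<open>If p divides \<open>a (i+1)\<close>, this number is \<open>p a i\<close> and already
  results from the earlier components, so component i adds nothing.\<close>

definition h :: "nat \<Rightarrow> 'k fls" where
  "h i = (if p dvd a (Suc i) then 0 else inverse (fls_X ^ a (Suc i)))"

sublocale T: as_tower p n "TYPE('k fls)" h "a 1"
proof -
  interpret ah p n "TYPE('k fls)" using p char_k by (rule ah_fls)
  show "as_tower p n h (a 1)"
    by unfold_locales (use n a_1 in \<open>simp_all add: h_def fls_subdegree_pow\<close>)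
qed

text \<open>The bottom of the tower is the tame extension of degree m of the eventual base field,
  and this map generates its Galois group.\<close>

definition scale :: "'k fls \<Rightarrow> 'k fls" where "scale = fls_subst (fls_const \<zeta> * fls_X)"

lemma \<zeta>_ne: "\<zeta> \<noteq> 0"
  using \<zeta>[of m] m by (auto simp: power_0_left)

lemma scale: "vhom scale 1" and scale_X: "scale fls_X = fls_const \<zeta> * fls_X"
proof -
  have "\<nu> (fls_const \<zeta> * fls_X) = int 1" using \<zeta>_ne by (simp add: fls_const_nonzero)
  from fls_subst[OF this order_refl] show "vhom scale 1" "scale fls_X = fls_const \<zeta> * fls_X"
    unfolding scale_def by blast+
qed

lemma scale_funpow_X: "(scale ^^ j) fls_X = fls_const (\<zeta> ^ j) * fls_X"
proof (induction j)
  case (Suc j)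
  interpret vhom scale 1 by (rule scale)
  show ?case by (simp add: Suc mult scale_X mult_ac flip: fls_const_mult_const)
qed simp

lemma scale_order: "scale ^^ m = id"
proof
  fix x
  have "(scale ^^ m) x = (\<lambda>x. x) x"
    by (rule vhom_unique[OF vhom_funpow[OF scale] vhom_id]) (use \<zeta>[of m] in \<open>simp add: scale_funpow_X\<close>)
  then show "(scale ^^ m) x = id x" by simp
qed

text \<open>The common factor by which \<open>scale\<close> multiplies the \<open>h i\<close>;
  \<kappa> is inverted because these are poles.\<close>

definition c :: "'k fls" where "c = fls_const (inverse (of_nat \<kappa>))"

lemma scale_h: "i < n \<Longrightarrow> scale (h i) = c * h i"
proof -
  assume i: "i < n"
  interpret vhom scale 1 by (rule scale)
  have "\<zeta> ^ a (Suc i) = \<zeta> ^ a 1"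
    using power_mod_exponent[of \<zeta> m] \<zeta>[of m] a_cong[OF i] unfolding cong_def by (metis dvd_refl)
  then have "scale (fls_X ^ a (Suc i)) = fls_const (of_nat \<kappa>) * fls_X ^ a (Suc i)"
    by (simp add: power scale_X power_mult_distrib \<zeta>_pow[unfolded One_nat_def] flip: fls_const_power)
  then show ?thesis by (simp add: h_def inverse c_def fls_inverse_const)
qed

lemma \<kappa>_ne: "(of_nat \<kappa> :: 'k) \<noteq> 0"
  using \<zeta>_ne unfolding \<zeta>_pow[symmetric] by simp

lemma c_p: "c ^ p = c"
proof -
  interpret F: field_hom "\<lambda>x::'k. x ^ p" by (rule field_hom_frobenius[OF p char_k])
  have "inverse (of_nat \<kappa> :: 'k) ^ p = inverse (of_nat \<kappa>)" by (simp add: F.inverse F.of_nat)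
  then show ?thesis by (simp add: c_def flip: fls_const_power)
qed

lemma c_m: "c ^ m = 1"
proof -
  have "(of_nat \<kappa> :: 'k) ^ m = 1"
    unfolding \<zeta>_pow[symmetric] power_mult[symmetric] \<zeta> by simp
  then have "inverse (of_nat \<kappa> :: 'k) ^ m = 1" by (simp add: power_inverse)
  then show ?thesis by (simp add: c_def flip: fls_const_power)
qed

text \<open>Scaling turns the right-hand side f into \<open>f^N\<close>, since
  \<open>E(c x) = E(x)^N\<close> for the representative N of c, so \<open>Y^N\<close> solves the
  scaled equation and \<tau> exists by universality with \<tau> Y = \<open>Y^N\<close>. Both \<tau>
  \<sigma> and \<open>\<sigma>^\<kappa> \<tau>\<close> then take Y to \<open>E Y^N\<close>, because
  N is inverse to \<kappa> modulo \<open>p^n\<close>.\<close>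

lemma generators:
  obtains \<theta> \<eta> \<sigma> \<tau> where "T.tower n \<theta> \<eta>"
    "field_hom \<sigma>" "\<And>x. \<sigma> (\<theta> x) = \<theta> x" "fcong (p ^ n) (fmap \<sigma> (T.wprod \<eta> n)) (T.E * T.wprod \<eta> n)" "\<sigma> ^^ (p ^ n) = id"
    "field_hom \<tau>" "\<And>x. \<tau> (\<theta> x) = \<theta> (scale x)" "\<tau> ^^ m = id" "\<And>x. \<tau> (\<sigma> x) = (\<sigma> ^^ \<kappa>) (\<tau> x)"
proof -
  obtain \<theta> \<eta> where T: "T.tower n \<theta> \<eta>" using T.tower_exists by blast
  interpret \<theta>: vhom \<theta> "p ^ n" using T.towerD(1)[OF T] .
  interpret S: vhom scale 1 by (rule scale)
  interpret fr: field_hom T.fr by (rule T.fr_hom)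
  define Y where "Y = T.wprod \<eta> n"
  define f where "f = T.wprod (\<lambda>i. \<theta> (h i)) n"
  have Y0: "fps_nth Y 0 = 1" by (simp add: Y_def)
  have typY: "ptypical p n Y" unfolding Y_def by (rule T.wprod_typical)
  have sysY: "fcong (p ^ n) (fmap T.fr Y) (f * Y)" using T.towerD(2)[OF T] by (simp add: T.sys_def Y_def f_def)
  obtain \<sigma> where \<sigma>: "field_hom \<sigma>" "\<And>x. \<sigma> (\<theta> x) = \<theta> x" "fcong (p ^ n) (fmap \<sigma> Y) (T.E * Y)" "\<sigma> ^^ (p ^ n) = id"
    unfolding Y_def by (rule T.tower_aut[OF T order_refl]) blast
  obtain N where N: "fcong (p ^ n) (esub T.E c 1) (T.E ^ N)" "of_nat N = c" "[N ^ m = 1] (mod p ^ n)"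
    by (rule T.E_scaled[OF c_p c_m])
  \<comment> \<open>The congruence is visible modulo p in k; it lifts because N and \<kappa> both
    have m-th power 1 modulo \<open>p^n\<close>.\<close>
  have N\<kappa>: "[N * \<kappa> = 1] (mod p ^ n)"
  proof -
    have "fls_const (of_nat N :: 'k) = fls_const (inverse (of_nat \<kappa>))" using N(2) by (simp add: c_def fls_of_nat)
    then have "(of_nat N :: 'k) = inverse (of_nat \<kappa>)" by (simp only: field_hom.eq_iff[OF field_hom_fls_const])
    then have "(of_nat (N * \<kappa>) :: 'k) = of_nat 1" using \<kappa>_ne by simp
    then have "[N * \<kappa> = 1] (mod p)" using char_k by (simp only: of_nat_eq_iff_cong_CHAR)
    moreover have "[(N * \<kappa>) ^ m = 1] (mod p ^ n)" using cong_mult[OF N(3) chi_pow] by (simp add: power_mult_distrib)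
    ultimately show ?thesis using cong_1_lift[OF p m(2) n] by blast
  qed
  define \<alpha> where "\<alpha> x = \<theta> (scale x)" for x
  have \<alpha>: "field_hom \<alpha>" unfolding \<alpha>_def by (rule field_hom_comp[OF \<theta>.field_hom_axioms S.field_hom_axioms])
  have \<theta>c: "\<theta> c = c" by (simp add: c_def)
  have f': "fcong (p ^ n) (T.wprod (\<lambda>i. \<alpha> (h i)) n) (f ^ N)"
  proof -
    have "fcong (p ^ n) (esub T.E (\<alpha> (h i)) (p ^ i)) (esub T.E (\<theta> (h i)) (p ^ i) ^ N)" if "i < n" for i
    proof -
      have "esub T.E (\<alpha> (h i)) (p ^ i) = esub (esub T.E c 1) (\<theta> (h i)) (p ^ i)"
        using that T.p_pos[of i] by (simp add: \<alpha>_def scale_h \<theta>.mult \<theta>c esub_esub)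
      also have "fcong (p ^ n) \<dots> (esub (T.E ^ N) (\<theta> (h i)) (p ^ i))" using N(1) T.p_pos[of i] by (intro fcong_esub)
      also have "esub (T.E ^ N) (\<theta> (h i)) (p ^ i) = esub T.E (\<theta> (h i)) (p ^ i) ^ N" using T.p_pos[of i] by (rule esub_power)
      finally show ?thesis .
    qed
    then show ?thesis unfolding T.wprod_def f_def prod_power_distrib by (intro fcong_prod) auto
  qed
  obtain y where y: "fcong (p ^ n) (Y ^ N) (T.wprod y n)"
    using T.normal_form[OF ptypical_power[OF typY] order_refl] by blast
  have "T.sys n (\<lambda>i. \<alpha> (h i)) y"
    unfolding T.sys_def
  proof -
    have "fcong (p ^ n) (fmap T.fr (T.wprod y n)) (fmap T.fr (Y ^ N))" using fcong_sym[OF y] by (rule fmap_cong_mod)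
    also have "fmap T.fr (Y ^ N) = fmap T.fr Y ^ N" by (rule fr.fmap_power)
    also have "fcong (p ^ n) (fmap T.fr Y ^ N) ((f * Y) ^ N)" using sysY by (rule fcong_power)
    also have "(f * Y) ^ N = f ^ N * Y ^ N" by (rule power_mult_distrib)
    also have "fcong (p ^ n) (f ^ N * Y ^ N) (T.wprod (\<lambda>i. \<alpha> (h i)) n * T.wprod y n)"
      by (intro fcong_mult fcong_sym[OF f'] y)
    finally show "fcong (p ^ n) (fmap T.fr (T.wprod y n)) (T.wprod (\<lambda>i. \<alpha> (h i)) n * T.wprod y n)" .
  qed
  from T.towerD(3)[OF T \<alpha> this]
  obtain \<tau> where \<tau>: "field_hom \<tau>" "\<And>x. \<tau> (\<theta> x) = \<theta> (scale x)" "\<And>i. i < n \<Longrightarrow> \<tau> (\<eta> i) = y i"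
    unfolding \<alpha>_def by blast
  interpret \<tau>: field_hom \<tau> by fact
  have \<tau>Y: "fcong (p ^ n) (fmap \<tau> Y) (Y ^ N)"
  proof -
    have "fmap \<tau> Y = T.wprod y n" unfolding Y_def T.fmap_wprod[OF \<tau>(1)] using \<tau>(3) by (intro T.wprod_cong)
    then show ?thesis using fcong_sym[OF y] by simp
  qed
  have \<tau>k: "fcong (p ^ n) (fmap (\<tau> ^^ k) Y) (Y ^ (N ^ k))" for k
  proof (induction k)
    case 0
    have "fmap (\<tau> ^^ 0) Y = Y" by (simp add: fps_eq_iff)
    then show ?case by (simp add: id_def)
  next
    case (Suc k)
    have "fmap (\<tau> ^^ Suc k) Y = fmap \<tau> (fmap (\<tau> ^^ k) Y)" by (simp add: fps_eq_iff)
    also have "fcong (p ^ n) \<dots> (fmap \<tau> (Y ^ (N ^ k)))" using Suc by (rule fmap_cong_mod)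
    also have "fmap \<tau> (Y ^ (N ^ k)) = fmap \<tau> Y ^ (N ^ k)" by (rule \<tau>.fmap_power)
    also have "fcong (p ^ n) \<dots> ((Y ^ N) ^ (N ^ k))" using \<tau>Y by (rule fcong_power)
    also have "(Y ^ N) ^ (N ^ k) = Y ^ (N ^ Suc k)" by (simp flip: power_mult)
    finally show ?case .
  qed
  have \<tau>\<theta>: "(\<tau> ^^ k) (\<theta> x) = \<theta> ((scale ^^ k) x)" for k x by (induction k) (simp_all add: \<tau>(2))
  have \<tau>m: "\<tau> ^^ m = id"
  proof (rule T.tower_eqI[OF T field_hom_funpow[OF \<tau>(1)]])
    show "field_hom (id :: 'k fls \<Rightarrow> 'k fls)" by unfold_locales simp_all
    show "(\<tau> ^^ m) (\<theta> x) = id (\<theta> x)" for x by (simp add: \<tau>\<theta> scale_order)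
    have "fmap id Y = Y" by (simp add: fps_eq_iff)
    moreover have "fcong (p ^ n) (Y ^ (N ^ m)) (Y ^ 1)" using N(3) by (rule T.E_power_cong[OF Y0])
    ultimately show "fcong (p ^ n) (fmap (\<tau> ^^ m) (T.wprod \<eta> n)) (fmap id (T.wprod \<eta> n))"
      using fcong_trans[OF \<tau>k[of m]] by (simp add: Y_def)
  qed
  interpret \<sigma>\<kappa>: field_hom "\<sigma> ^^ \<kappa>" using \<sigma>(1) by (rule field_hom_funpow)
  have \<sigma>\<theta>: "(\<sigma> ^^ k) (\<theta> x) = \<theta> x" for k x by (induction k) (simp_all add: \<sigma>(2))
  have "(\<lambda>x. \<tau> (\<sigma> x)) = (\<lambda>x. (\<sigma> ^^ \<kappa>) (\<tau> x))"
  proof (rule T.tower_eqI[OF T])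
    show "field_hom (\<lambda>x. \<tau> (\<sigma> x))" by (rule field_hom_comp[OF \<tau>(1) \<sigma>(1)])
    show "field_hom (\<lambda>x. (\<sigma> ^^ \<kappa>) (\<tau> x))" by (rule field_hom_comp[OF \<sigma>\<kappa>.field_hom_axioms \<tau>(1)])
    show "\<tau> (\<sigma> (\<theta> x)) = (\<sigma> ^^ \<kappa>) (\<tau> (\<theta> x))" for x by (simp add: \<sigma>(2) \<tau>(2) \<sigma>\<theta>)
    have "fmap (\<lambda>x. \<tau> (\<sigma> x)) Y = fmap \<tau> (fmap \<sigma> Y)" by (simp add: fps_eq_iff)
    also have "fcong (p ^ n) \<dots> (fmap \<tau> (T.E * Y))" using \<sigma>(3) by (rule fmap_cong_mod)
    also have "fmap \<tau> (T.E * Y) = T.E ^ 1 * fmap \<tau> Y" by (simp add: \<tau>.fmap_mult T.E_fmap[OF \<tau>(1)])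
    also have "fcong (p ^ n) \<dots> (T.E ^ (N * \<kappa>) * Y ^ N)"
      by (intro fcong_mult \<tau>Y T.E_power_cong[OF T.E_0] cong_sym[OF N\<kappa>])
    also have "T.E ^ (N * \<kappa>) * Y ^ N = (T.E ^ (1 * \<kappa>) * Y) ^ N"
      by (simp add: power_mult_distrib mult.commute[of N] flip: power_mult)
    also have "fcong (p ^ n) \<dots> (fmap (\<sigma> ^^ \<kappa>) Y ^ N)"
      using \<sigma>(3) by (intro fcong_power fcong_sym[OF T.fmap_E_power_iterate[OF \<sigma>(1)]]) simp
    also have "fmap (\<sigma> ^^ \<kappa>) Y ^ N = fmap (\<sigma> ^^ \<kappa>) (Y ^ N)" by (rule \<sigma>\<kappa>.fmap_power[symmetric])
    also have "fcong (p ^ n) \<dots> (fmap (\<sigma> ^^ \<kappa>) (fmap \<tau> Y))" by (intro fmap_cong_mod fcong_sym[OF \<tau>Y])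
    also have "fmap (\<sigma> ^^ \<kappa>) (fmap \<tau> Y) = fmap (\<lambda>x. (\<sigma> ^^ \<kappa>) (\<tau> x)) Y" by (simp add: fps_eq_iff)
    finally show "fcong (p ^ n) (fmap (\<lambda>x. \<tau> (\<sigma> x)) (T.wprod \<eta> n)) (fmap (\<lambda>x. (\<sigma> ^^ \<kappa>) (\<tau> x)) (T.wprod \<eta> n))"
      by (simp add: Y_def)
  qed
  then have "\<tau> (\<sigma> x) = (\<sigma> ^^ \<kappa>) (\<tau> x)" for x by (rule fun_cong)
  with T \<sigma>(1,2) \<sigma>(3)[unfolded Y_def] \<sigma>(4) \<tau>(1,2) \<tau>m show ?thesis by (rule that)
qed

lemma a_pos: "1 \<le> l \<Longrightarrow> l \<le> n \<Longrightarrow> a l > 0"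
proof (induction l)
  case (Suc l)
  then show ?case using a_1 a_Suc[of l] T.p_gt_1 by (cases "l = 0") (auto intro!: Nat.gr0I)
qed simp

lemma a_growth: "i \<le> j \<Longrightarrow> Suc j \<le> n \<Longrightarrow> p ^ (j - i) * a (Suc i) \<le> a (Suc j)"
proof (induction j)
  case (Suc j)
  show ?case
  proof (cases "i = Suc j")
    case False
    then have "p ^ (Suc j - i) * a (Suc i) = p * (p ^ (j - i) * a (Suc i))" using Suc.prems by (simp add: Suc_diff_le)
    also have "\<dots> \<le> p * a (Suc j)" using Suc False by simp
    also have "\<dots> \<le> a (Suc (Suc j))" using a_Suc[of "Suc j"] Suc.prems by auto
    finally show ?thesis .
  qed simp
qed simp

text \<open>Go back to the last index at which p does not divide a; from there each step multiplies
  by p exactly.\<close>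

lemma a_attained: "j < n \<Longrightarrow> \<exists>i\<le>j. \<not> p dvd a (Suc i) \<and> a (Suc j) = p ^ (j - i) * a (Suc i)"
proof (induction j)
  case 0
  then show ?case using a_1 by auto
next
  case (Suc j)
  show ?case
  proof (cases "p dvd a (Suc (Suc j))")
    case True
    then have "a (Suc (Suc j)) = p * a (Suc j)" using a_Suc[of "Suc j"] Suc.prems by auto
    moreover obtain i where i: "i \<le> j" "\<not> p dvd a (Suc i)" "a (Suc j) = p ^ (j - i) * a (Suc i)"
      using Suc by auto
    ultimately show ?thesis by (intro exI[of _ i]) (simp add: Suc_diff_le)
  qed (auto intro: exI[of _ "Suc j"])
qed

theorem action_exists:
  obtains A :: "'a \<Rightarrow> 'k fls \<Rightarrow> 'k fls" where "ramified_action G p n m s t \<kappa> A"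
    "ramified_action.upper_jumps G p n s A a"
proof -
  obtain \<theta> \<eta> \<sigma> \<tau> where T: "T.tower n \<theta> \<eta>"
    and \<sigma>: "field_hom \<sigma>" "\<And>x. \<sigma> (\<theta> x) = \<theta> x" "fcong (p ^ n) (fmap \<sigma> (T.wprod \<eta> n)) (T.E * T.wprod \<eta> n)" "\<sigma> ^^ (p ^ n) = id"
    and \<tau>: "field_hom \<tau>" "\<And>x. \<tau> (\<theta> x) = \<theta> (scale x)" "\<tau> ^^ m = id" and comm: "\<And>x. \<tau> (\<sigma> x) = (\<sigma> ^^ \<kappa>) (\<tau> x)"
    by (rule generators) blast
  interpret \<theta>: vhom \<theta> "p ^ n" using T.towerD(1)[OF T] .
  interpret S: vhom scale 1 by (rule scale)
  have aut_\<sigma>: "is_aut \<sigma>"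
  proof (rule is_autI[OF p char_k \<sigma>(1)])
    show "surj \<sigma>" using pn by (intro surj_if_finite_order[OF \<sigma>(4)]) linarith
    show "\<sigma> (fls_const d) = fls_const d" for d using \<sigma>(2)[of "fls_const d"] by simp
  qed
  have aut_\<tau>: "is_aut \<tau>"
  proof (rule is_autI[OF p char_k \<tau>(1)])
    show "surj \<tau>" using \<tau>(3) m(1) by (rule surj_if_finite_order)
    show "\<tau> (fls_const d) = fls_const d" for d using \<tau>(2)[of "fls_const d"] by simp
  qed
  have \<sigma>\<theta>: "(\<sigma> ^^ k) (\<theta> x) = \<theta> x" for k x by (induction k) (simp_all add: \<sigma>(2))
  have \<tau>\<theta>: "(\<tau> ^^ k) (\<theta> x) = \<theta> ((scale ^^ k) x)" for k x by (induction k) (simp_all add: \<tau>(2))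
  define Y where "Y = T.wprod \<eta> n"
  have Y0: "fps_nth Y 0 = 1" by (simp add: Y_def)
  have \<sigma>_id: "p ^ n dvd i" if i: "\<sigma> ^^ i = id" for i
  proof -
    have "fcong (p ^ n) (fmap (\<sigma> ^^ i) Y) (T.E ^ (1 * i) * Y)"
      using \<sigma>(3) unfolding Y_def by (intro T.fmap_E_power_iterate \<sigma>(1)) simp
    moreover have "fmap (\<sigma> ^^ i) Y = Y" unfolding i by (simp add: fps_eq_iff)
    ultimately have "fcong (p ^ n) (T.E ^ i * Y) (T.E ^ 0 * Y)" by (simp add: fcong_sym)
    then have "fcong (p ^ n) (T.E ^ i) (T.E ^ 0)" using Y0 by (rule T.fcong_cancel)
    then have "[i = 0] (mod p ^ n)" by (rule T.E_power_inj)
    then show ?thesis by (simp add: cong_0_iff)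
  qed
  have mod_\<sigma>: "\<sigma> ^^ (i mod p ^ n) = \<sigma> ^^ i" for i using \<sigma>(4) by (rule funpow_mod_order)
  have mod_\<tau>: "\<tau> ^^ (i mod m) = \<tau> ^^ i" for i using \<tau>(3) by (rule funpow_mod_order)
  \<comment> \<open>The exponents of the normal form of a group element; replacing them by their
    residues is harmless as \<sigma> and \<tau> satisfy the order relations of s and t.\<close>
  define ij where "ij = inv_into ({..<p ^ n} \<times> {..<m}) (\<lambda>(i, j). s [^] (i::nat) \<otimes> t [^] (j::nat))"
  define A where "A g = (case ij g of (i, j) \<Rightarrow> \<sigma> ^^ i \<circ> \<tau> ^^ j)" for g
  have A: "A (s [^] i \<otimes> t [^] j) = \<sigma> ^^ i \<circ> \<tau> ^^ j" for i j :: nat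
  proof -
    have "s [^] i = s [^] (i mod p ^ n)" by (simp add: spow_eq_iff cong_def)
    moreover have "t [^] j = t [^] (j mod m)"
    proof -
      have "t [^] j = t [^] (j div m * m + j mod m)" by simp
      also have "\<dots> = (t [^] m) [^] (j div m) \<otimes> t [^] (j mod m)"
        using t(1) by (simp add: nat_pow_mult nat_pow_pow mult.commute)
      also have "t [^] m = \<one>" using t by (simp add: pow_eq_id)
      finally show ?thesis using t(1) by simp
    qed
    ultimately have "s [^] i \<otimes> t [^] j = (\<lambda>(i, j). s [^] i \<otimes> t [^] j) (i mod p ^ n, j mod m)" by simp
    moreover have "ij ((\<lambda>(i, j). s [^] i \<otimes> t [^] j) (i mod p ^ n, j mod m)) = (i mod p ^ n, j mod m)"
      unfolding ij_def using pn m(1) by (intro inv_into_f_f bij_betw_imp_inj_on[OF elems]) simp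
    ultimately have "ij (s [^] i \<otimes> t [^] j) = (i mod p ^ n, j mod m)" by simp
    then show ?thesis by (simp add: A_def mod_\<sigma> mod_\<tau>)
  qed
  have As: "A (s [^] i) = \<sigma> ^^ i" for i :: nat using A[of i 0] s(1) by simp
  interpret ramified_action G p n m s t \<kappa> A
  proof
    show "CHAR('k) = p" by (rule char_k)
    fix g assume g: "g \<in> carrier G"
    then obtain i j where ij: "i < p ^ n" "j < m" "g = s [^] i \<otimes> t [^] j" by (rule elem_cases)
    show "is_aut (A g)"
      using is_aut_comp[OF is_aut_funpow[OF aut_\<sigma>] is_aut_funpow[OF aut_\<tau>]] by (simp add: ij(3) A comp_def)
    show "A (g \<otimes> h') x = A g (A h' x)" if h': "h' \<in> carrier G" for h' x
    proof -
      obtain i' j' :: nat where ij': "h' = s [^] i' \<otimes> t [^] j'" using h' by (rule elem_cases)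
      have "A (g \<otimes> h') x = (\<sigma> ^^ (i + \<kappa> ^ j * i')) ((\<tau> ^^ (j + j')) x)"
        unfolding ij(3) ij' mult_elem A by simp
      also have "\<dots> = (\<sigma> ^^ i) ((\<sigma> ^^ (\<kappa> ^ j * i')) ((\<tau> ^^ j) ((\<tau> ^^ j') x)))" by (simp add: funpow_add)
      also have "\<dots> = (\<sigma> ^^ i) ((\<tau> ^^ j) ((\<sigma> ^^ i') ((\<tau> ^^ j') x)))"
        using funpow_twisted_commute[of \<tau> \<sigma> \<kappa>, OF comm] by simp
      finally show ?thesis by (simp add: ij(3) ij' A)
    qed
    show "g = \<one>" if id: "A g = id"
    proof -
      have "\<theta> fls_X = (\<sigma> ^^ i) ((\<tau> ^^ j) (\<theta> fls_X))" using fun_cong[OF id, of "\<theta> fls_X"] by (simp add: ij(3) A)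
      also have "\<dots> = fls_const (\<zeta> ^ j) * \<theta> fls_X" unfolding \<tau>\<theta> \<sigma>\<theta> by (simp add: scale_funpow_X \<theta>.mult)
      finally have "fls_const (\<zeta> ^ j) * \<theta> fls_X = 1 * \<theta> fls_X" by simp
      then have "fls_const (\<zeta> ^ j) = 1" by (subst (asm) mult_cancel_right) simp
      then have "\<zeta> ^ j = 1" by (metis fls_const_1 fls_const_nonzero fls_const_nth)
      then have j: "j = 0" using ij(2) by (auto simp: \<zeta> dest: dvd_imp_le)
      then have "\<sigma> ^^ i = id" using id ij(3) As s(1) by simp
      then have "i = 0" using \<sigma>_id[of i] ij(1) by (auto dest: dvd_imp_le)
      then show ?thesis using ij(3) j by simp
    qed
  qed
  interpret C: cyclic_p_ext p n "TYPE('k fls)" \<sigma>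
  proof unfold_locales
    show "\<sigma> ^^ (p ^ n) = id" by fact
    show "\<sigma> ^^ (p ^ (n - 1)) \<noteq> id"
    proof
      assume "\<sigma> ^^ (p ^ (n - 1)) = id"
      then have "p ^ n dvd p ^ (n - 1)" by (rule \<sigma>_id)
      then show False using ppow_not_dvd[of "n - 1"] n by simp
    qed
  qed (use n aut_\<sigma> in auto)
  \<comment> \<open>By \<open>a_growth\<close> and \<open>a_attained\<close> the maximum over the
    components below l is \<open>a l\<close> itself, so U = a in the computation of breaks.\<close>
  interpret D: typical_data p n "TYPE('k fls)" \<sigma> Y "\<lambda>i. \<theta> (h i)" "\<lambda>i. a (Suc i)" a
  proof
    show "fps_nth Y 0 = 1" by fact
    show "fcong (p ^ n) (fmap \<sigma> Y) (T.E * Y)" using \<sigma>(3) by (simp add: Y_def)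
    show "fcong (p ^ n) (fmap T.fr Y) (T.wprod (\<lambda>i. \<theta> (h i)) n * Y)"
      using T.towerD(2)[OF T] by (simp add: T.sys_def Y_def)
    show "\<sigma> (\<theta> (h i)) = \<theta> (h i)" for i by (rule \<sigma>(2))
    show "\<nu> (\<theta> (h i)) = - int (p ^ n * a (Suc i)) \<and> a (Suc i) > 0 \<and> \<not> p dvd a (Suc i)"
      if "i < n" "\<theta> (h i) \<noteq> 0" for i
      using that a_pos[of "Suc i"] by (auto simp: h_def \<theta>.subdegree fls_subdegree_pow split: if_splits)
    fix l assume l: "1 \<le> l" "l \<le> n"
    then obtain j where j: "l = Suc j" by (cases l) auto
    show "p ^ (l - 1 - i) * a (Suc i) \<le> a l" if "i < l" for i
      using a_growth[of i j] that l j by simp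
    obtain i where i: "i \<le> j" "\<not> p dvd a (Suc i)" "a (Suc j) = p ^ (j - i) * a (Suc i)"
      using a_attained[of j] l j by auto
    then show "\<exists>i<l. \<theta> (h i) \<noteq> 0 \<and> a l = p ^ (l - 1 - i) * a (Suc i)"
      using j by (intro exI[of _ i]) (simp add: h_def)
  qed
  have J: "J l = brk (\<sigma> ^^ (p ^ l))" for l by (simp add: J_def As)
  show ?thesis
  proof (rule that)
    show "ramified_action G p n m s t \<kappa> A" by (rule ramified_action_axioms)
    show "upper_jumps a"
      unfolding upper_jumps_def using D.breaks_1 D.breaks_Suc[of "Suc _"] by (simp add: J)
  qed
qed

end

section \<open>Galois extensions from group actions\<close>

lemma (in field_hom) map_poly_mult: "map_poly f (P * Q) = map_poly f P * map_poly f Q"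
  by (rule poly_eqI) (simp add: coeff_map_poly coeff_mult sum mult)

lemma (in field_hom) map_poly_prod: "map_poly f (prod P S) = (\<Prod>i\<in>S. map_poly f (P i))"
  by (induction S rule: infinite_finite_induct) (simp_all add: map_poly_mult)

lemma order_prod_linear:
  fixes S :: "'a::idom set"
  assumes "finite S"
  shows "(\<Prod>w\<in>S. [:- w, 1:]) \<noteq> 0 \<and> order a (\<Prod>w\<in>S. [:- w, 1:]) \<le> 1"
proof -
  have "(\<Prod>w\<in>S. [:- w, 1:]) \<noteq> 0 \<and>
      order a (\<Prod>w\<in>S. [:- w, 1:]) = (if a \<in> S then 1 else 0)"
    using assms
  proof (induction S rule: finite_induct)
    case (insert w S)
    have lin: "order a [:- w, 1:] = (if a = w then 1 else 0)"
    proof (cases "a = w")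
      case True
      then show ?thesis using order_power_n_n[of w 1] by simp
    next
      case False
      then show ?thesis by (simp add: order_root[symmetric] order_0I)
    qed
    have ne: "[:- w, 1:] * (\<Prod>w\<in>S. [:- w, 1:]) \<noteq> 0" using insert.IH by (simp del: mult_pCons_left)
    show ?case using insert.hyps insert.IH order_mult[OF ne, of a] lin ne
      by (auto simp del: mult_pCons_left)
  qed (simp add: order_0I)
  then show ?thesis by simp
qed

text \<open>\<open>r\<close> plays the role of the minimal polynomial of \<open>x\<close>.\<close>

lemma irreducible_dvd_if_common_root:
  fixes f :: "'a::field \<Rightarrow> 'b::field"
  assumes f: "field_hom f" and q: "Factorial_Ring.irreducible q" "poly (map_poly f q) x = 0"
    and B: "B \<noteq> 0" "poly (map_poly f B) x = 0"
  shows "q dvd B"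
proof -
  interpret field_hom f by fact
  define r where "r = arg_min degree (\<lambda>r. r \<noteq> 0 \<and> poly (map_poly f r) x = 0)"
  have r: "r \<noteq> 0" "poly (map_poly f r) x = 0"
    and min: "\<And>s. s \<noteq> 0 \<Longrightarrow> poly (map_poly f s) x = 0 \<Longrightarrow> degree r \<le> degree s"
    using arg_min_nat_lemma[of "\<lambda>r. r \<noteq> 0 \<and> poly (map_poly f r) x = 0" B degree] B
    unfolding r_def by auto
  have dvd: "r dvd s" if "poly (map_poly f s) x = 0" for s
  proof (rule ccontr)
    assume "\<not> r dvd s"
    then have ne: "s mod r \<noteq> 0" by (simp add: dvd_eq_mod_eq_0)
    have "poly (map_poly f (s div r * r + s mod r)) x = 0" using that by simp
    then have "poly (map_poly f (s mod r)) x = 0" unfolding poly_map_add poly_map_mult r(2) by simp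
    then have "degree r \<le> degree (s mod r)" using min ne by blast
    moreover have "degree (s mod r) < degree r"
      using degree_mod_less[OF r(1), of s] ne by auto
    ultimately show False by simp
  qed
  obtain c where c: "q = r * c" using dvd[OF q(2)] by (elim dvdE)
  have "\<not> is_unit r"
  proof
    assume "is_unit r"
    then obtain k where k: "r = [:k:]" by (auto simp: is_unit_poly_iff)
    then have "k \<noteq> 0" using r(1) by auto
    then show False using k r(2) by (simp add: map_poly_pCons)
  qed
  then have "is_unit c" using Factorial_Ring.irreducibleD[OF q(1) c] by blast
  then have "q dvd r" unfolding c by simp
  then show ?thesis using dvd[OF B(2)] by (rule dvd_trans)
qed

lemma subfield_range_field_hom:
  assumes "field_hom (f :: 'a::field \<Rightarrow> 'b::field)"
  shows "subfield (range f) (ring_of_type_algebra :: 'b ring)"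
proof -
  interpret f: field_hom f by fact
  interpret A: field "ring_of_type_algebra :: 'a ring" by (rule field_from_type_algebra)
  interpret B: field "ring_of_type_algebra :: 'b ring" by (rule field_from_type_algebra)
  interpret ring_hom_ring "ring_of_type_algebra :: 'a ring" "ring_of_type_algebra :: 'b ring" f
    by (intro ring_hom_ringI2 A.ring_axioms B.ring_axioms ring_hom_memI)
      (simp_all add: ring_of_type_algebra_def f.add f.mult)
  have "subfield (f ` carrier (ring_of_type_algebra :: 'a ring)) (ring_of_type_algebra :: 'b ring)"
    by (intro img_is_subfield(2) A.carrier_is_subfield) (simp add: ring_of_type_algebra_def)
  then show ?thesis by (simp add: ring_of_type_algebra_def)
qed

lemma finite_dimension_type_algebra:
  fixes u :: "nat \<Rightarrow> 'b::field"
  assumes K: "subfield K (ring_of_type_algebra :: 'b ring)" and L: "subfield L (ring_of_type_algebra :: 'b ring)"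
    and "K \<subseteq> L" and u: "\<And>i. u i \<in> L" and span: "\<And>x. x \<in> L \<Longrightarrow> \<exists>c. (\<forall>i. c i \<in> K) \<and> x = (\<Sum>i<d. c i * u i)"
  shows "ring.finite_dimension (ring_of_type_algebra :: 'b ring) K L"
proof -
  interpret R: field "ring_of_type_algebra :: 'b ring" by (rule field_from_type_algebra)
  define Us where "Us j = map u (rev [0..<j])" for j
  have Span_Suc: "R.Span K (Us (Suc j)) = R.line_extension K (u j) (R.Span K (Us j))" for j
    by (simp add: Us_def)
  have "R.Span K (Us j) = {x. \<exists>c. (\<forall>i. c i \<in> K) \<and> x = (\<Sum>i<j. c i * u i)}" for j
  proof (induction j)
    case 0
    have "0 \<in> K" using subfield_type_algebraD(2)[OF K] subringE(2)[OF subfieldE(1)[OF K]]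
      by (simp add: ring_of_type_algebra_def)
    have "R.Span K (Us 0) = {0}" by (simp add: Us_def) (simp add: ring_of_type_algebra_def)
    with \<open>0 \<in> K\<close> show ?case by (auto intro: exI[of _ "\<lambda>_. 0"])
  next
    case (Suc j)
    show ?case
    proof (intro Set.set_eqI iffI)
      fix x assume "x \<in> R.Span K (Us (Suc j))"
      then obtain k c where k: "k \<in> K" "\<forall>i. c i \<in> K" "x = k * u j + (\<Sum>i<j. c i * u i)"
        unfolding Span_Suc R.line_extension_mem_iff Suc
        by (auto simp: ring_of_type_algebra_def)
      have "x = (\<Sum>i<Suc j. (c(j := k)) i * u i)" using k(3) by simp
      moreover have "\<forall>i. (c(j := k)) i \<in> K" using k by simp
      ultimately show "x \<in> {x. \<exists>c. (\<forall>i. c i \<in> K) \<and> x = (\<Sum>i<Suc j. c i * u i)}" by blast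
    next
      fix x assume "x \<in> {x. \<exists>c. (\<forall>i. c i \<in> K) \<and> x = (\<Sum>i<Suc j. c i * u i)}"
      then obtain c where c: "\<forall>i. c i \<in> K" "x = c j * u j + (\<Sum>i<j. c i * u i)" by auto
      then show "x \<in> R.Span K (Us (Suc j))"
        unfolding Span_Suc R.line_extension_mem_iff Suc
        by (auto simp: ring_of_type_algebra_def)
    qed
  qed
  then have Span: "R.Span K (Us d) = {x. \<exists>c. (\<forall>i. c i \<in> K) \<and> x = (\<Sum>i<d. c i * u i)}" .
  have "L = R.Span K (Us d)" unfolding Span
  proof (intro equalityI subsetI)
    fix x assume "x \<in> {x. \<exists>c. (\<forall>i. c i \<in> K) \<and> x = (\<Sum>i<d. c i * u i)}"
    then obtain c where c: "\<And>i. c i \<in> K" "x = (\<Sum>i<d. c i * u i)" by auto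
    have zero: "0 \<in> L" using subringE(2)[OF subfieldE(1)[OF L]] by (simp add: ring_of_type_algebra_def)
    have cL: "c i \<in> L" for i using c(1) assms(3) by blast
    have "(\<Sum>i<j. c i * u i) \<in> L" for j
    proof (induction j)
      case (Suc j)
      then show ?case unfolding sum.lessThan_Suc by (intro subfield_type_algebraD(2,3)[OF L] cL u)
    qed (simp add: zero)
    then show "x \<in> L" using c(2) by simp
  qed (use span in auto)
  moreover have "R.finite_dimension K (R.Span K (Us d))"
    by (rule R.Span_finite_dimension[OF K]) (simp add: ring_of_type_algebra_def)
  ultimately show ?thesis by simp
qed

section \<open>Transport of the action into the algebraic closure\<close>

context ramified_action
begin

lemma action_inverse: "g \<in> carrier G \<Longrightarrow> A (inv g) (A g x) = x" "g \<in> carrier G \<Longrightarrow> A g (A (inv g) x) = x"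
  using action[of "inv g" g x] action[of g "inv g" x] by (simp_all add: action_one)

lemma action_inj: "inj_on A (carrier G)"
proof (rule inj_onI)
  fix g h assume gh: "g \<in> carrier G" "h \<in> carrier G" "A g = A h"
  have "A (inv g \<otimes> h) = id" using gh action_inverse(1)[OF gh(1)] by (auto simp: fun_eq_iff action)
  then have "inv g \<otimes> h = \<one>" using gh by (intro faithful) auto
  then show "g = h" using gh by (metis inv_equality inv_inv inv_closed)
qed

text \<open>The action lives on k((X)), but an extension has to be a subfield of the algebraic
  closure of the base. \<theta> identifies the base with the fixed field, and the canonical
  embedding extends along \<theta> by choosing a root of a polynomial relation for X.\<close>

lemma fixed_field_embedding:
  obtains \<theta> d and \<Phi> :: "'k fls \<Rightarrow> 'k fls alg_closure" where "vhom \<theta> d" "range \<theta> = {x. \<forall>g\<in>carrier G. A g x = x}"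
    "field_hom \<Phi>" "\<And>x. \<Phi> (\<theta> x) = to_ac x"
proof -
  define d where "d = card (A ` carrier G)"
  have closed: "(\<lambda>x. g (h x)) \<in> A ` carrier G" if gh: "g \<in> A ` carrier G" "h \<in> A ` carrier G" for g h
  proof -
    obtain g' h' where g'h': "g' \<in> carrier G" "h' \<in> carrier G" "g = A g'" "h = A h'" using gh by blast
    then have "(\<lambda>x. g (h x)) = A (g' \<otimes> h')" by (simp add: fun_eq_iff action)
    then show ?thesis using g'h' by blast
  qed
  have fin: "finite (A ` carrier G)" "A ` carrier G \<noteq> {}" using card_carrier(2) one_closed by blast+
  have aut: "is_aut g" if "g \<in> A ` carrier G" for g using that is_aut by blast
  obtain \<theta> where \<theta>: "vhom \<theta> (card (A ` carrier G))" "range \<theta> = {x. \<forall>g\<in>A ` carrier G. g x = x}"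
  proof (rule fixed_field[OF fin])
    show "is_aut g" if g: "g \<in> A ` carrier G" for g using g by (rule aut)
    show "(\<lambda>x. g (h x)) \<in> A ` carrier G" if gh: "g \<in> A ` carrier G" "h \<in> A ` carrier G" for g h
      using gh by (rule closed)
  qed (rule that)
  interpret \<theta>: ramified_basis \<theta> d "\<lambda>i. fls_X ^ i" using \<theta>(1) unfolding d_def by (rule ramified_basis_X_powers)
  interpret ac: field_hom "to_ac :: 'k fls \<Rightarrow> _" by (rule field_hom_to_ac)
  obtain c where c: "fls_X ^ d = (\<Sum>i<d. \<theta> (c i) * fls_X ^ i)" using \<theta>.basis_span by blast
  define P where "P = monom 1 d + - (\<Sum>i<d. monom (c i) i)"
  have "degree (- (\<Sum>i<d. monom (c i) i)) < d"
  proof (rule degree_lessI)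
    show "- (\<Sum>i<d. monom (c i) i) \<noteq> 0 \<or> d > 0" using \<theta>.d_pos by simp
    show "\<forall>k\<ge>d. coeff (- (\<Sum>i<d. monom (c i) i)) k = 0" by (auto simp: coeff_sum)
  qed
  then have degP: "degree P = d"
    unfolding P_def by (subst degree_add_eq_left) (simp_all add: degree_monom_eq)
  have evP: "poly (map_poly f P) x = x ^ d - (\<Sum>i<d. f (c i) * x ^ i)" if "field_hom f"
    for f :: "'k fls \<Rightarrow> 'c::field" and x
  proof -
    interpret f: field_hom f by fact
    have neg: "- (\<Sum>i<d. monom (c i) i) = (\<Sum>i<d. monom (- c i) i)"
      unfolding sum_negf[symmetric] minus_monom ..
    show ?thesis unfolding P_def neg f.poly_map_add f.poly_map_sum
      by (simp add: map_poly_monom poly_monom f.uminus sum_negf)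
  qed
  have "degree (map_poly to_ac P) = d" using degP by (simp add: degree_map_poly)
  then obtain y where y: "poly (map_poly to_ac P) y = 0"
    using alg_closed_imp_poly_has_root[of "map_poly to_ac P"] \<theta>.d_pos by auto
  obtain \<Phi> :: "'k fls \<Rightarrow> 'k fls alg_closure" where \<Phi>: "field_hom \<Phi>" "\<And>x. \<Phi> (\<theta> x) = to_ac x" "\<Phi> fls_X = y"
  proof (rule field_hom_extend[OF \<theta>.ramified_basis_axioms ac.field_hom_axioms degP _ y])
    show "poly (map_poly \<theta> P) fls_X = 0" using c by (simp add: evP[OF \<theta>.field_hom_axioms])
  qed (rule that)
  show ?thesis by (rule that[OF \<theta>(1) _ \<Phi>(1,2)]) (simp add: \<theta>(2))
qed

end

locale realized_action = ramified_action +
  fixes \<theta> d and \<Phi> :: "'c fls \<Rightarrow> 'c::alg_closed_field fls alg_closure"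
  assumes \<theta>: "vhom \<theta> d" and range_\<theta>: "range \<theta> = {x. \<forall>g\<in>carrier G. A g x = x}"
    and \<Phi>: "field_hom \<Phi>" and \<Phi>_\<theta>: "\<Phi> (\<theta> x) = to_ac x"
begin

sublocale \<theta>: vhom \<theta> d by (rule \<theta>)
sublocale \<Phi>: field_hom \<Phi> by (rule \<Phi>)
sublocale ac: field_hom "to_ac :: 'c fls \<Rightarrow> _" by (rule field_hom_to_ac)

definition L where "L = range \<Phi>"
definition \<Phi>' where "\<Phi>' = inv_into UNIV \<Phi>"
definition act where "act g = (\<lambda>x\<in>L. \<Phi> (A g (\<Phi>' x)))"
definition val where "val x = \<nu> (\<Phi>' x)"

lemma \<Phi>'_\<Phi> [simp]: "\<Phi>' (\<Phi> x) = x"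
  by (simp add: \<Phi>'_def \<Phi>.inj)

lemma \<Phi>_in [simp]: "\<Phi> x \<in> L"
  by (simp add: L_def)

lemma act_\<Phi> [simp]: "act g (\<Phi> x) = \<Phi> (A g x)"
  by (simp add: act_def)

lemma L_cases: assumes "x \<in> L" obtains z where "x = \<Phi> z"
  using assms by (auto simp: L_def)

lemma A_\<theta>: "g \<in> carrier G \<Longrightarrow> A g (\<theta> x) = \<theta> x"
proof -
  assume g: "g \<in> carrier G"
  have "\<theta> x \<in> range \<theta>" by simp
  then show ?thesis unfolding range_\<theta> using g by simp
qed

lemma finite_field_extension_L: "finite_field_extension L"
  unfolding finite_field_extension_def
proof (intro conjI)
  show L: "subfield L ring_of_type_algebra" unfolding L_def by (rule subfield_range_field_hom[OF \<Phi>])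
  show sub: "range to_ac \<subseteq> L" using \<Phi>_\<theta> unfolding L_def by (metis image_subsetI rangeI)
  have K: "subfield (range (to_ac :: 'c fls \<Rightarrow> _)) ring_of_type_algebra"
    by (rule subfield_range_field_hom[OF field_hom_to_ac])
  interpret R: ramified_basis \<theta> d "\<lambda>i. fls_X ^ i" by (rule ramified_basis_X_powers[OF \<theta>])
  show "ring.finite_dimension ring_of_type_algebra (range to_ac) L"
  proof (rule finite_dimension_type_algebra[OF K L sub])
    show "\<Phi> (fls_X ^ i) \<in> L" for i by simp
    fix x assume "x \<in> L"
    then obtain z where z: "x = \<Phi> z" by (rule L_cases)
    obtain c where "z = (\<Sum>i<d. \<theta> (c i) * fls_X ^ i)" using R.basis_span by blast
    then have "x = (\<Sum>i<d. to_ac (c i) * \<Phi> (fls_X ^ i))" by (simp add: z \<Phi>.sum \<Phi>.mult \<Phi>_\<theta>)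
    then show "\<exists>c. (\<forall>i. c i \<in> range to_ac) \<and> x = (\<Sum>i<d. c i * \<Phi> (fls_X ^ i))"
      by (intro exI[of _ "\<lambda>i. to_ac (c i)"]) simp
  qed
qed

text \<open>The product of the linear factors over the orbit, without repetition, is invariant under
  G, so its coefficients come from the base. It serves for separability, for normality and for
  finding all automorphisms.\<close>

lemma conjugate_polynomial:
  obtains B where "B \<noteq> 0" "poly (map_poly to_ac B) (\<Phi> z) = 0"
    "map_poly to_ac B = (\<Prod>w\<in>\<Phi> ` (\<lambda>g. A g z) ` carrier G. [:- w, 1:])"
proof -
  define W where "W = (\<lambda>g. A g z) ` carrier G"
  have fin: "finite W" using card_carrier(2) by (simp add: W_def)
  define C where "C = (\<Prod>w\<in>W. [:- w, 1:])"
  have "coeff C i \<in> range \<theta>" for i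
    unfolding range_\<theta>
  proof (intro CollectI ballI)
    fix g assume g: "g \<in> carrier G"
    interpret g: vhom "A g" 1 using g by (rule vhom)
    have gW: "A g ` W = W"
    proof (rule card_subset_eq[OF fin])
      show "A g ` W \<subseteq> W"
      proof
        fix x assume "x \<in> A g ` W"
        then obtain h where h: "h \<in> carrier G" "x = A g (A h z)" by (auto simp: W_def)
        then have "x = A (g \<otimes> h) z" using g by (simp add: action)
        then show "x \<in> W" using g h by (auto simp: W_def)
      qed
      show "card (A g ` W) = card W" by (rule card_image) (use g.inj in \<open>auto intro: inj_on_subset\<close>)
    qed
    have "map_poly (A g) C = (\<Prod>w\<in>W. [:- A g w, 1:])"
      unfolding C_def g.map_poly_prod by (simp add: map_poly_pCons g.uminus)
    also have "\<dots> = (\<Prod>w\<in>A g ` W. [:- w, 1:])"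
      by (subst prod.reindex) (use g.inj in \<open>auto intro: inj_on_subset\<close>)
    also have "\<dots> = C" unfolding gW C_def ..
    finally have "coeff (map_poly (A g) C) i = coeff C i" by simp
    then show "A g (coeff C i) = coeff C i" by (simp add: coeff_map_poly)
  qed
  note coeff_C = this
  define B where "B = map_poly (inv_into UNIV \<theta>) C"
  have B: "\<theta> (coeff B i) = coeff C i" for i
  proof -
    \<comment> \<open>Applying a map to the coefficients of a polynomial behaves well only if 0 goes
      to 0.\<close>
    have "inv_into UNIV \<theta> 0 = 0" using inv_f_f[OF \<theta>.inj, of 0] by simp
    then have "coeff B i = inv_into UNIV \<theta> (coeff C i)" by (simp add: B_def coeff_map_poly)
    then show ?thesis using f_inv_into_f[OF coeff_C] by simp
  qed
  have "map_poly to_ac B = map_poly \<Phi> C"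
    by (rule poly_eqI) (simp add: coeff_map_poly flip: B \<Phi>_\<theta>)
  also have "\<dots> = (\<Prod>w\<in>W. [:- \<Phi> w, 1:])" unfolding C_def \<Phi>.map_poly_prod by (simp add: map_poly_pCons \<Phi>.uminus)
  also have "\<dots> = (\<Prod>w\<in>\<Phi> ` W. [:- w, 1:])"
    by (subst prod.reindex) (use \<Phi>.inj in \<open>auto intro: inj_on_subset\<close>)
  finally have eq: "map_poly to_ac B = (\<Prod>w\<in>\<Phi> ` W. [:- w, 1:])" .
  have "z \<in> W" unfolding W_def using action_one by (intro image_eqI[of _ _ \<one>]) auto
  then have "poly (map_poly to_ac B) (\<Phi> z) = 0"
    unfolding eq poly_prod using fin by (intro prod_zero bexI[of _ "\<Phi> z"]) auto
  moreover have "B \<noteq> 0"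
    using order_prod_linear[of "\<Phi> ` W" 0] fin unfolding eq[symmetric] by auto
  ultimately show ?thesis using eq unfolding W_def by (intro that)
qed

lemma galois_extension_L: "galois_extension L"
proof -
  have main: "rsquarefree (map_poly to_ac q) \<and> (\<forall>y. poly (map_poly to_ac q) y = 0 \<longrightarrow> y \<in> L)"
    if x: "x \<in> L" and q: "Factorial_Ring.irreducible q" "poly (map_poly to_ac q) x = 0" for x and q :: "'c fls poly"
  proof -
    obtain z where z: "x = \<Phi> z" using x by (rule L_cases)
    obtain B where B: "B \<noteq> 0" "poly (map_poly to_ac B) x = 0"
      "map_poly to_ac B = (\<Prod>w\<in>\<Phi> ` (\<lambda>g. A g z) ` carrier G. [:- w, 1:])"
      unfolding z by (rule conjugate_polynomial)
    \<comment> \<open>B has simple roots, all in L, and q inherits both properties as a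
      divisor.\<close>
    have "q dvd B" by (rule irreducible_dvd_if_common_root[OF field_hom_to_ac q B(1,2)])
    then have dvd: "map_poly to_ac q dvd (\<Prod>w\<in>\<Phi> ` (\<lambda>g. A g z) ` carrier G. [:- w, 1:])"
      unfolding B(3)[symmetric] by (auto simp: ac.map_poly_mult elim!: dvdE)
    have fin: "finite (\<Phi> ` (\<lambda>g. A g z) ` carrier G)" using card_carrier(2) by simp
    note ord = order_prod_linear[OF fin]
    have "order a (map_poly to_ac q) \<le> 1" for a
      using dvd_imp_order_le[OF _ dvd, of a] ord[of a] by auto
    then have "rsquarefree (map_poly to_ac q)"
      unfolding rsquarefree_def using dvd ord[of 0] by (auto simp: le_Suc_eq)
    moreover have "y \<in> L" if "poly (map_poly to_ac q) y = 0" for y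
    proof -
      have "poly (\<Prod>w\<in>\<Phi> ` (\<lambda>g. A g z) ` carrier G. [:- w, 1:]) y = 0" using dvd that by (auto elim!: dvdE)
      then have "y \<in> \<Phi> ` (\<lambda>g. A g z) ` carrier G" using fin unfolding poly_prod by (auto simp: prod_zero_iff)
      then show ?thesis by auto
    qed
    ultimately show ?thesis by blast
  qed
  show ?thesis
    unfolding galois_extension_def separable_extension_def normal_extension_def
    using finite_field_extension_L main by blast
qed

lemma act_in: "g \<in> carrier G \<Longrightarrow> act g \<in> carrier (field_aut_group L)"
proof -
  assume g: "g \<in> carrier G"
  interpret g: vhom "A g" 1 using g by (rule vhom)
  have "bij_betw (act g) L L"
  proof (rule bij_betw_imageI)
    show "inj_on (act g) L" by (auto simp: inj_on_def elim!: L_cases)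
    show "act g ` L = L"
    proof (intro equalityI subsetI)
      fix x assume "x \<in> L"
      then obtain z where z: "x = \<Phi> z" by (rule L_cases)
      have "x = act g (\<Phi> (A (inv g) z))" using action_inverse(2)[OF g] by (simp add: z)
      then show "x \<in> act g ` L" using \<Phi>_in by (rule image_eqI)
    qed (auto elim!: L_cases)
  qed
  moreover have "act g \<in> extensional L" by (simp add: act_def)
  moreover have "act g (x + y) = act g x + act g y" "act g (x * y) = act g x * act g y" if "x \<in> L" "y \<in> L" for x y
  proof -
    obtain z w where zw: "x = \<Phi> z" "y = \<Phi> w" using \<open>x \<in> L\<close> \<open>y \<in> L\<close> by (auto simp: L_def)
    show "act g (x + y) = act g x + act g y" "act g (x * y) = act g x * act g y"
      unfolding zw \<Phi>.add[symmetric] \<Phi>.mult[symmetric] act_\<Phi> by (simp_all add: \<Phi>.add \<Phi>.mult g.add g.mult)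
  qed
  moreover have "act g 1 = 1" using act_\<Phi>[of g 1] by simp
  moreover have "act g (to_ac x) = to_ac x" for x using act_\<Phi>[of g "\<theta> x"] by (simp add: \<Phi>_\<theta> A_\<theta>[OF g])
  moreover have "act g x \<in> L" if "x \<in> L" for x using that by (auto elim!: L_cases)
  ultimately show ?thesis
    by (auto simp: field_aut_group_def Bij_def ring_hom_def ring_of_type_algebra_def)
qed

text \<open>For surjectivity: an automorphism over the base sends the image of X to a root of its
  conjugate polynomial, hence to that of A g X for some g, and L is spanned over the base by powers
  of the image of X.\<close>

lemma act_iso: "act \<in> iso G (field_aut_group L)"
  unfolding iso_def
proof (intro CollectI conjI)
  show "act \<in> hom G (field_aut_group L)"
  proof (rule homI)
    fix g h assume gh: "g \<in> carrier G" "h \<in> carrier G"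
    have "act (g \<otimes> h) = compose L (act g) (act h)"
    proof (rule extensionalityI)
      show "act (g \<otimes> h) \<in> extensional L" by (simp add: act_def)
      show "compose L (act g) (act h) \<in> extensional L" by (simp add: compose_def)
      show "act (g \<otimes> h) x = compose L (act g) (act h) x" if "x \<in> L" for x
        using that gh by (auto simp: compose_def action elim!: L_cases)
    qed
    then show "act (g \<otimes> h) = act g \<otimes>\<^bsub>field_aut_group L\<^esub> act h"
      using gh by (simp add: field_aut_group_mult act_in)
  qed (rule act_in)
  show "bij_betw act (carrier G) (carrier (field_aut_group L))"
  proof (rule bij_betw_imageI)
    show "inj_on act (carrier G)"
    proof (rule inj_onI)
      fix g h assume gh: "g \<in> carrier G" "h \<in> carrier G" "act g = act h"
      have "A g x = A h x" for x using fun_cong[OF gh(3), of "\<Phi> x"] by simp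
      then have "A g = A h" by (rule ext)
      then show "g = h" using action_inj gh by (simp add: inj_on_def)
    qed
    show "act ` carrier G = carrier (field_aut_group L)"
    proof (intro equalityI subsetI)
      fix f assume f: "f \<in> carrier (field_aut_group L)"
      note fD = field_aut_groupD[OF f]
      have fL: "f x \<in> L" if "x \<in> L" for x using fD(1) that by (auto simp: bij_betw_def)
      define \<alpha> where "\<alpha> x = \<Phi>' (f (\<Phi> x))" for x
      have \<Phi>\<alpha>: "\<Phi> (\<alpha> x) = f (\<Phi> x)" for x
        using fL[OF \<Phi>_in[of x]] by (auto simp: \<alpha>_def elim!: L_cases)
      have \<alpha>: "field_hom \<alpha>"
      proof
        show "\<alpha> 1 = 1"
        proof -
          have "\<Phi> (\<alpha> 1) = \<Phi> 1" using \<Phi>\<alpha>[of 1] fD(5) by simp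
          then show ?thesis by (simp only: \<Phi>.eq_iff)
        qed
        show "\<alpha> (x + y) = \<alpha> x + \<alpha> y" for x y
        proof -
          have "\<Phi> (\<alpha> (x + y)) = \<Phi> (\<alpha> x + \<alpha> y)" by (simp add: \<Phi>\<alpha> \<Phi>.add fD(3))
          then show ?thesis by simp
        qed
        show "\<alpha> (x * y) = \<alpha> x * \<alpha> y" for x y
        proof -
          have "\<Phi> (\<alpha> (x * y)) = \<Phi> (\<alpha> x * \<alpha> y)" by (simp add: \<Phi>\<alpha> \<Phi>.mult fD(4))
          then show ?thesis by simp
        qed
      qed
      interpret \<alpha>: field_hom \<alpha> by fact
      have \<alpha>\<theta>: "\<alpha> (\<theta> x) = \<theta> x" for x
      proof -
        have "\<Phi> (\<alpha> (\<theta> x)) = \<Phi> (\<theta> x)" by (simp add: \<Phi>\<alpha> \<Phi>_\<theta> fD(6))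
        then show ?thesis by simp
      qed
      obtain B where B: "B \<noteq> 0" "poly (map_poly to_ac B) (\<Phi> fls_X) = 0"
        "map_poly to_ac B = (\<Prod>w\<in>\<Phi> ` (\<lambda>g. A g fls_X) ` carrier G. [:- w, 1:])"
        by (rule conjugate_polynomial)
      \<comment> \<open>Both \<Phi> and its composite with \<alpha> agree with \<open>to_ac\<close>
        on the base, so B can be evaluated through either of them.\<close>
      interpret \<Phi>\<alpha>: field_hom "\<lambda>x. \<Phi> (\<alpha> x)" by (rule field_hom_comp[OF \<Phi> \<alpha>])
      have mp: "map_poly \<Phi> (map_poly \<theta> B) = map_poly to_ac B" "map_poly (\<lambda>x. \<Phi> (\<alpha> x)) (map_poly \<theta> B) = map_poly to_ac B"
        by (rule poly_eqI, simp add: coeff_map_poly \<Phi>_\<theta> \<alpha>\<theta>)+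
      have "\<Phi> (poly (map_poly \<theta> B) fls_X) = 0" unfolding \<Phi>.poly mp using B(2) .
      then have "poly (map_poly \<theta> B) fls_X = 0" by simp
      then have "\<Phi> (\<alpha> (poly (map_poly \<theta> B) fls_X)) = 0" by simp
      then have "poly (map_poly to_ac B) (\<Phi> (\<alpha> fls_X)) = 0" unfolding \<Phi>\<alpha>.poly mp .
      then have "\<Phi> (\<alpha> fls_X) \<in> \<Phi> ` (\<lambda>g. A g fls_X) ` carrier G"
        unfolding B(3) poly_prod using card_carrier(2) by (auto simp: prod_zero_iff)
      then obtain g where g: "g \<in> carrier G" "\<alpha> fls_X = A g fls_X" by auto
      interpret g: vhom "A g" 1 using g(1) by (rule vhom)
      interpret R: ramified_basis \<theta> d "\<lambda>i. fls_X ^ i" by (rule ramified_basis_X_powers[OF \<theta>])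
      have "\<alpha> x = A g x" for x
      proof -
        obtain c where x: "x = (\<Sum>i<d. \<theta> (c i) * fls_X ^ i)" using R.basis_span by blast
        show ?thesis unfolding x \<alpha>.sum g.sum
          by (simp add: \<alpha>.mult g.mult \<alpha>.power g.power \<alpha>\<theta> A_\<theta>[OF g(1)] g(2))
      qed
      then have "f x = act g x" if "x \<in> L" for x
        using \<Phi>\<alpha> that by (auto elim!: L_cases)
      then have "f = act g" using fD(2) by (intro extensionalityI[of f L]) (auto simp: act_def)
      then show "f \<in> act ` carrier G" using g(1) by blast
    qed (use act_in in auto)
  qed
qed

lemma normalized_valuation_L: "normalized_valuation L val"
  unfolding normalized_valuation_def
proof (intro conjI ballI impI)
  fix x y assume "x \<in> L - {0}" "y \<in> L - {0}"
  then obtain z w where zw: "x = \<Phi> z" "y = \<Phi> w" "z \<noteq> 0" "w \<noteq> 0" by (auto simp: L_def)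
  show "val (x * y) = val x + val y" unfolding zw \<Phi>.mult[symmetric] using zw by (simp add: val_def)
  show "min (val x) (val y) \<le> val (x + y)" if "x + y \<noteq> 0"
  proof -
    have "z + w \<noteq> 0" using that unfolding zw \<Phi>.add[symmetric] by simp
    then show ?thesis unfolding zw \<Phi>.add[symmetric] by (simp add: val_def fls_plus_subdegree)
  qed
next
  have "i \<in> val ` (L - {0})" for i
  proof
    show "i = val (\<Phi> (fls_X powi i))" by (simp add: val_def)
    show "\<Phi> (fls_X powi i) \<in> L - {0}" by simp
  qed
  then show "val ` (L - {0}) = UNIV" by auto
  have "val (to_ac f) = int d * \<nu> f" if "f \<noteq> 0" for f
    using \<theta>.subdegree[OF that] by (simp add: val_def flip: \<Phi>_\<theta>)
  then show "\<exists>e::nat. e \<ge> 1 \<and> (\<forall>f. f \<noteq> 0 \<longrightarrow> val (to_ac f) = int e * \<nu> f)"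
    using \<theta>.d_pos by (intro exI[of _ d]) auto
qed

lemma uniformizer_L: "uniformizer L val (\<Phi> fls_X)"
  by (simp add: uniformizer_def val_def)

lemma lower_ramification_L: "lower_ramification G act val (\<Phi> fls_X) r = low r"
proof -
  have "val (\<Phi> x - \<Phi> y) = \<nu> (x - y)" for x y
    by (simp add: val_def flip: \<Phi>.diff)
  then show ?thesis by (simp add: lower_ramification_def low_def)
qed

end

text \<open>The gcd condition selects \<zeta>, the congruences modulo m give all \<open>h i\<close>
  the same scaling factor, and the growth condition makes a the sequence of maxima that the break
  computation returns.\<close>

theorem upper_breaks_sufficient:
  fixes G :: "('g, 'b) monoid_scheme" and a :: "nat \<Rightarrow> nat"
  assumes G: "cyclic_semidirect G p n m s t \<kappa>" and char: "CHAR('k::alg_closed_field) = p"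
    and gcd: "gcd m (a 1) = card (centralizer G s) div p ^ n" and a_1: "\<not> p dvd a 1"
    and a_Suc: "\<And>l. 1 \<le> l \<Longrightarrow> l < n \<Longrightarrow> a (Suc l) = p * a l \<or> (a (Suc l) > p * a l \<and> \<not> p dvd a (Suc l))"
    and a_cong: "\<And>l. l < n \<Longrightarrow> [a (Suc l) = a 1] (mod m)"
  shows "occurs_as_upper_breaks TYPE('k) G ((\<lambda>l. real (a l) / real m) ` {1..n})"
proof -
  interpret G: cyclic_semidirect G p n m s t \<kappa> by fact
  have "gcd m (a 1) = card {j. j < m \<and> [\<kappa> ^ j = 1] (mod p ^ n)}"
    using gcd unfolding G.card_centralizer nonzero_mult_div_cancel_left[OF G.pn[THEN less_imp_neq, symmetric]] .
  from root_of_unity_with_power[OF G.p char G.m G.n G.chi_pow this]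
  obtain \<zeta> :: 'k where \<zeta>: "\<And>j. \<zeta> ^ j = 1 \<longleftrightarrow> m dvd j" "\<zeta> ^ a 1 = of_nat \<kappa>" by blast
  interpret equivariant_tower G p n m s t \<kappa> a \<zeta>
    by unfold_locales (use char \<zeta> a_1 a_Suc a_cong in auto)
  obtain A :: "'g \<Rightarrow> 'k fls \<Rightarrow> 'k fls" where "ramified_action G p n m s t \<kappa> A"
    and J: "ramified_action.upper_jumps G p n s A a"
    by (rule action_exists)
  then interpret A: ramified_action G p n m s t \<kappa> A by simp
  obtain \<theta> d and \<Phi> :: "'k fls \<Rightarrow> 'k fls alg_closure" where "vhom \<theta> d" "range \<theta> = {x. \<forall>g\<in>carrier G. A g x = x}"
    "field_hom \<Phi>" "\<And>x. \<Phi> (\<theta> x) = to_ac x"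
    by (rule A.fixed_field_embedding) blast
  then interpret R: realized_action G p n m s t \<kappa> A \<theta> d \<Phi>
    by (intro realized_action.intro A.ramified_action_axioms realized_action_axioms.intro)
  have "positive_upper_breaks G R.act R.val (\<Phi> fls_X) = (\<lambda>l. real (a l) / real m) ` {1..n}"
    using R.lower_ramification_L J by (rule A.positive_upper_breaks)
  moreover have "G_galois_extension G R.L R.act"
    using R.galois_extension_L R.act_iso by (simp add: G_galois_extension_def)
  ultimately show ?thesis
    unfolding occurs_as_upper_breaks_def using R.normalized_valuation_L R.uniformizer_L by blast
qed

theorem theorem1p1:
  fixes p n m m' :: nat
    and G :: "('g, 'b) monoid_scheme" and s :: 'g
    and u :: "nat \<Rightarrow> rat"
  assumes "Factorial_Ring.prime p"
    and "CHAR('k::alg_closed_field) = p"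
    and "n \<ge> 1" and "m \<ge> 1" and "\<not> p dvd m"
    and "group G" and "cyclic_semidirect_product G (p ^ n) m"
    and "s \<in> carrier G" and "group.ord G s = p ^ n"
    and "m' = card (centralizer G s) div p ^ n"
    and "mono_on {1..n} u"
  shows "occurs_as_upper_breaks TYPE('k) G ((\<lambda>i. of_rat (u i)) ` {1..n}) \<longleftrightarrow>
    (\<exists>a :: nat \<Rightarrow> nat.
       (\<forall>i\<in>{1..n}. u i = of_nat (a i) / of_nat m) \<and>
       gcd m (a 1) = m' \<and>
       \<not> p dvd a 1 \<and>
       (\<forall>i\<in>{2..n}. u i = of_nat p * u (i - 1) \<or> (u i > of_nat p * u (i - 1) \<and> \<not> p dvd a i)) \<and>
       (\<forall>i\<in>{1..n}. [a i = a 1] (mod m)))"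
proof -
  obtain t \<kappa> where G: "cyclic_semidirect G p n m s t \<kappa>"
    using assms(1,3-9) by (rule cyclic_semidirectI)
  show ?thesis
  proof (rule iffI, goal_cases)
    case 1
    then show ?case
      unfolding assms(10) by (rule upper_breaks_necessary[OF G assms(2,11)])
  next
    case 2
    then obtain a where a: "\<And>i. i \<in> {1..n} \<Longrightarrow> u i = of_nat (a i) / of_nat m" "gcd m (a 1) = m'" "\<not> p dvd a 1"
      "\<And>i. i \<in> {2..n} \<Longrightarrow> u i = of_nat p * u (i - 1) \<or> (u i > of_nat p * u (i - 1) \<and> \<not> p dvd a i)"
      "\<And>i. i \<in> {1..n} \<Longrightarrow> [a i = a 1] (mod m)" by blast
    have m0: "(of_nat m :: rat) > 0" using assms(4) by simp
    have "a (Suc l) = p * a l \<or> (a (Suc l) > p * a l \<and> \<not> p dvd a (Suc l))" if l: "1 \<le> l" "l < n" for l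
    proof -
      have ul: "u (Suc l) = of_nat (a (Suc l)) / of_nat m" "of_nat p * u l = of_nat (p * a l) / of_nat m"
        using a(1)[of l] a(1)[of "Suc l"] l by simp_all
      have "u (Suc l) = of_nat p * u l \<longleftrightarrow> a (Suc l) = p * a l" "u (Suc l) > of_nat p * u l \<longleftrightarrow> a (Suc l) > p * a l"
        unfolding ul using m0 by (simp_all add: divide_less_cancel del: of_nat_mult)
      then show ?thesis using a(4)[of "Suc l"] l by simp
    qed
    then have "occurs_as_upper_breaks TYPE('k) G ((\<lambda>l. real (a l) / real m) ` {1..n})"
      using a(2,3,5) assms(10) by (intro upper_breaks_sufficient[OF G assms(2)]) auto
    moreover have "(\<lambda>i. real_of_rat (u i)) ` {1..n} = (\<lambda>l. real (a l) / real m) ` {1..n}"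
      using a(1) by (intro image_cong) (simp_all add: of_rat_divide)
    ultimately show ?case by simp
  qed
qed

end
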